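(* Work under the assumptions on $\mathcal O,\mu,\sigma,g,h,r,\alpha_0,T$ stated in the context, and let $v$ be the value of the game defined there. The mapping $x\mapsto v(t,x)$ is non-decreasing (on $\mathcal O$) for every $t\in[0,T]$.
   Context: Setting. $(\Omega,\mathcal F,\mathsf P)$ is a probability space with a filtration $\mathbb F=(\mathcal F_t)_{t\ge0}$ and $W$ is a one-dimensional Brownian motion adapted to $\mathbb F$. $T\in(0,\infty)$, $r\ge0$ and $\alpha_0>0$ are constants. $\mathcal O$ is either $\mathbb R$ or $(0,\infty)$; $\overline{\mathcal O}=\mathbb R$ in the first case and $\overline{\mathcal O}=[0,\infty)$ in the second. Assumptions on the dynamics. $\mu:\overline{\mathcal O}\to\mathbb R$ has linear growth, is continuously differentiable and convex, and $\mu_x$ is locally $\gamma$-Hölder continuous for some $\gamma\in(0,1)$ and bounded from above; if $\mathcal O=(0,\infty)$, also $\mu(0)=0$ and $\mu_x(0)=\lim_{x\downarrow0}\mu_x(x)$ is finite. $\sigma(x)=\sigma_0$ if $\mathcal O=\mathbb R$ and $\sigma(x)=\sigma_1x$ if $\mathcal O=(0,\infty)$, with constants $\sigma_0,\sigma_1\in(0,\infty)$. Assumptions on the payoffs. For some $\gamma\in(0,1)$, $c>0$: (i) $g:[0,T]\to\mathbb R$ is continuously differentiable with $\gamma$-Hölder derivative $\dot g$; (ii) $h:[0,T]\times\overline{\mathcal O}\to\mathbb R$ is $\gamma$-Hölder on any compact with $|h(t,x)|\le c(1+|x|^2)$; the spatial derivative $h_x$ is $\gamma$-Hölder on any compact,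 non-negative, $x\mapsto h_x(t,x)$ is non-decreasing, $t\mapsto h_x(t,x)$ is non-increasing, $|h_x(t,x)|\le c(1+|x|^2)$. Let $\Theta(t,x)=\dot g(t)-rg(t)+h(t,x)$. (iii) $t\mapsto\Theta(t,x)$ is non-increasing for all $x\in\overline{\mathcal O}$ and, if $\mathcal O=(0,\infty)$, $\Theta(0,0)<0$; (iv) $\inf_{[0,T]\times\mathcal O}\Theta=-K_1$ for some $K_1>0$; (v) $\sup_{x\in\mathcal O}\Theta(t,x)>0$ for all $t\in[0,T)$. Controls and stopping times. For $(t,x)\in[0,T]\times\mathcal O$, $\mathcal A_{t,x}$ is the set of processes $\nu=\nu^+-\nu^-$ (Jordan decomposition) with $\nu^\pm$ $\mathbb F$-adapted, real-valued, non-decreasing, càdlàg, $\nu^\pm_{0-}=0$, $\mathsf E[|\nu^\pm_{T-t}|^2]<\infty$ and, if $\mathcal O=(0,\infty)$, $X^\nu_{\tau_{\mathcal O}}=0$ a.s. on $\{\tau_{\mathcal O}<T-t\}$. Here $\tau_{\mathcal O}=\inf\{s\ge0:X^\nu_s\notin\mathcal O\}\wedge(T-t)$, and $X^\nu$ is the unique $\mathbb F$-adapted solution of $X^\nu_s=x+\int_0^s\mu(X^\nu_u)\,du+\int_0^s\sigma(X^\nu_u)\,dW_u+\nu_s$, $0\le s\le\tau_{\mathcal O}$, with $X^\nu_{0-}=x$ and $X^\nu_s=0$ for $s\in(\tau_{\mathcal O},T-t]$. $\mathcal T_t$ is the set of $\mathbb F$-stopping times with values in $[0,T-t]$. Game.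 For $(\tau,\nu)\in\mathcal T_t\times\mathcal A_{t,x}$, $$\mathcal J_{t,x}(\tau,\nu)=\mathsf E_x\Big[e^{-r(\tau\wedge\tau_{\mathcal O})}g(t+\tau\wedge\tau_{\mathcal O})+\int_0^{\tau\wedge\tau_{\mathcal O}}e^{-rs}h(t+s,X^\nu_s)\,ds+\int_{[0,\tau\wedge\tau_{\mathcal O}]}e^{-rs}\alpha_0\,d|\nu|_s\Big],$$ where $|\nu|$ is the total variation of $\nu$ and $\mathsf E_x$ is expectation given $X^\nu_{0-}=x$. It is known that the value $v(t,x)=\sup_{\tau\in\mathcal T_t}\inf_{\nu\in\mathcal A_{t,x}}\mathcal J_{t,x}(\tau,\nu)=\inf_{\nu\in\mathcal A_{t,x}}\sup_{\tau\in\mathcal T_t}\mathcal J_{t,x}(\tau,\nu)$ exists. *)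

theory Defs
  imports "HOL-Probability.Probability"
begin

text \<open>
  Stochastic processes are indexed by all of \<^typ>\<open>real\<close>; only times in \<open>[0, H]\<close> matter, where the
  horizon is \<open>H = T - t\<close>, except that the value at negative times encodes the value at time
  \<open>0-\<close>. Thus the jump at time \<open>0\<close> of a right-continuous process is an ordinary jump of its path.
\<close>

type_synonym 'a process = "real \<Rightarrow> 'a \<Rightarrow> real"


section \<open>Brownian motion and the stochastic integral\<close>

locale filtered_brownian_motion =
  prob_space M + filtration "space M" F
  for M :: "'a measure" and F :: "real \<Rightarrow> 'a measure" +
  fixes W :: "'a process"
  assumes sub_sigma: "\<And>t. sets (F t) \<subseteq> sets M"
    and W_adapted: "\<And>t. 0 \<le> t \<Longrightarrow> W t \<in> borel_measurable (F t)"
    and W_zero: "AE \<omega> in M. W 0 \<omega> = 0"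
    and W_continuous: "\<And>\<omega>. \<omega> \<in> space M \<Longrightarrow> continuous_on {0..} (\<lambda>t. W t \<omega>)"
    and W_increment_distr: "\<And>s t. 0 \<le> s \<Longrightarrow> s < t \<Longrightarrow>
      distributed M lborel (\<lambda>\<omega>. W t \<omega> - W s \<omega>) (\<lambda>x. ennreal (normal_density 0 (sqrt (t - s)) x))"
    and W_increment_indep: "\<And>s t. 0 \<le> s \<Longrightarrow> s < t \<Longrightarrow>
      indep_set (sets (F s)) (sets (vimage_algebra (space M) (\<lambda>\<omega>. W t \<omega> - W s \<omega>) borel))"

definition adapted_upto :: "(real \<Rightarrow> 'a measure) \<Rightarrow> real \<Rightarrow> 'a process \<Rightarrow> bool" where
  "adapted_upto F H X \<longleftrightarrow> (\<forall>s\<in>{0..H}. X s \<in> borel_measurable (F s))"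

definition cadlag_upto :: "real \<Rightarrow> (real \<Rightarrow> real) \<Rightarrow> bool" where
  "cadlag_upto H f \<longleftrightarrow>
     (\<forall>s\<in>{0..<H}. (f \<longlongrightarrow> f s) (at_right s)) \<and> (\<forall>s\<in>{0<..H}. \<exists>l. (f \<longlongrightarrow> l) (at_left s))"

text \<open>
  The simple integrand \<open>\<Sum>i<n. \<xi>\<^sub>i 1_(p\<^sub>i, p\<^sub>i\<^sub>+\<^sub>1]\<close>, with \<open>\<xi>\<^sub>i\<close> bounded and measurable with respect
  to \<open>F (p\<^sub>i)\<close>, is given by the triple \<open>(n, p, \<xi>)\<close>.
\<close>

definition simple_integrand ::
  "'a measure \<Rightarrow> (real \<Rightarrow> 'a measure) \<Rightarrow> nat \<Rightarrow> (nat \<Rightarrow> real) \<Rightarrow> (nat \<Rightarrow> 'a \<Rightarrow> real) \<Rightarrow> bool" where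
  "simple_integrand M F n p \<xi> \<longleftrightarrow>
     0 \<le> p 0 \<and> (\<forall>i<n. p i \<le> p (Suc i)) \<and>
     (\<forall>i<n. \<xi> i \<in> borel_measurable (F (p i)) \<and> (\<exists>C. \<forall>\<omega>\<in>space M. \<bar>\<xi> i \<omega>\<bar> \<le> C))"

definition simple_process :: "nat \<Rightarrow> (nat \<Rightarrow> real) \<Rightarrow> (nat \<Rightarrow> 'a \<Rightarrow> real) \<Rightarrow> 'a process" where
  "simple_process n p \<xi> s \<omega> = (\<Sum>i<n. \<xi> i \<omega> * indicator {p i<..p (Suc i)} s)"

definition simple_integral ::
  "'a process \<Rightarrow> nat \<Rightarrow> (nat \<Rightarrow> real) \<Rightarrow> (nat \<Rightarrow> 'a \<Rightarrow> real) \<Rightarrow> 'a process" where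
  "simple_integral W n p \<xi> s \<omega> =
     (\<Sum>i<n. \<xi> i \<omega> * (W (min s (p (Suc i))) \<omega> - W (min s (p i)) \<omega>))"

definition null_in_probability :: "'a measure \<Rightarrow> (nat \<Rightarrow> 'a \<Rightarrow> ennreal) \<Rightarrow> bool" where
  "null_in_probability M Y \<longleftrightarrow>
     (\<forall>k. Y k \<in> borel_measurable M) \<and>
     (\<forall>\<epsilon>>0. (\<lambda>k. measure M {\<omega> \<in> space M. ennreal \<epsilon> < Y k \<omega>}) \<longlonglongrightarrow> 0)"

text \<open>
  \<open>I\<close> is a continuous adapted version of the Ito integral process \<open>\<integral>\<^sub>0\<^sup>s K\<^sub>u dW\<^sub>u\<close>, \<open>0 \<le> s \<le> H\<close>:
  the integral is extended from simple integrands, by convergence in probability, to the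
  adapted integrands with almost surely square-integrable paths.
\<close>

definition has_ito_integral ::
  "'a measure \<Rightarrow> (real \<Rightarrow> 'a measure) \<Rightarrow> 'a process \<Rightarrow> real \<Rightarrow> 'a process \<Rightarrow> 'a process \<Rightarrow> bool" where
  "has_ito_integral M F W H K I \<longleftrightarrow>
     adapted_upto F H K \<and> adapted_upto F H I \<and>
     (\<forall>\<omega>\<in>space M. continuous_on {0..H} (\<lambda>s. I s \<omega>)) \<and>
     (\<exists>n p \<xi>. (\<forall>k. simple_integrand M F (n k) (p k) (\<xi> k)) \<and>
        null_in_probability M (\<lambda>k \<omega>.
          \<integral>\<^sup>+ s\<in>{0..H}. ennreal ((simple_process (n k) (p k) (\<xi> k) s \<omega> - K s \<omega>)\<^sup>2) \<partial>lborel) \<and>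
        null_in_probability M (\<lambda>k \<omega>.
          SUP s\<in>{0..H}. ennreal \<bar>simple_integral W (n k) (p k) (\<xi> k) s \<omega> - I s \<omega>\<bar>))"


section \<open>Controlled dynamics\<close>

text \<open>\<open>\<tau>\<^sub>\<O>\<close>, with the minimum with \<open>H\<close> built into the infimum.\<close>

definition exit_time :: "real set \<Rightarrow> real \<Rightarrow> 'a process \<Rightarrow> 'a \<Rightarrow> real" where
  "exit_time \<O> H X \<omega> = Inf (insert H {s\<in>{0..H}. X s \<omega> \<notin> \<O>})"

text \<open>
  Paths are cadlag and absorbed at \<open>0\<close> after \<open>\<tau>\<^sub>\<O>\<close> for every \<open>\<omega>\<close>; the integral equation, which
  involves the stochastic integral, holds almost surely.
\<close>

definition controlled_solution ::
  "'a measure \<Rightarrow> (real \<Rightarrow> 'a measure) \<Rightarrow> 'a process \<Rightarrow> real set \<Rightarrow> (real \<Rightarrow> real) \<Rightarrow> (real \<Rightarrow> real) \<Rightarrow>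
   real \<Rightarrow> real \<Rightarrow> 'a process \<Rightarrow> 'a process \<Rightarrow> bool" where
  "controlled_solution M F W \<O> \<mu> \<sigma> H x \<nu> X \<longleftrightarrow>
     adapted_upto F H X \<and>
     (\<forall>\<omega>\<in>space M.
        (\<forall>s<0. X s \<omega> = x) \<and> cadlag_upto H (\<lambda>s. X s \<omega>) \<and>
        (\<forall>s\<in>{exit_time \<O> H X \<omega><..H}. X s \<omega> = 0)) \<and>
     (\<exists>I. has_ito_integral M F W H (\<lambda>s \<omega>. \<sigma> (X s \<omega>)) I \<and>
        (AE \<omega> in M. \<forall>s\<in>{0..exit_time \<O> H X \<omega>}.
           X s \<omega> = x + (LINT u:{0..s}|lborel. \<mu> (X u \<omega>)) + I s \<omega> + \<nu> s \<omega>))"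

text \<open>The solution is unique only up to indistinguishability, so a version is chosen.\<close>

definition state ::
  "'a measure \<Rightarrow> (real \<Rightarrow> 'a measure) \<Rightarrow> 'a process \<Rightarrow> real set \<Rightarrow> (real \<Rightarrow> real) \<Rightarrow> (real \<Rightarrow> real) \<Rightarrow>
   real \<Rightarrow> real \<Rightarrow> 'a process \<Rightarrow> 'a process" where
  "state M F W \<O> \<mu> \<sigma> H x \<nu> = (SOME X. controlled_solution M F W \<O> \<mu> \<sigma> H x \<nu> X)"


section \<open>Controls and stopping times\<close>

definition total_variation :: "(real \<Rightarrow> real) \<Rightarrow> real \<Rightarrow> real" where
  "total_variation f s =
     (SUP (n, p)\<in>{(n::nat, p::nat \<Rightarrow> real). mono p \<and> p n \<le> s}. \<Sum>i<n. \<bar>f (p (Suc i)) - f (p i)\<bar>)"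

text \<open>
  Minimality of the decomposition is expressed by \<open>f\<^sup>+ + f\<^sup>- = |f|\<close>. The paths vanish at negative
  times, so \<open>total_variation\<close> includes the jump at time \<open>0\<close>.
\<close>

definition jordan_decomposition ::
  "real \<Rightarrow> (real \<Rightarrow> real) \<Rightarrow> (real \<Rightarrow> real) \<Rightarrow> (real \<Rightarrow> real) \<Rightarrow> bool" where
  "jordan_decomposition H f fp fm \<longleftrightarrow>
     (\<forall>s<0. fp s = 0 \<and> fm s = 0) \<and> mono_on {..H} fp \<and> mono_on {..H} fm \<and>
     (\<forall>s\<le>H. f s = fp s - fm s \<and> total_variation f s = fp s + fm s)"

definition controls ::
  "'a measure \<Rightarrow> (real \<Rightarrow> 'a measure) \<Rightarrow> 'a process \<Rightarrow> real set \<Rightarrow> (real \<Rightarrow> real) \<Rightarrow> (real \<Rightarrow> real) \<Rightarrow>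
   real \<Rightarrow> real \<Rightarrow> real \<Rightarrow> 'a process set" where
  "controls M F W \<O> \<mu> \<sigma> T t x = {\<nu>. let H = T - t; X = state M F W \<O> \<mu> \<sigma> H x \<nu> in
     (\<exists>\<nu>p \<nu>m.
        adapted_upto F H \<nu>p \<and> adapted_upto F H \<nu>m \<and>
        (\<forall>\<omega>\<in>space M. jordan_decomposition H (\<lambda>s. \<nu> s \<omega>) (\<lambda>s. \<nu>p s \<omega>) (\<lambda>s. \<nu>m s \<omega>) \<and>
           cadlag_upto H (\<lambda>s. \<nu>p s \<omega>) \<and> cadlag_upto H (\<lambda>s. \<nu>m s \<omega>)) \<and>
        integrable M (\<lambda>\<omega>. (\<nu>p H \<omega>)\<^sup>2) \<and> integrable M (\<lambda>\<omega>. (\<nu>m H \<omega>)\<^sup>2)) \<and>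
     controlled_solution M F W \<O> \<mu> \<sigma> H x \<nu> X \<and>
     (\<O> = {0<..} \<longrightarrow>
        (AE \<omega> in M. exit_time \<O> H X \<omega> < H \<longrightarrow> X (exit_time \<O> H X \<omega>) \<omega> = 0))}"

definition stopping_times ::
  "'a measure \<Rightarrow> (real \<Rightarrow> 'a measure) \<Rightarrow> real \<Rightarrow> real \<Rightarrow> ('a \<Rightarrow> real) set" where
  "stopping_times M F T t = {\<tau>. stopping_time F \<tau> \<and> (\<forall>\<omega>\<in>space M. \<tau> \<omega> \<in> {0..T - t})}"


section \<open>The game\<close>

text \<open>
  The measure \<open>d|\<nu>|\<close> on \<open>[0, H]\<close>; the variation is frozen after \<open>H\<close>, and it vanishes at negative
  times, so the measure has mass \<open>|\<nu>\<^sub>0|\<close> at \<open>0\<close>.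
\<close>

definition variation_measure :: "real \<Rightarrow> (real \<Rightarrow> real) \<Rightarrow> real measure" where
  "variation_measure H f = interval_measure (\<lambda>s. total_variation f (min s H))"

definition payoff ::
  "'a measure \<Rightarrow> (real \<Rightarrow> 'a measure) \<Rightarrow> 'a process \<Rightarrow> real set \<Rightarrow> (real \<Rightarrow> real) \<Rightarrow> (real \<Rightarrow> real) \<Rightarrow>
   real \<Rightarrow> real \<Rightarrow> real \<Rightarrow> (real \<Rightarrow> real) \<Rightarrow> (real \<Rightarrow> real \<Rightarrow> real) \<Rightarrow>
   real \<Rightarrow> real \<Rightarrow> ('a \<Rightarrow> real) \<Rightarrow> 'a process \<Rightarrow> real" where
  "payoff M F W \<O> \<mu> \<sigma> T r \<alpha>0 g h t x \<tau> \<nu> =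
     (let H = T - t; X = state M F W \<O> \<mu> \<sigma> H x \<nu> in
      LINT \<omega>|M. (let \<theta> = min (\<tau> \<omega>) (exit_time \<O> H X \<omega>) in
        exp (- r * \<theta>) * g (t + \<theta>)
        + (LINT s:{0..\<theta>}|lborel. exp (- r * s) * h (t + s) (X s \<omega>))
        + (LINT s:{0..\<theta>}|variation_measure H (\<lambda>s. \<nu> s \<omega>). exp (- r * s) * \<alpha>0)))"

definition lower_value ::
  "'a measure \<Rightarrow> (real \<Rightarrow> 'a measure) \<Rightarrow> 'a process \<Rightarrow> real set \<Rightarrow> (real \<Rightarrow> real) \<Rightarrow> (real \<Rightarrow> real) \<Rightarrow>
   real \<Rightarrow> real \<Rightarrow> real \<Rightarrow> (real \<Rightarrow> real) \<Rightarrow> (real \<Rightarrow> real \<Rightarrow> real) \<Rightarrow> real \<Rightarrow> real \<Rightarrow> ereal" where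
  "lower_value M F W \<O> \<mu> \<sigma> T r \<alpha>0 g h t x =
     (SUP \<tau>\<in>stopping_times M F T t. INF \<nu>\<in>controls M F W \<O> \<mu> \<sigma> T t x.
        ereal (payoff M F W \<O> \<mu> \<sigma> T r \<alpha>0 g h t x \<tau> \<nu>))"

definition upper_value ::
  "'a measure \<Rightarrow> (real \<Rightarrow> 'a measure) \<Rightarrow> 'a process \<Rightarrow> real set \<Rightarrow> (real \<Rightarrow> real) \<Rightarrow> (real \<Rightarrow> real) \<Rightarrow>
   real \<Rightarrow> real \<Rightarrow> real \<Rightarrow> (real \<Rightarrow> real) \<Rightarrow> (real \<Rightarrow> real \<Rightarrow> real) \<Rightarrow> real \<Rightarrow> real \<Rightarrow> ereal" where
  "upper_value M F W \<O> \<mu> \<sigma> T r \<alpha>0 g h t x =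
     (INF \<nu>\<in>controls M F W \<O> \<mu> \<sigma> T t x. SUP \<tau>\<in>stopping_times M F T t.
        ereal (payoff M F W \<O> \<mu> \<sigma> T r \<alpha>0 g h t x \<tau> \<nu>))"


section \<open>Standing assumptions\<close>

definition holder_on :: "real \<Rightarrow> 'a::metric_space set \<Rightarrow> ('a \<Rightarrow> real) \<Rightarrow> bool" where
  "holder_on \<gamma> A f \<longleftrightarrow> (\<exists>C. \<forall>x\<in>A. \<forall>y\<in>A. \<bar>f x - f y\<bar> \<le> C * dist x y powr \<gamma>)"

text \<open>
  Here and below the closure of \<open>\<O>\<close> is \<open>\<real>\<close> or \<open>[0, \<infinity>)\<close>, and derivatives at its boundary point,
  if any, are one-sided. The derivatives \<open>\<mu>\<^sub>x\<close>, \<open>g'\<close> and \<open>h\<^sub>x\<close> are passed as the arguments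
  \<open>\<mu>'\<close>, \<open>g'\<close> and \<open>hx\<close>.
\<close>

definition dynamics_assumptions ::
  "real set \<Rightarrow> (real \<Rightarrow> real) \<Rightarrow> (real \<Rightarrow> real) \<Rightarrow> (real \<Rightarrow> real) \<Rightarrow> bool" where
  "dynamics_assumptions \<O> \<mu> \<mu>' \<sigma> \<longleftrightarrow>
     (\<exists>c. \<forall>x\<in>closure \<O>. \<bar>\<mu> x\<bar> \<le> c * (1 + \<bar>x\<bar>)) \<and>
     (\<forall>x\<in>closure \<O>. (\<mu> has_real_derivative \<mu>' x) (at x within closure \<O>)) \<and>
     continuous_on (closure \<O>) \<mu>' \<and>
     convex_on (closure \<O>) \<mu> \<and>
     (\<exists>\<gamma>\<in>{0<..<1}. \<forall>K. compact K \<and> K \<subseteq> \<O> \<longrightarrow> holder_on \<gamma> K \<mu>') \<and>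
     (\<exists>c. \<forall>x\<in>\<O>. \<mu>' x \<le> c) \<and>
     (\<O> = {0<..} \<longrightarrow> \<mu> 0 = 0 \<and> (\<mu>' \<longlongrightarrow> \<mu>' 0) (at_right 0)) \<and>
     (\<O> = UNIV \<and> (\<exists>\<sigma>0>0. \<forall>x. \<sigma> x = \<sigma>0) \<or> \<O> = {0<..} \<and> (\<exists>\<sigma>1>0. \<forall>x. \<sigma> x = \<sigma>1 * x))"

definition running_gain ::
  "real \<Rightarrow> (real \<Rightarrow> real) \<Rightarrow> (real \<Rightarrow> real) \<Rightarrow> (real \<Rightarrow> real \<Rightarrow> real) \<Rightarrow> real \<Rightarrow> real \<Rightarrow> real" where
  "running_gain r g g' h t x = g' t - r * g t + h t x"

definition payoff_assumptions ::
  "real set \<Rightarrow> real \<Rightarrow> real \<Rightarrow> (real \<Rightarrow> real) \<Rightarrow> (real \<Rightarrow> real) \<Rightarrow>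
   (real \<Rightarrow> real \<Rightarrow> real) \<Rightarrow> (real \<Rightarrow> real \<Rightarrow> real) \<Rightarrow> bool" where
  "payoff_assumptions \<O> T r g g' h hx \<longleftrightarrow>
     (let \<Theta> = running_gain r g g' h in
     (\<exists>\<gamma>\<in>{0<..<1}. \<exists>c>0.
        (\<forall>t\<in>{0..T}. (g has_real_derivative g' t) (at t within {0..T})) \<and>
        holder_on \<gamma> {0..T} g' \<and>
        (\<forall>K. compact K \<and> K \<subseteq> {0..T} \<times> closure \<O> \<longrightarrow> holder_on \<gamma> K (\<lambda>(t, x). h t x)) \<and>
        (\<forall>t\<in>{0..T}. \<forall>x\<in>closure \<O>. \<bar>h t x\<bar> \<le> c * (1 + \<bar>x\<bar>\<^sup>2)) \<and>
        (\<forall>t\<in>{0..T}. \<forall>x\<in>closure \<O>. (h t has_real_derivative hx t x) (at x within closure \<O>)) \<and>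
        (\<forall>K. compact K \<and> K \<subseteq> {0..T} \<times> closure \<O> \<longrightarrow> holder_on \<gamma> K (\<lambda>(t, x). hx t x)) \<and>
        (\<forall>t\<in>{0..T}. \<forall>x\<in>closure \<O>. 0 \<le> hx t x) \<and>
        (\<forall>t\<in>{0..T}. mono_on (closure \<O>) (hx t)) \<and>
        (\<forall>x\<in>closure \<O>. antimono_on {0..T} (\<lambda>t. hx t x)) \<and>
        (\<forall>t\<in>{0..T}. \<forall>x\<in>closure \<O>. \<bar>hx t x\<bar> \<le> c * (1 + \<bar>x\<bar>\<^sup>2))) \<and>
     (\<forall>x\<in>closure \<O>. antimono_on {0..T} (\<lambda>t. \<Theta> t x)) \<and>
     (\<O> = {0<..} \<longrightarrow> \<Theta> 0 0 < 0) \<and>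
     (\<exists>K1>0. (INF (t, x)\<in>{0..T} \<times> \<O>. ereal (\<Theta> t x)) = ereal (- K1)) \<and>
     (\<forall>t\<in>{0..<T}. 0 < (SUP x\<in>\<O>. ereal (\<Theta> t x))))"

end

(*
  Fix x1 < x2. Every control nu for x2 is turned into a control nu' for x1 that is at most as
  expensive whichever stopping time the opponent uses: the state started at x1 stays below X, the
  exit times agree, and the variation of nu' does not exceed that of nu. As h is non-decreasing in
  space, the payoffs are ordered; taking the supremum and the infimum orders the values.

  On the real line sigma is constant, and nu' = nu works: the new state is X - D, where D solves
  the pathwise equation D' = mu(X) - mu(X - D), D(0) = x2 - x1, and stays positive.

  On the half-line sigma is linear, and the new state is phi X, where phi solves
  phi' = (mu(phi X) - phi mu(X)) / X, phi(0) = x1 / x2. Here 0 < phi < 1, because the right-hand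
  side is Lipschitz in phi and vanishes at 0 and 1, and phi is non-increasing, because mu is convex
  with mu(0) = 0. The product rule for a process of finite variation shows that phi X solves the
  equation with control d nu' = phi d nu. It leaves the half-line exactly when X does.

  The state of a control is a chosen solution, so pathwise uniqueness is needed to identify it with
  the solution constructed above; it follows from localized second moments and Gronwall.
*)

theory Submission
  imports Defs
begin

section \<open>Pathwise analysis\<close>

text \<open>Why a product on the half-line: with linear noise a multiplicative change keeps the
  noise term in form, as \<open>\<sigma> (\<phi> X) = \<phi> \<sigma> X\<close>, and it keeps
  absorption at 0. Requiring the drift \<open>\<phi> \<mu> X + \<phi>' X\<close> of
  \<open>\<phi> X\<close> to equal \<open>\<mu> (\<phi> X)\<close> gives the equation for
  \<open>\<phi>\<close>. Three obstacles shape the rest. The payoff is a Bochner integral, which is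
  0 for a non-integrable function, so pathwise order yields ordered payoffs only once integrability
  is known; as \<open>h\<close> may grow quadratically, this takes second moments of the state. The
  stochastic integral is given only as a limit in probability of simple integrals, so the moment
  estimate and the product rule are derived on partitions. Finally, a control has to come with its
  minimal decomposition, so it must be shown that weighting both monotone parts by
  \<open>\<phi>\<close> creates no new cancellation; knowing the variation exactly is also what
  allows the two control costs to be compared.\<close>

lemma set_integral_split:
  fixes f :: "real \<Rightarrow> real"
  assumes "set_integrable lborel {0..H} f" "0 \<le> u" "u \<le> v" "v \<le> H"
  shows "(LINT w:{0..v}|lborel. f w) = (LINT w:{0..u}|lborel. f w) + (LINT w:{u..v}|lborel. f w)"
proof -
  have eq: "{0..v} = {0..u} \<union> {u..v}" using assms by auto
  have "AE x in lborel. \<not> (x \<in> {0..u} \<and> x \<in> {u..v})"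
    using AE_lborel_singleton[of u] by eventually_elim auto
  moreover have "set_integrable lborel {0..u} f" "set_integrable lborel {u..v} f"
    using assms by (auto intro: set_integrable_subset[OF assms(1)])
  ultimately show ?thesis unfolding eq by (intro set_integral_Un_AE) auto
qed

lemma set_integrable_const_Icc: "set_integrable lborel {a..b::real} (\<lambda>_. C::real)"
  by (intro borel_integrable_atLeastAtMost') auto

lemma set_integral_singleton[simp]: "(LINT u:{a::real}|lborel. f u) = (0::real)"
  unfolding set_lebesgue_integral_def
proof (rule integral_eq_zero_AE)
  show "AE x in lborel. indicator {a} x *\<^sub>R f x = 0"
    using AE_lborel_singleton[of a] by eventually_elim auto
qed

lemma set_integrable_bounded:
  fixes f :: "real \<Rightarrow> real"
  assumes "set_borel_measurable lborel {a..b} f" "\<And>u. u \<in> {a..b} \<Longrightarrow> \<bar>f u\<bar> \<le> C"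
  shows "set_integrable lborel {a..b} f"
  unfolding set_integrable_def
proof (rule Bochner_Integration.integrable_bound[where f="\<lambda>x. indicator {a..b} x *\<^sub>R C"])
  show "integrable lborel (\<lambda>x. indicator {a..b} x *\<^sub>R C)"
    using set_integrable_const_Icc by (simp add: set_integrable_def)
  show "(\<lambda>x. indicator {a..b} x *\<^sub>R f x) \<in> borel_measurable lborel"
    using assms(1) by (simp add: set_borel_measurable_def)
  show "AE x in lborel. norm (indicator {a..b} x *\<^sub>R f x) \<le> norm (indicator {a..b} x *\<^sub>R C)"
    using assms(2) by (intro AE_I2) (fastforce simp: indicator_def split: if_splits)
qed

lemma set_integral_abs_le:
  fixes f g :: "real \<Rightarrow> real"
  assumes "set_integrable lborel A f" "set_integrable lborel A g" "A \<in> sets lborel"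
    "\<And>u. u \<in> A \<Longrightarrow> \<bar>f u\<bar> \<le> g u"
  shows "\<bar>LINT u:A|lborel. f u\<bar> \<le> (LINT u:A|lborel. g u)"
proof -
  have "(LINT u:A|lborel. f u) \<le> (LINT u:A|lborel. g u)"
    using assms by (intro set_integral_mono) fastforce+
  moreover have "(LINT u:A|lborel. - f u) \<le> (LINT u:A|lborel. g u)"
    using assms by (intro set_integral_mono) (fastforce simp: set_integrable_def)+
  ultimately show ?thesis
    by (simp add: set_integral_uminus[OF assms(1)] abs_le_iff)
qed

lemma set_integral_const_Icc:
  "a \<le> b \<Longrightarrow> (LINT u:{a..b}|lborel. C) = (b - a) * (C::real)"
  by (simp add: set_lebesgue_integral_def)

lemma set_integral_bound:
  fixes f :: "real \<Rightarrow> real"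
  assumes "set_integrable lborel {a..b} f" "a \<le> b" "\<And>u. u \<in> {a..b} \<Longrightarrow> \<bar>f u\<bar> \<le> C"
  shows "\<bar>LINT u:{a..b}|lborel. f u\<bar> \<le> C * (b - a)"
  using set_integral_abs_le[OF assms(1) set_integrable_const_Icc[of a b C] _ assms(3)]
  by (simp add: set_integral_const_Icc[OF assms(2)] mult.commute)

lemma set_integral_lipschitz:
  fixes f :: "real \<Rightarrow> real"
  assumes "set_integrable lborel {0..H} f" "\<And>u. u \<in> {0..H} \<Longrightarrow> \<bar>f u\<bar> \<le> C"
    "0 \<le> u" "u \<le> v" "v \<le> H"
  shows "\<bar>(LINT w:{0..v}|lborel. f w) - (LINT w:{0..u}|lborel. f w)\<bar> \<le> C * (v - u)"
proof -
  have "set_integrable lborel {u..v} f"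
    using assms by (auto intro: set_integrable_subset[OF assms(1)])
  then have "\<bar>LINT u:{u..v}|lborel. f u\<bar> \<le> C * (v - u)"
    using assms by (intro set_integral_bound) auto
  then show ?thesis using set_integral_split[OF assms(1,3-5)] by simp
qed

lemma continuous_on_lipschitz_Icc:
  fixes f :: "real \<Rightarrow> real"
  assumes "\<And>u v. a \<le> u \<Longrightarrow> u \<le> v \<Longrightarrow> v \<le> b \<Longrightarrow> \<bar>f v - f u\<bar> \<le> C * (v - u)"
  shows "continuous_on {a..b} f"
proof (rule lipschitz_on_continuous_on)
  show "(max C 0)-lipschitz_on {a..b} f"
  proof (rule lipschitz_onI)
    have *: "\<bar>f v - f u\<bar> \<le> max C 0 * (v - u)" if "a \<le> u" "u \<le> v" "v \<le> b" for u v
      using assms[OF that] that by (meson diff_ge_0_iff_ge max.cobounded1 mult_right_mono order_trans)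
    fix x y assume "x \<in> {a..b}" "y \<in> {a..b}"
    then show "dist (f x) (f y) \<le> max C 0 * dist x y"
      using *[of x y] *[of y x] by (cases "x \<le> y") (auto simp: dist_real_def abs_minus_commute)
  qed simp
qed

lemma set_integral_continuous_on:
  fixes f :: "real \<Rightarrow> real"
  assumes "set_integrable lborel {0..H} f" "\<And>u. u \<in> {0..H} \<Longrightarrow> \<bar>f u\<bar> \<le> C"
  shows "continuous_on {0..H} (\<lambda>s. LINT w:{0..s}|lborel. f w)"
  using set_integral_lipschitz[OF assms] by (rule continuous_on_lipschitz_Icc)

lemma set_borel_measurable_continuous_on:
  "continuous_on {a..b} f \<Longrightarrow> set_borel_measurable lborel {a..b} (f :: real \<Rightarrow> real)"
  using borel_measurable_continuous_on_indicator[of "{a..b}" f] by (simp add: set_borel_measurable_def)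

lemma set_borel_measurable_mult:
  fixes f g :: "real \<Rightarrow> real"
  assumes "set_borel_measurable M A f" "set_borel_measurable M A g"
  shows "set_borel_measurable M A (\<lambda>x. f x * g x)"
proof -
  have "(\<lambda>x. (indicator A x *\<^sub>R f x) * (indicator A x *\<^sub>R g x)) \<in> borel_measurable M"
    using assms unfolding set_borel_measurable_def by measurable
  also have "(\<lambda>x. (indicator A x *\<^sub>R f x) * (indicator A x *\<^sub>R g x)) = (\<lambda>x. indicator A x *\<^sub>R (f x * g x))"
    by (auto simp: indicator_def)
  finally show ?thesis by (simp add: set_borel_measurable_def)
qed

lemma set_integrable_imp_measurable: "set_integrable M A f \<Longrightarrow> set_borel_measurable M A f"
  by (simp add: set_integrable_def set_borel_measurable_def)

lemma continuous_bounded_Icc: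
  fixes f :: "real \<Rightarrow> real"
  assumes "continuous_on {a..b} f"
  obtains C where "0 \<le> C" "\<And>u. u \<in> {a..b} \<Longrightarrow> \<bar>f u\<bar> \<le> C"
proof -
  have "bounded (f ` {a..b})" using assms by (intro compact_imp_bounded compact_continuous_image) auto
  then obtain C where "\<forall>x\<in>f ` {a..b}. norm x \<le> C" by (auto simp: bounded_iff)
  then show ?thesis by (intro that[of "max C 0"]) force+
qed

section \<open>Integral equations with bounded integrands: product rule, positivity, Gronwall's
  inequality\<close>

lemma quadratic_increments_const:
  fixes E :: "real \<Rightarrow> real"
  assumes "\<And>u v. 0 \<le> u \<Longrightarrow> u \<le> v \<Longrightarrow> v \<le> H \<Longrightarrow> \<bar>E v - E u\<bar> \<le> C * (v - u)\<^sup>2" "s \<in> {0..H}"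
  shows "E s = E 0"
proof -
  have *: "\<bar>E v - E u\<bar> \<le> C * (v - u)\<^sup>2" if "u \<in> {0..H}" "v \<in> {0..H}" for u v
    using assms(1)[of u v] assms(1)[of v u] that
    by (cases "u \<le> v") (auto simp: abs_minus_commute power2_commute)
  \<comment> \<open>The quadratic bound on increments bounds the difference quotient at
    \<open>x\<close> by \<open>C * |y - x|\<close>, so the derivative is 0.\<close>
  have "(E has_field_derivative 0) (at x within {0..H})" if x: "x \<in> {0..H}" for x
    unfolding has_field_derivative_iff
  proof (rule Lim_null_comparison[where g="\<lambda>y. C * \<bar>y - x\<bar>"])
    show "\<forall>\<^sub>F y in at x within {0..H}. norm ((E y - E x) / (y - x)) \<le> C * \<bar>y - x\<bar>"
    proof (unfold eventually_at_filter, rule always_eventually, safe)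
      fix y assume "y \<noteq> x" "y \<in> {0..H}"
      then show "norm ((E y - E x) / (y - x)) \<le> C * \<bar>y - x\<bar>"
        using *[OF x, of y] by (simp add: abs_divide field_simps power2_eq_square)
    qed
    have "((\<lambda>y. C * \<bar>y - x\<bar>) \<longlongrightarrow> C * \<bar>x - x\<bar>) (at x within {0..H})" by (intro tendsto_intros)
    then show "((\<lambda>y. C * \<bar>y - x\<bar>) \<longlongrightarrow> 0) (at x within {0..H})" by simp
  qed
  then have "\<exists>c. \<forall>x\<in>{0..H}. E x = c" by (intro has_field_derivative_zero_constant) auto
  then show ?thesis using assms(2) by auto
qed

text \<open>\<open>a\<close> and \<open>f\<close> are merely bounded and measurable, so the product
  need not be differentiable at a given point. Instead the defect between the two sides is shown to
  have increments of order two, hence to be constant.\<close>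

lemma integral_product_rule:
  fixes a f :: "real \<Rightarrow> real"
  assumes a: "set_integrable lborel {0..H} a" and aA: "\<And>u. u \<in> {0..H} \<Longrightarrow> \<bar>a u\<bar> \<le> A"
    and f: "set_integrable lborel {0..H} f" and fB: "\<And>u. u \<in> {0..H} \<Longrightarrow> \<bar>f u\<bar> \<le> B"
    and \<phi>: "\<And>s. s \<in> {0..H} \<Longrightarrow> \<phi> s = \<phi>0 + (LINT u:{0..s}|lborel. a u)"
    and G: "\<And>s. s \<in> {0..H} \<Longrightarrow> G s = G0 + (LINT u:{0..s}|lborel. f u)"
    and s: "s \<in> {0..H}"
  shows "\<phi> s * G s = \<phi>0 * G0 + (LINT u:{0..s}|lborel. \<phi> u * f u + a u * G u)"
proof -
  have \<phi>L: "\<bar>\<phi> v - \<phi> u\<bar> \<le> A * (v - u)" if "0 \<le> u" "u \<le> v" "v \<le> H" for u v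
    using set_integral_lipschitz[OF a aA that] that by (simp add: \<phi>)
  have GL: "\<bar>G v - G u\<bar> \<le> B * (v - u)" if "0 \<le> u" "u \<le> v" "v \<le> H" for u v
    using set_integral_lipschitz[OF f fB that] that by (simp add: G)
  have c\<phi>: "continuous_on {0..H} \<phi>" and cG: "continuous_on {0..H} G"
    using \<phi>L GL by (blast intro: continuous_on_lipschitz_Icc)+
  obtain P where P: "0 \<le> P" "\<And>u. u \<in> {0..H} \<Longrightarrow> \<bar>\<phi> u\<bar> \<le> P" using continuous_bounded_Icc[OF c\<phi>] by blast
  obtain Q where Q: "0 \<le> Q" "\<And>u. u \<in> {0..H} \<Longrightarrow> \<bar>G u\<bar> \<le> Q" using continuous_bounded_Icc[OF cG] by blast
  have A0: "0 \<le> A" "0 \<le> B" using s aA[of s] fB[of s] abs_ge_zero order_trans by blast+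
  have i1: "set_integrable lborel {0..H} (\<lambda>u. \<phi> u * f u)"
  proof (rule set_integrable_bounded[where C="P * B"])
    show "set_borel_measurable lborel {0..H} (\<lambda>u. \<phi> u * f u)"
      by (intro set_borel_measurable_mult set_borel_measurable_continuous_on c\<phi> set_integrable_imp_measurable f)
  qed (use P fB in \<open>auto simp: abs_mult intro!: mult_mono\<close>)
  have i2: "set_integrable lborel {0..H} (\<lambda>u. a u * G u)"
  proof (rule set_integrable_bounded[where C="A * Q"])
    show "set_borel_measurable lborel {0..H} (\<lambda>u. a u * G u)"
      by (intro set_borel_measurable_mult set_borel_measurable_continuous_on cG set_integrable_imp_measurable a)
  qed (use Q aA A0 in \<open>auto simp: abs_mult intro!: mult_mono\<close>)
  have i3: "set_integrable lborel {0..H} (\<lambda>u. \<phi> u * f u + a u * G u)"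
    using i1 i2 by (rule set_integral_add)
  define E where "E s = \<phi> s * G s - (LINT u:{0..s}|lborel. \<phi> u * f u + a u * G u)" for s
  have "E s = E 0"
  proof (rule quadratic_increments_const[OF _ s, where C="2 * A * B"])
    fix u v assume uv: "0 \<le> u" "u \<le> v" "v \<le> H"
    have sub: "set_integrable lborel {u..v} h" if "set_integrable lborel {0..H} h" for h :: "real \<Rightarrow> real"
      using uv by (auto intro: set_integrable_subset[OF that])
    have 1: "\<phi> v - \<phi> u = (LINT w:{u..v}|lborel. a w)" "G v - G u = (LINT w:{u..v}|lborel. f w)"
      using set_integral_split[OF a uv] set_integral_split[OF f uv] uv by (auto simp: \<phi> G)
    have i4: "set_integrable lborel {u..v} (\<lambda>w. \<phi> u * f w + G v * a w)"
      using sub[OF f] sub[OF a] by (intro set_integral_add) auto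
    \<comment> \<open>Freezing \<open>\<phi>\<close> at the left end and \<open>G\<close> at the
      right end makes the increment of the product exactly the integral of
      \<open>\<phi> u * f + G v * a\<close>. What remains is the error of freezing, a product of two
      quantities of order \<open>v - u\<close>.\<close>
    have "E v - E u = \<phi> u * (G v - G u) + G v * (\<phi> v - \<phi> u)
        - (LINT w:{u..v}|lborel. \<phi> w * f w + a w * G w)"
      using set_integral_split[OF i3 uv] by (simp add: E_def algebra_simps)
    also have "\<phi> u * (G v - G u) + G v * (\<phi> v - \<phi> u) = (LINT w:{u..v}|lborel. \<phi> u * f w + G v * a w)"
      using sub[OF f] sub[OF a] unfolding 1 by (subst set_integral_add) auto
    also have "\<dots> - (LINT w:{u..v}|lborel. \<phi> w * f w + a w * G w)
       = (LINT w:{u..v}|lborel. (\<phi> u * f w + G v * a w) - (\<phi> w * f w + a w * G w))"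
      using i4 sub[OF i3] by (subst set_integral_diff) auto
    also have "\<bar>\<dots>\<bar> \<le> (2 * A * B * (v - u)) * (v - u)"
    proof (rule set_integral_bound)
      show "set_integrable lborel {u..v} (\<lambda>w. \<phi> u * f w + G v * a w - (\<phi> w * f w + a w * G w))"
        using i4 sub[OF i3] by (rule set_integral_diff)
      fix w assume w: "w \<in> {u..v}"
      have "\<phi> u * f w + G v * a w - (\<phi> w * f w + a w * G w) = (G v - G w) * a w - (\<phi> w - \<phi> u) * f w"
        by (simp add: algebra_simps)
      also have "\<bar>\<dots>\<bar> \<le> \<bar>G v - G w\<bar> * \<bar>a w\<bar> + \<bar>\<phi> w - \<phi> u\<bar> * \<bar>f w\<bar>"
        by (metis abs_mult abs_triangle_ineq4)
      also have "\<dots> \<le> (B * (v - u)) * A + (A * (v - u)) * B"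
      proof (intro add_mono mult_mono)
        show "\<bar>G v - G w\<bar> \<le> B * (v - u)"
          using GL[of w v] w uv A0 by (smt (verit, best) atLeastAtMost_iff mult_left_mono)
        show "\<bar>\<phi> w - \<phi> u\<bar> \<le> A * (v - u)"
          using \<phi>L[of u w] w uv A0 by (smt (verit, best) atLeastAtMost_iff mult_left_mono)
      qed (use w uv aA fB A0 in auto)
      finally show "\<bar>\<phi> u * f w + G v * a w - (\<phi> w * f w + a w * G w)\<bar> \<le> 2 * A * B * (v - u)"
        by (simp add: algebra_simps)
    qed (use uv in auto)
    finally show "\<bar>E v - E u\<bar> \<le> 2 * A * B * (v - u)\<^sup>2" by (simp add: power2_eq_square algebra_simps)
  qed
  moreover have "0 \<in> {0..H}" using s by auto
  ultimately show ?thesis using s by (simp add: E_def \<phi>[OF s] G[OF s] \<phi>[of 0] G[of 0])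
qed

text \<open>The bound \<open>|f| <= L * |y|\<close> makes 0 unreachable: running the equation
  backwards from a zero \<open>z\<close> gives a contraction in a weighted supremum norm, so
  \<open>y\<close> would vanish on all of \<open>{0..z}\<close>, in particular at time 0.\<close>

lemma integral_equation_positive:
  fixes y :: "real \<Rightarrow> real"
  assumes y: "\<And>s. s \<in> {0..H} \<Longrightarrow> y s = y0 + (LINT u:{0..s}|lborel. f u)"
    and f: "set_integrable lborel {0..H} f" and c: "continuous_on {0..H} y"
    and fL: "\<And>u. u \<in> {0..H} \<Longrightarrow> \<bar>f u\<bar> \<le> L * \<bar>y u\<bar>" and "0 < L" and y0: "0 < y0" and s: "s \<in> {0..H}"
  shows "0 < y s"
proof (rule ccontr)
  assume "\<not> 0 < y s"
  have H: "0 \<le> H" using s by auto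
  have "y 0 = y0" using y[of 0] H by simp
  then have "\<exists>x\<ge>0. x \<le> s \<and> y x = 0"
    using s \<open>\<not> 0 < y s\<close> y0 by (intro IVT2') (auto intro: continuous_on_subset[OF c])
  then obtain z where z: "0 \<le> z" "z \<le> s" "y z = 0" by auto
  have cc: "continuous_on {0..z} (\<lambda>u. exp (2 * L * u) * \<bar>y u\<bar>)"
    using z s by (intro continuous_intros continuous_on_subset[OF c]) auto
  \<comment> \<open>With the weight \<open>exp (2 * L * u)\<close>, integrating the bound on
    \<open>f\<close> from \<open>w\<close> to \<open>z\<close> gives at most half of
    \<open>|y w|\<close>, so the weighted maximum is 0.\<close>
  obtain w where w: "w \<in> {0..z}" "\<And>u. u \<in> {0..z} \<Longrightarrow> exp (2 * L * u) * \<bar>y u\<bar> \<le> exp (2 * L * w) * \<bar>y w\<bar>"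
    using continuous_attains_sup[OF _ _ cc] z by auto
  define B where "B = exp (2 * L * w) * \<bar>y w\<bar>"
  have yB: "\<bar>y u\<bar> \<le> B * exp (- (2 * L * u))" if "u \<in> {0..z}" for u
    using w(2)[OF that] by (simp add: B_def exp_minus field_simps)
  have "y z - y w = (LINT u:{w..z}|lborel. f u)"
    using set_integral_split[OF f, of w z] w z s by (simp add: y)
  also have "\<bar>\<dots>\<bar> \<le> (LINT u:{w..z}|lborel. L * B * exp (- (2 * L * u)))"
  proof (rule set_integral_abs_le)
    show "set_integrable lborel {w..z} f" using w z s by (auto intro: set_integrable_subset[OF f])
    show "set_integrable lborel {w..z} (\<lambda>u. L * B * exp (- (2 * L * u)))"
      unfolding set_integrable_def by (intro borel_integrable_compact continuous_intros) auto
    fix u assume u: "u \<in> {w..z}"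
    have "\<bar>f u\<bar> \<le> L * \<bar>y u\<bar>" using u w z s by (intro fL) auto
    also have "\<dots> \<le> L * (B * exp (- (2 * L * u)))" using yB[of u] u w \<open>0 < L\<close> by (intro mult_left_mono) auto
    finally show "\<bar>f u\<bar> \<le> L * B * exp (- (2 * L * u))" by simp
  qed auto
  also have "\<dots> = - B / 2 * exp (- (2 * L * z)) - (- B / 2 * exp (- (2 * L * w)))"
    unfolding set_lebesgue_integral_def
  proof (rule integral_FTC_Icc)
    fix x show "((\<lambda>u. - B / 2 * exp (- (2 * L * u))) has_vector_derivative L * B * exp (- (2 * L * x))) (at x within {w..z})"
      unfolding has_real_derivative_iff_has_vector_derivative[symmetric]
      by (auto intro!: derivative_eq_intros)
  qed (use w in \<open>auto intro!: continuous_intros\<close>)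
  also have "\<dots> \<le> B / 2 * exp (- (2 * L * w))" by (simp add: B_def)
  finally have "\<bar>y w\<bar> \<le> B / 2 * exp (- (2 * L * w))" by (simp add: z)
  then have "\<bar>y w\<bar> \<le> \<bar>y w\<bar> / 2" by (simp add: B_def exp_minus field_simps)
  then have "B = 0" by (simp add: B_def)
  then have "y 0 = 0" using yB[of 0] z by simp
  then show False using \<open>y 0 = y0\<close> y0 by simp
qed

text \<open>The weight \<open>exp (- (2 * C * s))\<close> makes the integral term contribute at most
  \<open>S / 2\<close> to the weighted supremum \<open>S\<close>. \<open>B\<close> only guarantees
  that \<open>S\<close> is finite, so that \<open>S / 2\<close> can be cancelled; it leaves no trace
  in the bound.\<close>

lemma gronwall_nn_integral:
  fixes f :: "real \<Rightarrow> ennreal"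
  assumes f[measurable]: "f \<in> borel_measurable borel" and "0 < C" and B: "B < \<infinity>"
    and fB: "\<And>s. s \<in> {0..H} \<Longrightarrow> f s \<le> B"
    and ineq: "\<And>s. s \<in> {0..H} \<Longrightarrow> f s \<le> A + ennreal C * (\<integral>\<^sup>+u\<in>{0..s}. f u \<partial>lborel)"
    and s: "s \<in> {0..H}"
  shows "f s \<le> ennreal (2 * exp (2 * C * H)) * A"
proof -
  define S where "S = (SUP s\<in>{0..H}. f s * ennreal (exp (- (2 * C * s))))"
  have "S \<le> B"
    unfolding S_def
  proof (rule SUP_least)
    fix u assume u: "u \<in> {0..H}"
    have "f u * ennreal (exp (- (2 * C * u))) \<le> B * 1"
      using u \<open>0 < C\<close> by (intro mult_mono fB) auto
    then show "f u * ennreal (exp (- (2 * C * u))) \<le> B" by simp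
  qed
  then have S: "S < \<infinity>" using B by (simp add: order_le_less_trans)
  have exps: "ennreal (exp (- x)) * ennreal (exp x) = 1" for x
    by (metis add.left_inverse ennreal_1 ennreal_mult' exp_add exp_ge_zero exp_zero)
  have fS: "f u \<le> S * ennreal (exp (2 * C * u))" if "u \<in> {0..H}" for u
  proof -
    have "f u * ennreal (exp (- (2 * C * u))) \<le> S" unfolding S_def using that by (intro SUP_upper)
    then have "f u * ennreal (exp (- (2 * C * u))) * ennreal (exp (2 * C * u)) \<le> S * ennreal (exp (2 * C * u))"
      by (intro mult_right_mono) auto
    then show ?thesis by (simp add: mult.assoc exps)
  qed
  have main: "f u * ennreal (exp (- (2 * C * u))) \<le> A + S / 2" if u: "u \<in> {0..H}" for u
  proof -
    have "(\<integral>\<^sup>+w\<in>{0..u}. f w \<partial>lborel) \<le> (\<integral>\<^sup>+w. S * (ennreal (exp (2 * C * w)) * indicator {0..u} w) \<partial>lborel)"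
      using u fS by (intro nn_integral_mono) (auto simp: indicator_def)
    also have "\<dots> = S * (\<integral>\<^sup>+w. ennreal (exp (2 * C * w)) * indicator {0..u} w \<partial>lborel)"
      by (intro nn_integral_cmult) auto
    also have "(\<integral>\<^sup>+w. ennreal (exp (2 * C * w)) * indicator {0..u} w \<partial>lborel)
       = ennreal (exp (2 * C * u) / (2 * C) - exp (2 * C * 0) / (2 * C))"
      using u \<open>0 < C\<close> by (intro nn_integral_FTC_Icc) (auto intro!: derivative_eq_intros)
    also have "\<dots> \<le> ennreal (exp (2 * C * u) / (2 * C))" using \<open>0 < C\<close> by (intro ennreal_leI) simp
    finally have "f u \<le> A + ennreal C * (S * ennreal (exp (2 * C * u) / (2 * C)))"
      using ineq[OF u] by (meson add_left_mono mult_left_mono order_trans zero_le mult_left_mono)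
    also have "ennreal C * (S * ennreal (exp (2 * C * u) / (2 * C))) = S * ennreal (C * (exp (2 * C * u) / (2 * C)))"
      using \<open>0 < C\<close> by (subst ennreal_mult) (auto simp: ac_simps)
    also have "C * (exp (2 * C * u) / (2 * C)) = 1/2 * exp (2 * C * u)" using \<open>0 < C\<close> by simp
    finally have "f u * ennreal (exp (- (2 * C * u)))
        \<le> (A + S * ennreal (1/2 * exp (2 * C * u))) * ennreal (exp (- (2 * C * u)))"
      by (intro mult_right_mono) auto
    also have "\<dots> = A * ennreal (exp (- (2 * C * u))) + S * (ennreal (1/2 * exp (2 * C * u)) * ennreal (exp (- (2 * C * u))))"
      by (simp add: distrib_right mult.assoc)
    also have "ennreal (1/2 * exp (2 * C * u)) * ennreal (exp (- (2 * C * u))) = ennreal (1/2)"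
      by (simp add: ennreal_mult'[symmetric] exp_minus)
    also have "S * ennreal (1/2) = S / 2"
      by (simp add: divide_ennreal_def ennreal_divide_numeral[symmetric] inverse_ennreal[symmetric])
    also have "A * ennreal (exp (- (2 * C * u))) \<le> A * 1" using u \<open>0 < C\<close> by (intro mult_left_mono) auto
    finally show ?thesis by simp
  qed
  have "S \<le> A + S / 2" unfolding S_def[symmetric] by (subst (1) S_def, rule SUP_least) (use main in auto)
  moreover have "S = S / 2 + S / 2"
    using ennreal_mult_divide_eq[of 2 S] by (simp add: mult_2[symmetric] ennreal_times_divide mult.commute)
  moreover have "S / 2 < \<infinity>" using S ennreal_divide_eq_top_iff[of S 2] by (auto simp: less_top)
  ultimately have "S / 2 \<le> A" by (metis add.commute ennreal_add_left_cancel_le infinity_ennreal_def order_less_irrefl)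
  then have "S \<le> 2 * A" using \<open>S = S / 2 + S / 2\<close> by (metis add_mono mult_2)
  have "f s \<le> S * ennreal (exp (2 * C * s))" by (rule fS[OF s])
  also have "\<dots> \<le> (2 * A) * ennreal (exp (2 * C * H))"
    using \<open>S \<le> 2 * A\<close> s \<open>0 < C\<close> by (intro mult_mono ennreal_leI) auto
  also have "\<dots> = ennreal (2 * exp (2 * C * H)) * A" by (simp add: ennreal_mult ac_simps)
  finally show ?thesis .
qed

section \<open>Progressive measurability and random differential equations\<close>

text \<open>
  Clamping the time argument turns measurability on \<open>[0, s] \<times> \<Omega>\<close> into measurability on
  \<open>\<real> \<times> \<Omega>\<close>.
\<close>

definition progressive :: "(real \<Rightarrow> 'a measure) \<Rightarrow> real \<Rightarrow> 'a process \<Rightarrow> bool" where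
  "progressive F H Z \<longleftrightarrow>
     (\<forall>s\<in>{0..H}. (\<lambda>x. Z (max 0 (min (fst x) s)) (snd x)) \<in> borel_measurable (borel \<Otimes>\<^sub>M F s))"

lemma progressiveD:
  "progressive F H Z \<Longrightarrow> 0 \<le> s \<Longrightarrow> s \<le> H \<Longrightarrow>
    (\<lambda>x. Z (max 0 (min (fst x) s)) (snd x)) \<in> borel_measurable (borel \<Otimes>\<^sub>M F s)"
  by (auto simp: progressive_def)

lemma progressive_comp:
  assumes "progressive F H Z" "f \<in> borel_measurable borel"
  shows "progressive F H (\<lambda>s \<omega>. f (Z s \<omega>))"
  unfolding progressive_def using measurable_compose[OF progressiveD[OF assms(1)] assms(2)] by auto

lemma progressive_comp2:
  assumes "progressive F H Z" "progressive F H Y" "(\<lambda>x. f (fst x) (snd x)) \<in> borel_measurable (borel \<Otimes>\<^sub>M borel)"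
  shows "progressive F H (\<lambda>s \<omega>. f (Z s \<omega>) (Y s \<omega>))"
  unfolding progressive_def
proof
  fix s assume s: "s \<in> {0..H}"
  have "(\<lambda>x. (Z (max 0 (min (fst x) s)) (snd x), Y (max 0 (min (fst x) s)) (snd x)))
      \<in> measurable (borel \<Otimes>\<^sub>M F s) (borel \<Otimes>\<^sub>M borel)"
    using progressiveD[OF assms(1), of s] progressiveD[OF assms(2), of s] s by (intro measurable_Pair) auto
  from measurable_compose[OF this assms(3)]
  show "(\<lambda>x. f (Z (max 0 (min (fst x) s)) (snd x)) (Y (max 0 (min (fst x) s)) (snd x))) \<in> borel_measurable (borel \<Otimes>\<^sub>M F s)"
    by simp
qed

lemma progressive_const: "progressive F H (\<lambda>s \<omega>. c)"
  by (simp add: progressive_def)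

lemma progressive_path:
  assumes "progressive F H Z" "0 \<le> s" "s \<le> H" "\<omega> \<in> space (F s)"
  shows "(\<lambda>u. Z (max 0 (min u s)) \<omega>) \<in> borel_measurable borel"
    and "set_borel_measurable lborel {0..s} (\<lambda>u. Z u \<omega>)"
proof -
  show *: "(\<lambda>u. Z (max 0 (min u s)) \<omega>) \<in> borel_measurable borel"
    using measurable_compose[OF measurable_Pair2'[OF assms(4)] progressiveD[OF assms(1-3)]] by simp
  have "(\<lambda>u. indicator {0..s} u *\<^sub>R Z (max 0 (min u s)) \<omega>) \<in> borel_measurable lborel"
    using * by measurable
  moreover have "(\<lambda>u. indicator {0..s} u *\<^sub>R Z (max 0 (min u s)) \<omega>) = (\<lambda>u. indicator {0..s} u *\<^sub>R Z u \<omega>)"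
    by (auto simp: indicator_def)
  ultimately show "set_borel_measurable lborel {0..s} (\<lambda>u. Z u \<omega>)"
    by (simp add: set_borel_measurable_def)
qed

lemma progressive_adapted:
  assumes "progressive F H Z"
  shows "adapted_upto F H Z"
  unfolding adapted_upto_def
proof
  fix s assume s: "s \<in> {0..H}"
  have "(\<lambda>\<omega>. (s, \<omega>)) \<in> measurable (F s) (borel \<Otimes>\<^sub>M F s)" by simp
  from measurable_compose[OF this progressiveD[OF assms]] s
  show "Z s \<in> borel_measurable (F s)" by simp
qed

lemma progressive_set_integral:
  assumes "progressive F H Z"
  shows "adapted_upto F H (\<lambda>s \<omega>. LINT u:{0..s}|lborel. Z u \<omega>)"
  unfolding adapted_upto_def
proof
  fix s assume s: "s \<in> {0..H}"
  have [measurable]: "(\<lambda>x. Z (max 0 (min (fst x) s)) (snd x)) \<in> borel_measurable (borel \<Otimes>\<^sub>M F s)"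
    using s by (intro progressiveD[OF assms]) auto
  have "(\<lambda>x. (snd x, fst x)) \<in> measurable (F s \<Otimes>\<^sub>M borel) (borel \<Otimes>\<^sub>M F s)" by simp
  from measurable_compose[OF this, of "\<lambda>x. Z (max 0 (min (fst x) s)) (snd x)" borel]
  have [measurable]: "(\<lambda>x. Z (max 0 (min (snd x) s)) (fst x)) \<in> borel_measurable (F s \<Otimes>\<^sub>M borel)" by simp
  have "(\<lambda>x. indicator {0..s} (snd x) *\<^sub>R Z (max 0 (min (snd x) s)) (fst x)) \<in> borel_measurable (F s \<Otimes>\<^sub>M borel)"
    by measurable
  then have "(\<lambda>(\<omega>, u). indicator {0..s} u *\<^sub>R Z (max 0 (min u s)) \<omega>) \<in> borel_measurable (F s \<Otimes>\<^sub>M lborel)"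
    by (simp add: case_prod_beta)
  then have "(\<lambda>\<omega>. LINT u|lborel. indicator {0..s} u *\<^sub>R Z (max 0 (min u s)) \<omega>) \<in> borel_measurable (F s)"
    by (rule lborel.borel_measurable_lebesgue_integral)
  moreover have "(\<lambda>u. indicator {0..s} u *\<^sub>R Z (max 0 (min u s)) \<omega>) = (\<lambda>u. indicator {0..s} u *\<^sub>R Z u \<omega>)" for \<omega>
    by (auto simp: indicator_def)
  ultimately show "(\<lambda>\<omega>. LINT u:{0..s}|lborel. Z u \<omega>) \<in> borel_measurable (F s)"
    unfolding set_lebesgue_integral_def by (simp only:)
qed

lemma filtration_measurable:
  assumes "filtration \<Omega> F" "s \<le> t" "f \<in> borel_measurable (F s)"
  shows "f \<in> borel_measurable (F t)"
proof -
  interpret filtration \<Omega> F by fact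
  have "subalgebra (F t) (F s)" using sets_F_mono[OF assms(2)] by (simp add: subalgebra_def space_F)
  then show ?thesis using assms(3) measurable_from_subalg by blast
qed

text \<open>Each path is sampled at a grid time strictly to the right of the current time, cut off
  at \<open>s\<close>. For a fixed mesh only countably many sampling times occur, all of them at
  most \<open>s\<close>, which gives joint measurability; right-continuity gives the limit.\<close>

lemma progressive_cadlag:
  fixes F :: "real \<Rightarrow> 'a measure"
  assumes "filtration \<Omega> F" "adapted_upto F H Z" "\<And>\<omega>. \<omega> \<in> \<Omega> \<Longrightarrow> cadlag_upto H (\<lambda>s. Z s \<omega>)"
  shows "progressive F H Z"
  unfolding progressive_def
proof
  interpret filtration \<Omega> F by fact
  fix s assume s: "s \<in> {0..H}"
  \<comment> \<open>The first multiple of \<open>1 / Suc n\<close> strictly after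
    \<open>max 0 u\<close>. Strictness matters, because \<open>at_right\<close> excludes the point
    itself.\<close>
  define t where "t n u = (real_of_int \<lfloor>max 0 u * real (Suc n)\<rfloor> + 1) / real (Suc n)" for n and u :: real
  have t1: "max 0 u < t n u" and t2: "t n u \<le> max 0 u + 1 / real (Suc n)" for n u
  proof -
    have "max 0 u * real (Suc n) < real_of_int \<lfloor>max 0 u * real (Suc n)\<rfloor> + 1" by linarith
    then show "max 0 u < t n u" unfolding t_def by (subst pos_less_divide_eq) auto
    have "real_of_int \<lfloor>max 0 u * real (Suc n)\<rfloor> \<le> max 0 u * real (Suc n)" by linarith
    then have "t n u \<le> (max 0 u * real (Suc n) + 1) / real (Suc n)" unfolding t_def by (intro divide_right_mono) auto
    also have "\<dots> = max 0 u + 1 / real (Suc n)" by (simp add: add_divide_distrib)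
    finally show "t n u \<le> max 0 u + 1 / real (Suc n)" .
  qed
  show "(\<lambda>x. Z (max 0 (min (fst x) s)) (snd x)) \<in> borel_measurable (borel \<Otimes>\<^sub>M F s)"
  proof (rule borel_measurable_LIMSEQ_real)
    fix n
    have Z: "(\<lambda>x. Z (max 0 (min s ((real_of_int i + 1) / real (Suc n)))) (snd x)) \<in> borel_measurable (borel \<Otimes>\<^sub>M F s)" for i
    proof -
      define r where "r = max 0 (min s ((real_of_int i + 1) / real (Suc n)))"
      have r: "r \<in> {0..H}" "r \<le> s" using s by (auto simp: r_def)
      have "Z r \<in> borel_measurable (F s)"
        using assms(2) r filtration_measurable[OF assms(1) r(2), of "Z r"] unfolding adapted_upto_def by blast
      then have "Z (max 0 (min s ((real_of_int i + 1) / real (Suc n)))) \<in> borel_measurable (F s)"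
        by (simp only: r_def)
      then show ?thesis by (rule measurable_compose[OF measurable_snd])
    qed
    have fl: "(\<lambda>x. \<lfloor>max 0 (fst x) * real (Suc n)\<rfloor>) \<in> measurable (borel \<Otimes>\<^sub>M F s) (count_space UNIV)"
      by measurable
    have "(\<lambda>x. Z (max 0 (min s ((real_of_int \<lfloor>max 0 (fst x) * real (Suc n)\<rfloor> + 1) / real (Suc n)))) (snd x))
       \<in> borel_measurable (borel \<Otimes>\<^sub>M F s)"
      by (rule measurable_compose_countable[OF Z fl])
    moreover have "max 0 (min s (t n u)) = min s (t n u)" for u
      using t1[of u n] s by auto
    ultimately show "(\<lambda>x. Z (min s (t n (fst x))) (snd x)) \<in> borel_measurable (borel \<Otimes>\<^sub>M F s)"
      by (simp add: t_def)
  next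
    fix x :: "real \<times> 'a" assume "x \<in> space (borel \<Otimes>\<^sub>M F s)"
    then have \<omega>: "snd x \<in> \<Omega>" by (auto simp: space_pair_measure space_F)
    define v where "v = max 0 (fst x)"
    show "(\<lambda>n. Z (min s (t n (fst x))) (snd x)) \<longlonglongrightarrow> Z (max 0 (min (fst x) s)) (snd x)"
    proof (cases "v < s")
      \<comment> \<open>From \<open>s\<close> on all cut-off sampling times equal \<open>s\<close>,
        so no limit is involved. In the other case \<open>v < s \<le> H\<close>, where
        right-continuity is available.\<close>
      case False
      then have "min s (t n (fst x)) = s" for n using t1[of "fst x" n] s by (auto simp: v_def min_def)
      moreover have "max 0 (min (fst x) s) = s" using False s by (auto simp: v_def)
      ultimately show ?thesis by simp
    next
      case True
      have v: "max 0 (min (fst x) s) = v" "0 \<le> v" using True by (auto simp: v_def)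
      have "((\<lambda>u. Z u (snd x)) \<longlongrightarrow> Z v (snd x)) (at_right v)"
        using assms(3)[OF \<omega>] True s v by (auto simp: cadlag_upto_def)
      moreover have "filterlim (\<lambda>n. min s (t n (fst x))) (at_right v) sequentially"
        unfolding filterlim_at
      proof
        show "(\<lambda>n. min s (t n (fst x))) \<longlonglongrightarrow> v"
        proof (rule tendsto_sandwich)
          show "(\<lambda>n. v) \<longlonglongrightarrow> v" by simp
          have "(\<lambda>n. v + 1 / real (Suc n)) \<longlonglongrightarrow> v + 0" by (intro tendsto_intros LIMSEQ_Suc lim_1_over_n)
          then show "(\<lambda>n. v + 1 / real (Suc n)) \<longlonglongrightarrow> v" by simp
          show "\<forall>\<^sub>F n in sequentially. v \<le> min s (t n (fst x))"
            using t1[of "fst x"] True by (intro always_eventually) (auto simp: v_def less_imp_le)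
          show "\<forall>\<^sub>F n in sequentially. min s (t n (fst x)) \<le> v + 1 / real (Suc n)"
            using t2[of _ "fst x"] unfolding v_def by (intro always_eventually allI min.coboundedI2) 
        qed
        show "\<forall>\<^sub>F n in sequentially. min s (t n (fst x)) \<in> {v<..} \<and> min s (t n (fst x)) \<noteq> v"
        proof (intro always_eventually allI)
          fix n
          have "v < t n (fst x)" unfolding v_def by (rule t1)
          then show "min s (t n (fst x)) \<in> {v<..} \<and> min s (t n (fst x)) \<noteq> v" using True by simp
        qed
      qed
      ultimately show ?thesis unfolding v(1) by (rule filterlim_compose)
    qed
  qed
qed

lemma cadlag_continuous:
  assumes "continuous_on {0..H} f"
  shows "cadlag_upto H f"
  unfolding cadlag_upto_def
proof (intro conjI ballI)
  fix s assume s: "s \<in> {0..<H}"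
  have "(f \<longlongrightarrow> f s) (at s within {0..H})" using assms s by (auto simp: continuous_on_def)
  then have "(f \<longlongrightarrow> f s) (at s within {s..H})" by (rule tendsto_within_subset) (use s in auto)
  then show "(f \<longlongrightarrow> f s) (at_right s)" using s by (simp add: at_within_Icc_at_right)
next
  fix s assume s: "s \<in> {0<..H}"
  have "(f \<longlongrightarrow> f s) (at s within {0..H})" using assms s by (auto simp: continuous_on_def)
  then have "(f \<longlongrightarrow> f s) (at s within {0..s})" by (rule tendsto_within_subset) (use s in auto)
  then show "\<exists>l. (f \<longlongrightarrow> l) (at_left s)" using s by (auto simp: at_within_Icc_at_left)
qed

lemma progressive_continuous:
  assumes "filtration \<Omega> F" "adapted_upto F H Z" "\<And>\<omega>. \<omega> \<in> \<Omega> \<Longrightarrow> continuous_on {0..H} (\<lambda>s. Z s \<omega>)"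
  shows "progressive F H Z"
  using assms by (intro progressive_cadlag) (auto intro: cadlag_continuous)

section \<open>Picard iteration for random differential equations\<close>

lemma set_integral_exp_le:
  fixes L s :: real
  assumes "0 < L" "0 \<le> s"
  shows "(LINT u:{0..s}|lborel. exp (2 * L * u)) \<le> (exp (2 * L * s) - 1) / (2 * L)"
proof -
  have "(LINT u:{0..s}|lborel. exp (2 * L * u)) = exp (2 * L * s) / (2 * L) - exp (2 * L * 0) / (2 * L)"
    unfolding set_lebesgue_integral_def
  proof (rule integral_FTC_Icc)
    fix x show "((\<lambda>u. exp (2 * L * u) / (2 * L)) has_vector_derivative exp (2 * L * x)) (at x within {0..s})"
      unfolding has_real_derivative_iff_has_vector_derivative[symmetric]
      using assms by (auto intro!: derivative_eq_intros)
  qed (use assms in \<open>auto intro!: continuous_intros\<close>)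
  then show ?thesis by (simp add: diff_divide_distrib)
qed

text \<open>The exponential weight with rate \<open>2 * L\<close> turns the Lipschitz constant
  \<open>L\<close> into the factor 1/2 that drives the iteration.\<close>

lemma set_integral_exp_bound:
  fixes f :: "real \<Rightarrow> real"
  assumes "0 < L" "0 \<le> c" "set_integrable lborel {0..s} f" "0 \<le> s"
    "\<And>u. u \<in> {0..s} \<Longrightarrow> \<bar>f u\<bar> \<le> L * (c * exp (2 * L * u))"
  shows "\<bar>LINT u:{0..s}|lborel. f u\<bar> \<le> c * ((exp (2 * L * s) - 1) / 2)"
proof -
  have "\<bar>LINT u:{0..s}|lborel. f u\<bar> \<le> (LINT u:{0..s}|lborel. L * c * exp (2 * L * u))"
  proof (rule set_integral_abs_le[OF assms(3)])
    show "set_integrable lborel {0..s} (\<lambda>u. L * c * exp (2 * L * u))"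
      by (intro borel_integrable_atLeastAtMost' continuous_intros)
  qed (use assms in \<open>auto simp: mult.assoc\<close>)
  also have "\<dots> = L * c * (LINT u:{0..s}|lborel. exp (2 * L * u))" by simp
  also have "\<dots> \<le> L * c * ((exp (2 * L * s) - 1) / (2 * L))"
    using assms by (intro mult_left_mono set_integral_exp_le) auto
  also have "\<dots> = c * ((exp (2 * L * s) - 1) / 2)" using assms by simp
  finally show ?thesis .
qed

text \<open>Picard iteration in the supremum norm weighted by \<open>exp (- (2 * L * s))\<close>,
  carried out on processes, so that every iterate and the pointwise limit are progressive.
  Measurability of the coefficient enters only through \<open>prog\<close>, as substitution of
  progressive processes; \<open>zero\<close> yields a bound on the iterates that does not depend on
  \<open>\<omega>\<close>.\<close>

lemma random_ode:
  fixes f :: "real \<Rightarrow> 'a \<Rightarrow> real \<Rightarrow> real"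
  assumes filt: "filtration \<Omega> F" and L: "0 < L"
    and lip: "\<And>u \<omega> y y'. u \<in> {0..H} \<Longrightarrow> \<omega> \<in> \<Omega> \<Longrightarrow> \<bar>f u \<omega> y - f u \<omega> y'\<bar> \<le> L * \<bar>y - y'\<bar>"
    and zero: "\<And>u \<omega>. u \<in> {0..H} \<Longrightarrow> \<omega> \<in> \<Omega> \<Longrightarrow> f u \<omega> 0 = 0"
    and prog: "\<And>Z. progressive F H Z \<Longrightarrow> progressive F H (\<lambda>u \<omega>. f u \<omega> (Z u \<omega>))"
  obtains Y where "progressive F H Y" "\<And>\<omega>. \<omega> \<in> \<Omega> \<Longrightarrow> continuous_on {0..H} (\<lambda>s. Y s \<omega>)"
    "\<And>\<omega>. \<omega> \<in> \<Omega> \<Longrightarrow> set_integrable lborel {0..H} (\<lambda>u. f u \<omega> (Y u \<omega>))"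
    "\<And>\<omega> s. \<omega> \<in> \<Omega> \<Longrightarrow> s \<in> {0..H} \<Longrightarrow> Y s \<omega> = y0 + (LINT u:{0..s}|lborel. f u \<omega> (Y u \<omega>))"
proof (cases "0 \<le> H")
  case False
  \<comment> \<open>For negative \<open>H\<close> all requirements range over an empty
    interval.\<close>
  then show thesis by (intro that[of "\<lambda>_ _. 0"]) (auto simp: progressive_def set_integrable_def)
next
  case H: True
  interpret filtration \<Omega> F by fact
  define c where "c = \<bar>y0\<bar>"
  have c0: "0 \<le> c" by (simp add: c_def)
  define Y where "Y = rec_nat (\<lambda>s \<omega>. y0) (\<lambda>_ Z s \<omega>. y0 + (LINT u:{0..s}|lborel. f u \<omega> (Z u \<omega>)))"
  have Y0: "Y 0 = (\<lambda>s \<omega>. y0)" and YS: "Y (Suc n) = (\<lambda>s \<omega>. y0 + (LINT u:{0..s}|lborel. f u \<omega> (Y n u \<omega>)))" for n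
    by (simp_all add: Y_def)
  have fL: "\<bar>f u \<omega> y\<bar> \<le> L * \<bar>y\<bar>" if "u \<in> {0..H}" "\<omega> \<in> \<Omega>" for u \<omega> y
    using lip[OF that, of y 0] zero[OF that] by simp
  have mon: "exp (2 * L * u) \<le> exp (2 * L * H)" if "u \<in> {0..H}" for u
    using that L by simp
  have integ: "set_integrable lborel {0..H} (\<lambda>u. f u \<omega> (Z u \<omega>))"
    if Z: "progressive F H Z" "\<And>u. u \<in> {0..H} \<Longrightarrow> \<bar>Z u \<omega>\<bar> \<le> c * exp (2 * L * u)" and \<omega>: "\<omega> \<in> \<Omega>" for Z \<omega>
  proof (rule set_integrable_bounded)
    show "set_borel_measurable lborel {0..H} (\<lambda>u. f u \<omega> (Z u \<omega>))"
      using progressive_path(2)[OF prog[OF Z(1)], of H \<omega>] H \<omega> by (simp add: space_F)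
    fix u assume u: "u \<in> {0..H}"
    have "\<bar>f u \<omega> (Z u \<omega>)\<bar> \<le> L * \<bar>Z u \<omega>\<bar>" using fL[OF u \<omega>] .
    also have "\<dots> \<le> L * (c * exp (2 * L * H))"
      using Z(2)[OF u] mon[OF u] L c0 by (intro mult_left_mono order_trans[OF Z(2)[OF u]]) auto
    finally show "\<bar>f u \<omega> (Z u \<omega>)\<bar> \<le> L * (c * exp (2 * L * H))" .
  qed
  have sub: "set_integrable lborel {0..s} g" if "set_integrable lborel {0..H} g" "s \<le> H" for s and g :: "real \<Rightarrow> real"
    using that by (auto intro: set_integrable_subset[OF that(1)])
  \<comment> \<open>The induction closes because \<open>c + c * ((E - 1) / 2) \<le> c * E\<close>
    for \<open>E = exp (2 * L * u) \<ge> 1\<close>, with \<open>c = |y0|\<close>.\<close>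
  have inv: "progressive F H (Y n) \<and> (\<forall>\<omega>\<in>\<Omega>. \<forall>u\<in>{0..H}. \<bar>Y n u \<omega>\<bar> \<le> c * exp (2 * L * u))" for n
  proof (induction n)
    case 0
    have "c * 1 \<le> c * exp (2 * L * u)" if "u \<in> {0..H}" for u
      using that L c0 by (intro mult_left_mono) auto
    then show ?case by (auto simp: Y0 progressive_const c_def)
  next
    case (Suc n)
    have I: "set_integrable lborel {0..H} (\<lambda>u. f u \<omega> (Y n u \<omega>))" if "\<omega> \<in> \<Omega>" for \<omega>
      using Suc that by (intro integ) auto
    have fb: "\<bar>f u \<omega> (Y n u \<omega>)\<bar> \<le> L * (c * exp (2 * L * u))" if "\<omega> \<in> \<Omega>" "u \<in> {0..H}" for \<omega> u
      using Suc that L by (intro order_trans[OF fL]) (auto intro!: mult_left_mono)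
    have fb': "\<bar>f u \<omega> (Y n u \<omega>)\<bar> \<le> L * (c * exp (2 * L * H))" if "\<omega> \<in> \<Omega>" "u \<in> {0..H}" for \<omega> u
      using fb[OF that] mon[OF that(2)] L c0 by (meson less_imp_le mult_left_mono order_trans)
    have "adapted_upto F H (Y (Suc n))"
      using progressive_set_integral[OF prog[of "Y n"]] Suc by (auto simp: YS adapted_upto_def)
    moreover have "continuous_on {0..H} (\<lambda>s. Y (Suc n) s \<omega>)" if "\<omega> \<in> \<Omega>" for \<omega>
      unfolding YS using set_integral_continuous_on[OF I[OF that] fb'[OF that]] by (intro continuous_intros) auto
    ultimately have "progressive F H (Y (Suc n))" by (intro progressive_continuous[OF filt]) auto
    moreover have "\<bar>Y (Suc n) s \<omega>\<bar> \<le> c * exp (2 * L * s)" if \<omega>: "\<omega> \<in> \<Omega>" and s: "s \<in> {0..H}" for s \<omega>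
    proof -
      have "\<bar>LINT u:{0..s}|lborel. f u \<omega> (Y n u \<omega>)\<bar> \<le> c * ((exp (2 * L * s) - 1) / 2)"
        using s \<omega> c0 L by (intro set_integral_exp_bound sub[OF I]) (auto intro!: fb)
      then have "\<bar>Y (Suc n) s \<omega>\<bar> \<le> c + c * ((exp (2 * L * s) - 1) / 2)"
        by (simp add: YS c_def)
      also have "\<dots> = c * (exp (2 * L * s) - (exp (2 * L * s) - 1) / 2)" by (simp add: field_simps)
      also have "\<dots> \<le> c * exp (2 * L * s)"
        using s L c0 by (intro mult_left_mono) auto
      finally show ?thesis .
    qed
    ultimately show ?case by auto
  qed
  have I: "set_integrable lborel {0..H} (\<lambda>u. f u \<omega> (Y n u \<omega>))" if "\<omega> \<in> \<Omega>" for \<omega> n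
    using inv that by (intro integ) auto
  \<comment> \<open>Lipschitz continuity and the weighted estimate halve the weighted distance of
    successive iterates.\<close>
  have step: "\<bar>Y (Suc n) s \<omega> - Y n s \<omega>\<bar> \<le> c * (1/2) ^ n * exp (2 * L * s)" if "\<omega> \<in> \<Omega>" "s \<in> {0..H}" for n s \<omega>
    using that(2)
  proof (induction n arbitrary: s)
    case 0
    have "\<bar>LINT u:{0..s}|lborel. f u \<omega> (Y 0 u \<omega>)\<bar> \<le> c * ((exp (2 * L * s) - 1) / 2)"
    proof (rule set_integral_exp_bound)
      fix u assume "u \<in> {0..s}"
      then have "\<bar>f u \<omega> (Y 0 u \<omega>)\<bar> \<le> L * \<bar>Y 0 u \<omega>\<bar>" "\<bar>Y 0 u \<omega>\<bar> \<le> c * exp (2 * L * u)"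
        using 0 that inv by (auto intro!: fL)
      then show "\<bar>f u \<omega> (Y 0 u \<omega>)\<bar> \<le> L * (c * exp (2 * L * u))"
        using L by (meson less_imp_le mult_left_mono order_trans)
    qed (use 0 L c0 that in \<open>auto intro!: sub[OF I]\<close>)
    also have "\<dots> \<le> c * exp (2 * L * s)"
    proof -
      have *: "(E - 1) / 2 \<le> E" if "0 < E" for E :: real using that by simp
      show ?thesis by (rule mult_left_mono[OF *[OF exp_gt_zero] c0])
    qed
    finally show ?case by (simp add: YS) (simp add: Y0)
  next
    case (Suc n)
    have "Y (Suc (Suc n)) s \<omega> - Y (Suc n) s \<omega>
        = (LINT u:{0..s}|lborel. f u \<omega> (Y (Suc n) u \<omega>)) - (LINT u:{0..s}|lborel. f u \<omega> (Y n u \<omega>))"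
      by (simp add: YS[of "Suc n"] YS[of n])
    also have "\<dots> = (LINT u:{0..s}|lborel. f u \<omega> (Y (Suc n) u \<omega>) - f u \<omega> (Y n u \<omega>))"
      using sub[OF I[OF that(1), of "Suc n"]] sub[OF I[OF that(1), of n]] Suc.prems
      by (intro set_integral_diff(2)[symmetric]) auto
    also have "\<bar>\<dots>\<bar> \<le> (c * (1/2) ^ n) * ((exp (2 * L * s) - 1) / 2)"
    proof (rule set_integral_exp_bound)
      fix u assume u: "u \<in> {0..s}"
      then have "\<bar>f u \<omega> (Y (Suc n) u \<omega>) - f u \<omega> (Y n u \<omega>)\<bar> \<le> L * \<bar>Y (Suc n) u \<omega> - Y n u \<omega>\<bar>"
        using Suc.prems that by (intro lip) auto
      also have "\<dots> \<le> L * (c * (1/2) ^ n * exp (2 * L * u))"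
        using Suc u L by (intro mult_left_mono) auto
      finally show "\<bar>f u \<omega> (Y (Suc n) u \<omega>) - f u \<omega> (Y n u \<omega>)\<bar> \<le> L * (c * (1/2) ^ n * exp (2 * L * u))" .
    qed (use Suc.prems L c0 that in \<open>auto intro!: sub[OF I] set_integral_diff\<close>)
    also have "\<dots> \<le> (c * (1/2) ^ n) * (exp (2 * L * s) / 2)" using c0 by (intro mult_left_mono) auto
    finally show ?case by (simp add: field_simps)
  qed
  define D where "D = c * exp (2 * L * H)"
  have D0: "0 \<le> D" by (simp add: D_def c0)
  have step': "\<bar>Y (Suc n) s \<omega> - Y n s \<omega>\<bar> \<le> D * (1/2) ^ n" if "\<omega> \<in> \<Omega>" "s \<in> {0..H}" for n s \<omega>
  proof -
    have "c * (1/2) ^ n * exp (2 * L * s) \<le> c * (1/2) ^ n * exp (2 * L * H)"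
      using that mon c0 by (intro mult_left_mono) auto
    then show ?thesis using step[OF that, of n] by (simp add: D_def mult.assoc mult.commute mult.left_commute)
  qed
  have tele: "\<bar>Y (n + k) s \<omega> - Y n s \<omega>\<bar> \<le> D * (1/2) ^ n * (2 - 2 * (1/2) ^ k)" if "\<omega> \<in> \<Omega>" "s \<in> {0..H}" for n k s \<omega>
  proof (induction k)
    case (Suc k)
    have "\<bar>Y (n + Suc k) s \<omega> - Y n s \<omega>\<bar> \<le> D * (1/2) ^ (n + k) + D * (1/2) ^ n * (2 - 2 * (1/2) ^ k)"
      using step'[OF that, of "n + k"] Suc by simp
    also have "\<dots> = D * (1/2) ^ n * (2 - 2 * (1/2) ^ Suc k)" by (simp add: power_add field_simps)
    finally show ?case .
  qed simp
  have tele': "\<bar>Y m s \<omega> - Y n s \<omega>\<bar> \<le> 2 * D * (1/2) ^ n" if "\<omega> \<in> \<Omega>" "s \<in> {0..H}" "n \<le> m" for n m s \<omega>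
  proof -
    have "D * (1/2) ^ n * (2 - 2 * (1/2) ^ (m - n)) \<le> D * (1/2) ^ n * 2" using D0 by (intro mult_left_mono) auto
    then show ?thesis using tele[OF that(1,2), of n "m - n"] that(3) by (simp add: mult.assoc mult.commute mult.left_commute)
  qed
  have null: "(\<lambda>n. K * (1/2) ^ n) \<longlonglongrightarrow> (0::real)" for K
    using tendsto_mult_right_zero[OF LIMSEQ_power_zero[of "1/2::real"], of K] by simp
  define Z where "Z s \<omega> = lim (\<lambda>n. Y n s \<omega>)" for s \<omega>
  have conv: "(\<lambda>n. Y n s \<omega>) \<longlonglongrightarrow> Z s \<omega>" if "\<omega> \<in> \<Omega>" "s \<in> {0..H}" for s \<omega>
  proof -
    have "Cauchy (\<lambda>n. Y n s \<omega>)"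
    proof (rule metric_CauchyI)
      fix e :: real assume "0 < e"
      have "\<forall>\<^sub>F n in sequentially. 4 * D * (1/2) ^ n < e"
        using order_tendstoD(2)[OF null[of "4 * D"] \<open>0 < e\<close>] .
      then obtain N where N: "4 * D * (1/2) ^ N < e" by (auto simp: eventually_sequentially)
      have "dist (Y m s \<omega>) (Y n s \<omega>) < e" if "m \<ge> N" "n \<ge> N" for m n
        using tele'[OF \<open>\<omega> \<in> \<Omega>\<close> \<open>s \<in> {0..H}\<close> that(1)] tele'[OF \<open>\<omega> \<in> \<Omega>\<close> \<open>s \<in> {0..H}\<close> that(2)] N
        unfolding dist_real_def by linarith
      then show "\<exists>N. \<forall>m\<ge>N. \<forall>n\<ge>N. dist (Y m s \<omega>) (Y n s \<omega>) < e" by blast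
    qed
    then show ?thesis unfolding Z_def by (simp add: Cauchy_convergent_iff convergent_LIMSEQ_iff)
  qed
  have close: "\<bar>Z s \<omega> - Y n s \<omega>\<bar> \<le> 2 * D * (1/2) ^ n" if "\<omega> \<in> \<Omega>" "s \<in> {0..H}" for n s \<omega>
  proof (rule LIMSEQ_le_const2)
    show "(\<lambda>m. \<bar>Y m s \<omega> - Y n s \<omega>\<bar>) \<longlonglongrightarrow> \<bar>Z s \<omega> - Y n s \<omega>\<bar>"
      using conv[OF that] by (intro tendsto_intros)
    show "\<exists>N. \<forall>m\<ge>N. \<bar>Y m s \<omega> - Y n s \<omega>\<bar> \<le> 2 * D * (1/2) ^ n" using tele'[OF that] by blast
  qed
  have Zb: "\<bar>Z u \<omega>\<bar> \<le> c * exp (2 * L * u)" if "\<omega> \<in> \<Omega>" "u \<in> {0..H}" for u \<omega>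
  proof (rule LIMSEQ_le_const2)
    show "(\<lambda>m. \<bar>Y m u \<omega>\<bar>) \<longlonglongrightarrow> \<bar>Z u \<omega>\<bar>" using conv[OF that] by (intro tendsto_intros)
    show "\<exists>N. \<forall>m\<ge>N. \<bar>Y m u \<omega>\<bar> \<le> c * exp (2 * L * u)" using inv that by blast
  qed
  \<comment> \<open>With clamped time arguments, convergence at the times in \<open>{0..H}\<close>
    is enough for joint measurability of the limit.\<close>
  have Zp: "progressive F H Z"
    unfolding progressive_def
  proof
    fix s assume s: "s \<in> {0..H}"
    show "(\<lambda>x. Z (max 0 (min (fst x) s)) (snd x)) \<in> borel_measurable (borel \<Otimes>\<^sub>M F s)"
    proof (rule borel_measurable_LIMSEQ_real)
      fix n show "(\<lambda>x. Y n (max 0 (min (fst x) s)) (snd x)) \<in> borel_measurable (borel \<Otimes>\<^sub>M F s)"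
        using inv[of n] s by (intro progressiveD) auto
    next
      fix x :: "real \<times> 'a" assume "x \<in> space (borel \<Otimes>\<^sub>M F s)"
      then show "(\<lambda>n. Y n (max 0 (min (fst x) s)) (snd x)) \<longlonglongrightarrow> Z (max 0 (min (fst x) s)) (snd x)"
        using s by (intro conv) (auto simp: space_pair_measure space_F)
    qed
  qed
  have ZI: "set_integrable lborel {0..H} (\<lambda>u. f u \<omega> (Z u \<omega>))" if "\<omega> \<in> \<Omega>" for \<omega>
    using Zp Zb that by (intro integ) auto
  have Zeq: "Z s \<omega> = y0 + (LINT u:{0..s}|lborel. f u \<omega> (Z u \<omega>))" if \<omega>: "\<omega> \<in> \<Omega>" and s: "s \<in> {0..H}" for s \<omega>
  \<comment> \<open>Both sides are limits of \<open>Y (Suc n)\<close>; the uniform closeness of the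
    iterates to \<open>Z\<close> carries the limit through the integral.\<close>
  proof (rule LIMSEQ_unique)
    show "(\<lambda>n. Y (Suc n) s \<omega>) \<longlonglongrightarrow> Z s \<omega>" using conv[OF \<omega> s] by (rule LIMSEQ_Suc)
    show "(\<lambda>n. Y (Suc n) s \<omega>) \<longlonglongrightarrow> y0 + (LINT u:{0..s}|lborel. f u \<omega> (Z u \<omega>))"
      unfolding YS
    proof (rule tendsto_add[OF tendsto_const], rule LIM_zero_cancel, rule Lim_null_comparison)
      show "\<forall>\<^sub>F n in sequentially. norm ((LINT u:{0..s}|lborel. f u \<omega> (Y n u \<omega>)) - (LINT u:{0..s}|lborel. f u \<omega> (Z u \<omega>)))
          \<le> (2 * D * L * s) * (1/2) ^ n"
      proof (intro always_eventually allI)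
        fix n
        have "(LINT u:{0..s}|lborel. f u \<omega> (Z u \<omega>)) - (LINT u:{0..s}|lborel. f u \<omega> (Y n u \<omega>))
           = (LINT u:{0..s}|lborel. f u \<omega> (Z u \<omega>) - f u \<omega> (Y n u \<omega>))"
          using sub[OF I[OF \<omega>]] sub[OF ZI[OF \<omega>]] s by (subst set_integral_diff) auto
        also have "\<bar>\<dots>\<bar> \<le> L * (2 * D * (1/2) ^ n) * (s - 0)"
        proof (rule set_integral_bound)
          fix u assume u: "u \<in> {0..s}"
          have "\<bar>f u \<omega> (Z u \<omega>) - f u \<omega> (Y n u \<omega>)\<bar> \<le> L * \<bar>Z u \<omega> - Y n u \<omega>\<bar>" using u s \<omega> by (intro lip) auto
          also have "\<dots> \<le> L * (2 * D * (1/2) ^ n)" using u s \<omega> L by (intro mult_left_mono close) auto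
          finally show "\<bar>f u \<omega> (Z u \<omega>) - f u \<omega> (Y n u \<omega>)\<bar> \<le> L * (2 * D * (1/2) ^ n)" .
        qed (use s \<omega> in \<open>auto intro!: sub[OF I] sub[OF ZI] set_integral_diff\<close>)
        finally show "norm ((LINT u:{0..s}|lborel. f u \<omega> (Y n u \<omega>)) - (LINT u:{0..s}|lborel. f u \<omega> (Z u \<omega>)))
          \<le> (2 * D * L * s) * (1/2) ^ n" by (simp add: mult_ac abs_minus_commute)
      qed
    qed (rule null)
  qed
  show thesis
  proof (rule that[OF Zp _ ZI Zeq])
    fix \<omega> assume \<omega>: "\<omega> \<in> \<Omega>"
    have fb: "\<bar>f u \<omega> (Z u \<omega>)\<bar> \<le> L * (c * exp (2 * L * H))" if u: "u \<in> {0..H}" for u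
      using fL[OF u \<omega>, of "Z u \<omega>"] Zb[OF \<omega> u] mon[OF u] L c0 by (meson less_imp_le mult_left_mono order_trans)
    have "continuous_on {0..H} (\<lambda>s. y0 + (LINT u:{0..s}|lborel. f u \<omega> (Z u \<omega>)))"
      using set_integral_continuous_on[OF ZI[OF \<omega>] fb] by (intro continuous_intros) auto
    then show "continuous_on {0..H} (\<lambda>s. Z s \<omega>)"
      by (rule continuous_on_cong[THEN iffD1, rotated 2]) (use Zeq[OF \<omega>] in auto)
  qed
qed

section \<open>Simple integrands on refined grids\<close>

text \<open>\<open>P\<close> stands for the possible jump times of a simple integrand, so that the
  integrand is constant on each cell. Strict increase excludes empty cells; for \<open>a = b\<close>
  the grid has \<open>N = 0\<close> and no cell at all.\<close>

definition grid :: "real set \<Rightarrow> real \<Rightarrow> real \<Rightarrow> real \<Rightarrow> nat \<Rightarrow> (nat \<Rightarrow> real) \<Rightarrow> bool" where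
  "grid P \<epsilon> a b N q \<longleftrightarrow> q 0 = a \<and> q N = b \<and> P \<inter> {a..b} \<subseteq> q ` {..N} \<and>
     (\<forall>i<N. q i < q (Suc i) \<and> q (Suc i) - q i \<le> \<epsilon> \<and> P \<inter> {q i<..<q (Suc i)} = {})"

lemma grid_exists:
  assumes "finite P" "0 < \<epsilon>" "a \<le> b"
  shows "\<exists>N q. grid P \<epsilon> a b N q"
proof -
  define K where "K = nat \<lceil>(b - a) / \<epsilon>\<rceil> + 1"
  define A where "A = {a, b} \<union> (P \<inter> {a..b}) \<union> ((\<lambda>i. a + real i * \<epsilon>) ` {..K} \<inter> {a..b})"
  have fin: "finite A" and ab: "a \<in> A" "b \<in> A" "A \<subseteq> {a..b}" using assms by (auto simp: A_def)
  define xs where "xs = sorted_list_of_set A"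
  have xs: "set xs = A" "sorted_wrt (<) xs" using fin by (auto simp: xs_def)
  have len: "0 < length xs" using xs ab by (cases xs) auto
  define N where "N = length xs - 1"
  have lt: "xs ! i < xs ! j" if "i < j" "j < length xs" for i j
    using sorted_wrt_nth_less[OF xs(2) that] .
  have le: "xs ! i \<le> xs ! j" if "i \<le> j" "j < length xs" for i j
    using lt[of i j] that by (cases "i = j") auto
  obtain ia where ia: "ia < length xs" "xs ! ia = a" using ab xs by (metis in_set_conv_nth)
  obtain ib where ib: "ib < length xs" "xs ! ib = b" using ab xs by (metis in_set_conv_nth)
  have mem: "xs ! i \<in> {a..b}" if "i < length xs" for i using xs ab that nth_mem by blast
  have q0: "xs ! 0 = a" using le[of 0 ia] ia mem[OF len] by auto
  have qN: "xs ! N = b" using le[of ib N] ib len mem[of N] by (auto simp: N_def)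
  have gap: "A \<inter> {xs ! i<..<xs ! Suc i} = {}" if "i < N" for i
  proof (rule ccontr)
    assume "A \<inter> {xs ! i<..<xs ! Suc i} \<noteq> {}"
    then obtain j where j: "j < length xs" "xs ! i < xs ! j" "xs ! j < xs ! Suc i"
      using xs by (auto simp: in_set_conv_nth)
    have "Suc i < length xs" using that len by (auto simp: N_def)
    then have "\<not> j \<le> i" "\<not> Suc i \<le> j" using le[of j i] le[of "Suc i" j] j by auto
    then show False by simp
  qed
  have "grid P \<epsilon> a b N (\<lambda>i. xs ! i)"
    unfolding grid_def
  proof (intro conjI allI impI)
    show "P \<inter> {a..b} \<subseteq> (!) xs ` {..N}"
    proof
      fix x assume "x \<in> P \<inter> {a..b}"
      then have "x \<in> set xs" by (auto simp: xs A_def)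
      then show "x \<in> (!) xs ` {..N}" by (auto simp: in_set_conv_nth N_def)
    qed
    fix i assume i: "i < N"
    then have i': "Suc i < length xs" by (auto simp: N_def)
    show "xs ! i < xs ! Suc i" using lt[of i "Suc i"] i' by simp
    have m: "xs ! i \<in> {a..b}" "xs ! Suc i \<in> {a..b}" using mem i' by auto
    show "P \<inter> {xs ! i<..<xs ! Suc i} = {}"
      using gap[OF i] m by (auto simp: A_def)
    show "xs ! Suc i - xs ! i \<le> \<epsilon>"
    proof (rule ccontr)
      assume *: "\<not> xs ! Suc i - xs ! i \<le> \<epsilon>"
      \<comment> \<open>\<open>a + real k * \<epsilon>\<close> is the first equidistant point
        strictly beyond \<open>xs ! i\<close>. In a cell longer than \<open>\<epsilon>\<close> it
        would be a point of \<open>A\<close> in the interior.\<close>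
      define k where "k = nat \<lfloor>(xs ! i - a) / \<epsilon>\<rfloor> + 1"
      have "0 \<le> (xs ! i - a) / \<epsilon>" using m assms by auto
      then have k: "(xs ! i - a) / \<epsilon> < real k" "real k \<le> (xs ! i - a) / \<epsilon> + 1" by (auto simp: k_def) linarith+
      have k': "xs ! i < a + real k * \<epsilon>" "a + real k * \<epsilon> \<le> xs ! i + \<epsilon>"
        using k assms by (auto simp: field_simps)
      have "(xs ! i - a) / \<epsilon> \<le> (b - a) / \<epsilon>" using m assms by (intro divide_right_mono) auto
      then have "k \<le> K" unfolding k_def K_def by linarith
      then have "a + real k * \<epsilon> \<in> A" using k' m * by (auto simp: A_def)
      then show False using gap[OF i] k' * by auto
    qed
  qed (use q0 qN in auto)
  then show ?thesis by blast
qed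

lemma grid_mono:
  assumes "grid P \<epsilon> a b N q" "i \<le> j" "j \<le> N"
  shows "q i \<le> q j"
  using assms(2,3)
proof (induction j)
  case (Suc j)
  then show ?case
    using assms(1) unfolding grid_def
    by (metis Suc_le_eq le_SucE less_imp_le order_refl order_trans)
qed simp

text \<open>The open cells are disjoint, so at every point at most one term of the step function
  survives, and there \<open>f\<close> dominates it. End points of cells are left out because
  \<open>f\<close> is controlled only inside.\<close>

lemma grid_sum_le_nn_integral:
  assumes "grid P \<epsilon> a b N q" "\<And>j. j < N \<Longrightarrow> 0 \<le> c j"
    "\<And>j u. j < N \<Longrightarrow> q j < u \<Longrightarrow> u < q (Suc j) \<Longrightarrow> ennreal (c j) \<le> f u"
  shows "ennreal (\<Sum>j<N. c j * (q (Suc j) - q j)) \<le> (\<integral>\<^sup>+u\<in>{a..b}. f u \<partial>lborel)"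
proof -
  have inc: "q j \<le> q (Suc j)" if "j < N" for j using grid_mono[OF assms(1), of j "Suc j"] that by simp
  have "ennreal (\<Sum>j<N. c j * (q (Suc j) - q j)) = (\<Sum>j<N. ennreal (c j) * ennreal (q (Suc j) - q j))"
    using assms(2) inc by (subst sum_ennreal[symmetric]) (auto simp: ennreal_mult intro!: sum.cong)
  also have "\<dots> = (\<Sum>j<N. \<integral>\<^sup>+u. ennreal (c j) * indicator {q j<..<q (Suc j)} u \<partial>lborel)"
    using inc by (intro sum.cong) (auto simp: nn_integral_cmult_indicator)
  also have "\<dots> = (\<integral>\<^sup>+u. (\<Sum>j<N. ennreal (c j) * indicator {q j<..<q (Suc j)} u) \<partial>lborel)"
    by (intro nn_integral_sum[symmetric]) auto
  also have "\<dots> \<le> (\<integral>\<^sup>+u\<in>{a..b}. f u \<partial>lborel)"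
  proof (rule nn_integral_mono)
    fix u
    show "(\<Sum>j<N. ennreal (c j) * indicator {q j<..<q (Suc j)} u) \<le> f u * indicator {a..b} u"
    proof (cases "\<exists>i<N. q i < u \<and> u < q (Suc i)")
      case False
      then have "(\<Sum>j<N. ennreal (c j) * indicator {q j<..<q (Suc j)} u) = 0" by (intro sum.neutral) auto
      then show ?thesis by simp
    next
      case True
      then obtain i where i: "i < N" "q i < u" "u < q (Suc i)" by blast
      have other: "u \<notin> {q j<..<q (Suc j)}" if "j < N" "j \<noteq> i" for j
      proof (cases "j < i")
        case True
        then have "q (Suc j) \<le> q i" using i by (intro grid_mono[OF assms(1)]) auto
        then show ?thesis using i by auto
      next
        case False
        then have "q (Suc i) \<le> q j" using that by (intro grid_mono[OF assms(1)]) auto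
        then show ?thesis using i by auto
      qed
      have "(\<Sum>j<N. ennreal (c j) * indicator {q j<..<q (Suc j)} u)
          = (\<Sum>j<N. if j = i then ennreal (c i) else 0)"
      proof (intro sum.cong refl)
        fix j assume "j \<in> {..<N}"
        then show "ennreal (c j) * indicator {q j<..<q (Suc j)} u = (if j = i then ennreal (c i) else 0)"
          using other[of j] i by (cases "j = i") (auto simp: indicator_def)
      qed
      also have "\<dots> = ennreal (c i)" using i by simp
      also have "\<dots> \<le> f u" using i by (intro assms(3))
      also have "a \<le> u" "u \<le> b"
        using grid_mono[OF assms(1), of 0 i] grid_mono[OF assms(1), of "Suc i" N] i assms(1)
        by (auto simp: grid_def)
      then have "f u = f u * indicator {a..b} u" by simp
      finally show ?thesis .
    qed
  qed
  finally show ?thesis .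
qed

context filtered_brownian_motion
begin

lemma filtration_F: "filtration (space M) F"
  by (rule filtration_axioms)

lemma measurable_F_mono: "f \<in> borel_measurable (F s) \<Longrightarrow> s \<le> t \<Longrightarrow> f \<in> borel_measurable (F t)"
  using filtration_measurable[OF filtration_F] .

lemma measurable_F_M: "f \<in> borel_measurable (F s) \<Longrightarrow> f \<in> borel_measurable M"
  using measurable_from_subalg[of M "F s"] sub_sigma by (auto simp: subalgebra_def space_F)

text \<open>
  A pair of a simple integrand and its integral, described without reference to a particular
  partition: \<open>P\<close> only has to contain the points where the integrand may jump.
\<close>

definition step_pair :: "real set \<Rightarrow> 'a process \<Rightarrow> 'a process \<Rightarrow> bool" where
  "step_pair P S J \<longleftrightarrow> finite P \<and>
     (\<forall>\<omega>\<in>space M. (\<lambda>s. S s \<omega>) \<in> borel_measurable borel) \<and> (\<forall>\<omega>\<in>space M. J 0 \<omega> = 0) \<and>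
     (\<forall>a b. 0 \<le> a \<longrightarrow> a < b \<longrightarrow> P \<inter> {a<..<b} = {} \<longrightarrow>
        S b \<in> borel_measurable (F a) \<and> (\<exists>C. \<forall>\<omega>\<in>space M. \<bar>S b \<omega>\<bar> \<le> C) \<and>
        (\<forall>\<omega>\<in>space M. (\<forall>u\<in>{a<..b}. S u \<omega> = S b \<omega>) \<and>
           (\<forall>u\<in>{a..b}. J u \<omega> - J a \<omega> = S b \<omega> * (W u \<omega> - W a \<omega>))))"

lemma step_pairD:
  assumes "step_pair P S J" "0 \<le> a" "a < b" "P \<inter> {a<..<b} = {}"
  shows "S b \<in> borel_measurable (F a)" "\<exists>C. \<forall>\<omega>\<in>space M. \<bar>S b \<omega>\<bar> \<le> C"
    "\<And>\<omega> u. \<omega> \<in> space M \<Longrightarrow> u \<in> {a<..b} \<Longrightarrow> S u \<omega> = S b \<omega>"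
    "\<And>\<omega> u. \<omega> \<in> space M \<Longrightarrow> u \<in> {a..b} \<Longrightarrow> J u \<omega> - J a \<omega> = S b \<omega> * (W u \<omega> - W a \<omega>)"
  using assms unfolding step_pair_def by blast+

text \<open>On an interval whose interior meets no partition point, each cell of the partition
  either covers the whole interval or misses it. The sum over the covering cells is both the
  constant value of the integrand and the slope of the integral against \<open>W\<close>.\<close>

lemma step_pair_simple:
  assumes "simple_integrand M F n p \<xi>"
  shows "step_pair (p ` {..n}) (simple_process n p \<xi>) (simple_integral W n p \<xi>)"
  unfolding step_pair_def
proof (intro conjI allI impI ballI)
  have p0: "0 \<le> p 0" and inc: "\<And>i. i < n \<Longrightarrow> p i \<le> p (Suc i)"
    and \<xi>: "\<And>i. i < n \<Longrightarrow> \<xi> i \<in> borel_measurable (F (p i))"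
    and bd: "\<And>i. i < n \<Longrightarrow> \<exists>C. \<forall>\<omega>\<in>space M. \<bar>\<xi> i \<omega>\<bar> \<le> C"
    using assms by (auto simp: simple_integrand_def)
  have pos: "0 \<le> p i" if "i \<le> n" for i
    using that by (induction i) (use p0 inc in \<open>auto intro: order_trans\<close>)
  show "finite (p ` {..n})" by simp
  show "(\<lambda>s. simple_process n p \<xi> s \<omega>) \<in> borel_measurable borel" for \<omega>
    unfolding simple_process_def by measurable
  show "simple_integral W n p \<xi> 0 \<omega> = 0" for \<omega>
    unfolding simple_integral_def by (intro sum.neutral) (auto simp: min_absorb1 pos)
  fix a b :: real assume ab: "0 \<le> a" "a < b" "p ` {..n} \<inter> {a<..<b} = {}"
  have cases: "p i \<le> a \<and> b \<le> p (Suc i) \<or> p (Suc i) \<le> a \<or> b \<le> p i" if "i < n" for i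
  proof -
    have "p i \<in> p ` {..n}" "p (Suc i) \<in> p ` {..n}" using that by auto
    then have "p i \<notin> {a<..<b}" "p (Suc i) \<notin> {a<..<b}" using ab(3) by blast+
    then show ?thesis using inc[OF that] by auto
  qed
  define act where "act i = (if p i \<le> a \<and> b \<le> p (Suc i) then 1 else 0 :: real)" for i
  have ind: "indicator {p i<..p (Suc i)} u = act i" if "i < n" "u \<in> {a<..b}" for i u
    using cases[OF that(1)] that ab(2) by (auto simp: act_def indicator_def)
  have S: "simple_process n p \<xi> u \<omega> = (\<Sum>i<n. \<xi> i \<omega> * act i)" if "u \<in> {a<..b}" for u \<omega>
    unfolding simple_process_def using ind[OF _ that] by (intro sum.cong) auto
  have Sb: "simple_process n p \<xi> b = (\<lambda>\<omega>. \<Sum>i<n. \<xi> i \<omega> * act i)" using S[of b] ab by auto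
  show "simple_process n p \<xi> b \<in> borel_measurable (F a)"
    unfolding Sb
  proof (intro borel_measurable_sum)
    fix i assume "i \<in> {..<n}"
    then show "(\<lambda>\<omega>. \<xi> i \<omega> * act i) \<in> borel_measurable (F a)"
      using measurable_F_mono[OF \<xi>, of i a] by (cases "p i \<le> a") (auto simp: act_def)
  qed
  obtain C where C: "\<And>i \<omega>. i < n \<Longrightarrow> \<omega> \<in> space M \<Longrightarrow> \<bar>\<xi> i \<omega>\<bar> \<le> C i" using bd by metis
  show "\<exists>C. \<forall>\<omega>\<in>space M. \<bar>simple_process n p \<xi> b \<omega>\<bar> \<le> C"
  proof (intro exI[of _ "\<Sum>i<n. C i"] ballI)
    fix \<omega> assume \<omega>: "\<omega> \<in> space M"
    show "\<bar>simple_process n p \<xi> b \<omega>\<bar> \<le> (\<Sum>i<n. C i)"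
      unfolding Sb
    proof (rule order_trans[OF sum_abs], rule sum_mono)
      fix i assume i: "i \<in> {..<n}"
      have "\<bar>\<xi> i \<omega> * act i\<bar> \<le> \<bar>\<xi> i \<omega>\<bar>" by (auto simp: act_def)
      then show "\<bar>\<xi> i \<omega> * act i\<bar> \<le> C i" using C[of i \<omega>] i \<omega> by simp
    qed
  qed
  fix \<omega> u
  show "simple_process n p \<xi> u \<omega> = simple_process n p \<xi> b \<omega>" if "u \<in> {a<..b}"
    using S[OF that] S[of b] ab by simp
  assume u: "u \<in> {a..b}"
  have "\<xi> i \<omega> * (W (min u (p (Suc i))) \<omega> - W (min u (p i)) \<omega>)
      - \<xi> i \<omega> * (W (min a (p (Suc i))) \<omega> - W (min a (p i)) \<omega>)
      = \<xi> i \<omega> * act i * (W u \<omega> - W a \<omega>)" if i: "i < n" for i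
  proof -
    consider "p i \<le> a" "b \<le> p (Suc i)" | "p (Suc i) \<le> a" "p i \<le> a" "\<not> b \<le> p (Suc i)"
      | "b \<le> p i" "b \<le> p (Suc i)" "\<not> p i \<le> a"
      using cases[OF i] inc[OF i] ab by force
    then show ?thesis
    proof cases
      case 1
      then have "min u (p (Suc i)) = u" "min u (p i) = p i" "min a (p (Suc i)) = a" "min a (p i) = p i"
        using u ab by auto
      then show ?thesis using 1 by (simp add: act_def algebra_simps)
    next
      case 2
      then have "min u (p (Suc i)) = p (Suc i)" "min u (p i) = p i" "min a (p (Suc i)) = p (Suc i)" "min a (p i) = p i"
        using u ab by auto
      then show ?thesis using 2 by (simp add: act_def)
    next
      case 3
      then have "min u (p (Suc i)) = u" "min u (p i) = u" "min a (p (Suc i)) = a" "min a (p i) = a"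
        using u ab by auto
      then show ?thesis using 3 by (simp add: act_def)
    qed
  qed
  then show "simple_integral W n p \<xi> u \<omega> - simple_integral W n p \<xi> a \<omega>
      = simple_process n p \<xi> b \<omega> * (W u \<omega> - W a \<omega>)"
    unfolding simple_integral_def Sb by (simp add: sum_subtractf[symmetric] sum_distrib_right)
qed

text \<open>Here the description by possible jump times pays off: the union of the two sets serves
  both pairs, and no common partition has to be written down.\<close>

lemma step_pair_diff:
  assumes "step_pair P S J" "step_pair P' S' J'"
  shows "step_pair (P \<union> P') (\<lambda>s \<omega>. S s \<omega> - S' s \<omega>) (\<lambda>s \<omega>. J s \<omega> - J' s \<omega>)"
  unfolding step_pair_def
proof (intro conjI allI impI ballI)
  show "finite (P \<union> P')" using assms by (auto simp: step_pair_def)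
  show "(\<lambda>s. S s \<omega> - S' s \<omega>) \<in> borel_measurable borel" if "\<omega> \<in> space M" for \<omega>
    using assms that by (intro borel_measurable_diff) (auto simp: step_pair_def)
  show "J 0 \<omega> - J' 0 \<omega> = 0" if "\<omega> \<in> space M" for \<omega> using assms that by (auto simp: step_pair_def)
  fix a b :: real assume ab: "0 \<le> a" "a < b" "(P \<union> P') \<inter> {a<..<b} = {}"
  then have ab': "P \<inter> {a<..<b} = {}" "P' \<inter> {a<..<b} = {}" by auto
  note D = step_pairD[OF assms(1) ab(1,2) ab'(1)] and D' = step_pairD[OF assms(2) ab(1,2) ab'(2)]
  show "(\<lambda>\<omega>. S b \<omega> - S' b \<omega>) \<in> borel_measurable (F a)" using D(1) D'(1) by (rule borel_measurable_diff)
  obtain C C' where "\<forall>\<omega>\<in>space M. \<bar>S b \<omega>\<bar> \<le> C" "\<forall>\<omega>\<in>space M. \<bar>S' b \<omega>\<bar> \<le> C'" using D(2) D'(2) by auto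
  then show "\<exists>C. \<forall>\<omega>\<in>space M. \<bar>S b \<omega> - S' b \<omega>\<bar> \<le> C"
    by (intro exI[of _ "C + C'"]) (fastforce intro: order_trans[OF abs_triangle_ineq4] add_mono)
  fix \<omega> u assume \<omega>: "\<omega> \<in> space M"
  show "S u \<omega> - S' u \<omega> = S b \<omega> - S' b \<omega>" if "u \<in> {a<..b}" using D(3)[OF \<omega> that] D'(3)[OF \<omega> that] by simp
  show "J u \<omega> - J' u \<omega> - (J a \<omega> - J' a \<omega>) = (S b \<omega> - S' b \<omega>) * (W u \<omega> - W a \<omega>)" if "u \<in> {a..b}"
    using D(4)[OF \<omega> that] D'(4)[OF \<omega> that] by (simp add: algebra_simps)
qed

text \<open>Telescoping from \<open>J 0 \<omega> = 0\<close>, since no point of \<open>P\<close>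
  lies inside a cell.\<close>

lemma step_pair_grid_sum:
  assumes "step_pair P S J" "grid P \<epsilon> 0 s N q" "\<omega> \<in> space M" "n \<le> N"
  shows "(\<Sum>j<n. S (q (Suc j)) \<omega> * (W (q (Suc j)) \<omega> - W (q j) \<omega>)) = J (q n) \<omega>"
  using assms(4)
proof (induction n)
  case 0
  then show ?case using assms by (auto simp: step_pair_def grid_def)
next
  case (Suc n)
  have "0 \<le> q n" using grid_mono[OF assms(2), of 0 n] Suc assms(2) by (auto simp: grid_def)
  moreover have "q n < q (Suc n)" "P \<inter> {q n<..<q (Suc n)} = {}" using Suc.prems assms(2) by (auto simp: grid_def)
  ultimately have "J (q (Suc n)) \<omega> - J (q n) \<omega> = S (q (Suc n)) \<omega> * (W (q (Suc n)) \<omega> - W (q n) \<omega>)"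
    using assms(3) by (intro step_pairD(4)[OF assms(1)]) auto
  then show ?case using Suc by simp
qed

section \<open>The Ito isometry\<close>

lemma W_measurable: "0 \<le> t \<Longrightarrow> W t \<in> borel_measurable M"
  using W_adapted measurable_F_M by blast

lemma increment_moments:
  assumes "0 \<le> s" "s < t"
  shows "integrable M (\<lambda>\<omega>. W t \<omega> - W s \<omega>)" "expectation (\<lambda>\<omega>. W t \<omega> - W s \<omega>) = 0"
    "integrable M (\<lambda>\<omega>. (W t \<omega> - W s \<omega>)\<^sup>2)" "expectation (\<lambda>\<omega>. (W t \<omega> - W s \<omega>)\<^sup>2) = t - s"
proof -
  have D: "distributed M lborel (\<lambda>\<omega>. W t \<omega> - W s \<omega>) (normal_density 0 (sqrt (t - s)))"
    using W_increment_distr[OF assms] by simp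
  have \<sigma>: "0 < sqrt (t - s)" using assms by simp
  have "integrable M (\<lambda>\<omega>. (W t \<omega> - W s \<omega>) ^ k)" for k
    using integrable_normal_moment[OF \<sigma>, of 0 k]
    by (subst distributed_integrable[OF D, symmetric]) auto
  from this[of 1] this[of 2] show i: "integrable M (\<lambda>\<omega>. W t \<omega> - W s \<omega>)" "integrable M (\<lambda>\<omega>. (W t \<omega> - W s \<omega>)\<^sup>2)"
    by auto
  show e: "expectation (\<lambda>\<omega>. W t \<omega> - W s \<omega>) = 0" by (rule normal_distributed_expectation[OF \<sigma> D])
  show "expectation (\<lambda>\<omega>. (W t \<omega> - W s \<omega>)\<^sup>2) = t - s"
    using normal_distributed_variance[OF \<sigma> D] assms by (simp add: e)
qed

text \<open>The sigma-algebras generated by \<open>Z\<close> and by \<open>g\<close> of the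
  increment lie inside the two that are independent by assumption. The isometry uses it with
  \<open>g\<close> the identity and with \<open>g\<close> the square.\<close>

lemma increment_indep:
  fixes Z :: "'a \<Rightarrow> real" and g :: "real \<Rightarrow> real"
  assumes "0 \<le> s" "s < t" "Z \<in> borel_measurable (F s)" "integrable M Z"
    and g: "g \<in> borel_measurable borel" "integrable M (\<lambda>\<omega>. g (W t \<omega> - W s \<omega>))"
  shows "integrable M (\<lambda>\<omega>. Z \<omega> * g (W t \<omega> - W s \<omega>))"
    "expectation (\<lambda>\<omega>. Z \<omega> * g (W t \<omega> - W s \<omega>)) = expectation Z * expectation (\<lambda>\<omega>. g (W t \<omega> - W s \<omega>))"
proof -
  define D where "D = (\<lambda>\<omega>. W t \<omega> - W s \<omega>)"
  have D: "D \<in> borel_measurable M" unfolding D_def using W_measurable assms by auto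
  have ind: "indep_set (sets (F s)) (sets (vimage_algebra (space M) D borel))"
    using W_increment_indep[OF assms(1,2)] by (simp add: D_def)
  have "indep_var borel Z borel (\<lambda>\<omega>. g (D \<omega>))"
    unfolding indep_var_eq
  proof (intro conjI)
    show "random_variable borel Z" using assms by auto
    show "random_variable borel (\<lambda>\<omega>. g (D \<omega>))" using D g by auto
    have "sigma_sets (space M) {Z -` A \<inter> space M |A. A \<in> sets borel} \<subseteq> sets (F s)"
    proof -
      have sub: "{Z -` A \<inter> space M |A. A \<in> sets borel} \<subseteq> sets (F s)"
        using measurable_sets[OF assms(3)] by (auto simp: space_F)
      show ?thesis using sets.sigma_sets_subset[OF sub] by (simp add: space_F)
    qed
    moreover have "sigma_sets (space M) {(\<lambda>\<omega>. g (D \<omega>)) -` A \<inter> space M |A. A \<in> sets borel}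
        \<subseteq> sets (vimage_algebra (space M) D borel)"
    proof -
      let ?V = "vimage_algebra (space M) D borel"
      have "(\<lambda>\<omega>. g (D \<omega>)) \<in> measurable ?V borel"
        by (rule measurable_compose[OF measurable_vimage_algebra1 g(1)]) auto
      then have "{(\<lambda>\<omega>. g (D \<omega>)) -` A \<inter> space M |A. A \<in> sets borel} \<subseteq> sets ?V"
        using measurable_sets[of "\<lambda>\<omega>. g (D \<omega>)" ?V borel] by auto
      then show ?thesis using sets.sigma_sets_subset[of _ ?V] by (simp only: space_vimage_algebra)
    qed
    ultimately show "indep_set (sigma_sets (space M) {Z -` A \<inter> space M |A. A \<in> sets borel})
        (sigma_sets (space M) {(\<lambda>\<omega>. g (D \<omega>)) -` A \<inter> space M |A. A \<in> sets borel})"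
      using indep_sets_mono_sets[OF ind[unfolded indep_set_def],
          of "case_bool (sigma_sets (space M) {Z -` A \<inter> space M |A. A \<in> sets borel})
            (sigma_sets (space M) {(\<lambda>\<omega>. g (D \<omega>)) -` A \<inter> space M |A. A \<in> sets borel})"]
      unfolding indep_set_def by (auto split: bool.splits)
  qed
  then show "integrable M (\<lambda>\<omega>. Z \<omega> * g (W t \<omega> - W s \<omega>))"
    "expectation (\<lambda>\<omega>. Z \<omega> * g (W t \<omega> - W s \<omega>)) = expectation Z * expectation (\<lambda>\<omega>. g (W t \<omega> - W s \<omega>))"
    using assms(4) g(2) indep_var_integrable[of Z "\<lambda>\<omega>. g (D \<omega>)"] indep_var_lebesgue_integral[of Z "\<lambda>\<omega>. g (D \<omega>)"]
    by (auto simp: D_def)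
qed

text \<open>In the step to \<open>Suc n\<close> the cross term has mean 0, because
  \<open>A n * \<eta> n\<close> is known at time \<open>q n\<close> while the next increment is
  centred and independent of that past. Measurability and square-integrability of \<open>A n\<close>
  are carried along to justify this.\<close>

lemma ito_isometry:
  assumes q: "0 \<le> q 0" "\<And>j. j < N \<Longrightarrow> q j < q (Suc j)"
    and \<eta>: "\<And>j. j < N \<Longrightarrow> \<eta> j \<in> borel_measurable (F (q j))"
      "\<And>j. j < N \<Longrightarrow> \<exists>C. \<forall>\<omega>\<in>space M. \<bar>\<eta> j \<omega>\<bar> \<le> C"
    and "n \<le> N"
  defines "A \<equiv> \<lambda>n \<omega>. \<Sum>j<n. \<eta> j \<omega> * (W (q (Suc j)) \<omega> - W (q j) \<omega>)"
  shows "A n \<in> borel_measurable (F (q n)) \<and> integrable M (\<lambda>\<omega>. (A n \<omega>)\<^sup>2) \<and>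
    integrable M (\<lambda>\<omega>. \<Sum>j<n. (\<eta> j \<omega>)\<^sup>2 * (q (Suc j) - q j)) \<and>
    expectation (\<lambda>\<omega>. (A n \<omega>)\<^sup>2) = expectation (\<lambda>\<omega>. \<Sum>j<n. (\<eta> j \<omega>)\<^sup>2 * (q (Suc j) - q j))"
  using \<open>n \<le> N\<close>
proof (induction n)
  case 0
  then show ?case by (simp add: A_def)
next
  case (Suc n)
  then have n: "n < N" by simp
  have pos: "0 \<le> q j" if "j \<le> N" for j
    using that
  proof (induction j)
    case (Suc j)
    then show ?case using q(2)[of j] by simp
  qed (use q in simp)
  have lt: "q n < q (Suc n)" using q n by auto
  define D where "D = (\<lambda>\<omega>. W (q (Suc n)) \<omega> - W (q n) \<omega>)"
  have IH: "A n \<in> borel_measurable (F (q n))" "integrable M (\<lambda>\<omega>. (A n \<omega>)\<^sup>2)"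
    "integrable M (\<lambda>\<omega>. \<Sum>j<n. (\<eta> j \<omega>)\<^sup>2 * (q (Suc j) - q j))"
    "expectation (\<lambda>\<omega>. (A n \<omega>)\<^sup>2) = expectation (\<lambda>\<omega>. \<Sum>j<n. (\<eta> j \<omega>)\<^sup>2 * (q (Suc j) - q j))"
    using Suc n by auto
  obtain C where C: "\<And>\<omega>. \<omega> \<in> space M \<Longrightarrow> \<bar>\<eta> n \<omega>\<bar> \<le> C" using \<eta>(2)[OF n] by auto
  have \<eta>n: "\<eta> n \<in> borel_measurable (F (q n))" using \<eta>(1)[OF n] .
  have \<eta>M: "\<eta> n \<in> borel_measurable M" "A n \<in> borel_measurable M" using \<eta>n IH(1) measurable_F_M by auto
  have intA: "integrable M (A n)"
    using IH(2) \<eta>M(2) by (rule square_integrable_imp_integrable[rotated])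
  have i1: "integrable M (\<lambda>\<omega>. A n \<omega> * \<eta> n \<omega>)"
  proof (rule Bochner_Integration.integrable_bound[OF integrable_mult_right[OF intA, of C]])
    show "(\<lambda>\<omega>. A n \<omega> * \<eta> n \<omega>) \<in> borel_measurable M" using \<eta>M by auto
    show "AE \<omega> in M. norm (A n \<omega> * \<eta> n \<omega>) \<le> norm (C * A n \<omega>)"
    proof (intro AE_I2)
      fix \<omega> assume "\<omega> \<in> space M"
      then have "\<bar>\<eta> n \<omega>\<bar> \<le> \<bar>C\<bar>" using C[of \<omega>] by simp
      then have "\<bar>\<eta> n \<omega>\<bar> * \<bar>A n \<omega>\<bar> \<le> \<bar>C\<bar> * \<bar>A n \<omega>\<bar>" by (intro mult_right_mono) auto
      then show "norm (A n \<omega> * \<eta> n \<omega>) \<le> norm (C * A n \<omega>)" by (simp add: abs_mult mult.commute)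
    qed
  qed
  have i2: "integrable M (\<lambda>\<omega>. (\<eta> n \<omega>)\<^sup>2)"
  proof (rule integrable_const_bound[where B="C\<^sup>2"])
    show "AE \<omega> in M. norm ((\<eta> n \<omega>)\<^sup>2) \<le> C\<^sup>2"
    proof (intro AE_I2)
      fix \<omega> assume "\<omega> \<in> space M"
      then have "\<bar>\<eta> n \<omega>\<bar>\<^sup>2 \<le> C\<^sup>2" using C by (intro power_mono) auto
      then show "norm ((\<eta> n \<omega>)\<^sup>2) \<le> C\<^sup>2" by simp
    qed
  qed (use \<eta>M in auto)
  have pn: "0 \<le> q n" using pos n by simp
  note mom = increment_moments[OF pn lt]
  have m1: "(\<lambda>\<omega>. A n \<omega> * \<eta> n \<omega>) \<in> borel_measurable (F (q n))"
    using IH(1) \<eta>n by (rule borel_measurable_times)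
  have m2: "(\<lambda>\<omega>. (\<eta> n \<omega>)\<^sup>2) \<in> borel_measurable (F (q n))"
    using \<eta>n by (rule borel_measurable_power)
  have id: "(\<lambda>x::real. x) \<in> borel_measurable borel" "(\<lambda>x::real. x\<^sup>2) \<in> borel_measurable borel" by auto
  have D1: "integrable M (\<lambda>\<omega>. A n \<omega> * \<eta> n \<omega> * D \<omega>)" "expectation (\<lambda>\<omega>. A n \<omega> * \<eta> n \<omega> * D \<omega>) = 0"
    unfolding D_def using increment_indep[OF pn lt m1 i1 id(1) mom(1)] by (simp_all only: mom(2) mult_zero_right)
  have D2: "integrable M (\<lambda>\<omega>. (\<eta> n \<omega>)\<^sup>2 * (D \<omega>)\<^sup>2)"
    "expectation (\<lambda>\<omega>. (\<eta> n \<omega>)\<^sup>2 * (D \<omega>)\<^sup>2) = expectation (\<lambda>\<omega>. (\<eta> n \<omega>)\<^sup>2) * (q (Suc n) - q n)"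
    unfolding D_def using increment_indep[OF pn lt m2 i2 id(2) mom(3)] by (simp_all only: mom(4))
  have AS: "A (Suc n) = (\<lambda>\<omega>. A n \<omega> + \<eta> n \<omega> * D \<omega>)" by (simp add: A_def D_def)
  have sq: "(\<lambda>\<omega>. (A (Suc n) \<omega>)\<^sup>2) = (\<lambda>\<omega>. (A n \<omega>)\<^sup>2 + 2 * (A n \<omega> * \<eta> n \<omega> * D \<omega>) + (\<eta> n \<omega>)\<^sup>2 * (D \<omega>)\<^sup>2)"
    by (auto simp: AS power2_eq_square algebra_simps)
  have "D \<in> borel_measurable (F (q (Suc n)))"
    unfolding D_def using pos[of n] pos[of "Suc n"] n lt measurable_F_mono[OF W_adapted, of "q n" "q (Suc n)"]
    by (intro borel_measurable_diff W_adapted) auto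
  then have "A (Suc n) \<in> borel_measurable (F (q (Suc n)))"
    unfolding AS using measurable_F_mono[OF IH(1)] measurable_F_mono[OF \<eta>n] lt by auto
  moreover have "integrable M (\<lambda>\<omega>. (A (Suc n) \<omega>)\<^sup>2)" unfolding sq using IH(2) D1(1) D2(1) by auto
  moreover have "integrable M (\<lambda>\<omega>. \<Sum>j<Suc n. (\<eta> j \<omega>)\<^sup>2 * (q (Suc j) - q j))"
    using IH(3) i2 by auto
  moreover have "expectation (\<lambda>\<omega>. (A (Suc n) \<omega>)\<^sup>2) = expectation (\<lambda>\<omega>. \<Sum>j<Suc n. (\<eta> j \<omega>)\<^sup>2 * (q (Suc j) - q j))"
    unfolding sq using IH(2-4) D1 D2 i2 by simp
  ultimately show ?case by blast
qed

end

section \<open>Localized second moments of Ito integrals\<close>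

text \<open>Borel-Cantelli: \<open>r k\<close> is any index at which each of the two variables
  exceeds \<open>1 / Suc k\<close> with probability below \<open>(1/2) ^ k\<close>. One sequence has
  to serve both, so that integrands and integrals converge together; the indices need not
  increase.\<close>

lemma (in prob_space) null_in_probability_subsequence:
  assumes "null_in_probability M Y" "null_in_probability M Z"
  obtains r where "AE \<omega> in M. (\<lambda>k. Y (r k) \<omega>) \<longlonglongrightarrow> 0" "AE \<omega> in M. (\<lambda>k. Z (r k) \<omega>) \<longlonglongrightarrow> 0"
proof -
  define A where "A X \<epsilon> k = {\<omega> \<in> space M. ennreal \<epsilon> < X k \<omega>}" for X :: "nat \<Rightarrow> 'a \<Rightarrow> ennreal" and \<epsilon> k
  have m: "(\<lambda>k. prob (A X \<epsilon> k)) \<longlonglongrightarrow> 0" if "null_in_probability M X" "0 < \<epsilon>" for X \<epsilon>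
    using that by (simp add: null_in_probability_def A_def)
  have "\<exists>j. prob (A Y (1 / Suc k) j) < (1/2) ^ k \<and> prob (A Z (1 / Suc k) j) < (1/2) ^ k" for k
  proof -
    have "\<forall>\<^sub>F j in sequentially. prob (A Y (1 / Suc k) j) < (1/2) ^ k"
      "\<forall>\<^sub>F j in sequentially. prob (A Z (1 / Suc k) j) < (1/2) ^ k"
      by (intro order_tendstoD(2)[OF m] assms; simp)+
    then have "\<forall>\<^sub>F j in sequentially. prob (A Y (1 / Suc k) j) < (1/2) ^ k \<and> prob (A Z (1 / Suc k) j) < (1/2) ^ k"
      by eventually_elim auto
    then show ?thesis using eventually_happens'[OF sequentially_bot] by blast
  qed
  then obtain r where r: "\<And>k. prob (A Y (1 / Suc k) (r k)) < (1/2) ^ k" "\<And>k. prob (A Z (1 / Suc k) (r k)) < (1/2) ^ k"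
    by metis
  have conv: "AE \<omega> in M. (\<lambda>k. X (r k) \<omega>) \<longlonglongrightarrow> 0"
    if X: "null_in_probability M X" and rX: "\<And>k. prob (A X (1 / Suc k) (r k)) < (1/2) ^ k" for X
  proof -
    have [measurable]: "X k \<in> borel_measurable M" for k using X by (simp add: null_in_probability_def)
    have "AE \<omega> in M. \<forall>\<^sub>F k in sequentially. \<omega> \<in> space M - A X (1 / Suc k) (r k)"
    proof (rule borel_cantelli_AE1)
      show "A X (1 / Suc k) (r k) \<in> sets M" for k unfolding A_def by measurable
      show "emeasure M (A X (1 / Suc k) (r k)) < \<infinity>" for k by (simp add: emeasure_eq_measure)
      show "summable (\<lambda>k. prob (A X (1 / Suc k) (r k)))"
        by (rule summable_comparison_test'[of "\<lambda>k. (1/2::real) ^ k" 0]) (auto simp del: of_nat_Suc intro: less_imp_le[OF rX] summable_geometric)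
    qed
    then show ?thesis
    proof eventually_elim
      fix \<omega> assume *: "\<forall>\<^sub>F k in sequentially. \<omega> \<in> space M - A X (1 / Suc k) (r k)"
      show "(\<lambda>k. X (r k) \<omega>) \<longlonglongrightarrow> 0"
      proof (rule tendsto_sandwich[where f="\<lambda>_. 0" and h="\<lambda>k. ennreal (1 / Suc k)"])
        show "\<forall>\<^sub>F k in sequentially. X (r k) \<omega> \<le> ennreal (1 / Suc k)"
          using * by eventually_elim (auto simp: A_def not_less)
        show "(\<lambda>k. ennreal (1 / Suc k)) \<longlonglongrightarrow> 0"
          using tendsto_ennrealI[OF LIMSEQ_Suc[OF lim_1_over_n]] by simp
      qed auto
    qed
  qed
  show thesis using that[of r] conv[OF assms(1) r(1)] conv[OF assms(2) r(2)] by blast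
qed

text \<open>The way back from almost sure limits to the convergence that
  \<open>has_ito_integral\<close> demands: the indicators of the exceedance events tend to 0 and are
  dominated by 1.\<close>

lemma (in prob_space) null_in_probability_AE:
  assumes [measurable]: "\<And>k. Y k \<in> borel_measurable M" and lim: "AE \<omega> in M. (\<lambda>k. Y k \<omega>) \<longlonglongrightarrow> 0"
  shows "null_in_probability M Y"
  unfolding null_in_probability_def
proof (intro conjI allI impI)
  fix \<epsilon> :: real assume "0 < \<epsilon>"
  define A where "A k = {\<omega> \<in> space M. ennreal \<epsilon> < Y k \<omega>}" for k
  have [measurable]: "A k \<in> sets M" for k unfolding A_def by measurable
  have "(\<lambda>k. LINT \<omega>|M. indicator (A k) \<omega> :: real) \<longlonglongrightarrow> (LINT \<omega>|M. 0)"
  proof (rule integral_dominated_convergence[where w="\<lambda>_. 1"])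
    show "AE \<omega> in M. (\<lambda>k. indicator (A k) \<omega> :: real) \<longlonglongrightarrow> 0"
      using lim
    proof eventually_elim
      fix \<omega> assume "(\<lambda>k. Y k \<omega>) \<longlonglongrightarrow> 0"
      then have "\<forall>\<^sub>F k in sequentially. Y k \<omega> < ennreal \<epsilon>" using \<open>0 < \<epsilon>\<close> by (intro order_tendstoD(2)) auto
      then have "\<forall>\<^sub>F k in sequentially. indicator (A k) \<omega> = (0::real)"
        by eventually_elim (auto simp: A_def indicator_def)
      then show "(\<lambda>k. indicator (A k) \<omega> :: real) \<longlonglongrightarrow> 0" by (rule tendsto_eventually)
    qed
  qed (auto simp: indicator_def)
  then show "(\<lambda>k. prob {\<omega> \<in> space M. ennreal \<epsilon> < Y k \<omega>}) \<longlonglongrightarrow> 0" by (simp add: A_def[symmetric])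
qed fact

context filtered_brownian_motion
begin

text \<open>An almost sure form of \<open>has_ito_integral\<close>, without its requirements on
  \<open>K\<close> and \<open>I\<close> themselves and with \<open>step_pair\<close> in place of
  explicit partitions, so that it passes easily to differences.\<close>

definition ito_limit :: "real \<Rightarrow> 'a process \<Rightarrow> 'a process \<Rightarrow> bool" where
  "ito_limit H K I \<longleftrightarrow> (\<exists>P S J. (\<forall>k. step_pair (P k) (S k) (J k)) \<and>
     (AE \<omega> in M. (\<lambda>k. \<integral>\<^sup>+ s\<in>{0..H}. ennreal ((S k s \<omega> - K s \<omega>)\<^sup>2) \<partial>lborel) \<longlonglongrightarrow> 0) \<and>
     (AE \<omega> in M. (\<lambda>k. SUP s\<in>{0..H}. ennreal \<bar>J k s \<omega> - I s \<omega>\<bar>) \<longlonglongrightarrow> 0))"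

lemma has_ito_integral_imp_ito_limit:
  assumes "has_ito_integral M F W H K I"
  shows "ito_limit H K I"
proof -
  obtain n p \<xi> where *: "\<And>k. simple_integrand M F (n k) (p k) (\<xi> k)"
    "null_in_probability M (\<lambda>k \<omega>. \<integral>\<^sup>+ s\<in>{0..H}. ennreal ((simple_process (n k) (p k) (\<xi> k) s \<omega> - K s \<omega>)\<^sup>2) \<partial>lborel)"
    "null_in_probability M (\<lambda>k \<omega>. SUP s\<in>{0..H}. ennreal \<bar>simple_integral W (n k) (p k) (\<xi> k) s \<omega> - I s \<omega>\<bar>)"
    using assms unfolding has_ito_integral_def by blast
  obtain r where
    "AE \<omega> in M. (\<lambda>k. \<integral>\<^sup>+ s\<in>{0..H}. ennreal ((simple_process (n (r k)) (p (r k)) (\<xi> (r k)) s \<omega> - K s \<omega>)\<^sup>2) \<partial>lborel) \<longlonglongrightarrow> 0"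
    "AE \<omega> in M. (\<lambda>k. SUP s\<in>{0..H}. ennreal \<bar>simple_integral W (n (r k)) (p (r k)) (\<xi> (r k)) s \<omega> - I s \<omega>\<bar>) \<longlonglongrightarrow> 0"
    using null_in_probability_subsequence[OF *(2,3)] by blast
  then show ?thesis
    unfolding ito_limit_def using step_pair_simple[OF *(1)]
    by (intro exI[of _ "\<lambda>k. p (r k) ` {..n (r k)}"] exI[of _ "\<lambda>k. simple_process (n (r k)) (p (r k)) (\<xi> (r k))"]
        exI[of _ "\<lambda>k. simple_integral W (n (r k)) (p (r k)) (\<xi> (r k))"]) auto
qed

text \<open>Meant for two solutions of the same equation, whose noise terms are to be subtracted.
  The approximations are subtracted too, and the square of a difference is at most twice the sum of
  the squares; progressiveness makes the time integrals additive.\<close>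

lemma ito_limit_diff:
  assumes "ito_limit H K I" "ito_limit H K' I'" "progressive F H K" "progressive F H K'"
  shows "ito_limit H (\<lambda>s \<omega>. K s \<omega> - K' s \<omega>) (\<lambda>s \<omega>. I s \<omega> - I' s \<omega>)"
proof -
  obtain P S J where 1: "\<And>k. step_pair (P k) (S k) (J k)"
     "AE \<omega> in M. (\<lambda>k. \<integral>\<^sup>+ s\<in>{0..H}. ennreal ((S k s \<omega> - K s \<omega>)\<^sup>2) \<partial>lborel) \<longlonglongrightarrow> 0"
     "AE \<omega> in M. (\<lambda>k. SUP s\<in>{0..H}. ennreal \<bar>J k s \<omega> - I s \<omega>\<bar>) \<longlonglongrightarrow> 0"
    using assms(1) unfolding ito_limit_def by blast
  obtain P' S' J' where 2: "\<And>k. step_pair (P' k) (S' k) (J' k)"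
     "AE \<omega> in M. (\<lambda>k. \<integral>\<^sup>+ s\<in>{0..H}. ennreal ((S' k s \<omega> - K' s \<omega>)\<^sup>2) \<partial>lborel) \<longlonglongrightarrow> 0"
     "AE \<omega> in M. (\<lambda>k. SUP s\<in>{0..H}. ennreal \<bar>J' k s \<omega> - I' s \<omega>\<bar>) \<longlonglongrightarrow> 0"
    using assms(2) unfolding ito_limit_def by blast
  show ?thesis
    unfolding ito_limit_def
  proof (intro exI conjI allI)
    show "step_pair (P k \<union> P' k) (\<lambda>s \<omega>. S k s \<omega> - S' k s \<omega>) (\<lambda>s \<omega>. J k s \<omega> - J' k s \<omega>)" for k
      using 1(1) 2(1) by (rule step_pair_diff)
    show "AE \<omega> in M. (\<lambda>k. \<integral>\<^sup>+ s\<in>{0..H}. ennreal ((S k s \<omega> - S' k s \<omega> - (K s \<omega> - K' s \<omega>))\<^sup>2) \<partial>lborel) \<longlonglongrightarrow> 0"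
      using 1(2) 2(2) AE_space
    proof eventually_elim
      fix \<omega> assume \<omega>: "\<omega> \<in> space M"
      assume l: "(\<lambda>k. \<integral>\<^sup>+ s\<in>{0..H}. ennreal ((S k s \<omega> - K s \<omega>)\<^sup>2) \<partial>lborel) \<longlonglongrightarrow> 0"
        "(\<lambda>k. \<integral>\<^sup>+ s\<in>{0..H}. ennreal ((S' k s \<omega> - K' s \<omega>)\<^sup>2) \<partial>lborel) \<longlonglongrightarrow> 0"
      show "(\<lambda>k. \<integral>\<^sup>+ s\<in>{0..H}. ennreal ((S k s \<omega> - S' k s \<omega> - (K s \<omega> - K' s \<omega>))\<^sup>2) \<partial>lborel) \<longlonglongrightarrow> 0"
      proof (cases "0 \<le> H")
        case False then show ?thesis by simp
      next
        case True
        have [measurable]: "(\<lambda>u. K (max 0 (min u H)) \<omega>) \<in> borel_measurable borel"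
            "(\<lambda>u. K' (max 0 (min u H)) \<omega>) \<in> borel_measurable borel"
          using progressive_path(1)[OF assms(3) True order_refl] progressive_path(1)[OF assms(4) True order_refl] \<omega>
          by (auto simp: space_F)
        have [measurable]: "(\<lambda>s. S k s \<omega>) \<in> borel_measurable borel" "(\<lambda>s. S' k s \<omega>) \<in> borel_measurable borel" for k
          using 1(1) 2(1) \<omega> by (auto simp: step_pair_def)
        define R where "R k = (\<integral>\<^sup>+ s\<in>{0..H}. ennreal ((S k s \<omega> - K s \<omega>)\<^sup>2) \<partial>lborel)" for k
        define R' where "R' k = (\<integral>\<^sup>+ s\<in>{0..H}. ennreal ((S' k s \<omega> - K' s \<omega>)\<^sup>2) \<partial>lborel)" for k
        have "(\<integral>\<^sup>+ s\<in>{0..H}. ennreal ((S k s \<omega> - S' k s \<omega> - (K s \<omega> - K' s \<omega>))\<^sup>2) \<partial>lborel)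
            \<le> (R k + R k) + (R' k + R' k)" (is "?X k \<le> _") for k
        proof -
          define a where "a s = ennreal ((S k s \<omega> - K (max 0 (min s H)) \<omega>)\<^sup>2) * indicator {0..H} s" for s
          define b where "b s = ennreal ((S' k s \<omega> - K' (max 0 (min s H)) \<omega>)\<^sup>2) * indicator {0..H} s" for s
          have [measurable]: "a \<in> borel_measurable lborel" "b \<in> borel_measurable lborel"
            unfolding a_def b_def by measurable
          have ab: "(\<integral>\<^sup>+ s. a s \<partial>lborel) = R k" "(\<integral>\<^sup>+ s. b s \<partial>lborel) = R' k"
            unfolding a_def b_def R_def R'_def by (intro nn_integral_cong; auto simp: indicator_def)+
          have "(\<integral>\<^sup>+ s\<in>{0..H}. ennreal ((S k s \<omega> - S' k s \<omega> - (K s \<omega> - K' s \<omega>))\<^sup>2) \<partial>lborel)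
              \<le> (\<integral>\<^sup>+ s. (a s + a s) + (b s + b s) \<partial>lborel)"
          proof (rule nn_integral_mono)
            fix s
            have "(S k s \<omega> - S' k s \<omega> - (K s \<omega> - K' s \<omega>))\<^sup>2 \<le> (S k s \<omega> - K s \<omega>)\<^sup>2 + (S k s \<omega> - K s \<omega>)\<^sup>2
                + ((S' k s \<omega> - K' s \<omega>)\<^sup>2 + (S' k s \<omega> - K' s \<omega>)\<^sup>2)"
              using zero_le_power2[of "(S k s \<omega> - K s \<omega>) + (S' k s \<omega> - K' s \<omega>)"]
              by (simp add: power2_eq_square algebra_simps)
            then show "ennreal ((S k s \<omega> - S' k s \<omega> - (K s \<omega> - K' s \<omega>))\<^sup>2) * indicator {0..H} s
                \<le> (a s + a s) + (b s + b s)"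
              by (auto simp: a_def b_def indicator_def ennreal_plus[symmetric] simp del: ennreal_plus intro!: ennreal_leI)
          qed
          also have "\<dots> = (R k + R k) + (R' k + R' k)"
            by (simp add: nn_integral_add ab)
          finally show ?thesis .
        qed
        then have up: "\<forall>\<^sub>F k in sequentially. ?X k \<le> (R k + R k) + (R' k + R' k)"
          by (intro always_eventually allI)
        have "(\<lambda>k. (R k + R k) + (R' k + R' k)) \<longlonglongrightarrow> (0 + 0) + (0 + 0)"
          using l unfolding R_def R'_def by (intro tendsto_add)
        then have "(\<lambda>k. (R k + R k) + (R' k + R' k)) \<longlonglongrightarrow> 0" by simp
        from tendsto_sandwich[OF _ up tendsto_const this] show ?thesis by simp
      qed
    qed
    show "AE \<omega> in M. (\<lambda>k. SUP s\<in>{0..H}. ennreal \<bar>J k s \<omega> - J' k s \<omega> - (I s \<omega> - I' s \<omega>)\<bar>) \<longlonglongrightarrow> 0"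
      using 1(3) 2(3)
    proof eventually_elim
      fix \<omega>
      assume l: "(\<lambda>k. SUP s\<in>{0..H}. ennreal \<bar>J k s \<omega> - I s \<omega>\<bar>) \<longlonglongrightarrow> 0"
        "(\<lambda>k. SUP s\<in>{0..H}. ennreal \<bar>J' k s \<omega> - I' s \<omega>\<bar>) \<longlonglongrightarrow> 0"
      have "(SUP s\<in>{0..H}. ennreal \<bar>J k s \<omega> - J' k s \<omega> - (I s \<omega> - I' s \<omega>)\<bar>)
        \<le> (SUP s\<in>{0..H}. ennreal \<bar>J k s \<omega> - I s \<omega>\<bar>) + (SUP s\<in>{0..H}. ennreal \<bar>J' k s \<omega> - I' s \<omega>\<bar>)" (is "?X k \<le> ?Y k") for k
      proof (rule SUP_least)
        fix s assume s: "s \<in> {0..H}"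
        have "ennreal \<bar>J k s \<omega> - J' k s \<omega> - (I s \<omega> - I' s \<omega>)\<bar> \<le> ennreal \<bar>J k s \<omega> - I s \<omega>\<bar> + ennreal \<bar>J' k s \<omega> - I' s \<omega>\<bar>"
        proof -
          have "\<bar>J k s \<omega> - J' k s \<omega> - (I s \<omega> - I' s \<omega>)\<bar> \<le> \<bar>J k s \<omega> - I s \<omega>\<bar> + \<bar>J' k s \<omega> - I' s \<omega>\<bar>" by linarith
          then show ?thesis by (metis abs_ge_zero ennreal_leI ennreal_plus)
        qed
        also have "\<dots> \<le> (SUP s\<in>{0..H}. ennreal \<bar>J k s \<omega> - I s \<omega>\<bar>) + (SUP s\<in>{0..H}. ennreal \<bar>J' k s \<omega> - I' s \<omega>\<bar>)"
          using s by (intro add_mono SUP_upper)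
        finally show "ennreal \<bar>J k s \<omega> - J' k s \<omega> - (I s \<omega> - I' s \<omega>)\<bar>
          \<le> (SUP s\<in>{0..H}. ennreal \<bar>J k s \<omega> - I s \<omega>\<bar>) + (SUP s\<in>{0..H}. ennreal \<bar>J' k s \<omega> - I' s \<omega>\<bar>)" .
      qed
      moreover have "(\<lambda>k. (SUP s\<in>{0..H}. ennreal \<bar>J k s \<omega> - I s \<omega>\<bar>) + (SUP s\<in>{0..H}. ennreal \<bar>J' k s \<omega> - I' s \<omega>\<bar>)) \<longlonglongrightarrow> 0 + 0"
        using l by (rule tendsto_add)
      ultimately have "\<forall>\<^sub>F k in sequentially. ?X k \<le> ?Y k" "?Y \<longlonglongrightarrow> 0"
        by (auto intro!: always_eventually)
      from tendsto_sandwich[OF _ this(1) tendsto_const this(2)]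
      show "(\<lambda>k. SUP s\<in>{0..H}. ennreal \<bar>J k s \<omega> - J' k s \<omega> - (I s \<omega> - I' s \<omega>)\<bar>) \<longlonglongrightarrow> 0" by simp
    qed
  qed
qed

text \<open>
  The integrand is split into its truncation at level \<open>C\<close> and the excess. On the event in the
  estimate the quadratic variation of the excess is at most \<open>\<delta>\<close>, so it may be stopped there.
\<close>

lemma step_pair_estimate:
  fixes C \<delta> \<epsilon> s :: real and \<rho> :: "'a \<Rightarrow> real"
  assumes sp: "step_pair P S J" and gr: "grid P \<epsilon> 0 s N q" and s: "0 \<le> s" "s \<le> H"
    and \<rho>F: "\<And>u. u \<in> {0..H} \<Longrightarrow> {\<omega> \<in> space M. u \<le> \<rho> \<omega>} \<in> sets (F u)" and C: "0 \<le> C" and \<delta>: "0 < \<delta>" and \<epsilon>: "0 \<le> \<epsilon>"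
  defines "cl \<equiv> \<lambda>x. max (- C) (min C x)"
  defines "Q \<equiv> \<lambda>n \<omega>. \<Sum>i<n. (S (q (Suc i)) \<omega> - cl (S (q (Suc i)) \<omega>))\<^sup>2 * (q (Suc i) - q i)"
  defines "c \<equiv> \<lambda>\<omega>. \<Sum>j<N. (if q (Suc j) \<le> \<rho> \<omega> then (cl (S (q (Suc j)) \<omega>))\<^sup>2 else 0) * (q (Suc j) - q j)"
  shows "(\<integral>\<^sup>+\<omega>. (if s \<le> \<rho> \<omega> \<and> Q N \<omega> \<le> \<delta> then ennreal ((J s \<omega>)\<^sup>2) else 0) \<partial>M)
      \<le> ennreal (2 * (C\<^sup>2 * \<epsilon>) + 2 * \<delta>) + (\<integral>\<^sup>+\<omega>. ennreal (2 * c \<omega>) \<partial>M)"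
    and "Q N \<in> borel_measurable M" "c \<in> borel_measurable M" "J s \<in> borel_measurable M"
proof -
  define \<xi> where "\<xi> j = S (q (Suc j))" for j
  have q: "q 0 = 0" "q N = s" and qlt: "\<And>i. i < N \<Longrightarrow> q i < q (Suc i)" and qe: "\<And>i. i < N \<Longrightarrow> q (Suc i) - q i \<le> \<epsilon>"
    and qP: "\<And>i. i < N \<Longrightarrow> P \<inter> {q i<..<q (Suc i)} = {}" using gr by (auto simp: grid_def)
  have qm: "q i \<le> q j" if "i \<le> j" "j \<le> N" for i j using grid_mono[OF gr that] .
  have q0: "0 \<le> q i" "q i \<le> s" if "i \<le> N" for i using qm[of 0 i] qm[of i N] that q by auto
  have \<xi>: "\<xi> j \<in> borel_measurable (F (q j))" "\<exists>C. \<forall>\<omega>\<in>space M. \<bar>\<xi> j \<omega>\<bar> \<le> C" if "j < N" for j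
    unfolding \<xi>_def using step_pairD(1,2)[OF sp q0(1)[OF less_imp_le[OF that]] qlt[OF that] qP[OF that]] by auto
  have [measurable]: "cl \<in> borel_measurable borel" unfolding cl_def by measurable
  have \<xi>M: "\<xi> j \<in> borel_measurable M" if "j < N" for j using \<xi>(1)[OF that] measurable_F_M by blast
  have Qm: "Q n \<in> borel_measurable (F t)" if "n \<le> N" "\<And>j. j < n \<Longrightarrow> q j \<le> t" for n t
    unfolding Q_def \<xi>_def[symmetric]
  proof (intro borel_measurable_sum borel_measurable_times borel_measurable_power borel_measurable_diff borel_measurable_const)
    fix i assume "i \<in> {..<n}"
    then show *: "\<xi> i \<in> borel_measurable (F t)" using that by (intro measurable_F_mono[OF \<xi>(1)]) auto
    then show "(\<lambda>\<omega>. cl (\<xi> i \<omega>)) \<in> borel_measurable (F t)" by measurable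
  qed
  have rho[measurable]: "{\<omega> \<in> space M. q j \<le> \<rho> \<omega>} \<in> sets (F (q j))" if "j \<le> N" for j
    using \<rho>F[of "q j"] q0[OF that] s by auto
  have rhoM: "{\<omega> \<in> space M. q j \<le> \<rho> \<omega>} \<in> sets M" if "j \<le> N" for j using rho[OF that] sub_sigma by blast
  show QM: "Q N \<in> borel_measurable M" using measurable_F_M[OF Qm[of N s]] q0 by auto
  show cM: "c \<in> borel_measurable M"
    unfolding c_def \<xi>_def[symmetric]
  proof (intro borel_measurable_sum borel_measurable_times measurable_If)
    fix i assume i: "i \<in> {..<N}"
    then have [measurable]: "\<xi> i \<in> borel_measurable M" using \<xi>M by auto
    show "(\<lambda>\<omega>. (cl (\<xi> i \<omega>))\<^sup>2) \<in> borel_measurable M" by measurable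
    show "{\<omega> \<in> space M. q (Suc i) \<le> \<rho> \<omega>} \<in> sets M" using i by (intro rhoM) auto
  qed auto
  \<comment> \<open>\<open>Q (Suc j)\<close> involves the integrand on the cell that starts at
    \<open>q j\<close>, whose value is already known at \<open>q j\<close>. Hence the cut-off
    integrand still qualifies for the isometry. On the event in the estimate nothing is cut off, so
    there its sum is \<open>J s\<close>.\<close>
  define \<eta> where "\<eta> j \<omega> = (if q j \<le> \<rho> \<omega> \<and> Q (Suc j) \<omega> \<le> \<delta> then \<xi> j \<omega> else 0)" for j \<omega>
  have \<eta>: "\<eta> j \<in> borel_measurable (F (q j))" "\<exists>C. \<forall>\<omega>\<in>space M. \<bar>\<eta> j \<omega>\<bar> \<le> C" if j: "j < N" for j
  proof -
    have [measurable]: "\<xi> j \<in> borel_measurable (F (q j))" "Q (Suc j) \<in> borel_measurable (F (q j))"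
      using \<xi>(1)[OF j] j qm by (auto intro!: Qm)
    have "{\<omega> \<in> space (F (q j)). q j \<le> \<rho> \<omega> \<and> Q (Suc j) \<omega> \<le> \<delta>} = {\<omega> \<in> space M. q j \<le> \<rho> \<omega>} \<inter> {\<omega> \<in> space (F (q j)). Q (Suc j) \<omega> \<le> \<delta>}"
      by (auto simp: space_F)
    also have "\<dots> \<in> sets (F (q j))" using rho[of j] j by (intro sets.Int) auto
    finally show "\<eta> j \<in> borel_measurable (F (q j))" unfolding \<eta>_def by (intro measurable_If) auto
    obtain C where C: "\<forall>\<omega>\<in>space M. \<bar>\<xi> j \<omega>\<bar> \<le> C" using \<xi>(2)[OF j] by auto
    then have "\<forall>\<omega>\<in>space M. \<bar>\<eta> j \<omega>\<bar> \<le> C" unfolding \<eta>_def by (auto intro: order_trans[OF abs_ge_zero])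
    then show "\<exists>C. \<forall>\<omega>\<in>space M. \<bar>\<eta> j \<omega>\<bar> \<le> C" by blast
  qed
  define A where "A \<omega> = (\<Sum>j<N. \<eta> j \<omega> * (W (q (Suc j)) \<omega> - W (q j) \<omega>))" for \<omega>
  define B where "B \<omega> = (\<Sum>j<N. (\<eta> j \<omega>)\<^sup>2 * (q (Suc j) - q j))" for \<omega>
  have iso: "integrable M (\<lambda>\<omega>. (A \<omega>)\<^sup>2)" "integrable M B" "expectation (\<lambda>\<omega>. (A \<omega>)\<^sup>2) = expectation B"
    using ito_isometry[of q N \<eta> N, OF _ qlt \<eta> order_refl] q by (auto simp: A_def[abs_def] B_def[abs_def])
  have Qmono: "Q m \<omega> \<le> Q n \<omega>" if "m \<le> n" "n \<le> N" for m n \<omega>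
    unfolding Q_def using that qlt by (intro sum_mono2) (auto intro!: mult_nonneg_nonneg simp: less_imp_le)
  have clC: "(cl x)\<^sup>2 \<le> C\<^sup>2" for x
  proof -
    have "\<bar>cl x\<bar> \<le> C" using C by (auto simp: cl_def)
    then show ?thesis using C by (simp add: abs_le_square_iff[symmetric])
  qed
  have AJ: "A \<omega> = J s \<omega>" if "\<omega> \<in> space M" "s \<le> \<rho> \<omega>" "Q N \<omega> \<le> \<delta>" for \<omega>
  proof -
    have "\<eta> j \<omega> = \<xi> j \<omega>" if "j < N" for j
      using q0[of j] Qmono[of "Suc j" N \<omega>] that \<open>s \<le> \<rho> \<omega>\<close> \<open>Q N \<omega> \<le> \<delta>\<close> by (auto simp: \<eta>_def)
    then have "A \<omega> = (\<Sum>j<N. S (q (Suc j)) \<omega> * (W (q (Suc j)) \<omega> - W (q j) \<omega>))"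
      unfolding A_def \<xi>_def by (intro sum.cong) auto
    then show ?thesis using step_pair_grid_sum[OF sp gr that(1) order_refl] q by simp
  qed
  show "J s \<in> borel_measurable M"
  proof (rule measurable_cong[THEN iffD1])
    show "(\<lambda>\<omega>. \<Sum>j<N. S (q (Suc j)) \<omega> * (W (q (Suc j)) \<omega> - W (q j) \<omega>)) \<in> borel_measurable M"
      using \<xi>M q0 by (intro borel_measurable_sum borel_measurable_times borel_measurable_diff W_measurable) (auto simp: \<xi>_def)
  qed (use step_pair_grid_sum[OF sp gr _ order_refl] q in simp)
  have B: "B \<omega> \<le> 2 * c \<omega> + (2 * (C\<^sup>2 * \<epsilon>) + 2 * \<delta>)" for \<omega>
  proof -
    define d where "d j = q (Suc j) - q j" for j
    have d: "0 \<le> d j" "d j \<le> \<epsilon>" if "j < N" for j using qlt[OF that] qe[OF that] by (auto simp: d_def)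
    let ?D = "\<lambda>j. (\<xi> j \<omega> - cl (\<xi> j \<omega>))\<^sup>2"
    have "(\<eta> j \<omega>)\<^sup>2 * d j \<le> 2 * ((if q j \<le> \<rho> \<omega> then (cl (\<xi> j \<omega>))\<^sup>2 else 0) * d j)
        + 2 * ((if Q (Suc j) \<omega> \<le> \<delta> then ?D j else 0) * d j)" if "j < N" for j
    proof -
      have "(\<xi> j \<omega>)\<^sup>2 \<le> 2 * (cl (\<xi> j \<omega>))\<^sup>2 + 2 * ?D j"
        using zero_le_power2[of "cl (\<xi> j \<omega>) - (\<xi> j \<omega> - cl (\<xi> j \<omega>))"] by (simp add: power2_eq_square algebra_simps)
      then have "(\<eta> j \<omega>)\<^sup>2 \<le> 2 * (if q j \<le> \<rho> \<omega> then (cl (\<xi> j \<omega>))\<^sup>2 else 0) + 2 * (if Q (Suc j) \<omega> \<le> \<delta> then ?D j else 0)"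
        by (auto simp: \<eta>_def)
      from mult_right_mono[OF this d(1)[OF that]] show ?thesis by (simp add: algebra_simps)
    qed
    then have "B \<omega> \<le> (\<Sum>j<N. 2 * ((if q j \<le> \<rho> \<omega> then (cl (\<xi> j \<omega>))\<^sup>2 else 0) * d j)
        + 2 * ((if Q (Suc j) \<omega> \<le> \<delta> then ?D j else 0) * d j))"
      unfolding B_def d_def[symmetric] by (intro sum_mono) auto
    also have "\<dots> = 2 * (\<Sum>j<N. (if q j \<le> \<rho> \<omega> then (cl (\<xi> j \<omega>))\<^sup>2 else 0) * d j)
        + 2 * (\<Sum>j<N. (if Q (Suc j) \<omega> \<le> \<delta> then ?D j else 0) * d j)"
      by (simp only: sum.distrib sum_distrib_left)
    \<comment> \<open>As \<open>Q\<close> is non-decreasing, the retained excess terms are those up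
      to the last index with \<open>Q \<le> \<delta>\<close>, and they add up to that value of
      \<open>Q\<close>.\<close>
    also have "(\<Sum>j<n. (if Q (Suc j) \<omega> \<le> \<delta> then ?D j else 0) * d j) \<le> \<delta>" if "n \<le> N" for n
      using that
    proof (induction n)
      case (Suc n)
      show ?case
      proof (cases "Q (Suc n) \<omega> \<le> \<delta>")
        case True
        have "(\<Sum>j<Suc n. (if Q (Suc j) \<omega> \<le> \<delta> then ?D j else 0) * d j) \<le> (\<Sum>j<Suc n. ?D j * d j)"
          using d(1) Suc.prems by (intro sum_mono mult_right_mono) auto
        also have "\<dots> = Q (Suc n) \<omega>" by (simp add: Q_def \<xi>_def d_def)
        finally show ?thesis using True by simp
      qed (use Suc in auto)
    qed (use \<delta> in simp)
    note this[OF order_refl]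
    \<comment> \<open>Passing from cells that begin before \<open>\<rho>\<close> to cells that end
      before it loses at most the one cell in which \<open>\<rho>\<close> falls, of weight at most
      \<open>C\<^sup>2 * \<epsilon>\<close>. Cells that end before \<open>\<rho>\<close> are wanted
      because in the application the limiting integrand is bounded by \<open>C\<close> throughout
      them.\<close>
    also have "(\<Sum>j<n. (if q j \<le> \<rho> \<omega> then (cl (\<xi> j \<omega>))\<^sup>2 else 0) * d j)
       \<le> (\<Sum>j<n. (if q (Suc j) \<le> \<rho> \<omega> then (cl (\<xi> j \<omega>))\<^sup>2 else 0) * d j) + (if q n \<le> \<rho> \<omega> then 0 else C\<^sup>2 * \<epsilon>)" if "n \<le> N" for n
      using that
    proof (induction n)
      case (Suc n)
      have x: "(cl (\<xi> n \<omega>))\<^sup>2 * d n \<le> C\<^sup>2 * \<epsilon>"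
        using clC d Suc.prems C by (intro mult_mono) auto
      have "q n < q (Suc n)" using qlt Suc.prems by auto
      then show ?case using Suc x \<epsilon> by (auto split: if_splits)
    qed (use C \<epsilon> in auto)
    note this[OF order_refl]
    also have "(if q N \<le> \<rho> \<omega> then 0 else C\<^sup>2 * \<epsilon>) \<le> C\<^sup>2 * \<epsilon>" using \<epsilon> by auto
    finally have fin: "B \<omega> \<le> 2 * ((\<Sum>j<N. (if q (Suc j) \<le> \<rho> \<omega> then (cl (\<xi> j \<omega>))\<^sup>2 else 0) * d j) + C\<^sup>2 * \<epsilon>) + 2 * \<delta>"
      by simp
    have "c \<omega> = (\<Sum>j<N. (if q (Suc j) \<le> \<rho> \<omega> then (cl (\<xi> j \<omega>))\<^sup>2 else 0) * d j)"
      by (simp only: c_def \<xi>_def d_def)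
    with fin show ?thesis by simp
  qed
  have c0: "0 \<le> c \<omega>" for \<omega> unfolding c_def using qlt by (intro sum_nonneg mult_nonneg_nonneg) (auto intro: less_imp_le)
  have B0: "0 \<le> B \<omega>" for \<omega> unfolding B_def using qlt by (intro sum_nonneg mult_nonneg_nonneg) (auto intro: less_imp_le)
  have "(\<integral>\<^sup>+\<omega>. (if s \<le> \<rho> \<omega> \<and> Q N \<omega> \<le> \<delta> then ennreal ((J s \<omega>)\<^sup>2) else 0) \<partial>M) \<le> (\<integral>\<^sup>+\<omega>. ennreal ((A \<omega>)\<^sup>2) \<partial>M)"
    using AJ by (intro nn_integral_mono) auto
  also have "\<dots> = ennreal (expectation B)"
    using iso by (subst nn_integral_eq_integral) auto
  also have "\<dots> = (\<integral>\<^sup>+\<omega>. ennreal (B \<omega>) \<partial>M)"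
    using iso B0 by (subst nn_integral_eq_integral) auto
  also have "\<dots> \<le> (\<integral>\<^sup>+\<omega>. ennreal (2 * (C\<^sup>2 * \<epsilon>) + 2 * \<delta>) + ennreal (2 * c \<omega>) \<partial>M)"
    using B C \<delta> \<epsilon> c0 by (intro nn_integral_mono) (auto simp: ennreal_plus[symmetric] add.commute simp del: ennreal_plus intro!: ennreal_leI)
  also have "\<dots> = ennreal (2 * (C\<^sup>2 * \<epsilon>) + 2 * \<delta>) + (\<integral>\<^sup>+\<omega>. ennreal (2 * c \<omega>) \<partial>M)"
    using cM by (subst nn_integral_add) (auto simp: emeasure_space_1)
  finally show "(\<integral>\<^sup>+\<omega>. (if s \<le> \<rho> \<omega> \<and> Q N \<omega> \<le> \<delta> then ennreal ((J s \<omega>)\<^sup>2) else 0) \<partial>M)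
      \<le> ennreal (2 * (C\<^sup>2 * \<epsilon>) + 2 * \<delta>) + (\<integral>\<^sup>+\<omega>. ennreal (2 * c \<omega>) \<partial>M)" .
qed

end

text \<open>Reduces a supremum over an interval to a countable one, for the sake of measurability.
  \<open>H\<close> has to be kept, because it cannot be approximated from the right within the
  interval.\<close>

lemma SUP_right_continuous:
  fixes f :: "real \<Rightarrow> ennreal"
  assumes "\<And>x. x \<in> {0..<H} \<Longrightarrow> (f \<longlongrightarrow> f x) (at_right x)"
  shows "(SUP s\<in>{0..H}. f s) = (SUP s\<in>{0..H} \<inter> (\<rat> \<union> {H}). f s)"
proof (rule antisym)
  show "(SUP s\<in>{0..H}. f s) \<le> (SUP s\<in>{0..H} \<inter> (\<rat> \<union> {H}). f s)" (is "_ \<le> ?r")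
  proof (rule SUP_least, rule ccontr)
    fix x assume x: "x \<in> {0..H}" and *: "\<not> f x \<le> ?r"
    then have "x \<noteq> H" by (metis IntI SUP_upper UnI2 insertI1)
    then have "x \<in> {0..<H}" using x by auto
    then have "\<forall>\<^sub>F y in at_right x. ?r < f y" using assms * by (intro order_tendstoD(1)) auto
    then obtain b where b: "b > x" "\<And>y. y > x \<Longrightarrow> y < b \<Longrightarrow> ?r < f y"
      by (auto simp: eventually_at_right_field)
    obtain z where z: "z \<in> \<rat>" "x < z" "z < min b H" using Rats_dense_in_real[of x "min b H"] b \<open>x \<in> {0..<H}\<close> by auto
    then have "f z \<le> ?r" using x by (intro SUP_upper) auto
    then show False using b(2)[of z] z by auto
  qed
qed (intro SUP_subset_mono; auto)

lemma grid_cell: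
  assumes "grid P \<epsilon> a b N q" "s \<in> {a<..b}"
  obtains j where "j < N" "q j < s" "s \<le> q (Suc j)"
proof -
  define m where "m = (LEAST m. s \<le> q m)"
  have "s \<le> q N" using assms by (auto simp: grid_def)
  then have m: "s \<le> q m" "m \<le> N" unfolding m_def by (auto intro: LeastI Least_le)
  have "m \<noteq> 0"
  proof
    assume "m = 0"
    then show False using m assms by (auto simp: grid_def)
  qed
  then obtain j where j: "m = Suc j" using not0_implies_Suc by blast
  then have "\<not> s \<le> q j" using not_less_Least[of j "\<lambda>m. s \<le> q m"] by (simp add: m_def)
  then show thesis using that[of j] m j by auto
qed

lemma grid_simple_process:
  assumes "grid P \<epsilon> a b N q" "j < N" "q j < s" "s \<le> q (Suc j)"
  shows "simple_process N q \<xi> s \<omega> = \<xi> j \<omega>"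
proof -
  have "\<xi> i \<omega> * indicator {q i<..q (Suc i)} s = (if i = j then \<xi> j \<omega> else 0)" if "i < N" for i
  proof (cases i j rule: linorder_cases)
    case less
    then have "q (Suc i) \<le> q j" using assms(2) by (intro grid_mono[OF assms(1)]) auto
    then show ?thesis using assms less by auto
  next
    case greater
    then have "q (Suc j) \<le> q i" using that by (intro grid_mono[OF assms(1)]) auto
    then show ?thesis using assms greater by auto
  qed (use assms in auto)
  then have "simple_process N q \<xi> s \<omega> = (\<Sum>i<N. if i = j then \<xi> j \<omega> else 0)"
    unfolding simple_process_def by (intro sum.cong) auto
  then show ?thesis using assms(2) by simp
qed

lemma grid_simple_integral:
  assumes "grid P \<epsilon> a b N q" "j < N" "q j \<le> s" "s \<le> q (Suc j)"
  shows "simple_integral W N q \<xi> s \<omega> - simple_integral W N q \<xi> (q j) \<omega> = \<xi> j \<omega> * (W s \<omega> - W (q j) \<omega>)"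
proof -
  have "\<xi> i \<omega> * (W (min s (q (Suc i))) \<omega> - W (min s (q i)) \<omega>)
      - \<xi> i \<omega> * (W (min (q j) (q (Suc i))) \<omega> - W (min (q j) (q i)) \<omega>)
      = (if i = j then \<xi> j \<omega> * (W s \<omega> - W (q j) \<omega>) else 0)" if "i < N" for i
  proof (cases i j rule: linorder_cases)
    case less
    then have "q (Suc i) \<le> q j" "q i \<le> q j" using assms(2) by (auto intro!: grid_mono[OF assms(1)])
    then show ?thesis using assms less by (simp add: min_absorb2)
  next
    case greater
    then have "q (Suc j) \<le> q i" "q (Suc j) \<le> q (Suc i)" using that by (auto intro!: grid_mono[OF assms(1)])
    then show ?thesis using assms greater by (simp add: min_absorb1)
  next
    case equal
    then show ?thesis using assms by (simp add: min_absorb1 min_absorb2 right_diff_distrib)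
  qed
  then have "simple_integral W N q \<xi> s \<omega> - simple_integral W N q \<xi> (q j) \<omega>
     = (\<Sum>i<N. if i = j then \<xi> j \<omega> * (W s \<omega> - W (q j) \<omega>) else 0)"
    unfolding simple_integral_def sum_subtractf[symmetric] by (intro sum.cong) auto
  then show ?thesis using assms(2) by simp
qed

section \<open>Second moments of an Ito integral up to a random time\<close>

context filtered_brownian_motion
begin

lemma progressive_joint:
  assumes "progressive F H Z" "0 \<le> s" "s \<le> H"
  shows "(\<lambda>x. Z (max 0 (min (snd x) s)) (fst x)) \<in> borel_measurable (M \<Otimes>\<^sub>M borel)"
proof -
  have "(\<lambda>\<omega>. \<omega>) \<in> measurable M (F s)"
    using sub_sigma[of s] by (intro measurableI) (auto simp: space_F Int_absorb2 sets.sets_into_space)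
  then have "(\<lambda>x. (snd x, fst x)) \<in> measurable (M \<Otimes>\<^sub>M borel) (borel \<Otimes>\<^sub>M F s)"
    by (intro measurable_Pair measurable_snd) (rule measurable_compose[OF measurable_fst])
  from measurable_compose[OF this progressiveD[OF assms]] show ?thesis by simp
qed

lemma progressive_nn_integral_measurable:
  assumes "progressive F H Z" "0 \<le> s" "s \<le> H"
    and f: "(\<lambda>x. f (fst (fst x)) (snd (fst x)) (snd x)) \<in> borel_measurable ((M \<Otimes>\<^sub>M borel) \<Otimes>\<^sub>M borel)"
  shows "(\<lambda>\<omega>. \<integral>\<^sup>+u\<in>{0..s}. f \<omega> u (Z u \<omega>) \<partial>lborel) \<in> borel_measurable M"
proof -
  have "(\<lambda>x. (x, Z (max 0 (min (snd x) s)) (fst x))) \<in> measurable (M \<Otimes>\<^sub>M borel) ((M \<Otimes>\<^sub>M borel) \<Otimes>\<^sub>M borel)"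
    using progressive_joint[OF assms(1-3)] by (intro measurable_Pair) auto
  from measurable_compose[OF this f]
  have [measurable]: "(\<lambda>x. f (fst x) (snd x) (Z (max 0 (min (snd x) s)) (fst x))) \<in> borel_measurable (M \<Otimes>\<^sub>M borel)"
    by simp
  have "(\<lambda>x. f (fst x) (snd x) (Z (max 0 (min (snd x) s)) (fst x)) * indicator {0..s} (snd x)) \<in> borel_measurable (M \<Otimes>\<^sub>M borel)"
    by measurable
  then have "(\<lambda>(\<omega>, u). f \<omega> u (Z (max 0 (min u s)) \<omega>) * indicator {0..s} u) \<in> borel_measurable (M \<Otimes>\<^sub>M lborel)"
    by (simp add: case_prod_beta)
  then have "(\<lambda>\<omega>. \<integral>\<^sup>+u. f \<omega> u (Z (max 0 (min u s)) \<omega>) * indicator {0..s} u \<partial>lborel) \<in> borel_measurable M"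
    by (rule lborel.borel_measurable_nn_integral)
  moreover have "(\<lambda>u. f \<omega> u (Z (max 0 (min u s)) \<omega>) * indicator {0..s} u) = (\<lambda>u. f \<omega> u (Z u \<omega>) * indicator {0..s} u)" for \<omega>
    by (auto simp: indicator_def)
  ultimately show ?thesis by (simp only:)
qed

text \<open>An upper bound with a factor 4 in place of the isometry is enough for Gronwall: one
  factor 2 comes from splitting off the excess over the level \<open>C\<close>, the other from
  comparing truncated simple integrands with \<open>K\<close>. \<open>C\<close> makes truncation
  harmless but does not enter the bound. Boundedness is assumed strictly before
  \<open>\<rho>\<close>, because a localised path may jump past the level at \<open>\<rho>\<close>
  itself.\<close>

lemma ito_estimate:
  fixes C H s :: real and \<rho> :: "'a \<Rightarrow> real"
  assumes lim: "ito_limit H K I" and K: "progressive F H K" and I: "I s \<in> borel_measurable M"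
    and \<rho>: "\<rho> \<in> borel_measurable M" and \<rho>F: "\<And>u. u \<in> {0..H} \<Longrightarrow> {\<omega> \<in> space M. u \<le> \<rho> \<omega>} \<in> sets (F u)"
    and C: "\<And>\<omega> u. \<omega> \<in> space M \<Longrightarrow> u \<in> {0..H} \<Longrightarrow> u < \<rho> \<omega> \<Longrightarrow> \<bar>K u \<omega>\<bar> \<le> C"
    and s: "s \<in> {0..H}"
  defines "\<kappa> \<equiv> \<lambda>\<omega>. \<integral>\<^sup>+u\<in>{0..s}. (if u \<le> \<rho> \<omega> then ennreal ((K u \<omega>)\<^sup>2) else 0) \<partial>lborel"
  shows "(\<integral>\<^sup>+\<omega>. (if s \<le> \<rho> \<omega> then ennreal ((I s \<omega>)\<^sup>2) else 0) \<partial>M) \<le> 4 * (\<integral>\<^sup>+\<omega>. \<kappa> \<omega> \<partial>M)"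
    and "\<kappa> \<in> borel_measurable M"
proof -
  have s': "0 \<le> s" "s \<le> H" using s by auto
  note \<rho>[measurable] I[measurable]
  show \<kappa>m[measurable]: "\<kappa> \<in> borel_measurable M"
    unfolding \<kappa>_def by (rule progressive_nn_integral_measurable[OF K s']) measurable
  obtain P S J where SJ: "\<And>k. step_pair (P k) (S k) (J k)"
     "AE \<omega> in M. (\<lambda>k. \<integral>\<^sup>+ s\<in>{0..H}. ennreal ((S k s \<omega> - K s \<omega>)\<^sup>2) \<partial>lborel) \<longlonglongrightarrow> 0"
     "AE \<omega> in M. (\<lambda>k. SUP s\<in>{0..H}. ennreal \<bar>J k s \<omega> - I s \<omega>\<bar>) \<longlonglongrightarrow> 0"
    using lim unfolding ito_limit_def by blast
  have "\<exists>N q. grid (P k) (1 / Suc k) 0 s N q" for k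
    using SJ(1)[of k] s' by (intro grid_exists) (auto simp: step_pair_def)
  then obtain N q where gr: "\<And>k. grid (P k) (1 / Suc k) 0 s (N k) (q k)" by metis
  \<comment> \<open>\<open>C\<close> may be negative if no time lies before \<open>\<rho>\<close>;
    the truncation level must not be.\<close>
  define C' where "C' = max C 0"
  have C': "0 \<le> C'" "\<And>\<omega> u. \<omega> \<in> space M \<Longrightarrow> u \<in> {0..H} \<Longrightarrow> u < \<rho> \<omega> \<Longrightarrow> \<bar>K u \<omega>\<bar> \<le> C'"
    using C by (auto simp: C'_def max.coboundedI1)
  define cl where "cl = (\<lambda>x::real. max (- C') (min C' x))"
  define Q where "Q k n \<omega> = (\<Sum>i<n. (S k (q k (Suc i)) \<omega> - cl (S k (q k (Suc i)) \<omega>))\<^sup>2 * (q k (Suc i) - q k i))" for k n \<omega>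
  define c where "c k \<omega> = (\<Sum>j<N k. (if q k (Suc j) \<le> \<rho> \<omega> then (cl (S k (q k (Suc j)) \<omega>))\<^sup>2 else 0) * (q k (Suc j) - q k j))" for k \<omega>
  define R where "R k \<omega> = (\<integral>\<^sup>+ s\<in>{0..H}. ennreal ((S k s \<omega> - K s \<omega>)\<^sup>2) \<partial>lborel)" for k \<omega>
  have est: "(\<integral>\<^sup>+\<omega>. (if s \<le> \<rho> \<omega> \<and> Q k (N k) \<omega> \<le> \<delta> then ennreal ((J k s \<omega>)\<^sup>2) else 0) \<partial>M)
      \<le> ennreal (2 * (C'\<^sup>2 * (1 / Suc k)) + 2 * \<delta>) + (\<integral>\<^sup>+\<omega>. ennreal (2 * c k \<omega>) \<partial>M)"
    and Qm[measurable]: "Q k (N k) \<in> borel_measurable M" and cm[measurable]: "c k \<in> borel_measurable M"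
    and Jm[measurable]: "J k s \<in> borel_measurable M" if "0 < \<delta>" for k \<delta>
    using step_pair_estimate[OF SJ(1) gr s' \<rho>F C'(1) that] unfolding Q_def[abs_def] c_def[abs_def] cl_def by auto
  have cl: "\<bar>cl x - y\<bar> \<le> \<bar>x - y\<bar>" "\<bar>x - cl x\<bar> \<le> \<bar>x - y\<bar>" if "\<bar>y\<bar> \<le> C'" for x y
    using that by (auto simp: cl_def)
  have clC: "(cl x)\<^sup>2 \<le> C'\<^sup>2" for x
  proof -
    have "\<bar>cl x\<bar> \<le> C'" using C' by (auto simp: cl_def)
    then show ?thesis using C' by (simp add: abs_le_square_iff[symmetric])
  qed
  have cellS: "S k u \<omega> = S k (q k (Suc j)) \<omega>" "0 \<le> q k j" "q k (Suc j) \<le> s"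
    if "j < N k" "q k j < u" "u < q k (Suc j)" "\<omega> \<in> space M" for k j u \<omega>
  proof -
    show 0: "0 \<le> q k j" "q k (Suc j) \<le> s"
      using grid_mono[OF gr, of 0 j k] grid_mono[OF gr, of "Suc j" "N k" k] gr[of k] that by (auto simp: grid_def)
    show "S k u \<omega> = S k (q k (Suc j)) \<omega>"
      using gr[of k] that 0 by (intro step_pairD(3)[OF SJ(1)[of k], of "q k j"]) (auto simp: grid_def)
  qed
  have qinc: "q k j \<le> q k (Suc j)" if "j < N k" for j k using grid_mono[OF gr, of j "Suc j" k] that by simp
  \<comment> \<open>Before \<open>\<rho>\<close> the limit \<open>K\<close> stays within the
    truncation level, so the excess of \<open>S k\<close> over that level is at most its distance to
    \<open>K\<close>.\<close>
  have QR: "ennreal (Q k (N k) \<omega>) \<le> R k \<omega>" if \<omega>: "\<omega> \<in> space M" "s \<le> \<rho> \<omega>" for k \<omega>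
  proof -
    have "ennreal (Q k (N k) \<omega>) \<le> (\<integral>\<^sup>+u\<in>{0..s}. ennreal ((S k u \<omega> - K u \<omega>)\<^sup>2) \<partial>lborel)"
      unfolding Q_def
    proof (rule grid_sum_le_nn_integral[OF gr])
      fix j u assume j: "j < N k" "q k j < u" "u < q k (Suc j)"
      note cs = cellS[OF j \<omega>(1)]
      have "\<bar>K u \<omega>\<bar> \<le> C'" using cs j \<omega> s' by (intro C') auto
      then have "\<bar>S k u \<omega> - cl (S k u \<omega>)\<bar> \<le> \<bar>S k u \<omega> - K u \<omega>\<bar>" by (rule cl)
      then show "ennreal ((S k (q k (Suc j)) \<omega> - cl (S k (q k (Suc j)) \<omega>))\<^sup>2) \<le> ennreal ((S k u \<omega> - K u \<omega>)\<^sup>2)"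
        by (auto simp: cs(1)[symmetric] abs_le_square_iff intro!: ennreal_leI)
    qed auto
    also have "\<dots> \<le> R k \<omega>" unfolding R_def using s' by (intro nn_integral_mono) (auto simp: indicator_def)
    finally show ?thesis .
  qed
  have cR: "ennreal (2 * c k \<omega>) \<le> 4 * \<kappa> \<omega> + 4 * R k \<omega>" if \<omega>: "\<omega> \<in> space M" for k \<omega>
  proof -
    have [measurable]: "(\<lambda>u. K (max 0 (min u s)) \<omega>) \<in> borel_measurable borel"
      using progressive_path(1)[OF K s'] \<omega> by (auto simp: space_F)
    have [measurable]: "(\<lambda>s. S k s \<omega>) \<in> borel_measurable borel"
      using SJ(1) \<omega> by (auto simp: step_pair_def)
    define a where "a u = (if u \<le> \<rho> \<omega> then ennreal ((K (max 0 (min u s)) \<omega>)\<^sup>2) else 0) * indicator {0..s} u" for u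
    define b where "b u = ennreal ((S k u \<omega> - K (max 0 (min u s)) \<omega>)\<^sup>2) * indicator {0..s} u" for u
    have [measurable]: "a \<in> borel_measurable lborel" "b \<in> borel_measurable lborel"
      unfolding a_def b_def by measurable
    have "ennreal (2 * c k \<omega>) = ennreal (\<Sum>j<N k. (2 * (if q k (Suc j) \<le> \<rho> \<omega> then (cl (S k (q k (Suc j)) \<omega>))\<^sup>2 else 0)) * (q k (Suc j) - q k j))"
      by (simp add: c_def sum_distrib_left mult.assoc)
    also have "\<dots> \<le> (\<integral>\<^sup>+u\<in>{0..s}. 4 * a u + 4 * b u \<partial>lborel)"
    proof (rule grid_sum_le_nn_integral[OF gr])
      fix j u assume j: "j < N k" "q k j < u" "u < q k (Suc j)"
      note cs = cellS[OF j \<omega>(1)]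
      show "ennreal (2 * (if q k (Suc j) \<le> \<rho> \<omega> then (cl (S k (q k (Suc j)) \<omega>))\<^sup>2 else 0)) \<le> 4 * a u + 4 * b u"
      proof (cases "q k (Suc j) \<le> \<rho> \<omega>")
        case True
        have "\<bar>K u \<omega>\<bar> \<le> C'" using cs j True \<omega> s' by (intro C') auto
        then have "\<bar>cl (S k u \<omega>) - K u \<omega>\<bar> \<le> \<bar>S k u \<omega> - K u \<omega>\<bar>" by (rule cl)
        then have "(cl (S k u \<omega>) - K u \<omega>)\<^sup>2 \<le> (S k u \<omega> - K u \<omega>)\<^sup>2" by (simp add: abs_le_square_iff)
        moreover have "(cl (S k u \<omega>))\<^sup>2 \<le> 2 * (K u \<omega>)\<^sup>2 + 2 * (cl (S k u \<omega>) - K u \<omega>)\<^sup>2"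
          using zero_le_power2[of "K u \<omega> - (cl (S k u \<omega>) - K u \<omega>)"] by (simp add: power2_eq_square algebra_simps)
        ultimately have "2 * (cl (S k u \<omega>))\<^sup>2 \<le> 4 * (K u \<omega>)\<^sup>2 + 4 * (S k u \<omega> - K u \<omega>)\<^sup>2" by linarith
        then have "ennreal (2 * (cl (S k u \<omega>))\<^sup>2) \<le> 4 * ennreal ((K u \<omega>)\<^sup>2) + 4 * ennreal ((S k u \<omega> - K u \<omega>)\<^sup>2)"
        proof -
          have "4 * ennreal x + 4 * ennreal y = ennreal (4 * x + 4 * y)" if "0 \<le> x" "0 \<le> y" for x y
            using that by (simp add: ennreal_mult)
          from this[OF zero_le_power2 zero_le_power2] show ?thesis
            using ennreal_leI[OF \<open>2 * (cl (S k u \<omega>))\<^sup>2 \<le> _\<close>] by (simp only:)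
        qed
        moreover have "u \<in> {0..s}" "max 0 (min u s) = u" "u \<le> \<rho> \<omega>" using cs j True by auto
        ultimately show ?thesis using True by (simp add: a_def b_def cs(1)[symmetric])
      qed simp
    qed auto
    also have "\<dots> = (\<integral>\<^sup>+u. 4 * a u + 4 * b u \<partial>lborel)"
      by (intro nn_integral_cong) (auto simp: a_def b_def indicator_def)
    also have "\<dots> = 4 * (\<integral>\<^sup>+u. a u \<partial>lborel) + 4 * (\<integral>\<^sup>+u. b u \<partial>lborel)"
      by (simp add: nn_integral_add nn_integral_cmult)
    also have "(\<integral>\<^sup>+u. a u \<partial>lborel) = \<kappa> \<omega>"
      unfolding a_def \<kappa>_def by (intro nn_integral_cong) (auto simp: indicator_def)
    also have "(\<integral>\<^sup>+u. b u \<partial>lborel) \<le> R k \<omega>"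
      unfolding b_def R_def using s' by (intro nn_integral_mono) (auto simp: indicator_def)
    finally show ?thesis by (simp add: mult_left_mono add_left_mono)
  qed
  have \<kappa>fin: "4 * \<kappa> \<omega> < \<infinity>" if \<omega>: "\<omega> \<in> space M" for \<omega>
  proof -
    have "\<kappa> \<omega> \<le> (\<integral>\<^sup>+u. ennreal (C'\<^sup>2) * indicator {0..s} u \<partial>lborel)"
      unfolding \<kappa>_def
    proof (rule nn_integral_mono_AE)
      show "AE u in lborel. (if u \<le> \<rho> \<omega> then ennreal ((K u \<omega>)\<^sup>2) else 0) * indicator {0..s} u \<le> ennreal (C'\<^sup>2) * indicator {0..s} u"
        using AE_lborel_singleton[of "\<rho> \<omega>"]
      proof eventually_elim
        fix u assume u: "u \<noteq> \<rho> \<omega>"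
        show "(if u \<le> \<rho> \<omega> then ennreal ((K u \<omega>)\<^sup>2) else 0) * indicator {0..s} u \<le> ennreal (C'\<^sup>2) * indicator {0..s} u"
        proof (cases "u < \<rho> \<omega> \<and> u \<in> {0..s}")
          case True
          then have "\<bar>K u \<omega>\<bar> \<le> C'" using \<omega> s' by (intro C') auto
          then have "(K u \<omega>)\<^sup>2 \<le> C'\<^sup>2" using C'(1) by (simp add: abs_le_square_iff[symmetric])
          then show ?thesis using True by (auto intro: ennreal_leI)
        qed (use u in auto)
      qed
    qed
    also have "\<dots> = ennreal (C'\<^sup>2) * ennreal s" using s' by (simp add: nn_integral_cmult_indicator)
    also have "\<dots> < \<infinity>" by (simp add: ennreal_mult_less_top)
    finally show ?thesis by (simp add: ennreal_mult_less_top)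
  qed
  \<comment> \<open>The subtraction of \<open>ennreal\<close> is truncated at 0, so
    \<open>e k\<close> is the mean amount by which \<open>2 * c k\<close> exceeds
    \<open>4 * \<kappa>\<close>. It tends to 0 by dominated convergence, with the bound supplied by
    the truncation.\<close>
  define e where "e k = (\<integral>\<^sup>+\<omega>. ennreal (2 * c k \<omega>) - 4 * \<kappa> \<omega> \<partial>M)" for k
  have cb: "c k \<omega> \<le> C'\<^sup>2 * s" for k \<omega>
  proof -
    have "c k \<omega> \<le> (\<Sum>j<N k. C'\<^sup>2 * (q k (Suc j) - q k j))"
      unfolding c_def using clC qinc by (intro sum_mono mult_right_mono) auto
    also have "\<dots> = C'\<^sup>2 * (q k (N k) - q k 0)"
      by (simp add: sum_distrib_left[symmetric] sum_lessThan_telescope)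
    finally show ?thesis using gr[of k] by (simp add: grid_def)
  qed
  have "e \<longlonglongrightarrow> (\<integral>\<^sup>+\<omega>. 0 \<partial>M)"
    unfolding e_def
  proof (rule nn_integral_dominated_convergence[where w="\<lambda>_. ennreal (2 * (C'\<^sup>2 * s))"])
    show "AE \<omega> in M. ennreal (2 * c k \<omega>) - 4 * \<kappa> \<omega> \<le> ennreal (2 * (C'\<^sup>2 * s))" for k
      using cb by (intro AE_I2) (metis diff_le_self_ennreal ennreal_leI mult_left_mono order_trans zero_le_numeral)
    show "AE \<omega> in M. (\<lambda>k. ennreal (2 * c k \<omega>) - 4 * \<kappa> \<omega>) \<longlonglongrightarrow> 0"
      using SJ(2) AE_space
    proof eventually_elim
      fix \<omega> assume \<omega>: "\<omega> \<in> space M" and "(\<lambda>k. \<integral>\<^sup>+ s\<in>{0..H}. ennreal ((S k s \<omega> - K s \<omega>)\<^sup>2) \<partial>lborel) \<longlonglongrightarrow> 0"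
      then have "(\<lambda>k. R k \<omega>) \<longlonglongrightarrow> 0" by (simp add: R_def)
      then have lim: "(\<lambda>k. (R k \<omega> + R k \<omega>) + (R k \<omega> + R k \<omega>)) \<longlonglongrightarrow> (0 + 0) + (0 + 0)" by (intro tendsto_add)
      have four: "4 * x = (x + x) + (x + x)" for x :: ennreal
        by (simp add: mult_2[symmetric] mult.assoc[symmetric])
      have "ennreal (2 * c k \<omega>) - 4 * \<kappa> \<omega> \<le> (R k \<omega> + R k \<omega>) + (R k \<omega> + R k \<omega>)" for k
        using cR[OF \<omega>, of k] \<kappa>fin[OF \<omega>] by (simp add: ennreal_minus_le_iff four[of "R k \<omega>"])
      then have up: "\<forall>\<^sub>F k in sequentially. ennreal (2 * c k \<omega>) - 4 * \<kappa> \<omega> \<le> (R k \<omega> + R k \<omega>) + (R k \<omega> + R k \<omega>)"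
        by (intro always_eventually allI)
      from tendsto_sandwich[OF _ up tendsto_const lim[unfolded add_0]]
      show "(\<lambda>k. ennreal (2 * c k \<omega>) - 4 * \<kappa> \<omega>) \<longlonglongrightarrow> 0" by simp
    qed
  qed (use cm[of 1] in \<open>auto simp: emeasure_space_1 ennreal_mult_less_top\<close>)
  then have e: "e \<longlonglongrightarrow> 0" by simp
  \<comment> \<open>Since \<open>Q\<close> is at most \<open>R\<close> and \<open>R\<close> tends to
    0, almost every path with \<open>s \<le> \<rho> \<omega>\<close> is eventually in the event
    \<open>Q \<le> \<delta>\<close>, however small \<open>\<delta>\<close> is. Fatou's lemma then
    removes the event from the estimate.\<close>
  have fatou: "(\<integral>\<^sup>+\<omega>. (if s \<le> \<rho> \<omega> then ennreal ((I s \<omega>)\<^sup>2) else 0) \<partial>M) \<le> (\<integral>\<^sup>+\<omega>. 4 * \<kappa> \<omega> \<partial>M) + ennreal (2 * \<delta>)"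
    if \<delta>: "0 < \<delta>" for \<delta>
  proof -
    note Qm[OF \<delta>, measurable] cm[OF \<delta>, measurable] Jm[OF \<delta>, measurable]
    define X where "X k \<omega> = (if s \<le> \<rho> \<omega> \<and> Q k (N k) \<omega> \<le> \<delta> then ennreal ((J k s \<omega>)\<^sup>2) else 0)" for k \<omega>
    have "(\<integral>\<^sup>+\<omega>. (if s \<le> \<rho> \<omega> then ennreal ((I s \<omega>)\<^sup>2) else 0) \<partial>M) \<le> (\<integral>\<^sup>+\<omega>. liminf (\<lambda>k. X k \<omega>) \<partial>M)"
    proof (rule nn_integral_mono_AE)
      show "AE \<omega> in M. (if s \<le> \<rho> \<omega> then ennreal ((I s \<omega>)\<^sup>2) else 0) \<le> liminf (\<lambda>k. X k \<omega>)"
        using SJ(2,3) AE_space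
      proof eventually_elim
        fix \<omega> assume \<omega>: "\<omega> \<in> space M"
          and R0: "(\<lambda>k. \<integral>\<^sup>+ s\<in>{0..H}. ennreal ((S k s \<omega> - K s \<omega>)\<^sup>2) \<partial>lborel) \<longlonglongrightarrow> 0"
          and JI: "(\<lambda>k. SUP s\<in>{0..H}. ennreal \<bar>J k s \<omega> - I s \<omega>\<bar>) \<longlonglongrightarrow> 0"
        show "(if s \<le> \<rho> \<omega> then ennreal ((I s \<omega>)\<^sup>2) else 0) \<le> liminf (\<lambda>k. X k \<omega>)"
        proof (cases "s \<le> \<rho> \<omega>")
          case True
          have "\<forall>\<^sub>F k in sequentially. R k \<omega> < ennreal \<delta>"
            using order_tendstoD(2)[OF R0, of "ennreal \<delta>"] \<delta> by (simp add: R_def)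
          then have ev: "\<forall>\<^sub>F k in sequentially. X k \<omega> = ennreal ((J k s \<omega>)\<^sup>2)"
          proof eventually_elim
            fix k assume "R k \<omega> < ennreal \<delta>"
            then have "ennreal (Q k (N k) \<omega>) < ennreal \<delta>" using QR[OF \<omega> True, of k] by (rule order_le_less_trans[rotated])
            then have "Q k (N k) \<omega> \<le> \<delta>" by (metis ennreal_leI leD linear)
            then show "X k \<omega> = ennreal ((J k s \<omega>)\<^sup>2)" using True by (simp add: X_def)
          qed
          have "(\<lambda>k. ennreal \<bar>J k s \<omega> - I s \<omega>\<bar>) \<longlonglongrightarrow> 0"
          proof (rule tendsto_sandwich[OF _ _ tendsto_const JI])
            show "\<forall>\<^sub>F k in sequentially. ennreal \<bar>J k s \<omega> - I s \<omega>\<bar> \<le> (SUP s\<in>{0..H}. ennreal \<bar>J k s \<omega> - I s \<omega>\<bar>)"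
              using s by (intro always_eventually allI SUP_upper)
          qed simp
          then have "(\<lambda>k. \<bar>J k s \<omega> - I s \<omega>\<bar>) \<longlonglongrightarrow> 0"
            using tendsto_enn2real[of "\<lambda>k. ennreal \<bar>J k s \<omega> - I s \<omega>\<bar>" 0 sequentially] by simp
          then have "(\<lambda>k. J k s \<omega>) \<longlonglongrightarrow> I s \<omega>" by (simp add: tendsto_rabs_zero_iff LIM_zero_iff)
          then have "(\<lambda>k. ennreal ((J k s \<omega>)\<^sup>2)) \<longlonglongrightarrow> ennreal ((I s \<omega>)\<^sup>2)" by (intro tendsto_ennrealI tendsto_power)
          then have "(\<lambda>k. X k \<omega>) \<longlonglongrightarrow> ennreal ((I s \<omega>)\<^sup>2)" using tendsto_cong[OF ev] by simp
          then have "liminf (\<lambda>k. X k \<omega>) = ennreal ((I s \<omega>)\<^sup>2)" by (intro lim_imp_Liminf) auto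
          then show ?thesis by simp
        qed simp
      qed
    qed
    also have "\<dots> \<le> liminf (\<lambda>k. \<integral>\<^sup>+\<omega>. X k \<omega> \<partial>M)"
      by (rule nn_integral_liminf) (simp add: X_def)
    also have "\<dots> \<le> liminf (\<lambda>k. ennreal (2 * (C'\<^sup>2 * (1 / Suc k)) + 2 * \<delta>) + ((\<integral>\<^sup>+\<omega>. 4 * \<kappa> \<omega> \<partial>M) + e k))"
    proof (rule Liminf_mono, intro always_eventually allI)
      fix k
      have "(\<integral>\<^sup>+\<omega>. ennreal (2 * c k \<omega>) \<partial>M) \<le> (\<integral>\<^sup>+\<omega>. 4 * \<kappa> \<omega> + (ennreal (2 * c k \<omega>) - 4 * \<kappa> \<omega>) \<partial>M)"
        by (intro nn_integral_mono) (metis add.commute ennreal_minus_le_iff order_refl ennreal_top_minus top_greatest add_top)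
      also have "\<dots> = (\<integral>\<^sup>+\<omega>. 4 * \<kappa> \<omega> \<partial>M) + e k" unfolding e_def by (intro nn_integral_add) auto
      finally show "(\<integral>\<^sup>+\<omega>. X k \<omega> \<partial>M) \<le> ennreal (2 * (C'\<^sup>2 * (1 / Suc k)) + 2 * \<delta>) + ((\<integral>\<^sup>+\<omega>. 4 * \<kappa> \<omega> \<partial>M) + e k)"
        using est[OF \<delta>, of k] unfolding X_def by (meson add_left_mono order_trans)
    qed
    also have "\<dots> = ennreal (2 * (C'\<^sup>2 * 0) + 2 * \<delta>) + ((\<integral>\<^sup>+\<omega>. 4 * \<kappa> \<omega> \<partial>M) + 0)"
      by (intro lim_imp_Liminf tendsto_add tendsto_ennrealI tendsto_const tendsto_mult e LIMSEQ_Suc[OF lim_1_over_n]) simp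
    finally show ?thesis by (simp add: add.commute)
  qed
  have "(\<integral>\<^sup>+\<omega>. (if s \<le> \<rho> \<omega> then ennreal ((I s \<omega>)\<^sup>2) else 0) \<partial>M) \<le> (\<integral>\<^sup>+\<omega>. 4 * \<kappa> \<omega> \<partial>M)"
  proof (rule ennreal_le_epsilon)
    fix \<delta> :: real assume "0 < \<delta>"
    then show "(\<integral>\<^sup>+\<omega>. (if s \<le> \<rho> \<omega> then ennreal ((I s \<omega>)\<^sup>2) else 0) \<partial>M) \<le> (\<integral>\<^sup>+\<omega>. 4 * \<kappa> \<omega> \<partial>M) + ennreal \<delta>"
      using fatou[of "\<delta> / 2"] by simp
  qed
  also have "\<dots> = 4 * (\<integral>\<^sup>+\<omega>. \<kappa> \<omega> \<partial>M)" by (rule nn_integral_cmult) simp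
  finally show "(\<integral>\<^sup>+\<omega>. (if s \<le> \<rho> \<omega> then ennreal ((I s \<omega>)\<^sup>2) else 0) \<partial>M) \<le> 4 * (\<integral>\<^sup>+\<omega>. \<kappa> \<omega> \<partial>M)" .
qed

end

section \<open>Products with absolutely continuous processes\<close>

context filtered_brownian_motion
begin

lemma adaptedD: "adapted_upto F H X \<Longrightarrow> s \<in> {0..H} \<Longrightarrow> X s \<in> borel_measurable (F s)"
  by (simp add: adapted_upto_def)

text \<open>Integration by parts: \<open>\<phi>\<close> has the bounded density \<open>a\<close>, so
  the integral of \<open>\<phi>\<close> against \<open>I\<close> is \<open>\<phi> I\<close> minus
  the time integral of \<open>a I\<close>. The approximating integrands are those of
  \<open>K\<close> multiplied by \<open>\<phi>\<close>, sampled at left end points of a grid that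
  contains their jump times and has mesh at most \<open>1 / Suc k\<close>.\<close>

lemma ito_product:
  assumes ito: "has_ito_integral M F W H K I" and K: "progressive F H K" and H: "0 \<le> H"
    and Kb: "\<And>\<omega>. \<omega> \<in> space M \<Longrightarrow> \<exists>B. \<forall>u\<in>{0..H}. \<bar>K u \<omega>\<bar> \<le> B"
    and a: "progressive F H a" and L: "0 \<le> L" "\<And>\<omega> u. \<omega> \<in> space M \<Longrightarrow> u \<in> {0..H} \<Longrightarrow> \<bar>a u \<omega>\<bar> \<le> L"
    and \<phi>: "progressive F H \<phi>" "\<And>\<omega> u. \<omega> \<in> space M \<Longrightarrow> u \<in> {0..H} \<Longrightarrow> \<bar>\<phi> u \<omega>\<bar> \<le> 1"
      "\<And>\<omega> s. \<omega> \<in> space M \<Longrightarrow> s \<in> {0..H} \<Longrightarrow> \<phi> s \<omega> = \<phi>0 + (LINT u:{0..s}|lborel. a u \<omega>)"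
  shows "has_ito_integral M F W H (\<lambda>s \<omega>. \<phi> s \<omega> * K s \<omega>)
    (\<lambda>s \<omega>. \<phi> s \<omega> * I s \<omega> - (LINT u:{0..s}|lborel. a u \<omega> * I u \<omega>))"
proof -
  define I' where "I' s \<omega> = \<phi> s \<omega> * I s \<omega> - (LINT u:{0..s}|lborel. a u \<omega> * I u \<omega>)" for s \<omega>
  have Iad: "adapted_upto F H I" and Icont: "\<And>\<omega>. \<omega> \<in> space M \<Longrightarrow> continuous_on {0..H} (\<lambda>s. I s \<omega>)"
    using ito by (auto simp: has_ito_integral_def)
  have Ip: "progressive F H I" using progressive_continuous[OF filtration_F Iad Icont] .
  have \<phi>K: "progressive F H (\<lambda>s \<omega>. \<phi> s \<omega> * K s \<omega>)" using \<phi>(1) K by (rule progressive_comp2) measurable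
  have aI: "progressive F H (\<lambda>s \<omega>. a s \<omega> * I s \<omega>)" using a Ip by (rule progressive_comp2) measurable
  have pathm: "set_borel_measurable lborel {0..H} (\<lambda>u. Z u \<omega>)" if "progressive F H Z" "\<omega> \<in> space M" for Z \<omega>
    using progressive_path(2)[OF that(1) H order_refl] that(2) by (simp add: space_F)
  have ai: "set_integrable lborel {0..H} (\<lambda>u. a u \<omega>)" if "\<omega> \<in> space M" for \<omega>
    using pathm[OF a that] L(2)[OF that] by (rule set_integrable_bounded)
  have \<phi>L: "\<bar>\<phi> v \<omega> - \<phi> u \<omega>\<bar> \<le> L * (v - u)" if "\<omega> \<in> space M" "0 \<le> u" "u \<le> v" "v \<le> H" for u v \<omega>
    using set_integral_lipschitz[OF ai[OF that(1)] L(2)[OF that(1)] that(2-4)] that by (simp add: \<phi>(3))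
  have \<phi>c: "continuous_on {0..H} (\<lambda>s. \<phi> s \<omega>)" if "\<omega> \<in> space M" for \<omega>
    using \<phi>L[OF that] by (rule continuous_on_lipschitz_Icc)
  have aIb: "\<exists>B. \<forall>u\<in>{0..H}. \<bar>a u \<omega> * I u \<omega>\<bar> \<le> B" if \<omega>: "\<omega> \<in> space M" for \<omega>
  proof -
    obtain B where B: "0 \<le> B" "\<And>u. u \<in> {0..H} \<Longrightarrow> \<bar>I u \<omega>\<bar> \<le> B" using continuous_bounded_Icc[OF Icont[OF \<omega>]] by blast
    have "\<bar>a u \<omega> * I u \<omega>\<bar> \<le> L * B" if "u \<in> {0..H}" for u
      unfolding abs_mult using L(2)[OF \<omega> that] B(2)[OF that] L(1) by (intro mult_mono) auto
    then show ?thesis by blast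
  qed
  have aIi: "set_integrable lborel {0..H} (\<lambda>u. a u \<omega> * I u \<omega>)" if \<omega>: "\<omega> \<in> space M" for \<omega>
    using aIb[OF \<omega>] pathm[OF aI \<omega>] set_integrable_bounded by blast
  have I'c: "continuous_on {0..H} (\<lambda>s. I' s \<omega>)" if \<omega>: "\<omega> \<in> space M" for \<omega>
  proof -
    have "continuous_on {0..H} (\<lambda>s. LINT u:{0..s}|lborel. a u \<omega> * I u \<omega>)"
      using aIb[OF \<omega>] set_integral_continuous_on[OF aIi[OF \<omega>]] by blast
    then show ?thesis unfolding I'_def using \<phi>c[OF \<omega>] Icont[OF \<omega>] by (intro continuous_intros)
  qed
  have I'a: "adapted_upto F H I'"
    unfolding adapted_upto_def
  proof
    fix s assume s: "s \<in> {0..H}"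
    have "\<phi> s \<in> borel_measurable (F s)" "I s \<in> borel_measurable (F s)"
      "(\<lambda>\<omega>. LINT u:{0..s}|lborel. a u \<omega> * I u \<omega>) \<in> borel_measurable (F s)"
      using s progressive_adapted[OF \<phi>(1)] Iad progressive_set_integral[OF aI] by (auto simp: adapted_upto_def)
    then show "I' s \<in> borel_measurable (F s)" unfolding I'_def by measurable
  qed
  obtain P S J where SJ: "\<And>k. step_pair (P k) (S k) (J k)"
     "AE \<omega> in M. (\<lambda>k. \<integral>\<^sup>+ s\<in>{0..H}. ennreal ((S k s \<omega> - K s \<omega>)\<^sup>2) \<partial>lborel) \<longlonglongrightarrow> 0"
     "AE \<omega> in M. (\<lambda>k. SUP s\<in>{0..H}. ennreal \<bar>J k s \<omega> - I s \<omega>\<bar>) \<longlonglongrightarrow> 0"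
    using has_ito_integral_imp_ito_limit[OF ito] unfolding ito_limit_def by blast
  have "\<exists>N q. grid (P k) (1 / Suc k) 0 H N q" for k
    using SJ(1)[of k] H by (intro grid_exists) (auto simp: step_pair_def)
  then obtain N q where gr: "\<And>k. grid (P k) (1 / Suc k) 0 H (N k) (q k)" by metis
  have qP: "q k j < q k (Suc j)" "P k \<inter> {q k j<..<q k (Suc j)} = {}" "q k (Suc j) - q k j \<le> 1 / Suc k"
      "0 \<le> q k j" "q k (Suc j) \<le> H"
    if "j < N k" for j k
    using grid_mono[OF gr, of 0 j k] grid_mono[OF gr, of "Suc j" "N k" k] gr[of k] that by (auto simp: grid_def)
  \<comment> \<open>The value of the simple integrand on a cell is read off at the right end but
    known at the left end \<open>q k j\<close>; \<open>\<phi>\<close> is sampled at the left end so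
    that the product is known there as well.\<close>
  define \<xi> where "\<xi> k j \<omega> = \<phi> (q k j) \<omega> * S k (q k (Suc j)) \<omega>" for k j \<omega>
  define J' where "J' k = simple_integral W (N k) (q k) (\<xi> k)" for k
  define S' where "S' k = simple_process (N k) (q k) (\<xi> k)" for k
  have simple: "simple_integrand M F (N k) (q k) (\<xi> k)" for k
    unfolding simple_integrand_def
  proof (intro conjI allI impI)
    show "0 \<le> q k 0" using gr[of k] by (simp add: grid_def)
    fix i assume i: "i < N k"
    show "q k i \<le> q k (Suc i)" using qP(1)[OF i] by simp
    note D = step_pairD(1,2)[OF SJ(1) qP(4)[OF i] qP(1,2)[OF i]]
    have "\<phi> (q k i) \<in> borel_measurable (F (q k i))"
      using progressive_adapted[OF \<phi>(1)] qP[OF i] by (intro adaptedD) auto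
    then show "\<xi> k i \<in> borel_measurable (F (q k i))" unfolding \<xi>_def using D(1) by (rule borel_measurable_times)
    obtain C where C: "\<And>\<omega>. \<omega> \<in> space M \<Longrightarrow> \<bar>S k (q k (Suc i)) \<omega>\<bar> \<le> C" using D(2) by auto
    have "\<bar>\<xi> k i \<omega>\<bar> \<le> 1 * C" if \<omega>: "\<omega> \<in> space M" for \<omega>
      unfolding \<xi>_def abs_mult using C[OF \<omega>] qP[OF i] by (intro mult_mono \<phi>(2)[OF \<omega>]) auto
    then show "\<exists>C. \<forall>\<omega>\<in>space M. \<bar>\<xi> k i \<omega>\<bar> \<le> C" by blast
  qed
  have cellS: "S k u \<omega> = S k (q k (Suc j)) \<omega>" if "j < N k" "q k j < u" "u \<le> q k (Suc j)" "\<omega> \<in> space M" for k j u \<omega>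
    using that by (intro step_pairD(3)[OF SJ(1) qP(4)[OF that(1)] qP(1,2)[OF that(1)]]) auto
  have limS: "AE \<omega> in M. (\<lambda>k. \<integral>\<^sup>+ s\<in>{0..H}. ennreal ((S' k s \<omega> - \<phi> s \<omega> * K s \<omega>)\<^sup>2) \<partial>lborel) \<longlonglongrightarrow> 0"
    using SJ(2) AE_space
  proof eventually_elim
    fix \<omega> assume \<omega>: "\<omega> \<in> space M" and l: "(\<lambda>k. \<integral>\<^sup>+ s\<in>{0..H}. ennreal ((S k s \<omega> - K s \<omega>)\<^sup>2) \<partial>lborel) \<longlonglongrightarrow> 0"
    obtain B where B: "\<And>u. u \<in> {0..H} \<Longrightarrow> \<bar>K u \<omega>\<bar> \<le> B" using Kb[OF \<omega>] by blast
    have [measurable]: "(\<lambda>u. K (max 0 (min u H)) \<omega>) \<in> borel_measurable borel"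
      using progressive_path(1)[OF K H order_refl] \<omega> by (auto simp: space_F)
    have [measurable]: "(\<lambda>s. S k s \<omega>) \<in> borel_measurable borel" for k
      using SJ(1) \<omega> by (auto simp: step_pair_def)
    define R where "R k = (\<integral>\<^sup>+ s\<in>{0..H}. ennreal ((S k s \<omega> - K s \<omega>)\<^sup>2) \<partial>lborel)" for k
    define E where "E k = ennreal (2 * (L * (1 / Suc k) * B)\<^sup>2 * H)" for k
    have up: "(\<integral>\<^sup>+ s\<in>{0..H}. ennreal ((S' k s \<omega> - \<phi> s \<omega> * K s \<omega>)\<^sup>2) \<partial>lborel) \<le> (R k + R k) + E k" (is "?X k \<le> _") for k
    proof -
      define b where "b u = ennreal ((S k u \<omega> - K (max 0 (min u H)) \<omega>)\<^sup>2) * indicator {0..H} u" for u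
      have [measurable]: "b \<in> borel_measurable lborel" unfolding b_def by measurable
      define e where "e = 2 * (L * (1 / Suc k) * B)\<^sup>2"
      have "?X k \<le> (\<integral>\<^sup>+u. (b u + b u) + ennreal e * indicator {0..H} u \<partial>lborel)"
      proof (rule nn_integral_mono_AE)
        \<comment> \<open>Grid cells are open on the left, so time 0 belongs to none of
          them.\<close>
        show "AE u in lborel. ennreal ((S' k u \<omega> - \<phi> u \<omega> * K u \<omega>)\<^sup>2) * indicator {0..H} u \<le> (b u + b u) + ennreal e * indicator {0..H} u"
          using AE_lborel_singleton[of 0]
        proof eventually_elim
          fix u :: real assume "u \<noteq> 0"
          show "ennreal ((S' k u \<omega> - \<phi> u \<omega> * K u \<omega>)\<^sup>2) * indicator {0..H} u \<le> (b u + b u) + ennreal e * indicator {0..H} u"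
          proof (cases "u \<in> {0..H}")
            case True
            then have "u \<in> {0<..H}" using \<open>u \<noteq> 0\<close> by auto
            then obtain j where j: "j < N k" "q k j < u" "u \<le> q k (Suc j)" using grid_cell[OF gr] by blast
            have "S' k u \<omega> = \<phi> (q k j) \<omega> * S k u \<omega>"
              unfolding S'_def using grid_simple_process[OF gr j, of "\<xi> k" \<omega>] cellS[OF j \<omega>] by (simp add: \<xi>_def)
            then have eq: "S' k u \<omega> - \<phi> u \<omega> * K u \<omega> = \<phi> (q k j) \<omega> * (S k u \<omega> - K u \<omega>) + (\<phi> (q k j) \<omega> - \<phi> u \<omega>) * K u \<omega>" (is "_ = ?p + ?r")
              by (simp add: algebra_simps)
            have "(?p + ?r)\<^sup>2 \<le> 2 * ?p\<^sup>2 + 2 * ?r\<^sup>2"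
              using zero_le_power2[of "?p - ?r"] by (simp add: power2_eq_square algebra_simps)
            moreover have "?p\<^sup>2 \<le> (S k u \<omega> - K u \<omega>)\<^sup>2"
            proof -
              have "\<bar>?p\<bar> \<le> 1 * \<bar>S k u \<omega> - K u \<omega>\<bar>"
                unfolding abs_mult using qP[OF j(1)] by (intro mult_right_mono \<phi>(2)[OF \<omega>]) auto
              then show ?thesis by (simp add: abs_le_square_iff)
            qed
            moreover have "?r\<^sup>2 \<le> (L * (1 / Suc k) * B)\<^sup>2"
            proof -
              have "\<bar>\<phi> (q k j) \<omega> - \<phi> u \<omega>\<bar> \<le> L * (u - q k j)"
                using \<phi>L[OF \<omega>, of "q k j" u] qP[OF j(1)] j by (simp add: abs_minus_commute)
              also have "\<dots> \<le> L * (1 / Suc k)" using qP(3)[OF j(1)] j L(1) by (intro mult_left_mono) auto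
              finally have "\<bar>?r\<bar> \<le> L * (1 / Suc k) * B"
                unfolding abs_mult using B[OF True] L(1) by (intro mult_mono) auto
              then show ?thesis by (rule abs_le_square_iff[THEN iffD1, OF order_trans[OF _ abs_ge_self]])
            qed
            ultimately have "(S' k u \<omega> - \<phi> u \<omega> * K u \<omega>)\<^sup>2 \<le> ((S k u \<omega> - K u \<omega>)\<^sup>2 + (S k u \<omega> - K u \<omega>)\<^sup>2) + e"
              unfolding eq e_def by linarith
            then have "ennreal ((S' k u \<omega> - \<phi> u \<omega> * K u \<omega>)\<^sup>2) \<le> ennreal (((S k u \<omega> - K u \<omega>)\<^sup>2 + (S k u \<omega> - K u \<omega>)\<^sup>2) + e)"
              by (rule ennreal_leI)
            also have "\<dots> = (b u + b u) + ennreal e"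
            proof -
              have "b u = ennreal ((S k u \<omega> - K u \<omega>)\<^sup>2)" using True by (simp add: b_def)
              moreover have "0 \<le> e" by (simp add: e_def)
              ultimately show ?thesis by (metis add_nonneg_nonneg ennreal_plus zero_le_power2)
            qed
            finally show ?thesis using True by simp
          qed simp
        qed
      qed
      also have "\<dots> = ((\<integral>\<^sup>+u. b u \<partial>lborel) + (\<integral>\<^sup>+u. b u \<partial>lborel)) + (\<integral>\<^sup>+u. ennreal e * indicator {0..H} u \<partial>lborel)"
        by (simp add: nn_integral_add)
      also have "(\<integral>\<^sup>+u. b u \<partial>lborel) = R k"
        unfolding b_def R_def by (intro nn_integral_cong) (auto simp: indicator_def)
      also have "(\<integral>\<^sup>+u. ennreal e * indicator {0..H} u \<partial>lborel) = E k"
        using H by (simp add: nn_integral_cmult_indicator E_def e_def ennreal_mult)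
      finally show ?thesis .
    qed
    have "(\<lambda>k. 2 * (L * (1 / Suc k) * B)\<^sup>2 * H) \<longlonglongrightarrow> 2 * (L * 0 * B)\<^sup>2 * H"
      by (intro tendsto_intros LIMSEQ_Suc[OF lim_1_over_n])
    then have "E \<longlonglongrightarrow> 0" unfolding E_def using tendsto_ennrealI by fastforce
    moreover have "R \<longlonglongrightarrow> 0" using l by (simp add: R_def[abs_def])
    ultimately have "(\<lambda>k. (R k + R k) + E k) \<longlonglongrightarrow> (0 + 0) + 0" by (intro tendsto_add)
    from tendsto_sandwich[OF _ _ tendsto_const this[unfolded add_0], of ?X] up show "?X \<longlonglongrightarrow> 0"
      by simp
  qed
  have limJ: "AE \<omega> in M. (\<lambda>k. SUP s\<in>{0..H}. ennreal \<bar>J' k s \<omega> - I' s \<omega>\<bar>) \<longlonglongrightarrow> 0"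
    using SJ(3) AE_space
  proof eventually_elim
    fix \<omega> assume \<omega>: "\<omega> \<in> space M" and l: "(\<lambda>k. SUP s\<in>{0..H}. ennreal \<bar>J k s \<omega> - I s \<omega>\<bar>) \<longlonglongrightarrow> 0"
    have "\<forall>\<^sub>F k in sequentially. (SUP s\<in>{0..H}. ennreal \<bar>J' k s \<omega> - I' s \<omega>\<bar>) \<le> ennreal (e * (2 * L * H + 1))"
      if e: "0 < e" for e
    proof -
      have "uniformly_continuous_on {0..H} (\<lambda>s. I s \<omega>)" using Icont[OF \<omega>] by (intro compact_uniformly_continuous) auto
      then obtain d where d: "0 < d" "\<And>u v. u \<in> {0..H} \<Longrightarrow> v \<in> {0..H} \<Longrightarrow> \<bar>u - v\<bar> < d \<Longrightarrow> \<bar>I u \<omega> - I v \<omega>\<bar> < e"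
        using e unfolding uniformly_continuous_on_def dist_real_def by metis
      have "\<forall>\<^sub>F k in sequentially. 1 / Suc k < d" using order_tendstoD(2)[OF LIMSEQ_Suc[OF lim_1_over_n] d(1)] .
      moreover have "\<forall>\<^sub>F k in sequentially. (SUP s\<in>{0..H}. ennreal \<bar>J k s \<omega> - I s \<omega>\<bar>) < ennreal e"
        using e by (intro order_tendstoD(2)[OF l]) auto
      ultimately show ?thesis
      proof eventually_elim
        fix k assume k: "1 / Suc k < d" and sup: "(SUP s\<in>{0..H}. ennreal \<bar>J k s \<omega> - I s \<omega>\<bar>) < ennreal e"
        have JI: "\<bar>J k s \<omega> - I s \<omega>\<bar> \<le> e" if "s \<in> {0..H}" for s
        proof -
          have "ennreal \<bar>J k s \<omega> - I s \<omega>\<bar> \<le> (SUP s\<in>{0..H}. ennreal \<bar>J k s \<omega> - I s \<omega>\<bar>)" using that by (rule SUP_upper)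
          then have "ennreal \<bar>J k s \<omega> - I s \<omega>\<bar> \<le> ennreal e" using sup by order
          then show ?thesis using e by (simp add: ennreal_le_iff)
        qed
        \<comment> \<open>The defect of integration by parts for the simple integrals, with the
          limit \<open>I\<close> under the time integral. Its increment up to \<open>v\<close>
          within a cell is the integral of \<open>a * (I - J k v)\<close>, at most
          \<open>L * (2 * e)\<close> per unit of time: one \<open>e\<close> from uniform continuity
          of \<open>I\<close> on cells shorter than \<open>d\<close>, one from the uniform distance
          of \<open>J k\<close> to \<open>I\<close>.\<close>
        define E where "E s = J' k s \<omega> - \<phi> s \<omega> * J k s \<omega> + (LINT u:{0..s}|lborel. a u \<omega> * I u \<omega>)" for s
        have step: "\<bar>E v - E (q k j)\<bar> \<le> 2 * e * L * (v - q k j)" if j: "j < N k" "q k j \<le> v" "v \<le> q k (Suc j)" for j v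
        proof -
          define u where "u = q k j"
          have uv: "0 \<le> u" "u \<le> v" "v \<le> H" using qP[OF j(1)] j by (auto simp: u_def)
          have "J k v \<omega> - J k u \<omega> = S k (q k (Suc j)) \<omega> * (W v \<omega> - W u \<omega>)"
            using j \<omega> unfolding u_def by (intro step_pairD(4)[OF SJ(1) qP(4)[OF j(1)] qP(1,2)[OF j(1)]]) auto
          moreover have "J' k v \<omega> - J' k u \<omega> = \<xi> k j \<omega> * (W v \<omega> - W u \<omega>)"
            unfolding J'_def u_def using gr j by (rule grid_simple_integral)
          ultimately have "J' k v \<omega> - J' k u \<omega> = \<phi> u \<omega> * (J k v \<omega> - J k u \<omega>)" by (simp add: \<xi>_def u_def)
          then have "E v - E u = - (\<phi> v \<omega> - \<phi> u \<omega>) * J k v \<omega> + (LINT w:{u..v}|lborel. a w \<omega> * I w \<omega>)"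
            using set_integral_split[OF aIi[OF \<omega>] uv] by (simp add: E_def algebra_simps)
          also have "\<phi> v \<omega> - \<phi> u \<omega> = (LINT w:{u..v}|lborel. a w \<omega>)"
            using set_integral_split[OF ai[OF \<omega>] uv] uv by (simp add: \<phi>(3)[OF \<omega>])
          also have "- (LINT w:{u..v}|lborel. a w \<omega>) * J k v \<omega> + (LINT w:{u..v}|lborel. a w \<omega> * I w \<omega>)
              = (LINT w:{u..v}|lborel. a w \<omega> * I w \<omega>) - (LINT w:{u..v}|lborel. a w \<omega> * J k v \<omega>)"
            by simp
          also have "\<dots> = (LINT w:{u..v}|lborel. a w \<omega> * I w \<omega> - a w \<omega> * J k v \<omega>)"
            using uv by (intro set_integral_diff(2)[symmetric] set_integrable_subset[OF aIi[OF \<omega>]] set_integrable_mult_left set_integrable_subset[OF ai[OF \<omega>]]) auto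
          also have "\<bar>\<dots>\<bar> \<le> (2 * e * L) * (v - u)"
          proof (rule set_integral_bound)
            show "set_integrable lborel {u..v} (\<lambda>w. a w \<omega> * I w \<omega> - a w \<omega> * J k v \<omega>)"
              using uv by (intro set_integral_diff(1) set_integrable_subset[OF aIi[OF \<omega>]] set_integrable_mult_left set_integrable_subset[OF ai[OF \<omega>]]) auto
            fix w assume w: "w \<in> {u..v}"
            have "\<bar>w - v\<bar> < d" using w uv j qP(3)[OF j(1)] k by (auto simp: u_def)
            then have "\<bar>I w \<omega> - I v \<omega>\<bar> < e" using w uv by (intro d) auto
            then have "\<bar>I w \<omega> - J k v \<omega>\<bar> \<le> 2 * e" using JI[of v] uv by auto
            then have "\<bar>a w \<omega>\<bar> * \<bar>I w \<omega> - J k v \<omega>\<bar> \<le> L * (2 * e)"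
              using w uv L(1) L(2)[OF \<omega>, of w] by (intro mult_mono) auto
            then show "\<bar>a w \<omega> * I w \<omega> - a w \<omega> * J k v \<omega>\<bar> \<le> 2 * e * L"
              by (simp add: abs_mult[symmetric] right_diff_distrib mult_ac)
          qed (use uv in auto)
          finally show ?thesis by (simp add: u_def)
        qed
        have E0: "E 0 = 0"
        proof -
          have "J' k 0 \<omega> = 0" using step_pair_simple[OF simple, of k] \<omega> by (simp add: step_pair_def J'_def)
          moreover have "J k 0 \<omega> = 0" using SJ(1)[of k] \<omega> by (simp add: step_pair_def)
          ultimately show ?thesis by (simp add: E_def)
        qed
        have Eq: "\<bar>E (q k j)\<bar> \<le> 2 * e * L * q k j" if "j \<le> N k" for j
          using that
        proof (induction j)
          case 0
          then show ?case using E0 gr[of k] by (simp add: grid_def)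
        next
          case (Suc j)
          then have "\<bar>E (q k (Suc j)) - E (q k j)\<bar> \<le> 2 * e * L * (q k (Suc j) - q k j)"
            using qP(1)[of j k] by (intro step) auto
          then show ?case using Suc by (simp add: algebra_simps)
        qed
        have E: "\<bar>E s\<bar> \<le> 2 * e * L * s" if s: "s \<in> {0..H}" for s
        proof (cases "s = 0")
          case False
          then have "s \<in> {0<..H}" using s by auto
          then obtain j where j: "j < N k" "q k j < s" "s \<le> q k (Suc j)" using grid_cell[OF gr] by blast
          then show ?thesis using step[of j s] Eq[of j] by (simp add: algebra_simps)
        qed (simp add: E0)
        show "(SUP s\<in>{0..H}. ennreal \<bar>J' k s \<omega> - I' s \<omega>\<bar>) \<le> ennreal (e * (2 * L * H + 1))"
        proof (rule SUP_least, rule ennreal_leI)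
          fix s assume s: "s \<in> {0..H}"
          have "J' k s \<omega> - I' s \<omega> = E s + \<phi> s \<omega> * (J k s \<omega> - I s \<omega>)" by (simp add: E_def I'_def algebra_simps)
          also have "\<bar>\<dots>\<bar> \<le> \<bar>E s\<bar> + \<bar>\<phi> s \<omega>\<bar> * \<bar>J k s \<omega> - I s \<omega>\<bar>" by (metis abs_mult abs_triangle_ineq)
          also have "\<dots> \<le> 2 * e * L * s + 1 * e" using E[OF s] \<phi>(2)[OF \<omega> s] JI[OF s] by (intro add_mono mult_mono) auto
          also have "\<dots> \<le> 2 * e * L * H + 1 * e" using s e L(1) by (intro add_mono mult_left_mono) auto
          finally show "\<bar>J' k s \<omega> - I' s \<omega>\<bar> \<le> e * (2 * L * H + 1)" by (simp add: algebra_simps)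
        qed
      qed
    qed
    note up = this
    show "(\<lambda>k. SUP s\<in>{0..H}. ennreal \<bar>J' k s \<omega> - I' s \<omega>\<bar>) \<longlonglongrightarrow> 0"
    proof (rule order_tendstoI)
      fix y :: ennreal assume "0 < y"
      \<comment> \<open>\<open>y\<close> may be infinite; a finite positive \<open>x\<close> below
        it determines the accuracy \<open>x / (2 * L * H + 1)\<close> used for
        \<open>e\<close>.\<close>
      then obtain x where x: "0 < x" "ennreal x < y"
        using dense[of 0 y] by (metis ennreal_cases ennreal_less_zero_iff less_top order_less_trans not_less_iff_gr_or_eq top_greatest)
      have pos: "0 < 2 * L * H + 1" using L(1) H by (simp add: add_nonneg_pos)
      have "\<forall>\<^sub>F k in sequentially. (SUP s\<in>{0..H}. ennreal \<bar>J' k s \<omega> - I' s \<omega>\<bar>) \<le> ennreal ((x / (2 * L * H + 1)) * (2 * L * H + 1))"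
        using x pos by (intro up) simp
      then show "\<forall>\<^sub>F k in sequentially. (SUP s\<in>{0..H}. ennreal \<bar>J' k s \<omega> - I' s \<omega>\<bar>) < y"
        by eventually_elim (use x pos in auto)
    qed simp
  qed
  have Sm: "(\<lambda>\<omega>. \<integral>\<^sup>+ s\<in>{0..H}. ennreal ((S' k s \<omega> - \<phi> s \<omega> * K s \<omega>)\<^sup>2) \<partial>lborel) \<in> borel_measurable M" for k
  proof (rule progressive_nn_integral_measurable[OF \<phi>K H order_refl])
    have [measurable]: "\<xi> k i \<in> borel_measurable M" if "i < N k" for i
      using simple[of k] that measurable_F_M by (auto simp: simple_integrand_def)
    have "(\<lambda>x. S' k (snd (fst x)) (fst (fst x))) \<in> borel_measurable ((M \<Otimes>\<^sub>M borel) \<Otimes>\<^sub>M borel)"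
      unfolding S'_def simple_process_def
    proof (intro borel_measurable_sum borel_measurable_times)
      fix i assume "i \<in> {..<N k}"
      then have "\<xi> k i \<in> borel_measurable M" using \<open>\<And>i. i < N k \<Longrightarrow> \<xi> k i \<in> borel_measurable M\<close> by simp
      then show "(\<lambda>x. \<xi> k i (fst (fst x))) \<in> borel_measurable ((M \<Otimes>\<^sub>M borel) \<Otimes>\<^sub>M borel)" by measurable
    qed measurable
    then show "(\<lambda>x. ennreal ((S' k (snd (fst x)) (fst (fst x)) - snd x)\<^sup>2)) \<in> borel_measurable ((M \<Otimes>\<^sub>M borel) \<Otimes>\<^sub>M borel)"
      by measurable
  qed
  \<comment> \<open>Convergence in probability, as defined, includes measurability. Path continuity
    lets the supremum run over countably many times.\<close>
  have Jm: "(\<lambda>\<omega>. SUP s\<in>{0..H}. ennreal \<bar>J' k s \<omega> - I' s \<omega>\<bar>) \<in> borel_measurable M" for k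
  proof (rule measurable_cong[THEN iffD1])
    have Wc: "continuous_on {0..} (\<lambda>s. W (min s r) \<omega>)" if "\<omega> \<in> space M" "0 \<le> r" for r \<omega>
      using that by (intro continuous_on_compose2[OF W_continuous[OF that(1)], of _ "\<lambda>s. min s r"] continuous_intros) auto
    have qpos: "0 \<le> q k i" if "i \<le> N k" for i
      using grid_mono[OF gr, of 0 i k] gr[of k] that by (auto simp: grid_def)
    fix \<omega> assume \<omega>: "\<omega> \<in> space M"
    have "continuous_on {0..H} (\<lambda>s. J' k s \<omega>)"
      unfolding J'_def simple_integral_def using qpos
      by (intro continuous_intros continuous_on_subset[OF Wc[OF \<omega>]]) auto
    then have "continuous_on {0..H} (\<lambda>s. ennreal \<bar>J' k s \<omega> - I' s \<omega>\<bar>)"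
      using I'c[OF \<omega>] by (intro continuous_on_ennreal continuous_on_rabs continuous_on_diff)
    then have "((\<lambda>s. ennreal \<bar>J' k s \<omega> - I' s \<omega>\<bar>) \<longlongrightarrow> ennreal \<bar>J' k x \<omega> - I' x \<omega>\<bar>) (at_right x)" if x: "x \<in> {0..<H}" for x
    proof -
      assume "continuous_on {0..H} (\<lambda>s. ennreal \<bar>J' k s \<omega> - I' s \<omega>\<bar>)"
      then have "((\<lambda>s. ennreal \<bar>J' k s \<omega> - I' s \<omega>\<bar>) \<longlongrightarrow> ennreal \<bar>J' k x \<omega> - I' x \<omega>\<bar>) (at x within {0..H})"
        using x by (auto simp: continuous_on_def)
      then have "((\<lambda>s. ennreal \<bar>J' k s \<omega> - I' s \<omega>\<bar>) \<longlongrightarrow> ennreal \<bar>J' k x \<omega> - I' x \<omega>\<bar>) (at x within {x..H})"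
        by (rule tendsto_within_subset) (use x in auto)
      then show ?thesis using x by (simp add: at_within_Icc_at_right)
    qed
    then show "(SUP s\<in>{0..H} \<inter> (\<rat> \<union> {H}). ennreal \<bar>J' k s \<omega> - I' s \<omega>\<bar>) = (SUP s\<in>{0..H}. ennreal \<bar>J' k s \<omega> - I' s \<omega>\<bar>)"
      by (rule SUP_right_continuous[symmetric])
  next
    show "(\<lambda>\<omega>. SUP s\<in>{0..H} \<inter> (\<rat> \<union> {H}). ennreal \<bar>J' k s \<omega> - I' s \<omega>\<bar>) \<in> borel_measurable M"
    proof (rule borel_measurable_SUP)
      show "countable ({0..H} \<inter> (\<rat> \<union> {H}))" by (auto intro: countable_subset[of _ "\<rat> \<union> {H}"] countable_rat)
      fix s assume "s \<in> {0..H} \<inter> (\<rat> \<union> {H})"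
      then have s: "s \<in> {0..H}" by simp
      have "I' s \<in> borel_measurable M" using adaptedD[OF I'a s] measurable_F_M by blast
      moreover have "J' k s \<in> borel_measurable M"
        unfolding J'_def simple_integral_def
      proof (intro borel_measurable_sum borel_measurable_times borel_measurable_diff W_measurable)
        fix i assume i: "i \<in> {..<N k}"
        then show "\<xi> k i \<in> borel_measurable M"
          using simple[of k] measurable_F_M by (auto simp: simple_integrand_def)
        show "0 \<le> min s (q k (Suc i))" "0 \<le> min s (q k i)" using i s qP(1,4)[of i k] by auto
      qed
      ultimately show "(\<lambda>\<omega>. ennreal \<bar>J' k s \<omega> - I' s \<omega>\<bar>) \<in> borel_measurable M" by measurable
    qed
  qed
  show ?thesis
    unfolding I'_def[symmetric] has_ito_integral_def
  proof (intro conjI ballI I'c exI allI)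
    show "adapted_upto F H (\<lambda>s \<omega>. \<phi> s \<omega> * K s \<omega>)" using progressive_adapted[OF \<phi>K] .
    show "adapted_upto F H I'" by fact
    show "simple_integrand M F (N k) (q k) (\<xi> k)" for k by fact
    show "null_in_probability M (\<lambda>k \<omega>. \<integral>\<^sup>+ s\<in>{0..H}. ennreal ((simple_process (N k) (q k) (\<xi> k) s \<omega> - \<phi> s \<omega> * K s \<omega>)\<^sup>2) \<partial>lborel)"
      using null_in_probability_AE[OF Sm limS] by (simp add: S'_def)
    show "null_in_probability M (\<lambda>k \<omega>. SUP s\<in>{0..H}. ennreal \<bar>simple_integral W (N k) (q k) (\<xi> k) s \<omega> - I' s \<omega>\<bar>)"
      using null_in_probability_AE[OF Jm limJ] by (simp add: J'_def)
  qed
qed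

end

section \<open>Exit times\<close>

lemma exit_time_le: "exit_time \<O> H X \<omega> \<le> H"
  unfolding exit_time_def by (rule cInf_lower) (auto intro!: bdd_belowI[of _ "min 0 H"])

lemma exit_time_ge: "0 \<le> H \<Longrightarrow> 0 \<le> exit_time \<O> H X \<omega>"
  unfolding exit_time_def by (rule cInf_greatest) auto

text \<open>\<open>u \<le> H\<close> ensures that the point \<open>H\<close> inserted into the
  infimum is no witness.\<close>

lemma exit_time_less_iff:
  assumes "u \<le> H"
  shows "exit_time \<O> H X \<omega> < u \<longleftrightarrow> (\<exists>s\<in>{0..<u}. X s \<omega> \<notin> \<O>)"
proof -
  have "exit_time \<O> H X \<omega> < u \<longleftrightarrow> (\<exists>s\<in>insert H {s\<in>{0..H}. X s \<omega> \<notin> \<O>}. s < u)"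
    unfolding exit_time_def by (rule cInf_less_iff) (auto intro!: bdd_belowI[of _ "min 0 H"])
  then show ?thesis using assms by auto
qed

lemma before_exit_time: "u \<in> {0..H} \<Longrightarrow> u < exit_time \<O> H X \<omega> \<Longrightarrow> X u \<omega> \<in> \<O>"
  by (metis atLeastAtMost_iff atLeastLessThan_iff exit_time_le exit_time_less_iff order_less_irrefl)

section \<open>Cadlag paths: algebra, boundedness, Cauchy-Schwarz in time\<close>

lemma cadlag_binop:
  assumes f: "cadlag_upto H f" and g: "cadlag_upto H g"
    and h: "\<And>A a b. (f \<longlongrightarrow> a) A \<Longrightarrow> (g \<longlongrightarrow> b) A \<Longrightarrow> ((\<lambda>s. h (f s) (g s)) \<longlongrightarrow> h a b) A"
  shows "cadlag_upto H (\<lambda>s. h (f s) (g s))"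
  unfolding cadlag_upto_def
proof (intro conjI ballI)
  fix s assume "s \<in> {0..<H}"
  then show "((\<lambda>s. h (f s) (g s)) \<longlongrightarrow> h (f s) (g s)) (at_right s)"
    using f g by (intro h) (auto simp: cadlag_upto_def)
next
  fix s assume s: "s \<in> {0<..H}"
  then obtain a b where "(f \<longlongrightarrow> a) (at_left s)" "(g \<longlongrightarrow> b) (at_left s)" using f g unfolding cadlag_upto_def by blast
  then show "\<exists>l. ((\<lambda>s. h (f s) (g s)) \<longlongrightarrow> l) (at_left s)" using h by blast
qed

lemma cadlag_diff: "cadlag_upto H f \<Longrightarrow> cadlag_upto H g \<Longrightarrow> cadlag_upto H (\<lambda>s. f s - g s)"
  by (rule cadlag_binop[where h="(-)"]) (auto intro: tendsto_diff)

lemma cadlag_mult: "cadlag_upto H f \<Longrightarrow> cadlag_upto H g \<Longrightarrow> cadlag_upto H (\<lambda>s. f s * g s)"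
  by (rule cadlag_binop[where h="(*)"]) (auto intro: tendsto_mult)

text \<open>The one-sided limits bound the path on both sides of each point, the value at the point
  is added, and Bolzano's bisection glues the local bounds.\<close>

lemma cadlag_bounded:
  assumes "cadlag_upto H f"
  obtains B where "0 \<le> B" "\<And>u. u \<in> {0..H} \<Longrightarrow> \<bar>f u\<bar> \<le> B"
proof (cases "0 \<le> H")
  case False
  then show thesis using that[of 0] by auto
next
  case True
  \<comment> \<open>The name \<open>S\<close> protects one copy of \<open>{0..H}\<close> from being
    generalised together with the interval in the induction.\<close>
  define S where "S = {0..H}"
  from True have "\<exists>B. \<forall>u\<in>{0..H}. u \<in> S \<longrightarrow> \<bar>f u\<bar> \<le> B"
  proof (induction rule: Bolzano)
    case (trans a b c)
    then obtain B B' where "\<forall>u\<in>{a..b}. u \<in> S \<longrightarrow> \<bar>f u\<bar> \<le> B" "\<forall>u\<in>{b..c}. u \<in> S \<longrightarrow> \<bar>f u\<bar> \<le> B'" by blast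
    then show ?case by (intro exI[of _ "max B B'"]) (metis atLeastAtMost_iff linear max.coboundedI1 max.coboundedI2)
  next
    case (local x)
    have "\<exists>d>0. \<exists>B. \<forall>u. x < u \<longrightarrow> u < x + d \<longrightarrow> u \<in> {0..H} \<longrightarrow> \<bar>f u\<bar> \<le> B"
    proof (cases "x < H")
      case True
      then have "(f \<longlongrightarrow> f x) (at_right x)" using assms local by (auto simp: cadlag_upto_def)
      then have "\<forall>\<^sub>F u in at_right x. dist (f u) (f x) < 1" by (rule tendstoD) simp
      then obtain b where "b > x" "\<And>u. x < u \<Longrightarrow> u < b \<Longrightarrow> dist (f u) (f x) < 1" by (auto simp: eventually_at_right_field)
      then show ?thesis by (intro exI[of _ "b - x"] conjI exI[of _ "\<bar>f x\<bar> + 1"]) (force simp: dist_real_def)+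
    qed (auto intro: exI[of _ 1])
    then obtain d B where d: "d > 0" "\<And>u. x < u \<Longrightarrow> u < x + d \<Longrightarrow> u \<in> {0..H} \<Longrightarrow> \<bar>f u\<bar> \<le> B" by blast
    have "\<exists>d>0. \<exists>B. \<forall>u. u < x \<longrightarrow> x - d < u \<longrightarrow> u \<in> {0..H} \<longrightarrow> \<bar>f u\<bar> \<le> B"
    proof (cases "0 < x")
      case True
      then obtain l where "(f \<longlongrightarrow> l) (at_left x)" using assms local by (fastforce simp: cadlag_upto_def)
      then have "\<forall>\<^sub>F u in at_left x. dist (f u) l < 1" by (rule tendstoD) simp
      then obtain b where "b < x" "\<And>u. b < u \<Longrightarrow> u < x \<Longrightarrow> dist (f u) l < 1" by (auto simp: eventually_at_left_field)
      then show ?thesis by (intro exI[of _ "x - b"] conjI exI[of _ "\<bar>l\<bar> + 1"]) (force simp: dist_real_def)+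
    qed (auto intro: exI[of _ 1])
    then obtain d' B' where d': "d' > 0" "\<And>u. u < x \<Longrightarrow> x - d' < u \<Longrightarrow> u \<in> {0..H} \<Longrightarrow> \<bar>f u\<bar> \<le> B'" by blast
    have "\<exists>B. \<forall>u\<in>{a..b}. u \<in> S \<longrightarrow> \<bar>f u\<bar> \<le> B" if ab: "a \<le> x \<and> x \<le> b \<and> b - a < min d d'" for a b
    proof (intro exI[of _ "max \<bar>f x\<bar> (max B B')"] ballI impI)
      fix u assume "u \<in> {a..b}" "u \<in> S"
      then have *: "u \<in> {a..b}" "u \<in> {0..H}" by (auto simp: S_def)
      show "\<bar>f u\<bar> \<le> max \<bar>f x\<bar> (max B B')"
        using d(2)[of u] d'(2)[of u] ab * by (cases u x rule: linorder_cases) auto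
    qed
    then show ?case using d(1) d'(1) by (intro exI[of _ "min d d'"]) auto
  qed
  then obtain B where "\<forall>u\<in>{0..H}. \<bar>f u\<bar> \<le> B" by (auto simp: S_def)
  then show thesis by (intro that[of "max B 0"]) force+
qed

lemma set_integral_nonneg_real:
  fixes f :: "real \<Rightarrow> real"
  assumes "\<And>u. u \<in> A \<Longrightarrow> 0 \<le> f u"
  shows "0 \<le> (LINT u:A|lborel. f u)"
  unfolding set_lebesgue_integral_def
  by (rule Bochner_Integration.integral_nonneg) (use assms in \<open>auto simp: indicator_def\<close>)

text \<open>Cauchy-Schwarz against the constant 1, obtained by integrating the square of
  \<open>g - m\<close> with \<open>m\<close> the mean of \<open>g\<close>. The case
  \<open>s = 0\<close> is split off because of the division.\<close>

lemma set_integral_square_le: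
  fixes g :: "real \<Rightarrow> real"
  assumes g: "set_borel_measurable lborel {0..s} g" "\<And>u. u \<in> {0..s} \<Longrightarrow> \<bar>g u\<bar> \<le> B" and s: "0 \<le> s"
  shows "(LINT u:{0..s}|lborel. g u)\<^sup>2 \<le> s * (LINT u:{0..s}|lborel. (g u)\<^sup>2)"
proof (cases "s = 0")
  case False
  then have s: "0 < s" using s by simp
  define m where "m = (LINT u:{0..s}|lborel. g u) / s"
  have gi: "set_integrable lborel {0..s} g" using g by (rule set_integrable_bounded)
  have g2: "set_integrable lborel {0..s} (\<lambda>u. (g u)\<^sup>2)"
  proof (rule set_integrable_bounded)
    show "set_borel_measurable lborel {0..s} (\<lambda>u. (g u)\<^sup>2)"
      using set_borel_measurable_mult[OF g(1) g(1)] by (simp add: power2_eq_square)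
    show "\<bar>(g u)\<^sup>2\<bar> \<le> \<bar>B\<bar>\<^sup>2" if "u \<in> {0..s}" for u
      using g(2)[OF that] by (simp add: abs_le_square_iff[symmetric])
  qed
  have i: "set_integrable lborel {0..s} (\<lambda>u. m\<^sup>2 - (2 * m) * g u)"
    using gi by (intro set_integral_diff set_integrable_const_Icc) auto
  have "0 \<le> (LINT u:{0..s}|lborel. (m\<^sup>2 - (2 * m) * g u) + (g u)\<^sup>2)"
  proof (rule set_integral_nonneg_real)
    fix u
    show "0 \<le> (m\<^sup>2 - (2 * m) * g u) + (g u)\<^sup>2"
      using zero_le_power2[of "g u - m"] by (simp add: power2_eq_square algebra_simps)
  qed
  also have "\<dots> = (LINT u:{0..s}|lborel. m\<^sup>2 - (2 * m) * g u) + (LINT u:{0..s}|lborel. (g u)\<^sup>2)"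
    using i g2 by (rule set_integral_add)
  also have "(LINT u:{0..s}|lborel. m\<^sup>2 - (2 * m) * g u) = (LINT u:{0..s}|lborel. m\<^sup>2) - (LINT u:{0..s}|lborel. (2 * m) * g u)"
    using gi by (intro set_integral_diff set_integrable_const_Icc) auto
  also have "\<dots> = s * m\<^sup>2 - (2 * m) * (m * s)"
    using s by (simp add: set_integral_const_Icc m_def)
  finally have "s * m\<^sup>2 \<le> (LINT u:{0..s}|lborel. (g u)\<^sup>2)" by (simp add: power2_eq_square algebra_simps)
  then have "s * (s * m\<^sup>2) \<le> s * (LINT u:{0..s}|lborel. (g u)\<^sup>2)" using s by (intro mult_left_mono) auto
  moreover have "s * (s * m\<^sup>2) = (LINT u:{0..s}|lborel. g u)\<^sup>2" using s by (simp add: m_def power2_eq_square)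
  ultimately show ?thesis by simp
qed simp

context filtered_brownian_motion
begin

text \<open>
  The hypothesis \<open>wit\<close> lets rational times decide whether a path has left \<open>\<O>\<close>.
\<close>

lemma exit_time_sets:
  assumes X: "adapted_upto F H X" and \<O>: "\<O> \<in> sets borel"
    and wit: "\<And>\<omega> s b. \<omega> \<in> space M \<Longrightarrow> s \<in> {0..<H} \<Longrightarrow> X s \<omega> \<notin> \<O> \<Longrightarrow> s < b \<Longrightarrow> \<exists>q\<in>\<rat>. s \<le> q \<and> q < b \<and> X q \<omega> \<notin> \<O>"
    and u: "u \<in> {0..H}"
  shows "{\<omega> \<in> space M. u \<le> exit_time \<O> H X \<omega>} \<in> sets (F u)"
proof -
  have "u \<le> exit_time \<O> H X \<omega> \<longleftrightarrow> (\<forall>s\<in>{0..<u} \<inter> \<rat>. X s \<omega> \<in> \<O>)" if \<omega>: "\<omega> \<in> space M" for \<omega>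
  proof -
    have "(\<forall>s\<in>{0..<u}. X s \<omega> \<in> \<O>)" if *: "\<forall>s\<in>{0..<u} \<inter> \<rat>. X s \<omega> \<in> \<O>"
    proof (rule ballI, rule ccontr)
      fix s assume s: "s \<in> {0..<u}" "X s \<omega> \<notin> \<O>"
      obtain q where "q \<in> \<rat>" "s \<le> q" "q < u" "X q \<omega> \<notin> \<O>" using wit[OF \<omega> _ s(2), of u] s u by auto
      then show False using * s by auto
    qed
    then show ?thesis using exit_time_less_iff[of u H \<O> X \<omega>] u by (auto simp: not_less[symmetric])
  qed
  then have "{\<omega> \<in> space M. u \<le> exit_time \<O> H X \<omega>} = {\<omega> \<in> space M. \<forall>s\<in>{0..<u} \<inter> \<rat>. X s \<omega> \<in> \<O>}" by auto
  also have "\<dots> = {\<omega> \<in> space (F u). \<forall>s\<in>{0..<u} \<inter> \<rat>. X s \<omega> \<in> \<O>}" by (simp add: space_F)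
  also have "\<dots> = {\<omega> \<in> space (F u). \<forall>r::rat. real_of_rat r \<in> {0..<u} \<longrightarrow> X (real_of_rat r) \<omega> \<in> \<O>}"
    by (auto simp: Rats_def)
  also have "\<dots> \<in> sets (F u)"
  proof (rule sets.sets_Collect_countable_All)
    fix r :: rat
    show "{\<omega> \<in> space (F u). real_of_rat r \<in> {0..<u} \<longrightarrow> X (real_of_rat r) \<omega> \<in> \<O>} \<in> sets (F u)"
    proof (cases "real_of_rat r \<in> {0..<u}")
      case True
      then have [measurable]: "X (real_of_rat r) \<in> borel_measurable (F u)" using u by (intro measurable_F_mono[OF adaptedD[OF X]]) auto
      note \<O>[measurable]
      have "{\<omega> \<in> space (F u). X (real_of_rat r) \<omega> \<in> \<O>} \<in> sets (F u)" by measurable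
      then show ?thesis using True by simp
    next
      case False
      then have "{\<omega> \<in> space (F u). real_of_rat r \<in> {0..<u} \<longrightarrow> X (real_of_rat r) \<omega> \<in> \<O>} = space (F u)" by auto
      then show ?thesis by (simp only: sets.top)
    qed
  qed
  finally show ?thesis .
qed

lemma random_time_measurable:
  assumes "\<And>u. u \<in> {0..H} \<Longrightarrow> {\<omega> \<in> space M. u \<le> \<rho> \<omega>} \<in> sets (F u)"
    and "\<And>\<omega>. \<omega> \<in> space M \<Longrightarrow> \<rho> \<omega> \<in> {0..H}"
  shows "\<rho> \<in> borel_measurable M"
proof (rule borel_measurableI_ge)
  fix y
  consider "y < 0" | "y \<in> {0..H}" | "0 \<le> y" "H < y" by force
  then show "{\<omega> \<in> space M. y \<le> \<rho> \<omega>} \<in> sets M"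
  proof cases
    case 1
    then have "{\<omega> \<in> space M. y \<le> \<rho> \<omega>} = space M" using assms(2) by force
    then show ?thesis by simp
  next
    case 2
    then show ?thesis using assms(1) sub_sigma by blast
  next
    case 3
    then have "{\<omega> \<in> space M. y \<le> \<rho> \<omega>} = {}" using assms(2) by force
    then show ?thesis by (simp only: sets.empty_sets)
  qed
qed

lemma progressive_joint':
  assumes "progressive F H Z" "0 \<le> s" "s \<le> H"
  shows "(\<lambda>x. Z (max 0 (min (fst x) s)) (snd x)) \<in> borel_measurable (borel \<Otimes>\<^sub>M M)"
proof -
  have "(\<lambda>x. (snd x, fst x)) \<in> measurable (borel \<Otimes>\<^sub>M M) (M \<Otimes>\<^sub>M borel)" by simp
  from measurable_compose[OF this progressive_joint[OF assms]] show ?thesis by simp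
qed

section \<open>Square moments of solutions\<close>

text \<open>
  Localizing at the first time at which \<open>Z\<close> exceeds \<open>n\<close> makes the second moments finite, as
  Gronwall's inequality requires.
\<close>

lemma square_moment_bound:
  fixes \<rho>0 :: "'a \<Rightarrow> real" and H :: real
  assumes ito: "ito_limit H \<kappa> I" and \<kappa>p: "progressive F H \<kappa>" and Ip: "adapted_upto F H I"
    and Za: "adapted_upto F H Z" and Zc: "\<And>\<omega>. \<omega> \<in> space M \<Longrightarrow> cadlag_upto H (\<lambda>s. Z s \<omega>)"
    and \<rho>: "\<And>u. u \<in> {0..H} \<Longrightarrow> {\<omega> \<in> space M. u \<le> \<rho>0 \<omega>} \<in> sets (F u)"
      "\<And>\<omega>. \<omega> \<in> space M \<Longrightarrow> \<rho>0 \<omega> \<in> {0..H}"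
    and L: "0 < L" and c: "0 \<le> c" and A: "A \<in> borel_measurable M" "\<And>\<omega>. \<omega> \<in> space M \<Longrightarrow> 0 \<le> A \<omega>"
    and bound: "AE \<omega> in M. \<forall>s\<in>{0..H}. s \<le> \<rho>0 \<omega> \<longrightarrow>
        \<bar>Z s \<omega>\<bar> \<le> A \<omega> + L * (LINT u:{0..s}|lborel. c + \<bar>Z u \<omega>\<bar>) + \<bar>I s \<omega>\<bar>"
    and \<kappa>b: "\<And>\<omega> u. \<omega> \<in> space M \<Longrightarrow> u \<in> {0..H} \<Longrightarrow> u < \<rho>0 \<omega> \<Longrightarrow> \<bar>\<kappa> u \<omega>\<bar> \<le> L * (c + \<bar>Z u \<omega>\<bar>)"
    and H: "0 \<le> H"
  obtains C where "0 \<le> C" "\<And>s. s \<in> {0..H} \<Longrightarrow>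
    (\<integral>\<^sup>+\<omega>. (if s \<le> \<rho>0 \<omega> then ennreal ((Z s \<omega>)\<^sup>2) else 0) \<partial>M) \<le> ennreal C * ((\<integral>\<^sup>+\<omega>. ennreal ((A \<omega>)\<^sup>2) \<partial>M) + ennreal (c\<^sup>2))"
proof -
  have Zp: "progressive F H Z" using progressive_cadlag[OF filtration_F Za Zc] .
  define \<tau> where "\<tau> n = exit_time {- real n..real n} H Z" for n
  define \<rho>n where "\<rho>n n \<omega> = min (\<rho>0 \<omega>) (\<tau> n \<omega>)" for n \<omega>
  have \<tau>s: "{\<omega> \<in> space M. u \<le> \<tau> n \<omega>} \<in> sets (F u)" if u: "u \<in> {0..H}" for u n
    unfolding \<tau>_def
  proof (rule exit_time_sets[OF Za _ _ u])
    fix \<omega> s b assume \<omega>: "\<omega> \<in> space M" and s: "s \<in> {0..<H}" "Z s \<omega> \<notin> {- real n..real n}" "s < b"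
    have "((\<lambda>s. Z s \<omega>) \<longlongrightarrow> Z s \<omega>) (at_right s)" using Zc[OF \<omega>] s by (auto simp: cadlag_upto_def)
    \<comment> \<open>The region beyond the level is open, so by right-continuity the path stays
      there for a while, and a rational time can be found.\<close>
    moreover have "open (- {- real n..real n})" by (simp add: open_Compl)
    ultimately have "\<forall>\<^sub>F v in at_right s. Z v \<omega> \<in> - {- real n..real n}" using s by (auto dest!: topological_tendstoD)
    then obtain d where d: "d > s" "\<And>v. s < v \<Longrightarrow> v < d \<Longrightarrow> Z v \<omega> \<notin> {- real n..real n}" by (auto simp: eventually_at_right_field)
    obtain q where "q \<in> \<rat>" "s < q" "q < min b d" using Rats_dense_in_real[of s "min b d"] d s by auto
    then show "\<exists>q\<in>\<rat>. s \<le> q \<and> q < b \<and> Z q \<omega> \<notin> {- real n..real n}" using d(2)[of q] by (intro bexI[of _ q]) auto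
  qed auto
  have \<rho>nr: "\<rho>n n \<omega> \<in> {0..H}" if "\<omega> \<in> space M" for n \<omega>
    using \<rho>(2)[OF that] exit_time_le[of _ H Z \<omega>] exit_time_ge[OF H, of _ Z \<omega>] by (auto simp: \<rho>n_def \<tau>_def)
  have \<rho>ns: "{\<omega> \<in> space M. u \<le> \<rho>n n \<omega>} \<in> sets (F u)" if u: "u \<in> {0..H}" for u n
  proof -
    have "{\<omega> \<in> space M. u \<le> \<rho>n n \<omega>} = {\<omega> \<in> space M. u \<le> \<rho>0 \<omega>} \<inter> {\<omega> \<in> space M. u \<le> \<tau> n \<omega>}" by (auto simp: \<rho>n_def)
    then show ?thesis using \<rho>(1)[OF u] \<tau>s[OF u] by auto
  qed
  have \<rho>nm[measurable]: "\<rho>n n \<in> borel_measurable M" for n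
    using random_time_measurable[OF \<rho>ns \<rho>nr] .
  have Zn: "\<bar>Z u \<omega>\<bar> \<le> real n" if "u \<in> {0..H}" "u < \<rho>n n \<omega>" for u n \<omega>
    using before_exit_time[OF that(1), of "{- real n..real n}" Z \<omega>] that(2) by (auto simp: \<rho>n_def \<tau>_def)
  have \<kappa>n: "\<bar>\<kappa> u \<omega>\<bar> \<le> L * (c + real n)" if "\<omega> \<in> space M" "u \<in> {0..H}" "u < \<rho>n n \<omega>" for u n \<omega>
  proof -
    have "\<bar>\<kappa> u \<omega>\<bar> \<le> L * (c + \<bar>Z u \<omega>\<bar>)" using that by (intro \<kappa>b) (auto simp: \<rho>n_def)
    also have "\<dots> \<le> L * (c + real n)" using Zn[OF that(2,3)] L by (intro mult_left_mono) auto
    finally show ?thesis .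
  qed
  define EA where "EA = (\<integral>\<^sup>+\<omega>. ennreal ((A \<omega>)\<^sup>2) \<partial>M)"
  \<comment> \<open>The coefficients in front of the time integral of the square of
    \<open>Z\<close>. Squaring three terms costs 3 and squaring \<open>c + |Z|\<close> costs 2; so
    the drift contributes \<open>3 * 2 * L\<^sup>2 * H\<close> by Cauchy-Schwarz, and the noise
    \<open>3 * 4 * 2 * L\<^sup>2\<close> with the 4 from \<open>ito_estimate\<close>.\<close>
  define K where "K = 6 * L\<^sup>2 * H + 24 * L\<^sup>2"
  have K: "0 < K" using L H by (simp add: K_def add_nonneg_pos)
  \<comment> \<open>Clamping makes the localised second moment a measurable function on the whole
    real line, as the Gronwall lemma asks.\<close>
  define cs where "cs u = max 0 (min u H)" for u :: real
  define f where "f n u = (\<integral>\<^sup>+\<omega>. (if cs u \<le> \<rho>n n \<omega> then ennreal ((Z (cs u) \<omega>)\<^sup>2) else 0) \<partial>M)" for n u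
  have Zj[measurable]: "(\<lambda>x. Z (cs (fst x)) (snd x)) \<in> borel_measurable (borel \<Otimes>\<^sub>M M)"
    using progressive_joint'[OF Zp H order_refl] by (simp add: cs_def)
  have csm[measurable]: "cs \<in> borel_measurable borel" unfolding cs_def by measurable
  define \<Phi> where "\<Phi> n u \<omega> = (if cs u \<le> \<rho>n n \<omega> then ennreal ((Z (cs u) \<omega>)\<^sup>2) else 0)" for n u \<omega>
  have \<Phi>m: "(\<lambda>x. \<Phi> n (fst x) (snd x)) \<in> borel_measurable (borel \<Otimes>\<^sub>M M)" for n
    unfolding \<Phi>_def by measurable
  have fm[measurable]: "f n \<in> borel_measurable borel" for n
    using borel_measurable_nn_integral[of "\<lambda>u \<omega>. \<Phi> n u \<omega>" borel] \<Phi>m[of n] by (simp add: f_def[abs_def] \<Phi>_def case_prod_beta)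
  have \<Phi>m1[measurable]: "\<Phi> n u \<in> borel_measurable M" for n u
    using measurable_compose[OF measurable_Pair1'[of u borel M] \<Phi>m] by simp
  define g where "g n s \<omega> = (\<integral>\<^sup>+u\<in>{0..s}. \<Phi> n u \<omega> \<partial>lborel)" for n s \<omega>
  have gE: "(\<integral>\<^sup>+\<omega>. g n s \<omega> \<partial>M) = (\<integral>\<^sup>+u\<in>{0..s}. f n u \<partial>lborel)" and gm[measurable]: "g n s \<in> borel_measurable M" for n s
  proof -
    have m: "(\<lambda>x. \<Phi> n (fst x) (snd x) * indicator {0..s} (fst x)) \<in> borel_measurable (borel \<Otimes>\<^sub>M M)"
      using \<Phi>m[of n] by measurable
    then have m': "(\<lambda>x. \<Phi> n (fst x) (snd x) * indicator {0..s} (fst x)) \<in> borel_measurable (lborel \<Otimes>\<^sub>M M)"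
      by simp
    interpret P: pair_sigma_finite lborel M by standard
    have "(\<integral>\<^sup>+\<omega>. g n s \<omega> \<partial>M) = (\<integral>\<^sup>+u. \<integral>\<^sup>+\<omega>. \<Phi> n u \<omega> * indicator {0..s} u \<partial>M \<partial>lborel)"
      using P.Fubini'[of "\<lambda>u \<omega>. \<Phi> n u \<omega> * indicator {0..s} u"] m' by (simp add: g_def case_prod_beta)
    also have "\<dots> = (\<integral>\<^sup>+u\<in>{0..s}. f n u \<partial>lborel)"
      by (intro nn_integral_cong) (simp add: nn_integral_multc f_def \<Phi>_def[symmetric] del: \<Phi>_def)
    finally show "(\<integral>\<^sup>+\<omega>. g n s \<omega> \<partial>M) = (\<integral>\<^sup>+u\<in>{0..s}. f n u \<partial>lborel)" .
    have "(\<lambda>x. (snd x, fst x)) \<in> measurable (M \<Otimes>\<^sub>M borel) (borel \<Otimes>\<^sub>M M)" by simp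
    from measurable_compose[OF this m]
    have "(\<lambda>(\<omega>, u). \<Phi> n u \<omega> * indicator {0..s} u) \<in> borel_measurable (M \<Otimes>\<^sub>M lborel)" by (simp add: case_prod_beta)
    then show "g n s \<in> borel_measurable M" unfolding g_def by (rule lborel.borel_measurable_nn_integral)
  qed
  \<comment> \<open>This is the finiteness gained by localisation. At
    \<open>u = \<rho>n n \<omega>\<close> the path may already exceed \<open>n\<close>, but a single
    time is a null set.\<close>
  have gn: "g n s \<omega> \<le> ennreal ((real n)\<^sup>2 * H)" if "s \<in> {0..H}" for n s \<omega>
  proof -
    have "g n s \<omega> \<le> (\<integral>\<^sup>+u. ennreal ((real n)\<^sup>2) * indicator {0..H} u \<partial>lborel)"
      unfolding g_def
    proof (rule nn_integral_mono_AE)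
      show "AE u in lborel. \<Phi> n u \<omega> * indicator {0..s} u \<le> ennreal ((real n)\<^sup>2) * indicator {0..H} u"
        using AE_lborel_singleton[of "\<rho>n n \<omega>"]
      proof eventually_elim
        fix u assume u: "u \<noteq> \<rho>n n \<omega>"
        show "\<Phi> n u \<omega> * indicator {0..s} u \<le> ennreal ((real n)\<^sup>2) * indicator {0..H} u"
        proof (cases "u \<in> {0..s} \<and> u < \<rho>n n \<omega>")
          case True
          then have "\<bar>Z u \<omega>\<bar> \<le> real n" using that by (intro Zn) auto
          then have "(Z u \<omega>)\<^sup>2 \<le> (real n)\<^sup>2" by (simp add: abs_le_square_iff[symmetric])
          then show ?thesis using True that by (auto simp: \<Phi>_def cs_def intro!: ennreal_leI)
        qed (use u that in \<open>auto simp: \<Phi>_def cs_def\<close>)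
      qed
    qed
    also have "\<dots> = ennreal ((real n)\<^sup>2 * H)" using H by (simp add: nn_integral_cmult_indicator ennreal_mult)
    finally show ?thesis .
  qed
  have main: "f n s \<le> (ennreal 3 * EA + ennreal (K * (c\<^sup>2 * H))) + ennreal K * (\<integral>\<^sup>+u\<in>{0..s}. f n u \<partial>lborel)"
    if s: "s \<in> {0..H}" for n s
  proof -
    have css: "cs s = s" using s by (simp add: cs_def)
    define V where "V \<omega> = (if s \<le> \<rho>n n \<omega> then ennreal ((I s \<omega>)\<^sup>2) else 0)" for \<omega>
    have [measurable]: "I s \<in> borel_measurable M" using adaptedD[OF Ip s] measurable_F_M by blast
    have [measurable]: "V \<in> borel_measurable M" unfolding V_def by measurable
    define k where "k \<omega> = (\<integral>\<^sup>+u\<in>{0..s}. (if u \<le> \<rho>n n \<omega> then ennreal ((\<kappa> u \<omega>)\<^sup>2) else 0) \<partial>lborel)" for \<omega>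
    have V: "(\<integral>\<^sup>+\<omega>. V \<omega> \<partial>M) \<le> 4 * (\<integral>\<^sup>+\<omega>. k \<omega> \<partial>M)"
      unfolding V_def k_def using \<kappa>n by (intro ito_estimate(1)[OF ito \<kappa>p _ \<rho>nm \<rho>ns _ s]) auto
    have kb: "k \<omega> \<le> ennreal (2 * L\<^sup>2 * c\<^sup>2 * H) + ennreal (2 * L\<^sup>2) * g n s \<omega>" if \<omega>: "\<omega> \<in> space M" for \<omega>
    proof -
      have [measurable]: "(\<lambda>u. \<Phi> n u \<omega>) \<in> borel_measurable borel"
        using measurable_compose[OF measurable_Pair2'[OF \<omega>] \<Phi>m] by simp
      have "k \<omega> \<le> (\<integral>\<^sup>+u. ennreal (2 * L\<^sup>2 * c\<^sup>2) * indicator {0..s} u + ennreal (2 * L\<^sup>2) * (\<Phi> n u \<omega> * indicator {0..s} u) \<partial>lborel)"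
        unfolding k_def
      proof (rule nn_integral_mono_AE)
        show "AE u in lborel. (if u \<le> \<rho>n n \<omega> then ennreal ((\<kappa> u \<omega>)\<^sup>2) else 0) * indicator {0..s} u
            \<le> ennreal (2 * L\<^sup>2 * c\<^sup>2) * indicator {0..s} u + ennreal (2 * L\<^sup>2) * (\<Phi> n u \<omega> * indicator {0..s} u)"
          using AE_lborel_singleton[of "\<rho>n n \<omega>"]
        proof eventually_elim
          fix u assume u: "u \<noteq> \<rho>n n \<omega>"
          show "(if u \<le> \<rho>n n \<omega> then ennreal ((\<kappa> u \<omega>)\<^sup>2) else 0) * indicator {0..s} u
            \<le> ennreal (2 * L\<^sup>2 * c\<^sup>2) * indicator {0..s} u + ennreal (2 * L\<^sup>2) * (\<Phi> n u \<omega> * indicator {0..s} u)"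
          proof (cases "u \<in> {0..s} \<and> u < \<rho>n n \<omega>")
            case True
            then have u': "u \<in> {0..H}" "u < \<rho>0 \<omega>" "cs u = u" using s by (auto simp: \<rho>n_def cs_def)
            have "\<bar>\<kappa> u \<omega>\<bar> \<le> \<bar>L * (c + \<bar>Z u \<omega>\<bar>)\<bar>" using \<kappa>b[OF \<omega> u'(1,2)] by simp
            then have "(\<kappa> u \<omega>)\<^sup>2 \<le> (L * (c + \<bar>Z u \<omega>\<bar>))\<^sup>2" by (simp only: abs_le_square_iff)
            also have "\<dots> = L\<^sup>2 * (c + \<bar>Z u \<omega>\<bar>)\<^sup>2" by (simp add: power_mult_distrib)
            also have "\<dots> \<le> L\<^sup>2 * (2 * c\<^sup>2 + 2 * (Z u \<omega>)\<^sup>2)"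
              using zero_le_power2[of "c - \<bar>Z u \<omega>\<bar>"] by (intro mult_left_mono) (auto simp: power2_eq_square algebra_simps)
            finally have "(\<kappa> u \<omega>)\<^sup>2 \<le> 2 * L\<^sup>2 * c\<^sup>2 + (2 * L\<^sup>2) * (Z u \<omega>)\<^sup>2" by (simp add: algebra_simps)
            then have "ennreal ((\<kappa> u \<omega>)\<^sup>2) \<le> ennreal (2 * L\<^sup>2 * c\<^sup>2) + ennreal (2 * L\<^sup>2) * ennreal ((Z u \<omega>)\<^sup>2)"
            proof -
              assume "(\<kappa> u \<omega>)\<^sup>2 \<le> 2 * L\<^sup>2 * c\<^sup>2 + (2 * L\<^sup>2) * (Z u \<omega>)\<^sup>2"
              then have "ennreal ((\<kappa> u \<omega>)\<^sup>2) \<le> ennreal (2 * L\<^sup>2 * c\<^sup>2 + (2 * L\<^sup>2) * (Z u \<omega>)\<^sup>2)" by (rule ennreal_leI)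
              then show ?thesis by (simp add: ennreal_mult ennreal_plus)
            qed
            then show ?thesis using True u' by (simp add: \<Phi>_def)
          qed (use u in auto)
        qed
      qed
      also have "\<dots> = ennreal (2 * L\<^sup>2 * c\<^sup>2) * ennreal s + ennreal (2 * L\<^sup>2) * g n s \<omega>"
        using s by (simp add: nn_integral_add nn_integral_cmult g_def)
      also have "ennreal (2 * L\<^sup>2 * c\<^sup>2) * ennreal s \<le> ennreal (2 * L\<^sup>2 * c\<^sup>2) * ennreal H"
        using s by (intro mult_left_mono ennreal_leI) auto
      also have "ennreal (2 * L\<^sup>2 * c\<^sup>2) * ennreal H = ennreal (2 * L\<^sup>2 * c\<^sup>2 * H)" using H by (simp add: ennreal_mult)
      finally show ?thesis by (simp add: add_right_mono)
    qed
    have "f n s \<le> (\<integral>\<^sup>+\<omega>. (ennreal 3 * ennreal ((A \<omega>)\<^sup>2) + ennreal (6 * L\<^sup>2 * H * (c\<^sup>2 * H)))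
        + (ennreal (6 * L\<^sup>2 * H) * g n s \<omega> + ennreal 3 * V \<omega>) \<partial>M)"
      unfolding f_def css
    proof (rule nn_integral_mono_AE)
      show "AE \<omega> in M. (if s \<le> \<rho>n n \<omega> then ennreal ((Z s \<omega>)\<^sup>2) else 0) \<le> (ennreal 3 * ennreal ((A \<omega>)\<^sup>2) + ennreal (6 * L\<^sup>2 * H * (c\<^sup>2 * H)))
        + (ennreal (6 * L\<^sup>2 * H) * g n s \<omega> + ennreal 3 * V \<omega>)"
        using bound AE_space
      proof eventually_elim
        fix \<omega> assume \<omega>: "\<omega> \<in> space M" and *: "\<forall>s\<in>{0..H}. s \<le> \<rho>0 \<omega> \<longrightarrow>
          \<bar>Z s \<omega>\<bar> \<le> A \<omega> + L * (LINT u:{0..s}|lborel. c + \<bar>Z u \<omega>\<bar>) + \<bar>I s \<omega>\<bar>"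
        show "(if s \<le> \<rho>n n \<omega> then ennreal ((Z s \<omega>)\<^sup>2) else 0) \<le> (ennreal 3 * ennreal ((A \<omega>)\<^sup>2) + ennreal (6 * L\<^sup>2 * H * (c\<^sup>2 * H)))
          + (ennreal (6 * L\<^sup>2 * H) * g n s \<omega> + ennreal 3 * V \<omega>)"
        proof (cases "s \<le> \<rho>n n \<omega>")
          case True
          obtain B where B: "0 \<le> B" "\<And>u. u \<in> {0..H} \<Longrightarrow> \<bar>Z u \<omega>\<bar> \<le> B" using cadlag_bounded[OF Zc[OF \<omega>]] by blast
          have Zb: "set_borel_measurable lborel {0..s} (\<lambda>u. Z u \<omega>)"
            using progressive_path(2)[OF Zp, of s \<omega>] s \<omega> by (simp add: space_F)
          have Zm[measurable]: "(\<lambda>u. indicator {0..s} u *\<^sub>R Z u \<omega>) \<in> borel_measurable lborel" using Zb by (simp add: set_borel_measurable_def)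
          have gm': "set_borel_measurable lborel {0..s} (\<lambda>u. c + \<bar>Z u \<omega>\<bar>)"
          proof -
            have "(\<lambda>u. indicator {0..s} u * c + \<bar>indicator {0..s} u *\<^sub>R Z u \<omega>\<bar>) \<in> borel_measurable lborel" by measurable
            moreover have "(\<lambda>u. indicator {0..s} u * c + \<bar>indicator {0..s} u *\<^sub>R Z u \<omega>\<bar>) = (\<lambda>u. indicator {0..s} u *\<^sub>R (c + \<bar>Z u \<omega>\<bar>))"
              by (auto simp: indicator_def)
            ultimately show ?thesis by (simp add: set_borel_measurable_def)
          qed
          define J where "J = (LINT u:{0..s}|lborel. c + \<bar>Z u \<omega>\<bar>)"
          have Z2: "set_integrable lborel {0..s} (\<lambda>u. (Z u \<omega>)\<^sup>2)"
          proof (rule set_integrable_bounded)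
            show "set_borel_measurable lborel {0..s} (\<lambda>u. (Z u \<omega>)\<^sup>2)" using set_borel_measurable_mult[OF Zb Zb] by (simp add: power2_eq_square)
            show "\<bar>(Z u \<omega>)\<^sup>2\<bar> \<le> B\<^sup>2" if "u \<in> {0..s}" for u using B(2)[of u] that s B(1) by (simp add: abs_le_square_iff[symmetric])
          qed
          define G where "G = (LINT u:{0..s}|lborel. (Z u \<omega>)\<^sup>2)"
          have G0: "0 \<le> G" unfolding G_def by (intro set_integral_nonneg_real) auto
          have "J\<^sup>2 \<le> s * (LINT u:{0..s}|lborel. (c + \<bar>Z u \<omega>\<bar>)\<^sup>2)"
            unfolding J_def
          proof (rule set_integral_square_le[OF gm'])
            show "\<bar>c + \<bar>Z u \<omega>\<bar>\<bar> \<le> c + B" if "u \<in> {0..s}" for u using B(2)[of u] that s c by auto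
          qed (use s in auto)
          also have "(LINT u:{0..s}|lborel. (c + \<bar>Z u \<omega>\<bar>)\<^sup>2) \<le> (LINT u:{0..s}|lborel. 2 * c\<^sup>2 + 2 * (Z u \<omega>)\<^sup>2)"
          proof (rule set_integral_mono)
            show "set_integrable lborel {0..s} (\<lambda>u. (c + \<bar>Z u \<omega>\<bar>)\<^sup>2)"
            proof (rule set_integrable_bounded)
              show "set_borel_measurable lborel {0..s} (\<lambda>u. (c + \<bar>Z u \<omega>\<bar>)\<^sup>2)" using set_borel_measurable_mult[OF gm' gm'] by (simp add: power2_eq_square)
              show "\<bar>(c + \<bar>Z u \<omega>\<bar>)\<^sup>2\<bar> \<le> (c + B)\<^sup>2" if "u \<in> {0..s}" for u using B(2)[of u] that s B(1) c by (simp add: abs_le_square_iff[symmetric])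
            qed
            show "set_integrable lborel {0..s} (\<lambda>u. 2 * c\<^sup>2 + 2 * (Z u \<omega>)\<^sup>2)"
              using Z2 by (intro set_integral_add set_integrable_const_Icc) auto
            show "(c + \<bar>Z u \<omega>\<bar>)\<^sup>2 \<le> 2 * c\<^sup>2 + 2 * (Z u \<omega>)\<^sup>2" for u
              using zero_le_power2[of "c - \<bar>Z u \<omega>\<bar>"] by (simp add: power2_eq_square algebra_simps)
          qed
          also have "\<dots> = s * (2 * c\<^sup>2) + 2 * G"
            using Z2 s by (subst set_integral_add) (auto simp: set_integrable_const_Icc set_integral_const_Icc G_def)
          finally have "J\<^sup>2 \<le> s * (s * (2 * c\<^sup>2) + 2 * G)" using s by (simp add: mult_left_mono)
          also have "\<dots> \<le> H * (H * (2 * c\<^sup>2) + 2 * G)" using s G0 by (intro mult_mono add_mono mult_right_mono) auto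
          finally have J2: "J\<^sup>2 \<le> H * (H * (2 * c\<^sup>2) + 2 * G)" .
          have "\<bar>Z s \<omega>\<bar> \<le> \<bar>A \<omega> + L * J + \<bar>I s \<omega>\<bar>\<bar>" using * s True by (auto simp: J_def \<rho>n_def)
          then have "(Z s \<omega>)\<^sup>2 \<le> (A \<omega> + L * J + \<bar>I s \<omega>\<bar>)\<^sup>2" by (simp only: abs_le_square_iff)
          also have "\<dots> \<le> 3 * ((A \<omega>)\<^sup>2 + (L * J)\<^sup>2 + (I s \<omega>)\<^sup>2)"
            using zero_le_power2[of "A \<omega> - L * J"] zero_le_power2[of "A \<omega> - \<bar>I s \<omega>\<bar>"] zero_le_power2[of "L * J - \<bar>I s \<omega>\<bar>"]
            by (simp add: power2_eq_square algebra_simps)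
          also have "(L * J)\<^sup>2 \<le> L\<^sup>2 * (H * (H * (2 * c\<^sup>2) + 2 * G))"
            using J2 by (simp add: power_mult_distrib mult_left_mono)
          finally have "(Z s \<omega>)\<^sup>2 \<le> (3 * (A \<omega>)\<^sup>2 + 6 * L\<^sup>2 * H * (c\<^sup>2 * H)) + (6 * L\<^sup>2 * H * G + 3 * (I s \<omega>)\<^sup>2)"
            by (simp add: algebra_simps)
          then have "ennreal ((Z s \<omega>)\<^sup>2) \<le> ennreal ((3 * (A \<omega>)\<^sup>2 + 6 * L\<^sup>2 * H * (c\<^sup>2 * H)) + (6 * L\<^sup>2 * H * G + 3 * (I s \<omega>)\<^sup>2))"
            by (rule ennreal_leI)
          also have "\<dots> = (ennreal 3 * ennreal ((A \<omega>)\<^sup>2) + ennreal (6 * L\<^sup>2 * H * (c\<^sup>2 * H))) + (ennreal (6 * L\<^sup>2 * H) * ennreal G + ennreal 3 * ennreal ((I s \<omega>)\<^sup>2))"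
            using H G0 by (subst (1 2 3) ennreal_mult[symmetric]; simp add: ennreal_plus)
          also have "ennreal G = g n s \<omega>"
          proof -
            have "ennreal G = (\<integral>\<^sup>+u. ennreal (indicator {0..s} u *\<^sub>R (Z u \<omega>)\<^sup>2) \<partial>lborel)"
              using Z2 unfolding G_def set_integrable_def set_lebesgue_integral_def by (intro nn_integral_eq_integral[symmetric]) auto
            also have "\<dots> = g n s \<omega>"
              unfolding g_def using s True by (intro nn_integral_cong) (auto simp: indicator_def \<Phi>_def cs_def)
            finally show ?thesis .
          qed
          finally show ?thesis using True by (simp add: V_def)
        qed simp
      qed
    qed
    also have "\<dots> = (ennreal 3 * EA + ennreal (6 * L\<^sup>2 * H * (c\<^sup>2 * H))) + (ennreal (6 * L\<^sup>2 * H) * (\<integral>\<^sup>+\<omega>. g n s \<omega> \<partial>M) + ennreal 3 * (\<integral>\<^sup>+\<omega>. V \<omega> \<partial>M))"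
      using A(1) by (simp add: nn_integral_add nn_integral_cmult EA_def emeasure_space_1)
    also have "ennreal 3 * (\<integral>\<^sup>+\<omega>. V \<omega> \<partial>M) \<le> ennreal 3 * (4 * (\<integral>\<^sup>+\<omega>. ennreal (2 * L\<^sup>2 * c\<^sup>2 * H) + ennreal (2 * L\<^sup>2) * g n s \<omega> \<partial>M))"
      using kb by (intro mult_left_mono order_trans[OF V] nn_integral_mono) auto
    also have "(\<integral>\<^sup>+\<omega>. ennreal (2 * L\<^sup>2 * c\<^sup>2 * H) + ennreal (2 * L\<^sup>2) * g n s \<omega> \<partial>M) = ennreal (2 * L\<^sup>2 * c\<^sup>2 * H) + ennreal (2 * L\<^sup>2) * (\<integral>\<^sup>+\<omega>. g n s \<omega> \<partial>M)"
      by (simp add: nn_integral_add nn_integral_cmult emeasure_space_1)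
    also have "ennreal 3 * (4 * (ennreal (2 * L\<^sup>2 * c\<^sup>2 * H) + ennreal (2 * L\<^sup>2) * (\<integral>\<^sup>+\<omega>. g n s \<omega> \<partial>M)))
        = ennreal (24 * L\<^sup>2 * (c\<^sup>2 * H)) + ennreal (24 * L\<^sup>2) * (\<integral>\<^sup>+\<omega>. g n s \<omega> \<partial>M)"
    proof -
      have "ennreal 3 * (4 * (x + ennreal (2 * L\<^sup>2) * y)) = ennreal 12 * x + (ennreal 12 * ennreal (2 * L\<^sup>2)) * y" for x y
        by (simp add: distrib_left mult.assoc[symmetric])
      then show ?thesis using H by (simp add: ennreal_mult[symmetric] mult.assoc del: ennreal_numeral)
    qed
    finally have fin: "f n s \<le> (ennreal 3 * EA + ennreal (6 * L\<^sup>2 * H * (c\<^sup>2 * H)))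
      + (ennreal (6 * L\<^sup>2 * H) * (\<integral>\<^sup>+\<omega>. g n s \<omega> \<partial>M) + (ennreal (24 * L\<^sup>2 * (c\<^sup>2 * H)) + ennreal (24 * L\<^sup>2) * (\<integral>\<^sup>+\<omega>. g n s \<omega> \<partial>M)))"
      by (simp add: add_left_mono)
    have e1: "ennreal (K * (c\<^sup>2 * H)) = ennreal (6 * L\<^sup>2 * H * (c\<^sup>2 * H)) + ennreal (24 * L\<^sup>2 * (c\<^sup>2 * H))"
      using H by (subst ennreal_plus[symmetric]) (auto simp: K_def algebra_simps)
    have e2: "ennreal K * x = ennreal (6 * L\<^sup>2 * H) * x + ennreal (24 * L\<^sup>2) * x" for x
      using H unfolding K_def by (subst ennreal_plus) (auto simp: distrib_right)
    show ?thesis unfolding e1 e2 using fin[unfolded gE] by (simp only: add_ac)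
  qed
  \<comment> \<open>Gronwall's factor times a number that dominates both 3 and \<open>K * H\<close>;
    it does not depend on the level \<open>n\<close>.\<close>
  define C where "C = 2 * exp (2 * K * H) * (3 + K * H)"
  have C: "0 < C" using K H by (simp add: C_def add_pos_nonneg)
  have fn: "f n s \<le> ennreal C * (EA + ennreal (c\<^sup>2))" if s: "s \<in> {0..H}" for n s
  proof (cases "EA = \<infinity>")
    \<comment> \<open>With infinite \<open>EA\<close> the right-hand side is infinite, because
      \<open>C\<close> is positive.\<close>
    case True
    then show ?thesis using C by (simp add: ennreal_mult_top)
  next
    case False
    have fin: "ennreal 3 * EA + ennreal (K * (c\<^sup>2 * H)) < \<infinity>" using False by (simp add: ennreal_mult_less_top less_top)
    have "f n s \<le> ennreal (2 * exp (2 * K * H)) * (ennreal 3 * EA + ennreal (K * (c\<^sup>2 * H)))"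
    proof (rule gronwall_nn_integral[OF fm K _ _ main s])
      show "(ennreal 3 * EA + ennreal (K * (c\<^sup>2 * H))) + ennreal K * ennreal ((real n)\<^sup>2 * H) < \<infinity>"
        using fin by (simp add: ennreal_mult_less_top)
      fix t assume t: "t \<in> {0..H}"
      have "(\<integral>\<^sup>+\<omega>. g n t \<omega> \<partial>M) \<le> (\<integral>\<^sup>+\<omega>. ennreal ((real n)\<^sup>2 * H) \<partial>M)" using gn[OF t] by (intro nn_integral_mono) auto
      then have "(\<integral>\<^sup>+u\<in>{0..t}. f n u \<partial>lborel) \<le> ennreal ((real n)\<^sup>2 * H)" unfolding gE by (simp add: emeasure_space_1)
      then show "f n t \<le> (ennreal 3 * EA + ennreal (K * (c\<^sup>2 * H))) + ennreal K * ennreal ((real n)\<^sup>2 * H)"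
        using main[OF t] by (meson add_left_mono mult_left_mono order_trans zero_le)
    qed
    also have "ennreal 3 * EA + ennreal (K * (c\<^sup>2 * H)) \<le> ennreal (3 + K * H) * EA + ennreal (3 + K * H) * ennreal (c\<^sup>2)"
    proof (rule add_mono)
      show "ennreal 3 * EA \<le> ennreal (3 + K * H) * EA" using K H by (intro mult_right_mono ennreal_leI) auto
      show "ennreal (K * (c\<^sup>2 * H)) \<le> ennreal (3 + K * H) * ennreal (c\<^sup>2)"
        using K H by (subst ennreal_mult[symmetric]) (auto intro!: ennreal_leI simp: algebra_simps)
    qed
    also have "ennreal (2 * exp (2 * K * H)) * (ennreal (3 + K * H) * EA + ennreal (3 + K * H) * ennreal (c\<^sup>2))
       = ennreal C * (EA + ennreal (c\<^sup>2))"
    proof -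
      have "ennreal C = ennreal (2 * exp (2 * K * H)) * ennreal (3 + K * H)"
        unfolding C_def using K H by (intro ennreal_mult) auto
      then show ?thesis by (simp only: distrib_left mult.assoc)
    qed
    finally show ?thesis by (simp add: mult_left_mono)
  qed
  show thesis
  proof (rule that[of C])
    fix s assume s: "s \<in> {0..H}"
    have "(\<integral>\<^sup>+\<omega>. (if s \<le> \<rho>0 \<omega> then ennreal ((Z s \<omega>)\<^sup>2) else 0) \<partial>M) \<le> (\<integral>\<^sup>+\<omega>. liminf (\<lambda>n. \<Phi> n s \<omega>) \<partial>M)"
    proof (rule nn_integral_mono)
      fix \<omega> assume \<omega>: "\<omega> \<in> space M"
      obtain B where B: "0 \<le> B" "\<And>u. u \<in> {0..H} \<Longrightarrow> \<bar>Z u \<omega>\<bar> \<le> B" using cadlag_bounded[OF Zc[OF \<omega>]] by blast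
      \<comment> \<open>The path is bounded on \<open>{0..H}\<close>, so the localisation is
        inactive from level \<open>N\<close> on, and Fatou's lemma removes it.\<close>
      obtain N where N: "B \<le> real N" using real_arch_simple by blast
      have "\<tau> n \<omega> = H" if "N \<le> n" for n
      proof -
        have "Z u \<omega> \<in> {- real n..real n}" if "u \<in> {0..H}" for u using B(2)[OF that] N \<open>N \<le> n\<close> by auto
        then have "insert H {s \<in> {0..H}. Z s \<omega> \<notin> {- real n..real n}} = {H}" by auto
        then show ?thesis by (simp only: \<tau>_def exit_time_def cInf_singleton)
      qed
      then have "\<forall>\<^sub>F n in sequentially. \<Phi> n s \<omega> = (if s \<le> \<rho>0 \<omega> then ennreal ((Z s \<omega>)\<^sup>2) else 0)"
        using s by (intro eventually_sequentiallyI[of N]) (auto simp: \<Phi>_def \<rho>n_def cs_def)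
      then have "(\<lambda>n. \<Phi> n s \<omega>) \<longlonglongrightarrow> (if s \<le> \<rho>0 \<omega> then ennreal ((Z s \<omega>)\<^sup>2) else 0)" by (rule tendsto_eventually)
      then have "liminf (\<lambda>n. \<Phi> n s \<omega>) = (if s \<le> \<rho>0 \<omega> then ennreal ((Z s \<omega>)\<^sup>2) else 0)" by (intro lim_imp_Liminf) auto
      then show "(if s \<le> \<rho>0 \<omega> then ennreal ((Z s \<omega>)\<^sup>2) else 0) \<le> liminf (\<lambda>n. \<Phi> n s \<omega>)" by simp
    qed
    also have "\<dots> \<le> liminf (\<lambda>n. f n s)"
    proof -
      have "(\<lambda>n. f n s) = (\<lambda>n. \<integral>\<^sup>+\<omega>. \<Phi> n s \<omega> \<partial>M)" by (simp add: f_def \<Phi>_def)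
      then show ?thesis by (simp only:) (rule nn_integral_liminf, simp)
    qed
    also have "\<dots> \<le> ennreal C * (EA + ennreal (c\<^sup>2))"
      using fn[OF s] by (intro Liminf_le) auto
    finally show "(\<integral>\<^sup>+\<omega>. (if s \<le> \<rho>0 \<omega> then ennreal ((Z s \<omega>)\<^sup>2) else 0) \<partial>M) \<le> ennreal C * ((\<integral>\<^sup>+\<omega>. ennreal ((A \<omega>)\<^sup>2) \<partial>M) + ennreal (c\<^sup>2))"
      by (simp add: EA_def)
  qed (use C in simp)
qed

text \<open>In the difference the controls have cancelled, so \<open>square_moment_bound\<close>
  applies with \<open>A\<close> and \<open>c\<close> equal to 0 and gives a vanishing second moment
  at each time up to \<open>\<rho>0\<close>. This is collected over rational times and extended to
  all times along the paths.\<close>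

lemma sde_solutions_agree:
  fixes b \<sigma> :: "real \<Rightarrow> real" and \<rho>0 :: "'a \<Rightarrow> real"
  assumes L: "0 < L" "\<And>y z. \<bar>b y - b z\<bar> \<le> L * \<bar>y - z\<bar>" "\<And>y z. \<bar>\<sigma> y - \<sigma> z\<bar> \<le> L * \<bar>y - z\<bar>" and H: "0 \<le> H"
    and X: "adapted_upto F H X" "\<And>\<omega>. \<omega> \<in> space M \<Longrightarrow> cadlag_upto H (\<lambda>s. X s \<omega>)"
    and Y: "adapted_upto F H Y" "\<And>\<omega>. \<omega> \<in> space M \<Longrightarrow> cadlag_upto H (\<lambda>s. Y s \<omega>)"
    and I: "has_ito_integral M F W H (\<lambda>s \<omega>. \<sigma> (X s \<omega>)) I" and I': "has_ito_integral M F W H (\<lambda>s \<omega>. \<sigma> (Y s \<omega>)) I'"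
    and \<rho>: "\<And>u. u \<in> {0..H} \<Longrightarrow> {\<omega> \<in> space M. u \<le> \<rho>0 \<omega>} \<in> sets (F u)"
      "\<And>\<omega>. \<omega> \<in> space M \<Longrightarrow> \<rho>0 \<omega> \<in> {0..H}"
    and eq: "AE \<omega> in M. \<forall>s\<in>{0..H}. s \<le> \<rho>0 \<omega> \<longrightarrow>
       X s \<omega> - Y s \<omega> = (LINT u:{0..s}|lborel. b (X u \<omega>)) - (LINT u:{0..s}|lborel. b (Y u \<omega>)) + (I s \<omega> - I' s \<omega>)"
  shows "AE \<omega> in M. \<forall>s\<in>{0..H}. s \<le> \<rho>0 \<omega> \<longrightarrow> X s \<omega> = Y s \<omega>"
proof -
  have lipm: "f \<in> borel_measurable borel" if "\<And>y z. \<bar>f y - f z\<bar> \<le> L * \<bar>y - z\<bar>" for f :: "real \<Rightarrow> real"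
  proof -
    have "L-lipschitz_on UNIV f" using that L(1) by (intro lipschitz_onI) (auto simp: dist_real_def)
    then show ?thesis by (intro borel_measurable_continuous_onI lipschitz_on_continuous_on)
  qed
  have Xp: "progressive F H X" and Yp: "progressive F H Y"
    using progressive_cadlag[OF filtration_F X] progressive_cadlag[OF filtration_F Y] by auto
  define Z where "Z s \<omega> = X s \<omega> - Y s \<omega>" for s \<omega>
  define \<kappa> where "\<kappa> s \<omega> = \<sigma> (X s \<omega>) - \<sigma> (Y s \<omega>)" for s \<omega>
  define V where "V s \<omega> = I s \<omega> - I' s \<omega>" for s \<omega>
  have Kp: "progressive F H (\<lambda>s \<omega>. \<sigma> (X s \<omega>))" "progressive F H (\<lambda>s \<omega>. \<sigma> (Y s \<omega>))"
    using Xp Yp lipm[OF L(3)] by (auto intro: progressive_comp)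
  have k1: "progressive F H \<kappa>" unfolding \<kappa>_def[abs_def] using Kp by (rule progressive_comp2) measurable
  have k2: "ito_limit H \<kappa> V"
    unfolding \<kappa>_def[abs_def] V_def[abs_def]
    using has_ito_integral_imp_ito_limit[OF I] has_ito_integral_imp_ito_limit[OF I'] Kp by (rule ito_limit_diff)
  have k3: "adapted_upto F H V" "adapted_upto F H Z"
  proof -
    have "adapted_upto F H I" "adapted_upto F H I'" using I I' by (auto simp: has_ito_integral_def)
    then show "adapted_upto F H V" "adapted_upto F H Z"
      using X(1) Y(1) unfolding adapted_upto_def V_def[abs_def] Z_def[abs_def] by (simp_all add: borel_measurable_diff)
  qed
  have Zc: "cadlag_upto H (\<lambda>s. Z s \<omega>)" if \<omega>: "\<omega> \<in> space M" for \<omega>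
    using X(2)[OF \<omega>] Y(2)[OF \<omega>] unfolding Z_def by (rule cadlag_diff)
  have bi: "set_integrable lborel {0..H} (\<lambda>u. b (X u \<omega>))" "set_integrable lborel {0..H} (\<lambda>u. b (Y u \<omega>))"
      "\<exists>B. \<forall>u\<in>{0..H}. \<bar>b (X u \<omega>)\<bar> \<le> B" "\<exists>B. \<forall>u\<in>{0..H}. \<bar>b (Y u \<omega>)\<bar> \<le> B"
      "set_borel_measurable lborel {0..H} (\<lambda>u. Z u \<omega>)" if \<omega>: "\<omega> \<in> space M" for \<omega>
  proof -
    have *: "set_integrable lborel {0..H} (\<lambda>u. b (Q u \<omega>)) \<and> (\<exists>B. \<forall>u\<in>{0..H}. \<bar>b (Q u \<omega>)\<bar> \<le> B)"
      if Q: "progressive F H Q" "cadlag_upto H (\<lambda>s. Q s \<omega>)" for Q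
    proof -
      obtain B where B: "0 \<le> B" "\<And>u. u \<in> {0..H} \<Longrightarrow> \<bar>Q u \<omega>\<bar> \<le> B" using cadlag_bounded[OF Q(2)] by blast
      have bb: "\<bar>b (Q u \<omega>)\<bar> \<le> \<bar>b 0\<bar> + L * B" if "u \<in> {0..H}" for u
      proof -
        have "\<bar>b (Q u \<omega>) - b 0\<bar> \<le> L * B"
        proof -
          have "L * \<bar>Q u \<omega>\<bar> \<le> L * B" using B(2)[OF that] L(1) by (intro mult_left_mono) auto
          then show ?thesis using L(2)[of "Q u \<omega>" 0] unfolding diff_0_right by linarith
        qed
        then show ?thesis by linarith
      qed
      have "set_borel_measurable lborel {0..H} (\<lambda>u. b (Q u \<omega>))"
        using progressive_path(2)[OF progressive_comp[OF Q(1) lipm[OF L(2)]] H order_refl] \<omega> by (simp add: space_F)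
      then have "set_integrable lborel {0..H} (\<lambda>u. b (Q u \<omega>))" using bb by (rule set_integrable_bounded)
      then show ?thesis using bb by blast
    qed
    show "set_integrable lborel {0..H} (\<lambda>u. b (X u \<omega>))" "set_integrable lborel {0..H} (\<lambda>u. b (Y u \<omega>))"
      "\<exists>B. \<forall>u\<in>{0..H}. \<bar>b (X u \<omega>)\<bar> \<le> B" "\<exists>B. \<forall>u\<in>{0..H}. \<bar>b (Y u \<omega>)\<bar> \<le> B"
      using *[OF Xp X(2)[OF \<omega>]] *[OF Yp Y(2)[OF \<omega>]] by auto
    have "progressive F H Z" unfolding Z_def[abs_def] using Xp Yp by (rule progressive_comp2) measurable
    then show "set_borel_measurable lborel {0..H} (\<lambda>u. Z u \<omega>)"
      by (rule progressive_path(2)[OF _ H order_refl]) (simp add: space_F \<omega>)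
  qed
  have k4: "AE \<omega> in M. \<forall>s\<in>{0..H}. s \<le> \<rho>0 \<omega> \<longrightarrow>
        \<bar>Z s \<omega>\<bar> \<le> 0 + L * (LINT u:{0..s}|lborel. 0 + \<bar>Z u \<omega>\<bar>) + \<bar>V s \<omega>\<bar>"
    using eq AE_space
  proof eventually_elim
    fix \<omega> assume \<omega>: "\<omega> \<in> space M" and e: "\<forall>s\<in>{0..H}. s \<le> \<rho>0 \<omega> \<longrightarrow>
       X s \<omega> - Y s \<omega> = (LINT u:{0..s}|lborel. b (X u \<omega>)) - (LINT u:{0..s}|lborel. b (Y u \<omega>)) + (I s \<omega> - I' s \<omega>)"
    obtain B where B: "0 \<le> B" "\<And>u. u \<in> {0..H} \<Longrightarrow> \<bar>Z u \<omega>\<bar> \<le> B" using cadlag_bounded[OF Zc[OF \<omega>]] by blast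
    have Zi: "set_integrable lborel {0..H} (\<lambda>u. \<bar>Z u \<omega>\<bar>)"
      using set_integrable_bounded[OF bi(5)[OF \<omega>] B(2)] by (simp add: set_integrable_abs)
    show "\<forall>s\<in>{0..H}. s \<le> \<rho>0 \<omega> \<longrightarrow> \<bar>Z s \<omega>\<bar> \<le> 0 + L * (LINT u:{0..s}|lborel. 0 + \<bar>Z u \<omega>\<bar>) + \<bar>V s \<omega>\<bar>"
    proof (intro ballI impI)
      fix s assume s: "s \<in> {0..H}" "s \<le> \<rho>0 \<omega>"
      have sub: "set_integrable lborel {0..s} h" if "set_integrable lborel {0..H} h" for h :: "real \<Rightarrow> real"
        using s by (auto intro: set_integrable_subset[OF that])
      have "(LINT u:{0..s}|lborel. b (X u \<omega>)) - (LINT u:{0..s}|lborel. b (Y u \<omega>)) = (LINT u:{0..s}|lborel. b (X u \<omega>) - b (Y u \<omega>))"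
        using bi[OF \<omega>] by (intro set_integral_diff(2)[symmetric] sub) auto
      also have "\<bar>\<dots>\<bar> \<le> (LINT u:{0..s}|lborel. L * \<bar>Z u \<omega>\<bar>)"
        using bi[OF \<omega>] Zi L(2) by (intro set_integral_abs_le set_integral_diff(1) sub) (auto simp: Z_def)
      also have "\<dots> = L * (LINT u:{0..s}|lborel. \<bar>Z u \<omega>\<bar>)" by simp
      finally show "\<bar>Z s \<omega>\<bar> \<le> 0 + L * (LINT u:{0..s}|lborel. 0 + \<bar>Z u \<omega>\<bar>) + \<bar>V s \<omega>\<bar>"
        using e s by (simp add: Z_def V_def)
    qed
  qed
  have k5: "\<bar>\<kappa> u \<omega>\<bar> \<le> L * (0 + \<bar>Z u \<omega>\<bar>)" if "\<omega> \<in> space M" "u \<in> {0..H}" "u < \<rho>0 \<omega>" for u \<omega>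
    using L(3) by (simp add: \<kappa>_def Z_def)
  obtain C where C: "\<And>s. s \<in> {0..H} \<Longrightarrow> (\<integral>\<^sup>+\<omega>. (if s \<le> \<rho>0 \<omega> then ennreal ((Z s \<omega>)\<^sup>2) else 0) \<partial>M)
      \<le> ennreal C * ((\<integral>\<^sup>+\<omega>. ennreal (0\<^sup>2) \<partial>M) + ennreal (0\<^sup>2))"
    by (rule square_moment_bound[OF k2 k1 k3(1) k3(2) Zc \<rho> L(1) order_refl _ _ k4 k5 H]) auto
  have [measurable]: "\<rho>0 \<in> borel_measurable M" using random_time_measurable[OF \<rho>] .
  have AEs: "AE \<omega> in M. s \<le> \<rho>0 \<omega> \<longrightarrow> Z s \<omega> = 0" if s: "s \<in> {0..H}" for s
  proof -
    have [measurable]: "Z s \<in> borel_measurable M" using adaptedD[OF k3(2) s] measurable_F_M by blast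
    have "(\<integral>\<^sup>+\<omega>. (if s \<le> \<rho>0 \<omega> then ennreal ((Z s \<omega>)\<^sup>2) else 0) \<partial>M) = 0" using C[OF s] by simp
    then have "AE \<omega> in M. (if s \<le> \<rho>0 \<omega> then ennreal ((Z s \<omega>)\<^sup>2) else 0) = 0" by (subst (asm) nn_integral_0_iff_AE) auto
    then show ?thesis by eventually_elim (auto split: if_splits)
  qed
  have "AE \<omega> in M. \<forall>r::rat. real_of_rat r \<in> {0..H} \<longrightarrow> real_of_rat r \<le> \<rho>0 \<omega> \<longrightarrow> Z (real_of_rat r) \<omega> = 0"
    by (subst AE_all_countable) (use AEs in auto)
  then show ?thesis
    using eq AE_space
  proof eventually_elim
    fix \<omega> assume \<omega>: "\<omega> \<in> space M" and r: "\<forall>r::rat. real_of_rat r \<in> {0..H} \<longrightarrow> real_of_rat r \<le> \<rho>0 \<omega> \<longrightarrow> Z (real_of_rat r) \<omega> = 0"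
      and e: "\<forall>s\<in>{0..H}. s \<le> \<rho>0 \<omega> \<longrightarrow>
       X s \<omega> - Y s \<omega> = (LINT u:{0..s}|lborel. b (X u \<omega>)) - (LINT u:{0..s}|lborel. b (Y u \<omega>)) + (I s \<omega> - I' s \<omega>)"
    \<comment> \<open>\<open>X\<close> and \<open>Y\<close> may jump, but the right-hand side for
      their difference is continuous. It vanishes at rational times, and the zero is carried to
      \<open>s\<close> from the left, since only times up to \<open>\<rho>0 \<omega>\<close> are
      under control.\<close>
    define D where "D s = (LINT u:{0..s}|lborel. b (X u \<omega>)) - (LINT u:{0..s}|lborel. b (Y u \<omega>)) + (I s \<omega> - I' s \<omega>)" for s
    have "continuous_on {0..H} (\<lambda>s. I s \<omega>)" "continuous_on {0..H} (\<lambda>s. I' s \<omega>)"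
      using I I' \<omega> by (auto simp: has_ito_integral_def)
    moreover have "continuous_on {0..H} (\<lambda>s. LINT u:{0..s}|lborel. b (X u \<omega>))" "continuous_on {0..H} (\<lambda>s. LINT u:{0..s}|lborel. b (Y u \<omega>))"
      using bi[OF \<omega>] set_integral_continuous_on by blast+
    ultimately have Dc: "continuous_on {0..H} D" unfolding D_def by (intro continuous_intros)
    show "\<forall>s\<in>{0..H}. s \<le> \<rho>0 \<omega> \<longrightarrow> X s \<omega> = Y s \<omega>"
    proof (intro ballI impI)
      fix s assume s: "s \<in> {0..H}" "s \<le> \<rho>0 \<omega>"
      have rat: "D q = 0" if "q \<in> \<rat>" "q \<in> {0..s}" for q
        using that r e s by (auto simp: Rats_def D_def Z_def)
      have "D s = 0"
      proof (cases "s = 0")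
        case False
        have "(D \<longlongrightarrow> D s) (at s within {0..H})" using Dc s by (auto simp: continuous_on_def)
        then have "(D \<longlongrightarrow> D s) (at s within {0..s})" by (rule tendsto_within_subset) (use s in auto)
        then have lim: "(D \<longlongrightarrow> D s) (at_left s)" using s False by (simp add: at_within_Icc_at_left)
        show ?thesis
        proof (rule ccontr)
          assume "D s \<noteq> 0"
          then have "\<forall>\<^sub>F v in at_left s. D v \<noteq> 0" using lim by (rule tendsto_imp_eventually_ne[rotated])
          then obtain d where d: "d < s" "\<And>v. d < v \<Longrightarrow> v < s \<Longrightarrow> D v \<noteq> 0" by (auto simp: eventually_at_left_field)
          obtain q where "q \<in> \<rat>" "max 0 d < q" "q < s" using Rats_dense_in_real[of "max 0 d" s] d s False by auto
          then show False using d(2)[of q] rat[of q] by auto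
        qed
      qed (use rat[of 0] s in auto)
      moreover have "X s \<omega> - Y s \<omega> = D s" using e s unfolding D_def by blast
      ultimately show "X s \<omega> = Y s \<omega>" by simp
    qed
  qed
qed

end

section \<open>Total variation\<close>

lemma total_variation_le:
  assumes "\<And>n p. mono p \<Longrightarrow> p n \<le> s \<Longrightarrow> (\<Sum>i<n. \<bar>f (p (Suc i)) - f (p i)\<bar>) \<le> B"
  shows "total_variation f s \<le> B"
  unfolding total_variation_def
proof (rule cSUP_least)
  show "{(n::nat, p::nat \<Rightarrow> real). mono p \<and> p n \<le> s} \<noteq> {}"
    using monoI[of "\<lambda>_::nat. s"] by auto
qed (use assms in auto)

text \<open>\<open>V\<close> acts as a distribution function for the increments of \<open>f\<close>:
  the sum telescopes, and the value at the first point is dropped because it is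
  non-negative.\<close>

lemma variation_sum_le:
  fixes p :: "nat \<Rightarrow> real"
  assumes V: "\<And>u v. u \<le> v \<Longrightarrow> v \<le> s \<Longrightarrow> \<bar>f v - f u\<bar> \<le> V v - V u" and pos: "\<And>u. u \<le> s \<Longrightarrow> (0::real) \<le> V u"
    and p: "mono p" "p n \<le> s"
  shows "(\<Sum>i<n. \<bar>f (p (Suc i)) - f (p i)\<bar>) \<le> V s"
proof -
  have ps: "p i \<le> s" if "i \<le> n" for i using monoD[OF p(1) that] p(2) by simp
  have "(\<Sum>i<n. \<bar>f (p (Suc i)) - f (p i)\<bar>) \<le> (\<Sum>i<n. V (p (Suc i)) - V (p i))"
    using p(1) ps by (intro sum_mono V) (auto simp: mono_def)
  also have "\<dots> = V (p n) - V (p 0)" by (rule sum_lessThan_telescope)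
  also have "\<dots> \<le> V s" using pos[OF ps[of 0]] V[OF ps[of n] order_refl] by auto
  finally show ?thesis .
qed

text \<open>\<open>B\<close> serves to make the set of sums bounded above; otherwise the real
  supremum would carry no information.\<close>

lemma variation_sum_le_total_variation:
  assumes "\<And>n p. mono p \<Longrightarrow> p n \<le> s \<Longrightarrow> (\<Sum>i<n. \<bar>f (p (Suc i)) - f (p i)\<bar>) \<le> B" "mono p" "p n \<le> s"
  shows "(\<Sum>i<n. \<bar>f (p (Suc i)) - f (p i)\<bar>) \<le> total_variation f s"
  unfolding total_variation_def
  using assms by (intro cSUP_upper2[where x="(n, p)"]) (auto intro!: bdd_aboveI2[where M=B])

lemma jordan_decompositionD:
  assumes "jordan_decomposition H f fp fm"
  shows "\<And>s. s < 0 \<Longrightarrow> fp s = 0" "\<And>s. s < 0 \<Longrightarrow> fm s = 0"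
    "\<And>u v. u \<le> v \<Longrightarrow> v \<le> H \<Longrightarrow> fp u \<le> fp v" "\<And>u v. u \<le> v \<Longrightarrow> v \<le> H \<Longrightarrow> fm u \<le> fm v"
    "\<And>s. s \<le> H \<Longrightarrow> f s = fp s - fm s" "\<And>s. s \<le> H \<Longrightarrow> total_variation f s = fp s + fm s"
    "\<And>s. s \<le> H \<Longrightarrow> 0 \<le> fp s" "\<And>s. s \<le> H \<Longrightarrow> 0 \<le> fm s"
proof -
  show z: "\<And>s. s < 0 \<Longrightarrow> fp s = 0" "\<And>s. s < 0 \<Longrightarrow> fm s = 0"
    and m: "\<And>u v. u \<le> v \<Longrightarrow> v \<le> H \<Longrightarrow> fp u \<le> fp v" "\<And>u v. u \<le> v \<Longrightarrow> v \<le> H \<Longrightarrow> fm u \<le> fm v"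
    and "\<And>s. s \<le> H \<Longrightarrow> f s = fp s - fm s" "\<And>s. s \<le> H \<Longrightarrow> total_variation f s = fp s + fm s"
    using assms by (auto simp: jordan_decomposition_def monotone_on_def)
  show "\<And>s. s \<le> H \<Longrightarrow> 0 \<le> fp s" "\<And>s. s \<le> H \<Longrightarrow> 0 \<le> fm s"
    using z[of "min s (-1)" for s] m[of "min s (-1)" s for s] by (metis min.cobounded1 min.cobounded2 neg_less_0_iff_less order_le_less_trans zero_less_one)+
qed

text \<open>
  On a grid that is fine for \<open>\<phi>\<close> and almost realizes the variation of \<open>f\<close>, the increments of
  \<open>g\<close> are \<open>\<phi>\<close> times those of \<open>f\<close> up to a small relative error, and cancellation between the two
  monotone parts of \<open>f\<close> is negligible.
\<close>

lemma jordan_decomposition_weighted: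
  fixes L :: real
  assumes J: "jordan_decomposition H f fp fm"
    and \<phi>: "\<And>v. v \<le> H \<Longrightarrow> 0 \<le> \<phi> v" "\<And>v. v \<le> H \<Longrightarrow> \<phi> v \<le> 1"
      "\<And>u v. u \<le> v \<Longrightarrow> v \<le> H \<Longrightarrow> \<phi> v \<le> \<phi> u" "\<And>u v. u \<le> v \<Longrightarrow> v \<le> H \<Longrightarrow> \<phi> u - \<phi> v \<le> L * (v - u)"
    and L: "0 \<le> L"
    and neg: "\<And>s. s < 0 \<Longrightarrow> gp s = 0" "\<And>s. s < 0 \<Longrightarrow> gm s = 0"
    and gp: "\<And>u v. u \<le> v \<Longrightarrow> v \<le> H \<Longrightarrow> \<phi> v * (fp v - fp u) \<le> gp v - gp u" "\<And>u v. u \<le> v \<Longrightarrow> v \<le> H \<Longrightarrow> gp v - gp u \<le> \<phi> u * (fp v - fp u)"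
    and gm: "\<And>u v. u \<le> v \<Longrightarrow> v \<le> H \<Longrightarrow> \<phi> v * (fm v - fm u) \<le> gm v - gm u" "\<And>u v. u \<le> v \<Longrightarrow> v \<le> H \<Longrightarrow> gm v - gm u \<le> \<phi> u * (fm v - fm u)"
  shows "jordan_decomposition H (\<lambda>s. gp s - gm s) gp gm"
proof -
  note JD = jordan_decompositionD[OF J]
  define V where "V s = fp s + fm s" for s
  define G where "G s = gp s + gm s" for s
  define g where "g s = gp s - gm s" for s
  have gpm: "gp u \<le> gp v" "gm u \<le> gm v" if "u \<le> v" "v \<le> H" for u v
    using gp(1)[OF that] gm(1)[OF that] mult_nonneg_nonneg[OF \<phi>(1)[OF that(2)], of "fp v - fp u"]
      mult_nonneg_nonneg[OF \<phi>(1)[OF that(2)], of "fm v - fm u"] JD(3,4)[OF that] by auto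
  have G0: "0 \<le> G u" if "u \<le> H" for u
  proof -
    have "gp (min u (-1)) = 0" "gm (min u (-1)) = 0" using neg by auto
    then show ?thesis using gpm[of "min u (-1)" u] that by (simp add: G_def)
  qed
  have V0: "0 \<le> V u" if "u \<le> H" for u using JD(7,8)[OF that] by (simp add: V_def)
  have gG: "\<bar>g v - g u\<bar> \<le> G v - G u" if "u \<le> v" "v \<le> H" for u v using gpm[OF that] by (auto simp: g_def G_def)
  have fV: "\<bar>f v - f u\<bar> \<le> V v - V u" if "u \<le> v" "v \<le> H" for u v
    using JD(3,4)[OF that] JD(5)[of u] JD(5)[of v] that by (auto simp: V_def)
  have "total_variation g s = G s" if s: "s \<le> H" for s
  proof (rule antisym)
    have gb: "(\<Sum>i<n. \<bar>g (p (Suc i)) - g (p i)\<bar>) \<le> G s" if "mono p" "p n \<le> s" for n and p :: "nat \<Rightarrow> real"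
      by (rule variation_sum_le[where V=G]) (use that gG G0 s in auto)
    show "total_variation g s \<le> G s" using gb by (rule total_variation_le)
    show "G s \<le> total_variation g s"
    proof (cases "s < 0")
      case True
      \<comment> \<open>The empty sum gives 0 as a lower bound for the variation before time
        0.\<close>
      have "(\<Sum>i<0::nat. \<bar>g ((\<lambda>_. s) (Suc i)) - g ((\<lambda>_. s) i)\<bar>) \<le> total_variation g s"
        by (rule variation_sum_le_total_variation[OF gb]) (auto simp: mono_def)
      then show ?thesis using neg True by (simp add: G_def)
    next
      case False
      show ?thesis
      proof (rule field_le_epsilon)
        fix e :: real assume e: "0 < e"
        define Vs where "Vs = V s"
        have Vs: "0 \<le> Vs" using V0[OF s] by (simp add: Vs_def)
        have fb: "(\<Sum>i<n. \<bar>f (p (Suc i)) - f (p i)\<bar>) \<le> V s" if "mono p" "p n \<le> s" for n and p :: "nat \<Rightarrow> real"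
          by (rule variation_sum_le[where V=V]) (use that fV V0 s in auto)
        have "\<exists>n p. mono p \<and> p n \<le> s \<and> Vs - e / 2 < (\<Sum>i<n. \<bar>f (p (Suc i)) - f (p i)\<bar>)"
        proof (rule ccontr)
          assume "\<not> ?thesis"
          then have "total_variation f s \<le> Vs - e / 2" by (intro total_variation_le) (auto simp: not_less)
          then show False using JD(6)[OF s] e by (simp add: Vs_def V_def)
        qed
        then obtain n p where p: "mono p" "p n \<le> s" "Vs - e / 2 < (\<Sum>i<n. \<bar>f (p (Suc i)) - f (p i)\<bar>)" by blast
        \<comment> \<open>\<open>f\<close> vanishes before time 0, so partition points below -1 may
          be moved to -1. All points then lie in the interval \<open>{-1..s}\<close> of the grid,
          which starts before 0 in order to see the jump at 0.\<close>
        define p' where "p' i = max (p i) (-1)" for i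
        have p's: "p' i \<in> {-1..s}" if "i \<le> n" for i
          using monoD[OF p(1) that] p(2) False by (auto simp: p'_def)
        have fp': "f (p' i) = f (p i)" if "i \<le> n" for i
          using JD(1,2)[of "p i"] JD(1,2)[of "-1"] JD(5)[of "p i"] JD(5)[of "-1"] monoD[OF p(1) that] p(2) s False
          by (auto simp: p'_def max_def)
        \<comment> \<open>Chosen to make \<open>L * \<epsilon> * Vs \<le> e / 2\<close>; the added
          ones keep the denominator positive.\<close>
        define \<epsilon> where "\<epsilon> = e / (2 * (L + 1) * (Vs + 1))"
        have \<epsilon>: "0 < \<epsilon>" using e L Vs by (simp add: \<epsilon>_def)
        obtain N q where gr: "grid (p' ` {..n}) \<epsilon> (-1) s N q" using grid_exists[of "p' ` {..n}" \<epsilon> "-1" s] \<epsilon> False by auto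
        have q: "q 0 = -1" "q N = s" and qlt: "\<And>i. i < N \<Longrightarrow> q i < q (Suc i)" and qe: "\<And>i. i < N \<Longrightarrow> q (Suc i) - q i \<le> \<epsilon>"
          using gr by (auto simp: grid_def)
        have qs: "q i \<le> s" if "i \<le> N" for i using grid_mono[OF gr that order_refl] q by simp
        have qstrict: "q i < q j" if "i < j" "j \<le> N" for i j
          using qlt[of i] grid_mono[OF gr, of "Suc i" j] that by auto
        have "\<exists>k\<le>N. q k = p' i" if "i \<le> n" for i
        proof -
          have "p' i \<in> p' ` {..n} \<inter> {-1..s}" using p's[OF that] that by auto
          then have "p' i \<in> q ` {..N}" using gr unfolding grid_def by blast
          then show ?thesis by (metis imageE atMost_iff)
        qed
        then obtain a where a: "\<And>i. i \<le> n \<Longrightarrow> a i \<le> N" "\<And>i. i \<le> n \<Longrightarrow> q (a i) = p' i" by metis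
        define T where "T m = (\<Sum>j<m. \<bar>f (q (Suc j)) - f (q j)\<bar>)" for m
        have T: "\<bar>f (q j) - f (q i)\<bar> \<le> T j - T i" if "i \<le> j" for i j
          using that by (induction j rule: dec_induct) (auto simp: T_def)
        have am: "a i \<le> a (Suc i)" if "Suc i \<le> n" for i
        proof (rule ccontr)
          assume "\<not> a i \<le> a (Suc i)"
          then have "q (a (Suc i)) < q (a i)" using a that by (intro qstrict) auto
          then have "p' (Suc i) < p' i" using a that by simp
          moreover have "p i \<le> p (Suc i)" using p(1) by (simp add: mono_def)
          ultimately show False by (auto simp: p'_def)
        qed
        have "(\<Sum>i<n. \<bar>f (p (Suc i)) - f (p i)\<bar>) \<le> (\<Sum>i<n. T (a (Suc i)) - T (a i))"
        proof (rule sum_mono)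
          fix i assume i: "i \<in> {..<n}"
          then have "f (p (Suc i)) = f (q (a (Suc i)))" "f (p i) = f (q (a i))" using fp' a by auto
          then show "\<bar>f (p (Suc i)) - f (p i)\<bar> \<le> T (a (Suc i)) - T (a i)" using T[OF am[of i]] i by simp
        qed
        also have "\<dots> = T (a n) - T (a 0)" by (rule sum_lessThan_telescope)
        also have "\<dots> \<le> T N" using T[of "a n" N] T[of 0 "a 0"] a[of n] by (auto simp: T_def)
        finally have TN: "Vs - e / 2 < T N" using p(3) by simp
        \<comment> \<open>On a cell \<open>x + y - |x - y|\<close> is the cancellation between the
          two parts of \<open>f\<close>. The cancellation of the weighted increments is at most
          \<open>\<phi> u \<le> 1\<close> times it plus the error from the variation of
          \<open>\<phi>\<close>. Summed over the grid, the right-hand side is below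
          \<open>e\<close>.\<close>
        have inc: "(G (q (Suc j)) - G (q j)) - \<bar>g (q (Suc j)) - g (q j)\<bar>
            \<le> (1 + L * \<epsilon>) * (V (q (Suc j)) - V (q j)) - \<bar>f (q (Suc j)) - f (q j)\<bar>" if j: "j < N" for j
        proof -
          define u v where "u = q j" and "v = q (Suc j)"
          have uv: "u \<le> v" "v \<le> H" "u \<le> H" using qlt[OF j] qs[of "Suc j"] j s by (auto simp: u_def v_def)
          define x y where "x = fp v - fp u" and "y = fm v - fm u"
          have xy: "0 \<le> x" "0 \<le> y" using JD(3,4)[OF uv(1,2)] by (auto simp: x_def y_def)
          have fxy: "f v - f u = x - y" "V v - V u = x + y" using JD(5)[OF uv(2)] JD(5)[OF uv(3)] by (auto simp: x_def y_def V_def)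
          define d where "d = \<phi> u - \<phi> v"
          have d: "0 \<le> d" "d \<le> L * \<epsilon>"
          proof -
            show "0 \<le> d" using \<phi>(3)[OF uv(1,2)] by (simp add: d_def)
            have "L * (v - u) \<le> L * \<epsilon>" using qe[OF j] L by (intro mult_left_mono) (auto simp: u_def v_def)
            then show "d \<le> L * \<epsilon>" using \<phi>(4)[OF uv(1,2)] by (simp add: d_def)
          qed
          define X Y where "X = gp v - gp u" and "Y = gm v - gm u"
          have X: "\<phi> u * x - d * x \<le> X" "X \<le> \<phi> u * x" and Y: "\<phi> u * y - d * y \<le> Y" "Y \<le> \<phi> u * y"
            using gp[OF uv(1,2)] gm[OF uv(1,2)] by (auto simp: X_def Y_def x_def y_def d_def algebra_simps)
          have dx: "0 \<le> d * x" "0 \<le> d * y" "d * x + d * y \<le> L * \<epsilon> * (x + y)"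
            using d xy mult_right_mono[OF d(2), of "x + y"] by (auto simp: distrib_left)
          have "\<phi> u * \<bar>x - y\<bar> = \<bar>\<phi> u * x - \<phi> u * y\<bar>" using \<phi>(1)[OF uv(3)] by (simp add: abs_mult right_diff_distrib[symmetric])
          moreover have "\<bar>\<phi> u * x - \<phi> u * y\<bar> \<le> \<bar>X - Y\<bar> + (d * x + d * y)" using X Y dx by linarith
          moreover have "\<phi> u * (x + y - \<bar>x - y\<bar>) \<le> 1 * (x + y - \<bar>x - y\<bar>)" using \<phi>(2)[OF uv(3)] xy by (intro mult_right_mono) auto
          ultimately have "X + Y - \<bar>X - Y\<bar> \<le> (x + y) + L * \<epsilon> * (x + y) - \<bar>x - y\<bar>"
            using X(2) Y(2) dx(3) by (simp add: algebra_simps)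
          moreover have "G v - G u = X + Y" "g v - g u = X - Y" by (auto simp: G_def g_def X_def Y_def)
          ultimately show ?thesis unfolding u_def[symmetric] v_def[symmetric] fxy by (simp add: algebra_simps)
        qed
        have "(\<Sum>j<N. (G (q (Suc j)) - G (q j)) - \<bar>g (q (Suc j)) - g (q j)\<bar>)
          \<le> (\<Sum>j<N. (1 + L * \<epsilon>) * (V (q (Suc j)) - V (q j)) - \<bar>f (q (Suc j)) - f (q j)\<bar>)"
          using inc by (intro sum_mono) auto
        then have "(\<Sum>j<N. G (q (Suc j)) - G (q j)) - (\<Sum>j<N. \<bar>g (q (Suc j)) - g (q j)\<bar>)
          \<le> (1 + L * \<epsilon>) * (\<Sum>j<N. V (q (Suc j)) - V (q j)) - T N"
          by (simp only: sum_subtractf[symmetric] sum_distrib_left T_def)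
        moreover have "(\<Sum>j<N. G (q (Suc j)) - G (q j)) = G s - G (-1)" "(\<Sum>j<N. V (q (Suc j)) - V (q j)) = Vs - V (-1)"
          using sum_lessThan_telescope[of "\<lambda>j. G (q j)" N] sum_lessThan_telescope[of "\<lambda>j. V (q j)" N] q by (simp_all add: Vs_def)
        ultimately have "(G s - G (-1)) - (\<Sum>j<N. \<bar>g (q (Suc j)) - g (q j)\<bar>) \<le> (1 + L * \<epsilon>) * (Vs - V (-1)) - T N"
          by (simp only:)
        moreover have "G (-1) = 0" "V (-1) = 0" using neg JD(1,2) by (auto simp: G_def V_def)
        moreover have "L * \<epsilon> * Vs \<le> e / 2"
        proof -
          have "L * Vs \<le> (L + 1) * (Vs + 1)" using L Vs by (intro mult_mono) auto
          then have "L * Vs * e \<le> (L + 1) * (Vs + 1) * e" using e by (intro mult_right_mono) auto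
          moreover have "0 < (L + 1) * (Vs + 1)" using L Vs by (intro mult_pos_pos) auto
          ultimately have "(L * Vs * e) / ((L + 1) * (Vs + 1)) \<le> e" by (simp add: pos_divide_le_eq mult.commute)
          moreover have "L * \<epsilon> * Vs = (L * Vs * e) / ((L + 1) * (Vs + 1)) / 2"
            unfolding \<epsilon>_def by (simp only: times_divide_eq_left times_divide_eq_right divide_divide_eq_left mult_ac)
          ultimately show ?thesis by simp
        qed
        moreover have "(\<Sum>j<N. \<bar>g (q (Suc j)) - g (q j)\<bar>) \<le> total_variation g s"
        proof -
          \<comment> \<open>\<open>total_variation\<close> ranges over infinite monotone sequences,
            so the grid is continued by its last point.\<close>
          have "mono (\<lambda>i. q (min i N))"
            by (rule monoI) (rule grid_mono[OF gr], auto simp: min_def)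
          then have "(\<Sum>j<N. \<bar>g (q (min (Suc j) N)) - g (q (min j N))\<bar>) \<le> total_variation g s"
            using q by (intro variation_sum_le_total_variation[OF gb]) auto
          moreover have "(\<Sum>j<N. \<bar>g (q (min (Suc j) N)) - g (q (min j N))\<bar>) = (\<Sum>j<N. \<bar>g (q (Suc j)) - g (q j)\<bar>)"
            by (intro sum.cong) (auto simp: min_absorb1)
          ultimately show ?thesis by (simp only:)
        qed
        ultimately show "G s \<le> total_variation g s + e" using TN by (simp add: algebra_simps)
      qed
    qed
  qed
  then show ?thesis
    using neg gpm by (auto simp: jordan_decomposition_def g_def[abs_def] G_def monotone_on_def)
qed

text \<open>Stieltjes integration by parts: \<open>exp (- r * s)\<close> is
  \<open>exp (- r * \<theta>)\<close> plus an integral from \<open>s\<close> to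
  \<open>\<theta>\<close>, and the two integrations are exchanged. On the right the variation enters
  only through its values, so for \<alpha> \<ge> 0 a pointwise smaller variation gives a smaller
  cost.\<close>

lemma variation_measure_integral_exp:
  fixes V :: "real \<Rightarrow> real"
  assumes V: "\<And>s. s \<le> H \<Longrightarrow> total_variation f s = V s" "\<And>s. s < 0 \<Longrightarrow> V s = 0" "\<And>u v. u \<le> v \<Longrightarrow> v \<le> H \<Longrightarrow> V u \<le> V v"
    and rc: "\<And>s. s \<in> {0..<H} \<Longrightarrow> (V \<longlongrightarrow> V s) (at_right s)"
    and \<theta>: "0 \<le> \<theta>" "\<theta> \<le> H" and r: "0 \<le> r"
  shows "(LINT s:{0..\<theta>}|variation_measure H f. exp (- r * s) * \<alpha>)
     = \<alpha> * (exp (- r * \<theta>) * V \<theta> + r * (LINT s:{0..\<theta>}|lborel. exp (- r * s) * V s))"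
proof -
  define U where "U s = V (min s H)" for s
  have U: "variation_measure H f = interval_measure U"
    unfolding variation_measure_def U_def by (simp add: V(1))
  have mono: "U u \<le> U v" if "u \<le> v" for u v using that unfolding U_def by (intro V) auto
  have U0: "U s = 0" if "s < 0" for s using that \<theta> by (simp add: U_def min_def V(2))
  have Upos: "0 \<le> U s" for s using mono[of "min s (-1)" s] U0[of "min s (-1)"] by simp
  have right: "continuous (at_right a) U" for a
  proof -
    consider "a < 0" | "a \<in> {0..<H}" | "H \<le> a" by force
    then have "(U \<longlongrightarrow> U a) (at_right a)"
    proof cases
      case 1
      have "\<forall>\<^sub>F s in at_right a. U s = U a"
        using 1 U0 by (auto simp: eventually_at_right_field intro!: exI[of _ 0])
      then show ?thesis by (rule tendsto_eventually)
    next
      case 2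
      have "\<forall>\<^sub>F s in at_right a. V s = U s"
        using 2 by (auto simp: eventually_at_right_field U_def intro!: exI[of _ H])
      then show ?thesis using rc[OF 2] 2 by (subst (asm) tendsto_cong) (auto simp: U_def)
    next
      case 3
      then have "\<forall>\<^sub>F s in at_right a. U s = U a"
        by (auto simp: eventually_at_right_field U_def min_absorb2 intro!: exI[of _ "a + 1"])
      then show ?thesis by (rule tendsto_eventually)
    qed
    then show ?thesis by (simp add: continuous_within)
  qed
  define \<mu> where "\<mu> = interval_measure U"
  interpret \<mu>: sigma_finite_measure \<mu> unfolding \<mu>_def by (rule sigma_finite_interval_measure[OF mono right])
  have [measurable_cong, simp]: "sets \<mu> = sets borel" by (simp add: \<mu>_def)
  have Ioc: "emeasure \<mu> {a<..b} = ennreal (U b - U a)" if "a \<le> b" for a b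
    unfolding \<mu>_def by (rule emeasure_interval_measure_Ioc[OF that mono right])
  \<comment> \<open>Leads from half-open intervals, whose measure is known, to
    \<open>{0..u}\<close>, so that the atom of size \<open>V 0\<close> at time 0 is counted.\<close>
  have null: "emeasure \<mu> {-1<..<0} = 0"
  proof -
    have "{-1<..<0::real} \<subseteq> (\<Union>n::nat. {-1<..- 1 / real (Suc n)})"
    proof
      fix x :: real assume x: "x \<in> {-1<..<0}"
      obtain n where "1 / real (Suc n) < - x" using reals_Archimedean[of "- x"] x by (auto simp: inverse_eq_divide)
      then show "x \<in> (\<Union>n::nat. {-1<..- 1 / real (Suc n)})" using x by (intro UN_I[of n]) auto
    qed
    moreover have "(\<Union>n::nat. {-1<..- 1 / real (Suc n)}) \<in> null_sets \<mu>"
    proof (rule null_sets_UN)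
      fix n :: nat
      have "emeasure \<mu> {-1<..- 1 / real (Suc n)} = ennreal (U (- 1 / real (Suc n)) - U (-1))" by (rule Ioc) simp
      also have "\<dots> = 0" by (subst U0, simp)+ simp
      finally show "{-1<..- 1 / real (Suc n)} \<in> null_sets \<mu>" by (simp add: null_sets_def)
    qed
    ultimately have "{-1<..<0} \<in> null_sets \<mu>" by (rule null_sets_subset[rotated 2]) simp
    then show ?thesis by auto
  qed
  have Icc: "emeasure \<mu> {0..u} = ennreal (U u)" if u: "0 \<le> u" for u
  proof -
    have "{-1<..u} = {-1<..<0} \<union> {0..u}" using u by auto
    then have "emeasure \<mu> {-1<..u} = emeasure \<mu> {-1<..<0} + emeasure \<mu> {0..u}"
      by (simp only:) (rule plus_emeasure[symmetric], auto)
    then show ?thesis using null Ioc[of "-1" u] u U0[of "-1"] by simp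
  qed
  have Um[measurable]: "U \<in> borel_measurable borel" using mono by (intro borel_measurable_mono monoI)
  define w where "w s = (if s \<le> \<theta> \<and> 0 \<le> s then ennreal (exp (- r * s)) else 0)" for s
  have split: "ennreal (exp (- r * s)) = ennreal (exp (- r * \<theta>)) + (\<integral>\<^sup>+u. ennreal (r * exp (- r * u)) * indicator {s..\<theta>} u \<partial>lborel)"
    if "s \<in> {0..\<theta>}" for s
  proof -
    have "(\<integral>\<^sup>+u. ennreal (r * exp (- r * u)) * indicator {s..\<theta>} u \<partial>lborel) = ennreal ((- exp (- r * \<theta>)) - (- exp (- r * s)))"
      using that r by (intro nn_integral_FTC_Icc) (auto intro!: derivative_eq_intros)
    moreover have "exp (- r * \<theta>) \<le> exp (- r * s)" using that r by (simp add: mult_left_mono)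
    ultimately show ?thesis by (subst (asm) minus_diff_minus) (simp add: ennreal_plus[symmetric] del: ennreal_plus)
  qed
  have "(\<integral>\<^sup>+s. ennreal (exp (- r * s)) * indicator {0..\<theta>} s \<partial>\<mu>)
     = (\<integral>\<^sup>+s. ennreal (exp (- r * \<theta>)) * indicator {0..\<theta>} s
        + (\<integral>\<^sup>+u. ennreal (r * exp (- r * u)) * (indicator {s..\<theta>} u * indicator {0..\<theta>} s) \<partial>lborel) \<partial>\<mu>)"
  proof (intro nn_integral_cong)
    fix s
    show "ennreal (exp (- r * s)) * indicator {0..\<theta>} s = ennreal (exp (- r * \<theta>)) * indicator {0..\<theta>} s
        + (\<integral>\<^sup>+u. ennreal (r * exp (- r * u)) * (indicator {s..\<theta>} u * indicator {0..\<theta>} s) \<partial>lborel)"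
      using split[of s] by (cases "s \<in> {0..\<theta>}") auto
  qed
  also have "\<dots> = ennreal (exp (- r * \<theta>)) * ennreal (U \<theta>)
      + (\<integral>\<^sup>+s. (\<integral>\<^sup>+u. ennreal (r * exp (- r * u)) * (indicator {s..\<theta>} u * indicator {0..\<theta>} s) \<partial>lborel) \<partial>\<mu>)"
  proof -
    have m: "(\<lambda>x. ennreal (r * exp (- r * snd x)) * (indicator {fst x..\<theta>} (snd x) * indicator {0..\<theta>} (fst x))) \<in> borel_measurable (\<mu> \<Otimes>\<^sub>M lborel)"
    proof -
      have eq: "indicator {fst x..\<theta>} (snd x) * indicator {0..\<theta>} (fst x) = (if fst x \<le> snd x \<and> snd x \<le> \<theta> \<and> 0 \<le> fst x then 1 else 0::ennreal)" for x :: "real \<times> real"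
        by (auto simp: indicator_def)
      show ?thesis unfolding eq by measurable
    qed
    have "(\<lambda>s. \<integral>\<^sup>+u. ennreal (r * exp (- r * u)) * (indicator {s..\<theta>} u * indicator {0..\<theta>} s) \<partial>lborel) \<in> borel_measurable \<mu>"
      by (rule lborel.borel_measurable_nn_integral) (use m in \<open>simp add: case_prod_beta\<close>)
    then show ?thesis using \<theta> by (subst nn_integral_add) (auto simp: nn_integral_cmult_indicator Icc)
  qed
  also have "(\<integral>\<^sup>+s. (\<integral>\<^sup>+u. ennreal (r * exp (- r * u)) * (indicator {s..\<theta>} u * indicator {0..\<theta>} s) \<partial>lborel) \<partial>\<mu>)
     = (\<integral>\<^sup>+u. (\<integral>\<^sup>+s. ennreal (r * exp (- r * u)) * (indicator {s..\<theta>} u * indicator {0..\<theta>} s) \<partial>\<mu>) \<partial>lborel)"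
  proof -
    interpret P: pair_sigma_finite \<mu> lborel by standard
    have eq: "indicator {fst x..\<theta>} (snd x) * indicator {0..\<theta>} (fst x) = (if fst x \<le> snd x \<and> snd x \<le> \<theta> \<and> 0 \<le> fst x then 1 else 0::ennreal)" for x :: "real \<times> real"
      by (auto simp: indicator_def)
    have "(\<lambda>x. ennreal (r * exp (- r * snd x)) * (indicator {fst x..\<theta>} (snd x) * indicator {0..\<theta>} (fst x))) \<in> borel_measurable (\<mu> \<Otimes>\<^sub>M lborel)"
      unfolding eq by measurable
    then show ?thesis
      using P.Fubini'[of "\<lambda>s u. ennreal (r * exp (- r * u)) * (indicator {s..\<theta>} u * indicator {0..\<theta>} s)"]
      by (simp add: case_prod_beta)
  qed
  also have "\<dots> = (\<integral>\<^sup>+u. ennreal (r * (exp (- r * u) * U u)) * indicator {0..\<theta>} u \<partial>lborel)"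
  proof (intro nn_integral_cong)
    fix u
    have "(\<integral>\<^sup>+s. ennreal (r * exp (- r * u)) * (indicator {s..\<theta>} u * indicator {0..\<theta>} s) \<partial>\<mu>)
       = (\<integral>\<^sup>+s. (ennreal (r * exp (- r * u)) * indicator {0..\<theta>} u) * indicator {0..u} s \<partial>\<mu>)"
      by (intro nn_integral_cong) (auto simp: indicator_def)
    also have "\<dots> = (ennreal (r * exp (- r * u)) * indicator {0..\<theta>} u) * emeasure \<mu> {0..u}"
      by (rule nn_integral_cmult_indicator) simp
    also have "\<dots> = ennreal (r * (exp (- r * u) * U u)) * indicator {0..\<theta>} u"
      using r Icc[of u] Upos[of u] by (auto simp: indicator_def ennreal_mult mult.assoc)
    finally show "(\<integral>\<^sup>+s. ennreal (r * exp (- r * u)) * (indicator {s..\<theta>} u * indicator {0..\<theta>} s) \<partial>\<mu>)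
       = ennreal (r * (exp (- r * u) * U u)) * indicator {0..\<theta>} u" .
  qed
  also have "\<dots> = ennreal (LINT u:{0..\<theta>}|lborel. r * (exp (- r * u) * U u))"
  proof -
    have i: "set_integrable lborel {0..\<theta>} (\<lambda>u. r * (exp (- r * u) * U u))"
    proof (rule set_integrable_bounded)
      show "set_borel_measurable lborel {0..\<theta>} (\<lambda>u. r * (exp (- r * u) * U u))"
        unfolding set_borel_measurable_def by measurable
      fix u assume u: "u \<in> {0..\<theta>}"
      have "exp (- r * u) \<le> 1" using u r by simp
      then have "exp (- r * u) * U u \<le> 1 * U \<theta>" using u Upos mono by (intro mult_mono) auto
      then show "\<bar>r * (exp (- r * u) * U u)\<bar> \<le> r * U \<theta>" using r Upos[of u] by (simp add: abs_mult mult_left_mono)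
    qed
    then have "(\<integral>\<^sup>+u. ennreal (indicator {0..\<theta>} u *\<^sub>R (r * (exp (- r * u) * U u))) \<partial>lborel) = ennreal (LINT u:{0..\<theta>}|lborel. r * (exp (- r * u) * U u))"
      unfolding set_integrable_def set_lebesgue_integral_def using r Upos by (intro nn_integral_eq_integral) auto
    moreover have "ennreal (indicator {0..\<theta>} u *\<^sub>R (r * (exp (- r * u) * U u))) = ennreal (r * (exp (- r * u) * U u)) * indicator {0..\<theta>} u" for u
      by (auto simp: indicator_def)
    ultimately show ?thesis by simp
  qed
  also have "ennreal (exp (- r * \<theta>)) * ennreal (U \<theta>) + ennreal (LINT u:{0..\<theta>}|lborel. r * (exp (- r * u) * U u))
      = ennreal (exp (- r * \<theta>) * U \<theta> + r * (LINT u:{0..\<theta>}|lborel. exp (- r * u) * U u))"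
  proof -
    have "0 \<le> (LINT u:{0..\<theta>}|lborel. exp (- r * u) * U u)"
      unfolding set_lebesgue_integral_def using Upos by (intro Bochner_Integration.integral_nonneg) auto
    then show ?thesis using r Upos[of \<theta>] by (simp add: ennreal_mult[symmetric] ennreal_plus[symmetric] del: ennreal_plus)
  qed
  finally have nn: "(\<integral>\<^sup>+s. ennreal (exp (- r * s)) * indicator {0..\<theta>} s \<partial>\<mu>) = ennreal (exp (- r * \<theta>) * U \<theta> + r * (LINT u:{0..\<theta>}|lborel. exp (- r * u) * U u))" .
  have "(LINT s:{0..\<theta>}|\<mu>. exp (- r * s)) = enn2real (\<integral>\<^sup>+s. ennreal (indicator {0..\<theta>} s *\<^sub>R exp (- r * s)) \<partial>\<mu>)"
    unfolding set_lebesgue_integral_def by (rule integral_eq_nn_integral) auto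
  also have "(\<integral>\<^sup>+s. ennreal (indicator {0..\<theta>} s *\<^sub>R exp (- r * s)) \<partial>\<mu>) = (\<integral>\<^sup>+s. ennreal (exp (- r * s)) * indicator {0..\<theta>} s \<partial>\<mu>)"
    by (intro nn_integral_cong) (auto simp: indicator_def)
  also have "enn2real \<dots> = exp (- r * \<theta>) * U \<theta> + r * (LINT u:{0..\<theta>}|lborel. exp (- r * u) * U u)"
  proof -
    have "0 \<le> (LINT u:{0..\<theta>}|lborel. exp (- r * u) * U u)"
      unfolding set_lebesgue_integral_def using Upos by (intro Bochner_Integration.integral_nonneg) auto
    then show ?thesis unfolding nn using r Upos by (intro enn2real_ennreal) auto
  qed
  also have "(LINT u:{0..\<theta>}|lborel. exp (- r * u) * U u) = (LINT u:{0..\<theta>}|lborel. exp (- r * u) * V u)"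
    using \<theta> by (intro set_lebesgue_integral_cong) (auto simp: U_def)
  also have "U \<theta> = V \<theta>" using \<theta> by (simp add: U_def)
  finally show ?thesis unfolding U \<mu>_def[symmetric] by (simp add: mult.commute)
qed

section \<open>The game\<close>

text \<open>\<open>\<mu>\<close> and \<open>h\<close> are unspecified outside the closure of
  \<open>\<O>\<close>, where the state may be at the terminal time. Changing an integrand at the one
  point \<open>p\<close> affects neither measurability nor the integral.\<close>

lemma set_integral_cong_point:
  fixes f k :: "real \<Rightarrow> real"
  assumes eq: "\<And>u. u \<in> A \<Longrightarrow> u \<noteq> p \<Longrightarrow> f u = k u" and k: "set_borel_measurable lborel A k"
  shows "(LINT u:A|lborel. f u) = (LINT u:A|lborel. k u)"
  unfolding set_lebesgue_integral_def
proof (rule integral_cong_AE)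
  show km: "(\<lambda>u. indicator A u *\<^sub>R k u) \<in> borel_measurable lborel" using k by (simp add: set_borel_measurable_def)
  have e: "(\<lambda>u. indicator A u *\<^sub>R f u) = (\<lambda>u. if u = p then indicator A p *\<^sub>R f p else indicator A u *\<^sub>R k u)"
    using eq by (auto simp: indicator_def)
  show "(\<lambda>u. indicator A u *\<^sub>R f u) \<in> borel_measurable lborel"
    by (rule ssubst[OF e]) (intro measurable_If km, auto)
  show "AE u in lborel. indicator A u *\<^sub>R f u = indicator A u *\<^sub>R k u"
    using AE_lborel_singleton[of p] by eventually_elim (auto simp: eq indicator_def)
qed

lemma holder_on_continuous_on:
  assumes "holder_on \<gamma> A f" "0 < \<gamma>"
  shows "continuous_on A f"
  unfolding continuous_on_def
proof
  fix x assume x: "x \<in> A"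
  obtain C where C: "\<forall>x\<in>A. \<forall>y\<in>A. \<bar>f x - f y\<bar> \<le> C * dist x y powr \<gamma>" using assms(1) by (auto simp: holder_on_def)
  have "((\<lambda>y. f y - f x) \<longlongrightarrow> 0) (at x within A)"
  proof (rule Lim_null_comparison)
    show "\<forall>\<^sub>F y in at x within A. norm (f y - f x) \<le> C * dist y x powr \<gamma>"
      using C x by (auto simp: eventually_at_filter dist_commute)
    have "((\<lambda>y. dist y x) \<longlongrightarrow> dist x x) (at x within A)" by (intro tendsto_intros)
    then have "((\<lambda>y. dist y x powr \<gamma>) \<longlongrightarrow> 0 powr \<gamma>) (at x within A)"
      using assms(2) by (intro tendsto_powr') auto
    from tendsto_mult[OF tendsto_const[of C] this]
    show "((\<lambda>y. C * dist y x powr \<gamma>) \<longlongrightarrow> 0) (at x within A)" by simp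
  qed
  then show "(f \<longlongrightarrow> f x) (at x within A)" by (rule LIM_zero_cancel)
qed

locale singular_control_game = filtered_brownian_motion M F W
  for M :: "'a measure" and F :: "real \<Rightarrow> 'a measure" and W :: "'a process" +
  fixes \<O> :: "real set" and \<mu> \<mu>' \<sigma> :: "real \<Rightarrow> real" and T r \<alpha>0 :: real
    and g g' :: "real \<Rightarrow> real" and h hx :: "real \<Rightarrow> real \<Rightarrow> real"
  assumes \<O>: "\<O> = UNIV \<or> \<O> = {0<..}"
    and T_pos: "0 < T" and r_nonneg: "0 \<le> r" and \<alpha>0_pos: "0 < \<alpha>0"
    and dynamics: "dynamics_assumptions \<O> \<mu> \<mu>' \<sigma>"
    and payoffs: "payoff_assumptions \<O> T r g g' h hx"
begin

section \<open>Lipschitz coefficients from convexity\<close>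

lemma open_\<O>: "open \<O>" and borel_\<O>: "\<O> \<in> sets borel"
  using \<O> by auto

lemma \<O>_subset: "x \<in> \<O> \<Longrightarrow> x \<in> closure \<O>"
  using closure_subset by blast

lemma mu_deriv: "x \<in> \<O> \<Longrightarrow> (\<mu> has_real_derivative \<mu>' x) (at x)"
  using dynamics at_within_open_subset[OF _ open_\<O> closure_subset, of x] \<O>_subset
  unfolding dynamics_assumptions_def by metis

lemma mu_continuous: "continuous_on (closure \<O>) \<mu>"
  using dynamics unfolding dynamics_assumptions_def
  by (meson DERIV_continuous continuous_on_eq_continuous_within)

lemma mu_convex: "convex_on (closure \<O>) \<mu>"
  using dynamics by (simp add: dynamics_assumptions_def)

lemma mu_tangent: "x \<in> \<O> \<Longrightarrow> y \<in> closure \<O> \<Longrightarrow> \<mu>' x * (y - x) \<le> \<mu> y - \<mu> x"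
proof -
  assume x: "x \<in> \<O>" and y: "y \<in> closure \<O>"
  have "connected (closure \<O>)" using convex_on_imp_convex[OF mu_convex] by (rule convex_connected)
  moreover have "x \<in> interior (closure \<O>)" using x open_\<O> closure_subset by (metis interiorI)
  ultimately show ?thesis
    using convex_on_imp_above_tangent[OF mu_convex _ _ y, of x "\<mu>' x"] mu_deriv[OF x]
    by (simp add: has_field_derivative_at_within)
qed

text \<open>On the whole line, a tangent with slope below \<open>- c\<close>, followed to the left,
  would lift the convex \<open>\<mu>\<close> above its linear growth bound. On the half-line
  \<open>\<mu>'\<close> is non-decreasing by convexity, so its limit at 0 is a lower bound.\<close>

lemma mu_deriv_lower: "\<exists>B. \<forall>x\<in>\<O>. B \<le> \<mu>' x"
  using \<O>
proof
  assume U: "\<O> = UNIV"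
  obtain c where c: "\<And>x. \<bar>\<mu> x\<bar> \<le> c * (1 + \<bar>x\<bar>)" using dynamics U by (auto simp: dynamics_assumptions_def)
  have c0: "0 \<le> c" using c[of 0] by auto
  have "- c \<le> \<mu>' x" for x
  proof (rule ccontr)
    assume "\<not> - c \<le> \<mu>' x"
    then have d: "0 < - \<mu>' x - c" by simp
    \<comment> \<open>One more than the gap between the growth bound and \<open>\<mu>\<close> at
      \<open>x\<close>; \<open>t\<close> is the distance at which the tangent has overcome
      it.\<close>
    define K where "K = \<bar>c * (1 + \<bar>x\<bar>) - \<mu> x\<bar> + 1"
    define t where "t = K / (- \<mu>' x - c)"
    have t: "0 < t" using d by (auto simp: t_def K_def)
    have "\<mu>' x * (- t) \<le> \<mu> (x - t) - \<mu> x" using mu_tangent[of x "x - t"] U by simp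
    also have "\<mu> (x - t) \<le> c * (1 + \<bar>x - t\<bar>)" using c[of "x - t"] by simp
    also have "\<dots> \<le> c * (1 + \<bar>x\<bar> + t)" using c0 t by (intro mult_left_mono) auto
    finally have "(- \<mu>' x - c) * t \<le> c * (1 + \<bar>x\<bar>) - \<mu> x" by (simp add: algebra_simps)
    moreover have "(- \<mu>' x - c) * t = K" using d by (simp add: t_def)
    ultimately show False by (simp add: K_def)
  qed
  then show ?thesis by blast
next
  assume P: "\<O> = {0<..}"
  have lim: "(\<mu>' \<longlongrightarrow> \<mu>' 0) (at_right 0)" using dynamics P by (simp add: dynamics_assumptions_def)
  have "\<mu>' 0 \<le> \<mu>' x" if x: "x \<in> \<O>" for x
  proof (rule tendsto_upperbound[OF lim])
    have "\<mu>' z \<le> \<mu>' x" if z: "0 < z" "z < x" for z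
    proof -
      have "\<mu>' z * (x - z) \<le> \<mu> x - \<mu> z" "\<mu>' x * (z - x) \<le> \<mu> z - \<mu> x"
        using mu_tangent[of z x] mu_tangent[of x z] x z P by auto
      then have "\<mu>' z * (x - z) \<le> \<mu>' x * (x - z)" by (simp add: algebra_simps)
      then show ?thesis using z by simp
    qed
    then show "\<forall>\<^sub>F z in at_right 0. \<mu>' z \<le> \<mu>' x"
      using x P by (auto simp: eventually_at_right_field intro!: exI[of _ x])
  qed simp
  then show ?thesis by blast
qed

lemma between_\<O>: "y \<in> closure \<O> \<Longrightarrow> y < w \<Longrightarrow> w \<in> \<O>"
  using \<O> by auto

text \<open>The slope is bounded above by assumption and below by \<open>mu_deriv_lower\<close>. The
  mean value theorem also reaches the boundary point, since the open interval between two points of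
  the closure lies in \<open>\<O>\<close>.\<close>

lemma mu_lipschitz: "\<exists>L. 0 < L \<and> (\<forall>y\<in>closure \<O>. \<forall>z\<in>closure \<O>. \<bar>\<mu> y - \<mu> z\<bar> \<le> L * \<bar>y - z\<bar>)"
proof -
  have "\<exists>c. \<forall>x\<in>\<O>. \<mu>' x \<le> c" using dynamics unfolding dynamics_assumptions_def by (elim conjE)
  then obtain c where c: "\<And>x. x \<in> \<O> \<Longrightarrow> \<mu>' x \<le> c" by blast
  obtain B where B: "\<And>x. x \<in> \<O> \<Longrightarrow> B \<le> \<mu>' x" using mu_deriv_lower by blast
  define L where "L = \<bar>c\<bar> + \<bar>B\<bar> + 1"
  have d: "\<bar>\<mu>' x\<bar> \<le> L" if "x \<in> \<O>" for x using c[OF that] B[OF that] by (auto simp: L_def)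
  have *: "\<bar>\<mu> z - \<mu> y\<bar> \<le> L * (z - y)" if yz: "y \<in> closure \<O>" "z \<in> closure \<O>" "y < z" for y z
  proof -
    have "{y..z} \<subseteq> closure \<O>" using between_\<O>[OF yz(1)] \<O>_subset yz(1) by force
    then have cont: "continuous_on {y..z} \<mu>" using mu_continuous continuous_on_subset by blast
    have "\<exists>\<xi>\<in>{y<..<z}. \<mu> z - \<mu> y = (z - y) * \<mu>' \<xi>"
    proof -
      have "\<exists>\<xi>\<in>{y<..<z}. \<mu> z - \<mu> y = (\<lambda>v. v * \<mu>' \<xi>) (z - y)"
        using yz(3) cont
      proof (rule mvt)
        fix x assume "y < x" "x < z"
        then show "(\<mu> has_derivative (\<lambda>v. v * \<mu>' x)) (at x)"
          using mu_deriv[OF between_\<O>[OF yz(1)]] by (simp add: has_field_derivative_def mult_commute_abs)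
      qed auto
      then show ?thesis .
    qed
    then obtain \<xi> where \<xi>: "\<xi> \<in> {y<..<z}" "\<mu> z - \<mu> y = (z - y) * \<mu>' \<xi>" by blast
    have "\<bar>\<mu>' \<xi>\<bar> \<le> L" using between_\<O>[OF yz(1), of \<xi>] \<xi>(1) by (intro d) auto
    then have "(z - y) * \<bar>\<mu>' \<xi>\<bar> \<le> (z - y) * L" using yz(3) by (intro mult_left_mono) auto
    then show ?thesis using \<xi>(2) yz(3) by (simp add: abs_mult mult.commute)
  qed
  have "\<bar>\<mu> y - \<mu> z\<bar> \<le> L * \<bar>y - z\<bar>" if "y \<in> closure \<O>" "z \<in> closure \<O>" for y z
    using *[of y z] *[of z y] that by (cases y z rule: linorder_cases) (auto simp: abs_minus_commute)
  moreover have "0 < L" by (simp add: L_def)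
  ultimately show ?thesis by blast
qed

text \<open>The nearest-point projection onto the closure; composing with it does not increase a
  Lipschitz constant.\<close>

definition proj :: "real \<Rightarrow> real" where
  "proj y = (if \<O> = UNIV then y else max 0 y)"

lemma proj_closure: "proj y \<in> closure \<O>" and proj_id: "y \<in> closure \<O> \<Longrightarrow> proj y = y"
  and proj_contract: "\<bar>proj y - proj z\<bar> \<le> \<bar>y - z\<bar>" and proj_abs: "\<bar>proj y\<bar> \<le> \<bar>y\<bar>"
  using \<O> by (auto simp: proj_def)

lemma proj_continuous: "continuous_on UNIV proj"
  unfolding proj_def by (cases "\<O> = UNIV") (auto intro!: continuous_intros)

text \<open>
  \<open>\<mu>\<close> is arbitrary outside the closure of \<open>\<O>\<close>; the solution may take a value there only at the
  terminal time.
\<close>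

definition drift :: "real \<Rightarrow> real" where "drift y = \<mu> (proj y)"

lemma lipschitz_coefficients:
  obtains L where "0 < L" "\<And>y z. \<bar>drift y - drift z\<bar> \<le> L * \<bar>y - z\<bar>" "\<And>y z. \<bar>\<sigma> y - \<sigma> z\<bar> \<le> L * \<bar>y - z\<bar>"
proof -
  obtain L where L: "0 < L" "\<And>y z. y \<in> closure \<O> \<Longrightarrow> z \<in> closure \<O> \<Longrightarrow> \<bar>\<mu> y - \<mu> z\<bar> \<le> L * \<bar>y - z\<bar>"
    using mu_lipschitz by blast
  have "\<exists>S\<ge>0. \<forall>y z. \<bar>\<sigma> y - \<sigma> z\<bar> \<le> S * \<bar>y - z\<bar>"
  proof -
    consider \<sigma>0 where "\<forall>x. \<sigma> x = \<sigma>0" | \<sigma>1 where "0 < \<sigma>1" "\<forall>x. \<sigma> x = \<sigma>1 * x"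
      using dynamics by (auto simp: dynamics_assumptions_def)
    then show ?thesis
    proof cases
      case 1
      then show ?thesis by (intro exI[of _ 0]) auto
    next
      case 2
      then show ?thesis by (intro exI[of _ \<sigma>1]) (auto simp: right_diff_distrib[symmetric] abs_mult)
    qed
  qed
  then obtain S where S: "0 \<le> S" "\<And>y z. \<bar>\<sigma> y - \<sigma> z\<bar> \<le> S * \<bar>y - z\<bar>" by blast
  show thesis
  proof (rule that[of "L + S"])
    show "0 < L + S" using L S by auto
    fix y z
    have "\<bar>drift y - drift z\<bar> \<le> L * \<bar>proj y - proj z\<bar>" unfolding drift_def by (intro L proj_closure)
    also have "\<dots> \<le> L * \<bar>y - z\<bar>" using L proj_contract by (intro mult_left_mono) auto
    also have "\<dots> \<le> (L + S) * \<bar>y - z\<bar>" using S by (intro mult_right_mono) auto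
    finally show "\<bar>drift y - drift z\<bar> \<le> (L + S) * \<bar>y - z\<bar>" .
    have "S * \<bar>y - z\<bar> \<le> (L + S) * \<bar>y - z\<bar>" using L by (intro mult_right_mono) auto
    then show "\<bar>\<sigma> y - \<sigma> z\<bar> \<le> (L + S) * \<bar>y - z\<bar>" using S(2)[of y z] by linarith
  qed
qed

lemma drift_measurable[measurable]: "drift \<in> borel_measurable borel"
  and sigma_measurable[measurable]: "\<sigma> \<in> borel_measurable borel"
proof -
  obtain L where L: "0 < L" "\<And>y z. \<bar>drift y - drift z\<bar> \<le> L * \<bar>y - z\<bar>" "\<And>y z. \<bar>\<sigma> y - \<sigma> z\<bar> \<le> L * \<bar>y - z\<bar>"
    using lipschitz_coefficients by blast
  have "L-lipschitz_on UNIV drift" "L-lipschitz_on UNIV \<sigma>"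
    using L by (auto intro!: lipschitz_onI simp: dist_real_def)
  then show "drift \<in> borel_measurable borel" "\<sigma> \<in> borel_measurable borel"
    by (auto intro: borel_measurable_continuous_onI lipschitz_on_continuous_on)
qed

lemma mu_subhomogeneous:
  assumes "\<O> = {0<..}" "0 \<le> y" "y \<le> 1" "0 \<le> x"
  shows "\<mu> (y * x) \<le> y * \<mu> x"
proof -
  have "\<mu> 0 = 0" using dynamics assms(1) by (simp add: dynamics_assumptions_def)
  moreover have "\<mu> ((1 - y) *\<^sub>R 0 + y *\<^sub>R x) \<le> (1 - y) * \<mu> 0 + y * \<mu> x"
    using assms by (intro convex_onD[OF mu_convex]) auto
  ultimately show ?thesis by simp
qed

subsection \<open>Paths of controlled solutions\<close>

lemma exit_time_UNIV: "exit_time UNIV H X \<omega> = H"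
  by (simp add: exit_time_def)

context
  fixes H x :: real and \<nu> X :: "'a process"
  assumes H: "0 \<le> H" and sol: "controlled_solution M F W \<O> \<mu> \<sigma> H x \<nu> X"
begin

lemma solution_adapted: "adapted_upto F H X"
  and solution_cadlag: "\<omega> \<in> space M \<Longrightarrow> cadlag_upto H (\<lambda>s. X s \<omega>)"
  and solution_absorbed: "\<omega> \<in> space M \<Longrightarrow> exit_time \<O> H X \<omega> < s \<Longrightarrow> s \<le> H \<Longrightarrow> X s \<omega> = 0"
  using sol unfolding controlled_solution_def by auto

lemma solution_progressive: "progressive F H X"
  using progressive_cadlag[OF filtration_F solution_adapted solution_cadlag] .

text \<open>The path is 0 right after the exit time and right-continuous there. Thus the extra
  condition that \<open>controls\<close> imposes on the half-line holds for every solution.\<close>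

lemma solution_at_exit:
  assumes \<omega>: "\<omega> \<in> space M" and lt: "exit_time \<O> H X \<omega> < H"
  shows "X (exit_time \<O> H X \<omega>) \<omega> = 0"
proof -
  define e where "e = exit_time \<O> H X \<omega>"
  have e: "0 \<le> e" "e < H" using exit_time_ge[OF H] lt by (auto simp: e_def)
  have "\<forall>\<^sub>F s in at_right e. X s \<omega> = 0"
    using solution_absorbed[OF \<omega>] e by (auto simp: eventually_at_right_field e_def intro!: exI[of _ H])
  then have "((\<lambda>s. X s \<omega>) \<longlongrightarrow> 0) (at_right e)" by (rule tendsto_eventually)
  moreover have "((\<lambda>s. X s \<omega>) \<longlongrightarrow> X e \<omega>) (at_right e)"
    using solution_cadlag[OF \<omega>] e by (auto simp: cadlag_upto_def)
  ultimately show ?thesis using tendsto_unique[of "at_right e"] by (simp add: e_def trivial_limit_at_right_real)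
qed

text \<open>The terminal time has to be excluded: a path that first leaves \<open>\<O>\<close> at
  \<open>H\<close> may end anywhere, because absorption acts only after the exit time.\<close>

lemma solution_in_closure:
  assumes \<omega>: "\<omega> \<in> space M" and u: "0 \<le> u" "u < H"
  shows "X u \<omega> \<in> closure \<O>"
proof (cases "u < exit_time \<O> H X \<omega>")
  case True
  then show ?thesis using before_exit_time[of u H \<O> X \<omega>] u \<O>_subset by auto
next
  case False
  then have "exit_time \<O> H X \<omega> < H" using u by auto
  then have "X u \<omega> = 0"
    using False solution_at_exit[OF \<omega>] solution_absorbed[OF \<omega>, of u] u by (cases "u = exit_time \<O> H X \<omega>") auto
  then show ?thesis using \<O> by auto
qed

text \<open>After the exit time the path sits at 0, which is outside the half-line, so every later
  rational time witnesses the exit.\<close>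

lemma solution_exit_sets:
  assumes "u \<in> {0..H}"
  shows "{\<omega> \<in> space M. u \<le> exit_time \<O> H X \<omega>} \<in> sets (F u)"
proof (rule exit_time_sets[OF solution_adapted borel_\<O> _ assms])
  fix \<omega> s b assume \<omega>: "\<omega> \<in> space M" and s: "s \<in> {0..<H}" "X s \<omega> \<notin> \<O>" "s < b"
  have P: "\<O> = {0<..}" using s \<O> by auto
  obtain q where q: "q \<in> \<rat>" "s < q" "q < min b H" using Rats_dense_in_real[of s "min b H"] s by auto
  have "exit_time \<O> H X \<omega> \<le> s" using before_exit_time[of s H \<O> X \<omega>] s by force
  then have "X q \<omega> = 0" using q by (intro solution_absorbed[OF \<omega>]) auto
  then show "\<exists>q\<in>\<rat>. s \<le> q \<and> q < b \<and> X q \<omega> \<notin> \<O>" using q P by (intro bexI[of _ q]) auto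
qed

lemma solution_exit_range: "exit_time \<O> H X \<omega> \<in> {0..H}"
  using exit_time_ge[OF H] exit_time_le by auto

lemma solution_exit_measurable: "exit_time \<O> H X \<in> borel_measurable M"
  using random_time_measurable[OF solution_exit_sets solution_exit_range] .

lemma solution_path_measurable:
  fixes f :: "real \<Rightarrow> real"
  assumes "f \<in> borel_measurable borel" "\<omega> \<in> space M" "0 \<le> s" "s \<le> H"
  shows "set_borel_measurable lborel {0..s} (\<lambda>u. f (X u \<omega>))"
  by (rule progressive_path(2)[OF progressive_comp[OF solution_progressive assms(1)] assms(3,4)]) (simp add: space_F assms(2))

text \<open>The two integrands can differ only at the terminal time \<open>H\<close>.\<close>

lemma solution_drift_integral:
  assumes "\<omega> \<in> space M" "s \<le> H"
  shows "(LINT u:{0..s}|lborel. \<mu> (X u \<omega>)) = (LINT u:{0..s}|lborel. drift (X u \<omega>))"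
proof (rule set_integral_cong_point[where p=H])
  show "\<mu> (X u \<omega>) = drift (X u \<omega>)" if "u \<in> {0..s}" "u \<noteq> H" for u
    using solution_in_closure[OF assms(1), of u] assms(2) that by (simp add: drift_def proj_id)
  show "set_borel_measurable lborel {0..s} (\<lambda>u. drift (X u \<omega>))"
  proof (cases "0 \<le> s")
    case True
    then show ?thesis using solution_path_measurable[OF drift_measurable assms(1) True assms(2)] by simp
  qed (simp add: set_borel_measurable_def)
qed

end

text \<open>Both solutions obey the same equation up to the smaller exit time, so they agree there.
  If one exited strictly earlier, it would be at 0 while the other was still inside the half-line;
  hence the exit times agree, and afterwards both paths are 0.\<close>

lemma solution_unique:
  assumes H: "0 \<le> H" and X: "controlled_solution M F W \<O> \<mu> \<sigma> H x \<nu> X" and Y: "controlled_solution M F W \<O> \<mu> \<sigma> H x \<nu> Y"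
  shows "AE \<omega> in M. exit_time \<O> H X \<omega> = exit_time \<O> H Y \<omega> \<and> (\<forall>s\<in>{0..H}. X s \<omega> = Y s \<omega>)"
proof -
  obtain L where L: "0 < L" "\<And>y z. \<bar>drift y - drift z\<bar> \<le> L * \<bar>y - z\<bar>" "\<And>y z. \<bar>\<sigma> y - \<sigma> z\<bar> \<le> L * \<bar>y - z\<bar>"
    using lipschitz_coefficients by blast
  obtain I where I: "has_ito_integral M F W H (\<lambda>s \<omega>. \<sigma> (X s \<omega>)) I"
    "AE \<omega> in M. \<forall>s\<in>{0..exit_time \<O> H X \<omega>}. X s \<omega> = x + (LINT u:{0..s}|lborel. \<mu> (X u \<omega>)) + I s \<omega> + \<nu> s \<omega>"
    using X unfolding controlled_solution_def by blast
  obtain I' where I': "has_ito_integral M F W H (\<lambda>s \<omega>. \<sigma> (Y s \<omega>)) I'"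
    "AE \<omega> in M. \<forall>s\<in>{0..exit_time \<O> H Y \<omega>}. Y s \<omega> = x + (LINT u:{0..s}|lborel. \<mu> (Y u \<omega>)) + I' s \<omega> + \<nu> s \<omega>"
    using Y unfolding controlled_solution_def by blast
  define \<rho> where "\<rho> \<omega> = min (exit_time \<O> H X \<omega>) (exit_time \<O> H Y \<omega>)" for \<omega>
  have \<rho>s: "{\<omega> \<in> space M. u \<le> \<rho> \<omega>} \<in> sets (F u)" if u: "u \<in> {0..H}" for u
  proof -
    have "{\<omega> \<in> space M. u \<le> \<rho> \<omega>} = {\<omega> \<in> space M. u \<le> exit_time \<O> H X \<omega>} \<inter> {\<omega> \<in> space M. u \<le> exit_time \<O> H Y \<omega>}"
      by (auto simp: \<rho>_def)
    then show ?thesis using solution_exit_sets[OF H X u] solution_exit_sets[OF H Y u] by auto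
  qed
  have "AE \<omega> in M. \<forall>s\<in>{0..H}. s \<le> \<rho> \<omega> \<longrightarrow> X s \<omega> = Y s \<omega>"
  proof (rule sde_solutions_agree[OF L H solution_adapted[OF H X] solution_cadlag[OF H X] solution_adapted[OF H Y] solution_cadlag[OF H Y] I(1) I'(1) \<rho>s])
    show "\<rho> \<omega> \<in> {0..H}" for \<omega> using solution_exit_range[OF H X, of \<omega>] solution_exit_range[OF H Y, of \<omega>] by (auto simp: \<rho>_def)
    show "AE \<omega> in M. \<forall>s\<in>{0..H}. s \<le> \<rho> \<omega> \<longrightarrow>
       X s \<omega> - Y s \<omega> = (LINT u:{0..s}|lborel. drift (X u \<omega>)) - (LINT u:{0..s}|lborel. drift (Y u \<omega>)) + (I s \<omega> - I' s \<omega>)"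
      using I(2) I'(2) AE_space
    proof eventually_elim
      fix \<omega> assume \<omega>: "\<omega> \<in> space M"
        and e: "\<forall>s\<in>{0..exit_time \<O> H X \<omega>}. X s \<omega> = x + (LINT u:{0..s}|lborel. \<mu> (X u \<omega>)) + I s \<omega> + \<nu> s \<omega>"
           "\<forall>s\<in>{0..exit_time \<O> H Y \<omega>}. Y s \<omega> = x + (LINT u:{0..s}|lborel. \<mu> (Y u \<omega>)) + I' s \<omega> + \<nu> s \<omega>"
      show "\<forall>s\<in>{0..H}. s \<le> \<rho> \<omega> \<longrightarrow>
       X s \<omega> - Y s \<omega> = (LINT u:{0..s}|lborel. drift (X u \<omega>)) - (LINT u:{0..s}|lborel. drift (Y u \<omega>)) + (I s \<omega> - I' s \<omega>)"
      proof (intro ballI impI)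
        fix s assume s: "s \<in> {0..H}" "s \<le> \<rho> \<omega>"
        then have "s \<in> {0..exit_time \<O> H X \<omega>}" "s \<in> {0..exit_time \<O> H Y \<omega>}" by (auto simp: \<rho>_def)
        then have "X s \<omega> = x + (LINT u:{0..s}|lborel. drift (X u \<omega>)) + I s \<omega> + \<nu> s \<omega>"
          "Y s \<omega> = x + (LINT u:{0..s}|lborel. drift (Y u \<omega>)) + I' s \<omega> + \<nu> s \<omega>"
          using e solution_drift_integral[OF H X \<omega>, of s] solution_drift_integral[OF H Y \<omega>, of s] s by auto
        then show "X s \<omega> - Y s \<omega> = (LINT u:{0..s}|lborel. drift (X u \<omega>)) - (LINT u:{0..s}|lborel. drift (Y u \<omega>)) + (I s \<omega> - I' s \<omega>)"
          by (simp only:)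
      qed
    qed
  qed auto
  then show ?thesis
    using AE_space
  proof eventually_elim
    fix \<omega> assume \<omega>: "\<omega> \<in> space M" and e: "\<forall>s\<in>{0..H}. s \<le> \<rho> \<omega> \<longrightarrow> X s \<omega> = Y s \<omega>"
    have le: "exit_time \<O> H Z \<omega> \<le> exit_time \<O> H Z' \<omega>"
      if Z: "controlled_solution M F W \<O> \<mu> \<sigma> H x \<nu> Z" and eq: "\<forall>s\<in>{0..H}. s \<le> min (exit_time \<O> H Z \<omega>) (exit_time \<O> H Z' \<omega>) \<longrightarrow> Z s \<omega> = Z' s \<omega>"
        and Z': "controlled_solution M F W \<O> \<mu> \<sigma> H x \<nu> Z'" for Z Z'
    proof (rule ccontr)
      assume lt: "\<not> exit_time \<O> H Z \<omega> \<le> exit_time \<O> H Z' \<omega>"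
      define e where "e = exit_time \<O> H Z' \<omega>"
      have e: "e \<in> {0..H}" "e < exit_time \<O> H Z \<omega>" using solution_exit_range[OF H Z', of \<omega>] lt by (auto simp: e_def)
      then have "Z e \<omega> \<in> \<O>" by (rule before_exit_time)
      moreover have "e < H" using e exit_time_le[of \<O> H Z \<omega>] by auto
      then have "Z' e \<omega> = 0" using solution_at_exit[OF H Z' \<omega>] by (simp add: e_def)
      moreover have "Z e \<omega> = Z' e \<omega>" using eq e by (auto simp: e_def)
      ultimately have "0 \<in> \<O>" by simp
      then have "\<O> = UNIV" using \<O> by auto
      then show False using lt by (simp add: exit_time_UNIV)
    qed
    have ex: "exit_time \<O> H X \<omega> = exit_time \<O> H Y \<omega>"
      using le[OF X _ Y] le[OF Y _ X] e by (intro antisym) (auto simp: \<rho>_def min.commute)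
    moreover have "X s \<omega> = Y s \<omega>" if s: "s \<in> {0..H}" for s
    proof (cases "s \<le> \<rho> \<omega>")
      case False
      then have "exit_time \<O> H X \<omega> < s" "exit_time \<O> H Y \<omega> < s" using ex by (auto simp: \<rho>_def)
      then show ?thesis using solution_absorbed[OF H X \<omega>, of s] solution_absorbed[OF H Y \<omega>, of s] s by auto
    qed (use e s in auto)
    ultimately show "exit_time \<O> H X \<omega> = exit_time \<O> H Y \<omega> \<and> (\<forall>s\<in>{0..H}. X s \<omega> = Y s \<omega>)" by blast
  qed
qed

text \<open>With the quadratic growth of \<open>h\<close> this is the integrability needed for the
  running payoff. Only times up to the exit count, since the integral equation holds only
  there.\<close>

lemma solution_square_integrable:
  assumes H: "0 \<le> H" and X: "controlled_solution M F W \<O> \<mu> \<sigma> H x \<nu> X"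
    and N: "N \<in> borel_measurable M" "\<And>\<omega> s. \<omega> \<in> space M \<Longrightarrow> s \<in> {0..H} \<Longrightarrow> \<bar>\<nu> s \<omega>\<bar> \<le> N \<omega>" "integrable M (\<lambda>\<omega>. (N \<omega>)\<^sup>2)"
  shows "(\<integral>\<^sup>+\<omega>. (\<integral>\<^sup>+s\<in>{0..H}. (if s \<le> exit_time \<O> H X \<omega> then ennreal ((X s \<omega>)\<^sup>2) else 0) \<partial>lborel) \<partial>M) < \<infinity>"
proof -
  obtain L where L: "0 < L" "\<And>y z. \<bar>drift y - drift z\<bar> \<le> L * \<bar>y - z\<bar>" "\<And>y z. \<bar>\<sigma> y - \<sigma> z\<bar> \<le> L * \<bar>y - z\<bar>"
    using lipschitz_coefficients by blast
  obtain I where I: "has_ito_integral M F W H (\<lambda>s \<omega>. \<sigma> (X s \<omega>)) I"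
    "AE \<omega> in M. \<forall>s\<in>{0..exit_time \<O> H X \<omega>}. X s \<omega> = x + (LINT u:{0..s}|lborel. \<mu> (X u \<omega>)) + I s \<omega> + \<nu> s \<omega>"
    using X unfolding controlled_solution_def by blast
  \<comment> \<open>The offset that gives both coefficients the growth bound
    \<open>L * (c + |y|)\<close> required by \<open>square_moment_bound\<close>.\<close>
  define c where "c = (\<bar>drift 0\<bar> + \<bar>\<sigma> 0\<bar>) / L"
  have c: "0 \<le> c" "L * c = \<bar>drift 0\<bar> + \<bar>\<sigma> 0\<bar>" using L(1) by (auto simp: c_def)
  have db: "\<bar>drift y\<bar> \<le> L * (c + \<bar>y\<bar>)" for y
    using L(2)[of y 0] c(2) unfolding distrib_left diff_0_right by linarith
  have sb: "\<bar>\<sigma> y\<bar> \<le> L * (c + \<bar>y\<bar>)" for y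
    using L(3)[of y 0] c(2) unfolding distrib_left diff_0_right by linarith
  note sol = solution_adapted[OF H X] solution_cadlag[OF H X] solution_progressive[OF H X]
  define A where "A \<omega> = \<bar>x\<bar> + \<bar>N \<omega>\<bar>" for \<omega>
  have A[measurable]: "A \<in> borel_measurable M" using N(1) unfolding A_def by measurable
  have \<kappa>p: "progressive F H (\<lambda>s \<omega>. \<sigma> (X s \<omega>))" by (rule progressive_comp[OF sol(3) sigma_measurable])
  have Ia: "adapted_upto F H I" using I(1) by (simp add: has_ito_integral_def)
  have bound: "AE \<omega> in M. \<forall>s\<in>{0..H}. s \<le> exit_time \<O> H X \<omega> \<longrightarrow>
        \<bar>X s \<omega>\<bar> \<le> A \<omega> + L * (LINT u:{0..s}|lborel. c + \<bar>X u \<omega>\<bar>) + \<bar>I s \<omega>\<bar>"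
    using I(2) AE_space
  proof eventually_elim
    fix \<omega> assume \<omega>: "\<omega> \<in> space M"
      and e: "\<forall>s\<in>{0..exit_time \<O> H X \<omega>}. X s \<omega> = x + (LINT u:{0..s}|lborel. \<mu> (X u \<omega>)) + I s \<omega> + \<nu> s \<omega>"
    obtain B where B: "0 \<le> B" "\<And>u. u \<in> {0..H} \<Longrightarrow> \<bar>X u \<omega>\<bar> \<le> B" using cadlag_bounded[OF sol(2)[OF \<omega>]] by blast
    show "\<forall>s\<in>{0..H}. s \<le> exit_time \<O> H X \<omega> \<longrightarrow>
        \<bar>X s \<omega>\<bar> \<le> A \<omega> + L * (LINT u:{0..s}|lborel. c + \<bar>X u \<omega>\<bar>) + \<bar>I s \<omega>\<bar>"
    proof (intro ballI impI)
      fix s assume s: "s \<in> {0..H}" "s \<le> exit_time \<O> H X \<omega>"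
      have Bs: "\<bar>X u \<omega>\<bar> \<le> B" if "u \<in> {0..s}" for u using B(2)[of u] that s by auto
      have i1: "set_integrable lborel {0..s} (\<lambda>u. drift (X u \<omega>))"
      proof (rule set_integrable_bounded)
        show "set_borel_measurable lborel {0..s} (\<lambda>u. drift (X u \<omega>))"
          using s by (intro solution_path_measurable[OF H X drift_measurable \<omega>]) auto
        fix u assume "u \<in> {0..s}"
        then have "L * (c + \<bar>X u \<omega>\<bar>) \<le> L * (c + B)" using Bs L(1) by (intro mult_left_mono) auto
        then show "\<bar>drift (X u \<omega>)\<bar> \<le> L * (c + B)" using db[of "X u \<omega>"] by linarith
      qed
      have i2: "set_integrable lborel {0..s} (\<lambda>u. L * (c + \<bar>X u \<omega>\<bar>))"
      proof (rule set_integrable_bounded)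
        show "set_borel_measurable lborel {0..s} (\<lambda>u. L * (c + \<bar>X u \<omega>\<bar>))"
          using s by (intro solution_path_measurable[OF H X _ \<omega>]) auto
        fix u assume "u \<in> {0..s}"
        then show "\<bar>L * (c + \<bar>X u \<omega>\<bar>)\<bar> \<le> L * (c + B)" using Bs[of u] L(1) c(1) by (simp add: abs_mult)
      qed
      have "\<bar>LINT u:{0..s}|lborel. drift (X u \<omega>)\<bar> \<le> (LINT u:{0..s}|lborel. L * (c + \<bar>X u \<omega>\<bar>))"
        using i1 i2 db by (intro set_integral_abs_le) auto
      also have "\<dots> = L * (LINT u:{0..s}|lborel. c + \<bar>X u \<omega>\<bar>)" by (rule set_integral_mult_right)
      finally have d: "\<bar>LINT u:{0..s}|lborel. drift (X u \<omega>)\<bar> \<le> L * (LINT u:{0..s}|lborel. c + \<bar>X u \<omega>\<bar>)" .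
      have "X s \<omega> = x + (LINT u:{0..s}|lborel. drift (X u \<omega>)) + I s \<omega> + \<nu> s \<omega>"
        using e s solution_drift_integral[OF H X \<omega>, of s] by auto
      then show "\<bar>X s \<omega>\<bar> \<le> A \<omega> + L * (LINT u:{0..s}|lborel. c + \<bar>X u \<omega>\<bar>) + \<bar>I s \<omega>\<bar>"
        using d N(2)[OF \<omega> s(1)] unfolding A_def by linarith
    qed
  qed
  obtain C where C: "0 \<le> C" "\<And>s. s \<in> {0..H} \<Longrightarrow>
    (\<integral>\<^sup>+\<omega>. (if s \<le> exit_time \<O> H X \<omega> then ennreal ((X s \<omega>)\<^sup>2) else 0) \<partial>M) \<le> ennreal C * ((\<integral>\<^sup>+\<omega>. ennreal ((A \<omega>)\<^sup>2) \<partial>M) + ennreal (c\<^sup>2))"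
    by (rule square_moment_bound[OF has_ito_integral_imp_ito_limit[OF I(1)] \<kappa>p Ia sol(1,2) solution_exit_sets[OF H X] solution_exit_range[OF H X] L(1) c(1) A _ bound sb H])
      (auto simp: A_def)
  have "(\<integral>\<^sup>+\<omega>. ennreal ((A \<omega>)\<^sup>2) \<partial>M) \<le> (\<integral>\<^sup>+\<omega>. ennreal (2 * x\<^sup>2 + 2 * (N \<omega>)\<^sup>2) \<partial>M)"
  proof (intro nn_integral_mono ennreal_leI)
    fix \<omega>
    show "(A \<omega>)\<^sup>2 \<le> 2 * x\<^sup>2 + 2 * (N \<omega>)\<^sup>2"
      using zero_le_power2[of "\<bar>x\<bar> - \<bar>N \<omega>\<bar>"] by (simp add: A_def power2_eq_square algebra_simps)
  qed
  also have "\<dots> = ennreal (expectation (\<lambda>\<omega>. 2 * x\<^sup>2 + 2 * (N \<omega>)\<^sup>2))"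
    using N(3) by (intro nn_integral_eq_integral) auto
  also have "\<dots> < \<infinity>" by simp
  finally have EA: "(\<integral>\<^sup>+\<omega>. ennreal ((A \<omega>)\<^sup>2) \<partial>M) < \<infinity>" .
  define B where "B = ennreal C * ((\<integral>\<^sup>+\<omega>. ennreal ((A \<omega>)\<^sup>2) \<partial>M) + ennreal (c\<^sup>2))"
  have B: "B < \<infinity>" using EA by (simp add: B_def ennreal_mult_less_top)
  define G where "G = (\<lambda>x. (if fst x \<le> exit_time \<O> H X (snd x) then ennreal ((X (max 0 (min (fst x) H)) (snd x))\<^sup>2) else 0) * indicator {0..H} (fst x))"
  have [measurable]: "exit_time \<O> H X \<in> borel_measurable M" by (rule solution_exit_measurable[OF H X])
  have [measurable]: "(\<lambda>x. X (max 0 (min (fst x) H)) (snd x)) \<in> borel_measurable (borel \<Otimes>\<^sub>M M)"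
    by (rule progressive_joint'[OF sol(3) H order_refl])
  have "G \<in> borel_measurable (borel \<Otimes>\<^sub>M M)" unfolding G_def by measurable
  then have G: "G \<in> borel_measurable (lborel \<Otimes>\<^sub>M M)" by simp
  interpret P: pair_sigma_finite lborel M by standard
  have "(\<integral>\<^sup>+\<omega>. (\<integral>\<^sup>+s\<in>{0..H}. (if s \<le> exit_time \<O> H X \<omega> then ennreal ((X s \<omega>)\<^sup>2) else 0) \<partial>lborel) \<partial>M)
      = (\<integral>\<^sup>+\<omega>. (\<integral>\<^sup>+s. G (s, \<omega>) \<partial>lborel) \<partial>M)"
    by (intro nn_integral_cong) (auto simp: G_def indicator_def)
  also have "\<dots> = (\<integral>\<^sup>+s. (\<integral>\<^sup>+\<omega>. G (s, \<omega>) \<partial>M) \<partial>lborel)"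
    using P.Fubini'[of "\<lambda>s \<omega>. G (s, \<omega>)"] G by simp
  also have "\<dots> \<le> (\<integral>\<^sup>+s. B * indicator {0..H} s \<partial>lborel)"
  proof (rule nn_integral_mono)
    fix s :: real
    have Gs: "G (s, \<omega>) = (if s \<le> exit_time \<O> H X \<omega> then ennreal ((X s \<omega>)\<^sup>2) else 0)" if "s \<in> {0..H}" for \<omega>
      using that by (auto simp: G_def)
    show "(\<integral>\<^sup>+\<omega>. G (s, \<omega>) \<partial>M) \<le> B * indicator {0..H} s"
    proof (cases "s \<in> {0..H}")
      case True
      then show ?thesis using C(2)[of s] by (simp add: Gs B_def)
    qed (simp add: G_def)
  qed
  also have "\<dots> = B * ennreal H" using H by (simp add: nn_integral_cmult_indicator)
  also have "\<dots> < \<infinity>" using B by (simp add: ennreal_mult_less_top)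
  finally show ?thesis .
qed

end

section \<open>Congruence on the horizon and measurability along random times\<close>

lemma cadlag_cong:
  assumes "cadlag_upto H f" "\<And>s. s \<in> {0..H} \<Longrightarrow> f s = k s"
  shows "cadlag_upto H k"
  unfolding cadlag_upto_def
proof (intro conjI ballI)
  fix s assume s: "s \<in> {0..<H}"
  have "\<forall>\<^sub>F u in at_right s. f u = k u"
    using s by (auto simp: eventually_at_right_field assms(2) intro!: exI[of _ H])
  moreover have "(f \<longlongrightarrow> k s) (at_right s)" using assms s by (auto simp: cadlag_upto_def)
  ultimately show "(k \<longlongrightarrow> k s) (at_right s)" by (rule tendsto_cong[THEN iffD1])
next
  fix s assume s: "s \<in> {0<..H}"
  have "\<forall>\<^sub>F u in at_left s. f u = k u"
    using s by (auto simp: eventually_at_left_field assms(2) intro!: exI[of _ 0])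
  moreover obtain l where "(f \<longlongrightarrow> l) (at_left s)" using assms(1) s unfolding cadlag_upto_def by blast
  ultimately have "(k \<longlongrightarrow> l) (at_left s)" by (rule tendsto_cong[THEN iffD1])
  then show "\<exists>l. (k \<longlongrightarrow> l) (at_left s)" ..
qed

lemma has_ito_integral_cong:
  fixes K K' :: "'a process"
  assumes "\<And>s \<omega>. s \<in> {0..H} \<Longrightarrow> K s \<omega> = K' s \<omega>" "has_ito_integral M F W H K I"
  shows "has_ito_integral M F W H K' I"
proof -
  have ad: "adapted_upto F H K'"
    using assms(2) ext[of "K s" "K' s" for s, OF assms(1)] by (simp add: has_ito_integral_def adapted_upto_def)
  have eq: "(\<lambda>k \<omega>. \<integral>\<^sup>+ s\<in>{0..H}. ennreal ((S k s \<omega> - K s \<omega>)\<^sup>2) \<partial>lborel)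
      = (\<lambda>k \<omega>. \<integral>\<^sup>+ s\<in>{0..H}. ennreal ((S k s \<omega> - K' s \<omega>)\<^sup>2) \<partial>lborel)" for S :: "nat \<Rightarrow> 'a process"
    by (intro ext nn_integral_cong) (auto simp: assms(1) indicator_def)
  show ?thesis
    using assms(2) ad unfolding has_ito_integral_def eq[of "\<lambda>k. simple_process (n k) (p k) (\<xi> k)" for n p \<xi>] by blast
qed

context filtered_brownian_motion
begin

text \<open>The random upper limit is moved into the integrand as a jointly measurable cut-off,
  after which integration over time preserves measurability.\<close>

lemma time_integral_measurable:
  fixes k :: "real \<Rightarrow> real \<Rightarrow> real"
  assumes Z: "progressive F H Z" "0 \<le> H" and k: "(\<lambda>x. k (fst x) (snd x)) \<in> borel_measurable (borel \<Otimes>\<^sub>M borel)"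
    and \<theta>: "\<theta> \<in> borel_measurable M" "\<And>\<omega>. \<omega> \<in> space M \<Longrightarrow> \<theta> \<omega> \<le> H"
  shows "(\<lambda>\<omega>. LINT s:{0..\<theta> \<omega>}|lborel. k s (Z s \<omega>)) \<in> borel_measurable M"
proof -
  note [measurable] = progressive_joint[OF Z order_refl] \<theta>(1)
  have "(\<lambda>x. (snd x, Z (max 0 (min (snd x) H)) (fst x))) \<in> measurable (M \<Otimes>\<^sub>M borel) (borel \<Otimes>\<^sub>M borel)" by measurable
  from measurable_compose[OF this k]
  have [measurable]: "(\<lambda>x. k (snd x) (Z (max 0 (min (snd x) H)) (fst x))) \<in> borel_measurable (M \<Otimes>\<^sub>M borel)" by simp
  have "(\<lambda>x. if 0 \<le> snd x \<and> snd x \<le> \<theta> (fst x) then k (snd x) (Z (max 0 (min (snd x) H)) (fst x)) else 0) \<in> borel_measurable (M \<Otimes>\<^sub>M borel)"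
    by measurable
  then have "(\<lambda>(\<omega>, s). if 0 \<le> s \<and> s \<le> \<theta> \<omega> then k s (Z (max 0 (min s H)) \<omega>) else 0) \<in> borel_measurable (M \<Otimes>\<^sub>M lborel)"
    by (simp add: case_prod_beta)
  then have "(\<lambda>\<omega>. LINT s|lborel. (if 0 \<le> s \<and> s \<le> \<theta> \<omega> then k s (Z (max 0 (min s H)) \<omega>) else 0)) \<in> borel_measurable M"
    by (rule lborel.borel_measurable_lebesgue_integral)
  then show ?thesis
  proof (rule measurable_cong[THEN iffD1, rotated])
    fix \<omega> assume "\<omega> \<in> space M"
    then show "(LINT s|lborel. (if 0 \<le> s \<and> s \<le> \<theta> \<omega> then k s (Z (max 0 (min s H)) \<omega>) else 0)) = (LINT s:{0..\<theta> \<omega>}|lborel. k s (Z s \<omega>))"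
      using \<theta>(2) unfolding set_lebesgue_integral_def
      by (intro Bochner_Integration.integral_cong refl) (force simp: indicator_def)
  qed
qed

lemma random_time_value_measurable:
  assumes Z: "progressive F H Z" "0 \<le> H" and \<theta>: "\<theta> \<in> borel_measurable M" "\<And>\<omega>. \<omega> \<in> space M \<Longrightarrow> \<theta> \<omega> \<in> {0..H}"
  shows "(\<lambda>\<omega>. Z (\<theta> \<omega>) \<omega>) \<in> borel_measurable M"
proof -
  have "(\<lambda>\<omega>. (\<omega>, \<theta> \<omega>)) \<in> measurable M (M \<Otimes>\<^sub>M borel)" using \<theta>(1) by measurable
  from measurable_compose[OF this progressive_joint[OF Z order_refl]]
  have "(\<lambda>\<omega>. Z (max 0 (min (\<theta> \<omega>) H)) \<omega>) \<in> borel_measurable M" by simp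
  then show ?thesis
    by (rule measurable_cong[THEN iffD1, rotated]) (use \<theta>(2) in force)
qed

end

context singular_control_game
begin

subsection \<open>The payoff\<close>

text \<open>\<open>g\<close> and \<open>h\<close> are constrained only for times in
  \<open>{0..T}\<close> and, for \<open>h\<close>, for states in the closure of \<open>\<O>\<close>.
  Projecting the arguments gives functions for which measurability and bounds hold on the whole
  space.\<close>

definition g_ext :: "real \<Rightarrow> real" where "g_ext u = g (max 0 (min u T))"

definition h_ext :: "real \<Rightarrow> real \<Rightarrow> real" where "h_ext u y = h (max 0 (min u T)) (proj y)"

lemma payoff_facts:
  obtains \<gamma> c where "0 < \<gamma>" "0 < c"
    "\<And>t. t \<in> {0..T} \<Longrightarrow> (g has_real_derivative g' t) (at t within {0..T})"
    "\<And>K. compact K \<Longrightarrow> K \<subseteq> {0..T} \<times> closure \<O> \<Longrightarrow> holder_on \<gamma> K (\<lambda>(t, x). h t x)"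
    "\<And>t x. t \<in> {0..T} \<Longrightarrow> x \<in> closure \<O> \<Longrightarrow> \<bar>h t x\<bar> \<le> c * (1 + \<bar>x\<bar>\<^sup>2)"
    "\<And>t x. t \<in> {0..T} \<Longrightarrow> x \<in> closure \<O> \<Longrightarrow> (h t has_real_derivative hx t x) (at x within closure \<O>)"
    "\<And>t x. t \<in> {0..T} \<Longrightarrow> x \<in> closure \<O> \<Longrightarrow> 0 \<le> hx t x"
proof -
  obtain \<gamma> c where *: "\<gamma> \<in> {0<..<1}" "0 < c"
    "\<forall>t\<in>{0..T}. (g has_real_derivative g' t) (at t within {0..T})"
    "\<forall>K. compact K \<and> K \<subseteq> {0..T} \<times> closure \<O> \<longrightarrow> holder_on \<gamma> K (\<lambda>(t, x). h t x)"
    "\<forall>t\<in>{0..T}. \<forall>x\<in>closure \<O>. \<bar>h t x\<bar> \<le> c * (1 + \<bar>x\<bar>\<^sup>2)"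
    "\<forall>t\<in>{0..T}. \<forall>x\<in>closure \<O>. (h t has_real_derivative hx t x) (at x within closure \<O>)"
    "\<forall>t\<in>{0..T}. \<forall>x\<in>closure \<O>. 0 \<le> hx t x"
    using payoffs unfolding payoff_assumptions_def Let_def by (elim conjE bexE exE) (rule that; assumption)
  have "0 < \<gamma>" using *(1) by simp
  then show thesis by (rule that[OF _ *(2)]) (blast intro: *(3-7)[rule_format])+
qed

lemma g_ext_measurable[measurable]: "g_ext \<in> borel_measurable borel"
  and g_ext_bounded: "\<exists>G\<ge>0. \<forall>u. \<bar>g_ext u\<bar> \<le> G"
proof -
  obtain \<gamma> c where g: "\<And>t. t \<in> {0..T} \<Longrightarrow> (g has_real_derivative g' t) (at t within {0..T})"
    using payoff_facts by blast
  have gc: "continuous_on {0..T} g"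
    unfolding continuous_on_eq_continuous_within using DERIV_continuous[OF g] by blast
  have "continuous_on UNIV (\<lambda>u. g (max 0 (min u T)))"
    using T_pos by (intro continuous_on_compose2[OF gc] continuous_intros) auto
  then show "g_ext \<in> borel_measurable borel" unfolding g_ext_def[abs_def] by (rule borel_measurable_continuous_onI)
  obtain G where "0 \<le> G" "\<And>u. u \<in> {0..T} \<Longrightarrow> \<bar>g u\<bar> \<le> G" using continuous_bounded_Icc[OF gc] by blast
  then show "\<exists>G\<ge>0. \<forall>u. \<bar>g_ext u\<bar> \<le> G" using T_pos by (intro exI[of _ G]) (auto simp: g_ext_def)
qed

text \<open>Hoelder continuity is available on compact sets only. So continuity is shown on the open
  strips \<open>D n\<close>, which the projections map into a compact set; the strips cover the
  plane.\<close>

lemma h_ext_measurable: "(\<lambda>x. h_ext (fst x) (snd x)) \<in> borel_measurable (borel \<Otimes>\<^sub>M borel)"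
proof -
  obtain \<gamma> c where h: "0 < \<gamma>" "\<And>K. compact K \<Longrightarrow> K \<subseteq> {0..T} \<times> closure \<O> \<Longrightarrow> holder_on \<gamma> K (\<lambda>(t, x). h t x)"
    using payoff_facts by metis
  define D where "D n = {x :: real \<times> real. \<bar>snd x\<bar> < real n}" for n
  have "continuous_on (\<Union>n\<in>UNIV. D n) (\<lambda>x. h_ext (fst x) (snd x))"
  proof (rule continuous_on_open_UN)
    fix n
    show "open (D n)" unfolding D_def by (intro open_Collect_less continuous_intros)
    define K where "K = {0..T} \<times> (closure \<O> \<inter> {- real n..real n})"
    have "compact K" unfolding K_def by (intro compact_Times compact_Icc closed_Int_compact) auto
    then have "continuous_on K (\<lambda>(t, x). h t x)"
      using h by (intro holder_on_continuous_on[OF h(2) h(1)]) (auto simp: K_def)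
    moreover have "continuous_on (D n) (\<lambda>x. (max 0 (min (fst x) T), proj (snd x)))"
      by (intro continuous_on_Pair continuous_on_compose2[OF proj_continuous, of _ snd] continuous_intros) auto
    moreover have "(\<lambda>x. (max 0 (min (fst x) T), proj (snd x))) ` D n \<subseteq> K"
    proof
      fix z assume "z \<in> (\<lambda>x. (max 0 (min (fst x) T), proj (snd x))) ` D n"
      then obtain x where x: "\<bar>snd x\<bar> < real n" "z = (max 0 (min (fst x) T), proj (snd x))" by (auto simp: D_def)
      then show "z \<in> K" using T_pos proj_closure[of "snd x"] proj_abs[of "snd x"] by (auto simp: K_def)
    qed
    ultimately have "continuous_on (D n) (\<lambda>x. (\<lambda>(t, x). h t x) (max 0 (min (fst x) T), proj (snd x)))"
      by (rule continuous_on_compose2)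
    then show "continuous_on (D n) (\<lambda>x. h_ext (fst x) (snd x))" by (simp add: h_ext_def)
  qed
  moreover have "(\<Union>n\<in>UNIV. D n) = UNIV"
    using reals_Archimedean2 by (auto simp: D_def)
  ultimately have "(\<lambda>x. h_ext (fst x) (snd x)) \<in> borel_measurable borel" by (intro borel_measurable_continuous_onI) simp
  then show ?thesis by (simp only: borel_prod)
qed

lemma h_ext_bound: "\<exists>c>0. \<forall>u y. \<bar>h_ext u y\<bar> \<le> c * (1 + y\<^sup>2)"
proof -
  obtain \<gamma> c where c: "0 < c" "\<And>t x. t \<in> {0..T} \<Longrightarrow> x \<in> closure \<O> \<Longrightarrow> \<bar>h t x\<bar> \<le> c * (1 + \<bar>x\<bar>\<^sup>2)"
    using payoff_facts by metis
  have "\<bar>h_ext u y\<bar> \<le> c * (1 + y\<^sup>2)" for u y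
  proof -
    have "\<bar>h_ext u y\<bar> \<le> c * (1 + \<bar>proj y\<bar>\<^sup>2)"
      unfolding h_ext_def using T_pos proj_closure by (intro c) auto
    also have "\<dots> \<le> c * (1 + \<bar>y\<bar>\<^sup>2)" using c(1) proj_abs by (intro mult_left_mono add_left_mono power_mono) auto
    finally show ?thesis by simp
  qed
  then show ?thesis using c(1) by blast
qed

lemma h_ext_mono: "y \<le> z \<Longrightarrow> h_ext u y \<le> h_ext u z"
proof -
  assume "y \<le> z"
  obtain \<gamma> c where d: "\<And>t x. t \<in> {0..T} \<Longrightarrow> x \<in> closure \<O> \<Longrightarrow> (h t has_real_derivative hx t x) (at x within closure \<O>)"
    "\<And>t x. t \<in> {0..T} \<Longrightarrow> x \<in> closure \<O> \<Longrightarrow> 0 \<le> hx t x"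
    using payoff_facts by metis
  define t where "t = max 0 (min u T)"
  have t: "t \<in> {0..T}" using T_pos by (auto simp: t_def)
  define a b where "a = proj y" and "b = proj z"
  have ab: "a \<le> b" "a \<in> closure \<O>" using \<open>y \<le> z\<close> proj_closure by (auto simp: a_def b_def proj_def)
  have sub: "{a..b} \<subseteq> closure \<O>" using between_\<O>[OF ab(2)] \<O>_subset ab(2) by force
  have "h t a \<le> h t b"
  proof (rule DERIV_nonneg_imp_increasing_open[OF ab(1)])
    fix w assume "a < w" "w < b"
    then have w: "w \<in> \<O>" using between_\<O>[OF ab(2)] by auto
    then have "(h t has_real_derivative hx t w) (at w)"
      using d(1)[OF t \<O>_subset[OF w]] at_within_open_subset[OF w open_\<O> closure_subset] by simp
    then show "\<exists>l. (h t has_real_derivative l) (at w) \<and> 0 \<le> l" using d(2)[OF t \<O>_subset[OF w]] by blast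
  next
    have "continuous_on (closure \<O>) (h t)"
      unfolding continuous_on_eq_continuous_within using DERIV_continuous[OF d(1)[OF t]] by blast
    then show "continuous_on {a..b} (h t)" using sub by (rule continuous_on_subset)
  qed
  then show ?thesis by (simp add: h_ext_def a_def b_def t_def)
qed

text \<open>Unlike in \<open>controls\<close>, the solution \<open>X\<close> and the decomposition
  are arguments, so that \<open>X\<close> may be a constructed solution and not the version chosen
  by \<open>state\<close>. The exit condition of \<open>controls\<close> is omitted, because every
  solution satisfies it.\<close>

definition admissible :: "real \<Rightarrow> real \<Rightarrow> 'a process \<Rightarrow> 'a process \<Rightarrow> 'a process \<Rightarrow> 'a process \<Rightarrow> bool" where
  "admissible H x \<nu> X \<nu>p \<nu>m \<longleftrightarrow> controlled_solution M F W \<O> \<mu> \<sigma> H x \<nu> X \<and>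
     adapted_upto F H \<nu>p \<and> adapted_upto F H \<nu>m \<and>
     (\<forall>\<omega>\<in>space M. jordan_decomposition H (\<lambda>s. \<nu> s \<omega>) (\<lambda>s. \<nu>p s \<omega>) (\<lambda>s. \<nu>m s \<omega>) \<and>
        cadlag_upto H (\<lambda>s. \<nu>p s \<omega>) \<and> cadlag_upto H (\<lambda>s. \<nu>m s \<omega>)) \<and>
     integrable M (\<lambda>\<omega>. (\<nu>p H \<omega>)\<^sup>2) \<and> integrable M (\<lambda>\<omega>. (\<nu>m H \<omega>)\<^sup>2)"

definition gain :: "real \<Rightarrow> 'a process \<Rightarrow> 'a process \<Rightarrow> real \<Rightarrow> 'a \<Rightarrow> real" where
  "gain t \<nu> X \<theta> \<omega> = exp (- r * \<theta>) * g (t + \<theta>)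
     + (LINT s:{0..\<theta>}|lborel. exp (- r * s) * h (t + s) (X s \<omega>))
     + (LINT s:{0..\<theta>}|variation_measure (T - t) (\<lambda>s. \<nu> s \<omega>). exp (- r * s) * \<alpha>0)"

context
  fixes t H x :: real and \<nu> X \<nu>p \<nu>m :: "'a process"
  assumes t: "t \<in> {0..T}" and H_def: "H = T - t" and adm: "admissible H x \<nu> X \<nu>p \<nu>m"
begin

lemma horizon: "0 \<le> H"
  using t H_def by simp

lemma admissible_solution: "controlled_solution M F W \<O> \<mu> \<sigma> H x \<nu> X"
  using adm by (simp add: admissible_def)

lemma admissible_jordan: "\<omega> \<in> space M \<Longrightarrow> jordan_decomposition H (\<lambda>s. \<nu> s \<omega>) (\<lambda>s. \<nu>p s \<omega>) (\<lambda>s. \<nu>m s \<omega>)"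
  and admissible_adapted: "adapted_upto F H \<nu>p" "adapted_upto F H \<nu>m"
  and admissible_cadlag: "\<omega> \<in> space M \<Longrightarrow> cadlag_upto H (\<lambda>s. \<nu>p s \<omega>)" "\<omega> \<in> space M \<Longrightarrow> cadlag_upto H (\<lambda>s. \<nu>m s \<omega>)"
  and admissible_square: "integrable M (\<lambda>\<omega>. (\<nu>p H \<omega>)\<^sup>2)" "integrable M (\<lambda>\<omega>. (\<nu>m H \<omega>)\<^sup>2)"
  using adm by (auto simp: admissible_def)

lemma admissible_progressive: "progressive F H \<nu>p" "progressive F H \<nu>m"
  using progressive_cadlag[OF filtration_F admissible_adapted(1) admissible_cadlag(1)]
    progressive_cadlag[OF filtration_F admissible_adapted(2) admissible_cadlag(2)] by auto

lemma admissible_variation_progressive: "progressive F H (\<lambda>s \<omega>. \<nu>p s \<omega> + \<nu>m s \<omega>)"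
  using admissible_progressive by (rule progressive_comp2) measurable

lemma admissible_variation_bounds:
  assumes "\<omega> \<in> space M" "s \<le> H"
  shows "0 \<le> \<nu>p s \<omega> + \<nu>m s \<omega>" "\<nu>p s \<omega> + \<nu>m s \<omega> \<le> \<nu>p H \<omega> + \<nu>m H \<omega>"
  using jordan_decompositionD(3,4,7,8)[OF admissible_jordan[OF assms(1)]] assms(2) by (auto intro!: add_mono)

lemma solution_bounded:
  assumes "\<omega> \<in> space M"
  obtains B where "0 \<le> B" "\<And>u. u \<in> {0..H} \<Longrightarrow> \<bar>X u \<omega>\<bar> \<le> B"
  using cadlag_bounded[OF solution_cadlag[OF horizon admissible_solution assms]] by blast

lemma path_measurable2:
  fixes k :: "real \<Rightarrow> real \<Rightarrow> real"
  assumes Z: "progressive F H Z" and k: "(\<lambda>x. k (fst x) (snd x)) \<in> borel_measurable (borel \<Otimes>\<^sub>M borel)" and \<omega>: "\<omega> \<in> space M" and \<theta>: "\<theta> \<le> H"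
  shows "set_borel_measurable lborel {0..\<theta>} (\<lambda>s. k s (Z s \<omega>))"
proof -
  have [measurable]: "(\<lambda>u. Z (max 0 (min u H)) \<omega>) \<in> borel_measurable borel"
    by (rule progressive_path(1)[OF Z horizon order_refl]) (simp add: space_F \<omega>)
  have "(\<lambda>u. (u, Z (max 0 (min u H)) \<omega>)) \<in> measurable borel (borel \<Otimes>\<^sub>M borel)" by measurable
  from measurable_compose[OF this k]
  have [measurable]: "(\<lambda>u. k u (Z (max 0 (min u H)) \<omega>)) \<in> borel_measurable borel" by simp
  have "(\<lambda>u. indicator {0..\<theta>} u *\<^sub>R k u (Z (max 0 (min u H)) \<omega>)) \<in> borel_measurable lborel" by measurable
  moreover have "(\<lambda>u. indicator {0..\<theta>} u *\<^sub>R k u (Z (max 0 (min u H)) \<omega>)) = (\<lambda>u. indicator {0..\<theta>} u *\<^sub>R k u (Z u \<omega>))"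
    using \<theta> by (auto simp: indicator_def)
  ultimately show ?thesis unfolding set_borel_measurable_def by (simp only:)
qed

lemma h_discounted_measurable: "(\<lambda>x. exp (- r * fst x) * h_ext (t + fst x) (snd x)) \<in> borel_measurable (borel \<Otimes>\<^sub>M borel)"
proof -
  have "(\<lambda>x. (t + fst x, snd x)) \<in> measurable (borel \<Otimes>\<^sub>M borel) (borel \<Otimes>\<^sub>M borel)" by measurable
  from measurable_compose[OF this h_ext_measurable]
  have [measurable]: "(\<lambda>x. h_ext (t + fst x) (snd x)) \<in> borel_measurable (borel \<Otimes>\<^sub>M borel)" by simp
  show ?thesis by measurable
qed

lemma h_discounted_integrable:
  assumes \<omega>: "\<omega> \<in> space M" and \<theta>: "0 \<le> \<theta>" "\<theta> \<le> H"
  shows "set_integrable lborel {0..\<theta>} (\<lambda>s. exp (- r * s) * h_ext (t + s) (X s \<omega>))"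
proof -
  obtain B where B: "0 \<le> B" "\<And>u. u \<in> {0..H} \<Longrightarrow> \<bar>X u \<omega>\<bar> \<le> B" using solution_bounded[OF \<omega>] by blast
  obtain c where c: "0 < c" "\<And>u y. \<bar>h_ext u y\<bar> \<le> c * (1 + y\<^sup>2)" using h_ext_bound by blast
  show ?thesis
  proof (rule set_integrable_bounded)
    show "set_borel_measurable lborel {0..\<theta>} (\<lambda>s. exp (- r * s) * h_ext (t + s) (X s \<omega>))"
      by (rule path_measurable2[OF solution_progressive[OF horizon admissible_solution] h_discounted_measurable \<omega> \<theta>(2)])
    fix s assume s: "s \<in> {0..\<theta>}"
    have "(X s \<omega>)\<^sup>2 \<le> B\<^sup>2" using B(2)[of s] s \<theta> B(1) by (simp add: abs_le_square_iff[symmetric])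
    then have "c * (1 + (X s \<omega>)\<^sup>2) \<le> c * (1 + B\<^sup>2)" using c(1) by simp
    then have "\<bar>h_ext (t + s) (X s \<omega>)\<bar> \<le> c * (1 + B\<^sup>2)" using c(2)[of "t + s" "X s \<omega>"] by linarith
    moreover have "exp (- r * s) \<le> 1" using s r_nonneg by simp
    ultimately have "exp (- r * s) * \<bar>h_ext (t + s) (X s \<omega>)\<bar> \<le> 1 * (c * (1 + B\<^sup>2))" by (intro mult_mono) auto
    then show "\<bar>exp (- r * s) * h_ext (t + s) (X s \<omega>)\<bar> \<le> c * (1 + B\<^sup>2)" by (simp add: abs_mult)
  qed
qed

lemma variation_discounted_integrable:
  assumes \<omega>: "\<omega> \<in> space M" and \<theta>: "0 \<le> \<theta>" "\<theta> \<le> H"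
  shows "set_integrable lborel {0..\<theta>} (\<lambda>s. exp (- r * s) * (\<nu>p s \<omega> + \<nu>m s \<omega>))"
    and "\<And>s. s \<in> {0..\<theta>} \<Longrightarrow> \<bar>exp (- r * s) * (\<nu>p s \<omega> + \<nu>m s \<omega>)\<bar> \<le> \<nu>p H \<omega> + \<nu>m H \<omega>"
proof -
  show b: "\<bar>exp (- r * s) * (\<nu>p s \<omega> + \<nu>m s \<omega>)\<bar> \<le> \<nu>p H \<omega> + \<nu>m H \<omega>" if s: "s \<in> {0..\<theta>}" for s
  proof -
    have "exp (- r * s) \<le> 1" using s r_nonneg by simp
    then have "exp (- r * s) * (\<nu>p s \<omega> + \<nu>m s \<omega>) \<le> 1 * (\<nu>p H \<omega> + \<nu>m H \<omega>)"
      using admissible_variation_bounds[OF \<omega>, of s] s \<theta> by (intro mult_mono) auto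
    then show ?thesis using admissible_variation_bounds(1)[OF \<omega>, of s] s \<theta> by (simp add: abs_mult)
  qed
  show "set_integrable lborel {0..\<theta>} (\<lambda>s. exp (- r * s) * (\<nu>p s \<omega> + \<nu>m s \<omega>))"
  proof (rule set_integrable_bounded[OF _ b])
    show "set_borel_measurable lborel {0..\<theta>} (\<lambda>s. exp (- r * s) * (\<nu>p s \<omega> + \<nu>m s \<omega>))"
      by (rule path_measurable2[OF admissible_variation_progressive _ \<omega> \<theta>(2), of "\<lambda>s v. exp (- r * s) * v"]) measurable
  qed
qed

text \<open>Gives the payoff a form that is manifestly measurable in \<open>\<omega>\<close> and
  monotone in the state and in the variation: the control cost is integrated by parts, and the
  extensions replace \<open>g\<close> and \<open>h\<close>.\<close>

lemma gain_eq:
  assumes \<omega>: "\<omega> \<in> space M" and \<theta>: "\<theta> \<in> {0..H}"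
  shows "gain t \<nu> X \<theta> \<omega> = exp (- r * \<theta>) * g_ext (t + \<theta>)
     + (LINT s:{0..\<theta>}|lborel. exp (- r * s) * h_ext (t + s) (X s \<omega>))
     + \<alpha>0 * (exp (- r * \<theta>) * (\<nu>p \<theta> \<omega> + \<nu>m \<theta> \<omega>) + r * (LINT s:{0..\<theta>}|lborel. exp (- r * s) * (\<nu>p s \<omega> + \<nu>m s \<omega>)))"
proof -
  note J = jordan_decompositionD[OF admissible_jordan[OF \<omega>]]
  have cl: "max 0 (min (t + s) T) = t + s" if "s \<in> {0..\<theta>}" for s using that \<theta> t H_def by auto
  have "(LINT s:{0..\<theta>}|lborel. exp (- r * s) * h (t + s) (X s \<omega>)) = (LINT s:{0..\<theta>}|lborel. exp (- r * s) * h_ext (t + s) (X s \<omega>))"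
  proof (rule set_integral_cong_point[where p=H])
    fix s assume s: "s \<in> {0..\<theta>}" "s \<noteq> H"
    then have "X s \<omega> \<in> closure \<O>" using \<theta> by (intro solution_in_closure[OF horizon admissible_solution \<omega>]) auto
    then show "exp (- r * s) * h (t + s) (X s \<omega>) = exp (- r * s) * h_ext (t + s) (X s \<omega>)"
      using cl[OF s(1)] by (simp add: h_ext_def proj_id)
  next
    show "set_borel_measurable lborel {0..\<theta>} (\<lambda>s. exp (- r * s) * h_ext (t + s) (X s \<omega>))"
      using h_discounted_integrable[OF \<omega>] \<theta> by (intro set_integrable_imp_measurable) auto
  qed
  moreover have "(LINT s:{0..\<theta>}|variation_measure H (\<lambda>s. \<nu> s \<omega>). exp (- r * s) * \<alpha>0)
      = \<alpha>0 * (exp (- r * \<theta>) * (\<nu>p \<theta> \<omega> + \<nu>m \<theta> \<omega>) + r * (LINT s:{0..\<theta>}|lborel. exp (- r * s) * (\<nu>p s \<omega> + \<nu>m s \<omega>)))"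
  proof (rule variation_measure_integral_exp)
    show "((\<lambda>s. \<nu>p s \<omega> + \<nu>m s \<omega>) \<longlongrightarrow> \<nu>p s \<omega> + \<nu>m s \<omega>) (at_right s)" if "s \<in> {0..<H}" for s
      using that admissible_cadlag[OF \<omega>] by (intro tendsto_add) (auto simp: cadlag_upto_def)
  qed (use J \<theta> r_nonneg in \<open>auto intro!: add_mono\<close>)
  moreover have "g (t + \<theta>) = g_ext (t + \<theta>)" using cl[of \<theta>] \<theta> by (simp add: g_ext_def)
  ultimately show ?thesis unfolding gain_def H_def[symmetric] by simp
qed

lemma stopped_time:
  assumes \<tau>: "\<tau> \<in> stopping_times M F T t"
  defines "\<theta> \<equiv> \<lambda>\<omega>. min (\<tau> \<omega>) (exit_time \<O> H X \<omega>)"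
  shows "\<theta> \<in> borel_measurable M" "\<And>\<omega>. \<omega> \<in> space M \<Longrightarrow> \<theta> \<omega> \<in> {0..H}"
proof -
  have "{\<omega> \<in> space M. \<tau> \<omega> \<le> y} \<in> sets M" for y
  proof -
    have "Measurable.pred (F y) (\<lambda>\<omega>. \<tau> \<omega> \<le> y)" using \<tau> by (auto simp: stopping_times_def stopping_time_def)
    then have "{\<omega> \<in> space (F y). \<tau> \<omega> \<le> y} \<in> sets (F y)" by (simp add: pred_def)
    then show ?thesis using sub_sigma[of y] by (auto simp: space_F)
  qed
  then have [measurable]: "\<tau> \<in> borel_measurable M" by (intro borel_measurableI_le)
  have [measurable]: "exit_time \<O> H X \<in> borel_measurable M"
    by (rule solution_exit_measurable[OF horizon admissible_solution])
  show "\<theta> \<in> borel_measurable M" unfolding \<theta>_def by measurable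
  show "\<theta> \<omega> \<in> {0..H}" if "\<omega> \<in> space M" for \<omega>
    using \<tau> that solution_exit_range[OF horizon admissible_solution, of \<omega>] by (auto simp: \<theta>_def stopping_times_def H_def)
qed

text \<open>The dominating variable consists of the bound \<open>G\<close> for \<open>g\<close>, the
  time integral \<open>R\<close> of the quadratic bound for \<open>h\<close>, and the variation
  \<open>N\<close> at \<open>H\<close>. Without integrability the expectation could be the default
  value 0, and pathwise order would say nothing.\<close>

lemma gain_integrable:
  assumes \<tau>: "\<tau> \<in> stopping_times M F T t"
  shows "integrable M (\<lambda>\<omega>. gain t \<nu> X (min (\<tau> \<omega>) (exit_time \<O> H X \<omega>)) \<omega>)"
proof -
  define \<theta> where "\<theta> \<omega> = min (\<tau> \<omega>) (exit_time \<O> H X \<omega>)" for \<omega>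
  have \<theta>: "\<theta> \<in> borel_measurable M" "\<And>\<omega>. \<omega> \<in> space M \<Longrightarrow> \<theta> \<omega> \<in> {0..H}"
    using stopped_time[OF \<tau>] unfolding \<theta>_def[abs_def] by auto
  note [measurable] = \<theta>(1)
  define e where "e = exit_time \<O> H X"
  have e: "e \<in> borel_measurable M" "\<And>\<omega>. e \<omega> \<in> {0..H}"
    using solution_exit_measurable[OF horizon admissible_solution] solution_exit_range[OF horizon admissible_solution] by (auto simp: e_def)
  note Xp = solution_progressive[OF horizon admissible_solution]
  obtain c where c: "0 < c" "\<And>u y. \<bar>h_ext u y\<bar> \<le> c * (1 + y\<^sup>2)" using h_ext_bound by blast
  obtain G where G: "0 \<le> G" "\<And>u. \<bar>g_ext u\<bar> \<le> G" using g_ext_bounded by blast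
  define V where "V s \<omega> = \<nu>p s \<omega> + \<nu>m s \<omega>" for s \<omega>
  \<comment> \<open>Integrating up to the exit time, and not only to
    \<open>\<theta> \<omega>\<close>, gives one bound for all stopping times; it is the quantity
    that \<open>solution_square_integrable\<close> controls.\<close>
  define R where "R \<omega> = (LINT s:{0..e \<omega>}|lborel. c * (1 + (X s \<omega>)\<^sup>2))" for \<omega>
  have Ri: "set_integrable lborel {0..s} (\<lambda>s. c * (1 + (X s \<omega>)\<^sup>2))" if \<omega>: "\<omega> \<in> space M" and s: "s \<le> H" for \<omega> s
  proof -
    obtain B where B: "0 \<le> B" "\<And>u. u \<in> {0..H} \<Longrightarrow> \<bar>X u \<omega>\<bar> \<le> B" using solution_bounded[OF \<omega>] by blast
    show ?thesis
    proof (rule set_integrable_bounded)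
      show "set_borel_measurable lborel {0..s} (\<lambda>s. c * (1 + (X s \<omega>)\<^sup>2))"
        by (rule path_measurable2[OF Xp _ \<omega> s, of "\<lambda>s y. c * (1 + y\<^sup>2)"]) measurable
      fix u assume "u \<in> {0..s}"
      then have "(X u \<omega>)\<^sup>2 \<le> B\<^sup>2" using B(2)[of u] s B(1) by (simp add: abs_le_square_iff[symmetric])
      then have "c * (1 + (X u \<omega>)\<^sup>2) \<le> c * (1 + B\<^sup>2)" using c(1) by simp
      then show "\<bar>c * (1 + (X u \<omega>)\<^sup>2)\<bar> \<le> c * (1 + B\<^sup>2)" using c(1) by (simp add: abs_mult)
    qed
  qed
  have Rm[measurable]: "R \<in> borel_measurable M"
    unfolding R_def using e by (intro time_integral_measurable[OF Xp horizon, of "\<lambda>s y. c * (1 + y\<^sup>2)"]) auto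
  have Rnn: "ennreal (R \<omega>) = (\<integral>\<^sup>+s\<in>{0..H}. (if s \<le> e \<omega> then ennreal (c * (1 + (X s \<omega>)\<^sup>2)) else 0) \<partial>lborel)" if \<omega>: "\<omega> \<in> space M" for \<omega>
  proof -
    have "ennreal (R \<omega>) = (\<integral>\<^sup>+s. ennreal (indicator {0..e \<omega>} s *\<^sub>R (c * (1 + (X s \<omega>)\<^sup>2))) \<partial>lborel)"
      using Ri[OF \<omega>, of "e \<omega>"] e(2)[of \<omega>] c(1) unfolding R_def set_integrable_def set_lebesgue_integral_def
      by (intro nn_integral_eq_integral[symmetric]) auto
    also have "\<dots> = (\<integral>\<^sup>+s\<in>{0..H}. (if s \<le> e \<omega> then ennreal (c * (1 + (X s \<omega>)\<^sup>2)) else 0) \<partial>lborel)"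
      using e(2)[of \<omega>] by (intro nn_integral_cong) (auto simp: indicator_def)
    finally show ?thesis .
  qed
  define N where "N \<omega> = \<bar>\<nu>p H \<omega>\<bar> + \<bar>\<nu>m H \<omega>\<bar>" for \<omega>
  have [measurable]: "\<nu>p H \<in> borel_measurable M" "\<nu>m H \<in> borel_measurable M"
    using admissible_adapted adaptedD[of H _ H] horizon measurable_F_M by auto
  have N: "N \<in> borel_measurable M" unfolding N_def by measurable
  have N2: "integrable M (\<lambda>\<omega>. (N \<omega>)\<^sup>2)"
  proof (rule Bochner_Integration.integrable_bound)
    show "integrable M (\<lambda>\<omega>. 2 * (\<nu>p H \<omega>)\<^sup>2 + 2 * (\<nu>m H \<omega>)\<^sup>2)" using admissible_square by auto
    show "(\<lambda>\<omega>. (N \<omega>)\<^sup>2) \<in> borel_measurable M" using N by measurable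
    show "AE \<omega> in M. norm ((N \<omega>)\<^sup>2) \<le> norm (2 * (\<nu>p H \<omega>)\<^sup>2 + 2 * (\<nu>m H \<omega>)\<^sup>2)"
    proof (intro AE_I2)
      fix \<omega>
      have "(N \<omega>)\<^sup>2 \<le> 2 * (\<nu>p H \<omega>)\<^sup>2 + 2 * (\<nu>m H \<omega>)\<^sup>2"
        using zero_le_power2[of "\<bar>\<nu>p H \<omega>\<bar> - \<bar>\<nu>m H \<omega>\<bar>"] by (simp add: N_def power2_eq_square algebra_simps)
      then show "norm ((N \<omega>)\<^sup>2) \<le> norm (2 * (\<nu>p H \<omega>)\<^sup>2 + 2 * (\<nu>m H \<omega>)\<^sup>2)" by simp
    qed
  qed
  have N1: "integrable M N" using N2 N by (rule square_integrable_imp_integrable[rotated])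
  have fin: "(\<integral>\<^sup>+\<omega>. (\<integral>\<^sup>+s\<in>{0..H}. (if s \<le> e \<omega> then ennreal ((X s \<omega>)\<^sup>2) else 0) \<partial>lborel) \<partial>M) < \<infinity>"
    unfolding e_def
  proof (rule solution_square_integrable[OF horizon admissible_solution N _ N2])
    fix \<omega> s assume \<omega>: "\<omega> \<in> space M" and s: "s \<in> {0..H}"
    note J = jordan_decompositionD[OF admissible_jordan[OF \<omega>]]
    have "0 \<le> \<nu>p s \<omega>" "0 \<le> \<nu>m s \<omega>" "\<nu>p s \<omega> \<le> \<nu>p H \<omega>" "\<nu>m s \<omega> \<le> \<nu>m H \<omega>" "\<nu> s \<omega> = \<nu>p s \<omega> - \<nu>m s \<omega>"
      using J s by auto
    then show "\<bar>\<nu> s \<omega>\<bar> \<le> N \<omega>" by (simp add: N_def)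
  qed
  have "(\<integral>\<^sup>+\<omega>. ennreal (R \<omega>) \<partial>M) \<le> (\<integral>\<^sup>+\<omega>. ennreal (c * H) + ennreal c * (\<integral>\<^sup>+s\<in>{0..H}. (if s \<le> e \<omega> then ennreal ((X s \<omega>)\<^sup>2) else 0) \<partial>lborel) \<partial>M)"
  proof (rule nn_integral_mono)
    fix \<omega> assume \<omega>: "\<omega> \<in> space M"
    have [measurable]: "(\<lambda>u. X (max 0 (min u H)) \<omega>) \<in> borel_measurable borel"
      by (rule progressive_path(1)[OF Xp horizon order_refl]) (simp add: space_F \<omega>)
    have "ennreal (R \<omega>) \<le> (\<integral>\<^sup>+s. ennreal c * indicator {0..H} s + ennreal c * ((if s \<le> e \<omega> then ennreal ((X (max 0 (min s H)) \<omega>)\<^sup>2) else 0) * indicator {0..H} s) \<partial>lborel)"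
      unfolding Rnn[OF \<omega>]
    proof (rule nn_integral_mono)
      fix s
      show "(if s \<le> e \<omega> then ennreal (c * (1 + (X s \<omega>)\<^sup>2)) else 0) * indicator {0..H} s
        \<le> ennreal c * indicator {0..H} s + ennreal c * ((if s \<le> e \<omega> then ennreal ((X (max 0 (min s H)) \<omega>)\<^sup>2) else 0) * indicator {0..H} s)"
        using c(1) by (auto simp: indicator_def distrib_left ennreal_mult)
    qed
    also have "\<dots> = ennreal c * ennreal H + ennreal c * (\<integral>\<^sup>+s. (if s \<le> e \<omega> then ennreal ((X (max 0 (min s H)) \<omega>)\<^sup>2) else 0) * indicator {0..H} s \<partial>lborel)"
      using horizon by (simp add: nn_integral_add nn_integral_cmult nn_integral_cmult_indicator)
    also have "(\<integral>\<^sup>+s. (if s \<le> e \<omega> then ennreal ((X (max 0 (min s H)) \<omega>)\<^sup>2) else 0) * indicator {0..H} s \<partial>lborel)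
       = (\<integral>\<^sup>+s\<in>{0..H}. (if s \<le> e \<omega> then ennreal ((X s \<omega>)\<^sup>2) else 0) \<partial>lborel)"
      by (intro nn_integral_cong) (auto simp: indicator_def)
    finally show "ennreal (R \<omega>) \<le> ennreal (c * H) + ennreal c * (\<integral>\<^sup>+s\<in>{0..H}. (if s \<le> e \<omega> then ennreal ((X s \<omega>)\<^sup>2) else 0) \<partial>lborel)"
      using c(1) horizon by (simp add: ennreal_mult)
  qed
  also have "\<dots> = ennreal (c * H) + ennreal c * (\<integral>\<^sup>+\<omega>. (\<integral>\<^sup>+s\<in>{0..H}. (if s \<le> e \<omega> then ennreal ((X s \<omega>)\<^sup>2) else 0) \<partial>lborel) \<partial>M)"
  proof -
    have [measurable]: "(\<lambda>\<omega>. \<integral>\<^sup>+s\<in>{0..H}. (if s \<le> e \<omega> then ennreal ((X s \<omega>)\<^sup>2) else 0) \<partial>lborel) \<in> borel_measurable M"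
    proof -
      note [measurable] = e(1)
      show ?thesis
        by (rule progressive_nn_integral_measurable[OF Xp horizon order_refl, of "\<lambda>\<omega> s y. if s \<le> e \<omega> then ennreal (y\<^sup>2) else 0"]) measurable
    qed
    show ?thesis by (simp add: nn_integral_add nn_integral_cmult emeasure_space_1)
  qed
  also have "\<dots> < \<infinity>" using fin by (simp add: ennreal_mult_less_top)
  finally have "(\<integral>\<^sup>+\<omega>. ennreal (R \<omega>) \<partial>M) < \<infinity>" .
  moreover have R0: "0 \<le> R \<omega>" for \<omega> unfolding R_def using c(1) by (intro set_integral_nonneg_real) auto
  ultimately have Rint: "integrable M R" by (intro integrableI_nonneg) auto
  show ?thesis
    unfolding \<theta>_def[symmetric]
  proof (rule Bochner_Integration.integrable_bound)
    show "integrable M (\<lambda>\<omega>. (G + R \<omega>) + \<alpha>0 * ((1 + r * H) * N \<omega>))" using Rint N1 by auto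
    have "(\<lambda>\<omega>. exp (- r * \<theta> \<omega>) * g_ext (t + \<theta> \<omega>)
       + (LINT s:{0..\<theta> \<omega>}|lborel. exp (- r * s) * h_ext (t + s) (X s \<omega>))
       + \<alpha>0 * (exp (- r * \<theta> \<omega>) * (\<nu>p (\<theta> \<omega>) \<omega> + \<nu>m (\<theta> \<omega>) \<omega>) + r * (LINT s:{0..\<theta> \<omega>}|lborel. exp (- r * s) * (\<nu>p s \<omega> + \<nu>m s \<omega>)))) \<in> borel_measurable M"
    proof -
      have [measurable]: "(\<lambda>\<omega>. LINT s:{0..\<theta> \<omega>}|lborel. exp (- r * s) * h_ext (t + s) (X s \<omega>)) \<in> borel_measurable M"
        using \<theta> by (intro time_integral_measurable[OF Xp horizon h_discounted_measurable]) auto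
      have [measurable]: "(\<lambda>\<omega>. LINT s:{0..\<theta> \<omega>}|lborel. exp (- r * s) * (\<nu>p s \<omega> + \<nu>m s \<omega>)) \<in> borel_measurable M"
        using \<theta> by (intro time_integral_measurable[OF admissible_variation_progressive horizon, of "\<lambda>s v. exp (- r * s) * v"]) auto
      have [measurable]: "(\<lambda>\<omega>. \<nu>p (\<theta> \<omega>) \<omega>) \<in> borel_measurable M" "(\<lambda>\<omega>. \<nu>m (\<theta> \<omega>) \<omega>) \<in> borel_measurable M"
        using random_time_value_measurable[OF _ horizon \<theta>] admissible_progressive by auto
      show ?thesis by measurable
    qed
    then show "(\<lambda>\<omega>. gain t \<nu> X (\<theta> \<omega>) \<omega>) \<in> borel_measurable M"
      by (rule measurable_cong[THEN iffD1, rotated]) (use gain_eq \<theta>(2) in auto)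
    show "AE \<omega> in M. norm (gain t \<nu> X (\<theta> \<omega>) \<omega>) \<le> norm ((G + R \<omega>) + \<alpha>0 * ((1 + r * H) * N \<omega>))"
    proof (intro AE_I2)
      fix \<omega> assume \<omega>: "\<omega> \<in> space M"
      note th = \<theta>(2)[OF \<omega>]
      have th': "0 \<le> \<theta> \<omega>" "\<theta> \<omega> \<le> H" "\<theta> \<omega> \<le> e \<omega>" "e \<omega> \<le> H" using th e(2)[of \<omega>] by (auto simp: \<theta>_def e_def)
      have ex: "0 \<le> exp (- r * s)" "exp (- r * s) \<le> 1" if "0 \<le> s" for s using that r_nonneg by auto
      have a1: "\<bar>exp (- r * \<theta> \<omega>) * g_ext (t + \<theta> \<omega>)\<bar> \<le> G"
        using mult_mono[OF ex(2)[OF th'(1)] G(2)[of "t + \<theta> \<omega>"]] by (simp add: abs_mult)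
      have "\<bar>LINT s:{0..\<theta> \<omega>}|lborel. exp (- r * s) * h_ext (t + s) (X s \<omega>)\<bar> \<le> (LINT s:{0..\<theta> \<omega>}|lborel. c * (1 + (X s \<omega>)\<^sup>2))"
      proof (rule set_integral_abs_le[OF h_discounted_integrable[OF \<omega> th'(1,2)] Ri[OF \<omega> th'(2)]])
        fix s assume "s \<in> {0..\<theta> \<omega>}"
        then have "exp (- r * s) * \<bar>h_ext (t + s) (X s \<omega>)\<bar> \<le> 1 * (c * (1 + (X s \<omega>)\<^sup>2))"
          using ex[of s] c by (intro mult_mono) auto
        then show "\<bar>exp (- r * s) * h_ext (t + s) (X s \<omega>)\<bar> \<le> c * (1 + (X s \<omega>)\<^sup>2)" by (simp add: abs_mult)
      qed simp
      also have "\<dots> \<le> R \<omega>"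
      proof -
        have "0 \<le> (LINT s:{\<theta> \<omega>..e \<omega>}|lborel. c * (1 + (X s \<omega>)\<^sup>2))" using c(1) by (intro set_integral_nonneg_real) auto
        then show ?thesis using set_integral_split[OF Ri[OF \<omega> order_refl] th'(1,3,4)] by (simp only: R_def)
      qed
      finally have a2: "\<bar>LINT s:{0..\<theta> \<omega>}|lborel. exp (- r * s) * h_ext (t + s) (X s \<omega>)\<bar> \<le> R \<omega>" .
      note vb = variation_discounted_integrable[OF \<omega> th'(1,2)]
      have VN: "\<nu>p H \<omega> + \<nu>m H \<omega> \<le> N \<omega>" by (simp add: N_def)
      have "\<bar>LINT s:{0..\<theta> \<omega>}|lborel. exp (- r * s) * (\<nu>p s \<omega> + \<nu>m s \<omega>)\<bar> \<le> N \<omega> * (\<theta> \<omega> - 0)"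
        using vb th'(1) VN by (intro set_integral_bound) force+
      also have "\<dots> \<le> N \<omega> * H" using th' by (intro mult_left_mono) (auto simp: N_def)
      finally have "r * \<bar>LINT s:{0..\<theta> \<omega>}|lborel. exp (- r * s) * (\<nu>p s \<omega> + \<nu>m s \<omega>)\<bar> \<le> r * (N \<omega> * H)"
        using r_nonneg by (rule mult_left_mono)
      moreover have "\<bar>exp (- r * \<theta> \<omega>) * (\<nu>p (\<theta> \<omega>) \<omega> + \<nu>m (\<theta> \<omega>) \<omega>)\<bar> \<le> N \<omega>" using vb(2)[of "\<theta> \<omega>"] th'(1) VN by force
      moreover have "\<bar>a + r * b\<bar> \<le> \<bar>a\<bar> + r * \<bar>b\<bar>" for a b using r_nonneg abs_triangle_ineq[of a "r * b"] by (simp add: abs_mult)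
      ultimately have "\<bar>exp (- r * \<theta> \<omega>) * (\<nu>p (\<theta> \<omega>) \<omega> + \<nu>m (\<theta> \<omega>) \<omega>) + r * (LINT s:{0..\<theta> \<omega>}|lborel. exp (- r * s) * (\<nu>p s \<omega> + \<nu>m s \<omega>))\<bar> \<le> N \<omega> + r * (N \<omega> * H)"
        by (meson add_mono order_trans)
      then have "\<alpha>0 * \<bar>exp (- r * \<theta> \<omega>) * (\<nu>p (\<theta> \<omega>) \<omega> + \<nu>m (\<theta> \<omega>) \<omega>) + r * (LINT s:{0..\<theta> \<omega>}|lborel. exp (- r * s) * (\<nu>p s \<omega> + \<nu>m s \<omega>))\<bar> \<le> \<alpha>0 * (N \<omega> + r * (N \<omega> * H))"
        using \<alpha>0_pos by (intro mult_left_mono) auto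
      then have a3: "\<bar>\<alpha>0 * (exp (- r * \<theta> \<omega>) * (\<nu>p (\<theta> \<omega>) \<omega> + \<nu>m (\<theta> \<omega>) \<omega>) + r * (LINT s:{0..\<theta> \<omega>}|lborel. exp (- r * s) * (\<nu>p s \<omega> + \<nu>m s \<omega>)))\<bar> \<le> \<alpha>0 * ((1 + r * H) * N \<omega>)"
      proof -
        have "(1 + r * H) * N \<omega> = N \<omega> + r * (N \<omega> * H)" by (simp add: algebra_simps)
        then show ?thesis
          using \<open>\<alpha>0 * \<bar>_\<bar> \<le> \<alpha>0 * (N \<omega> + r * (N \<omega> * H))\<close> by (simp only: abs_mult abs_of_pos[OF \<alpha>0_pos])
      qed
      show "norm (gain t \<nu> X (\<theta> \<omega>) \<omega>) \<le> norm ((G + R \<omega>) + \<alpha>0 * ((1 + r * H) * N \<omega>))"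
        unfolding gain_eq[OF \<omega> th] real_norm_def using a1 a2 a3 by linarith
    qed
  qed
qed

end

text \<open>Running payoff and control cost are ordered path by path. The order of the states may
  fail at \<open>s = H\<close>, where they need not lie in the closure; one time does not affect the
  running payoff.\<close>

lemma gain_mono:
  assumes t: "t \<in> {0..T}" "H = T - t"
    and 1: "admissible H x1 \<nu>1 X1 p1 m1" and 2: "admissible H x2 \<nu>2 X2 p2 m2"
    and cmp: "AE \<omega> in M. exit_time \<O> H X1 \<omega> = exit_time \<O> H X2 \<omega> \<and>
      (\<forall>s\<in>{0..H}. X1 s \<omega> \<le> X2 s \<omega> \<or> s = H) \<and> (\<forall>s\<in>{0..H}. p1 s \<omega> + m1 s \<omega> \<le> p2 s \<omega> + m2 s \<omega>)"
    and \<tau>: "\<tau> \<in> stopping_times M F T t"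
  shows "expectation (\<lambda>\<omega>. gain t \<nu>1 X1 (min (\<tau> \<omega>) (exit_time \<O> H X1 \<omega>)) \<omega>)
     \<le> expectation (\<lambda>\<omega>. gain t \<nu>2 X2 (min (\<tau> \<omega>) (exit_time \<O> H X2 \<omega>)) \<omega>)"
proof (rule integral_mono_AE[OF gain_integrable[OF t 1 \<tau>] gain_integrable[OF t 2 \<tau>]])
  show "AE \<omega> in M. gain t \<nu>1 X1 (min (\<tau> \<omega>) (exit_time \<O> H X1 \<omega>)) \<omega> \<le> gain t \<nu>2 X2 (min (\<tau> \<omega>) (exit_time \<O> H X2 \<omega>)) \<omega>"
    using cmp AE_space
  proof eventually_elim
    fix \<omega> assume \<omega>: "\<omega> \<in> space M" and c: "exit_time \<O> H X1 \<omega> = exit_time \<O> H X2 \<omega> \<and>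
      (\<forall>s\<in>{0..H}. X1 s \<omega> \<le> X2 s \<omega> \<or> s = H) \<and> (\<forall>s\<in>{0..H}. p1 s \<omega> + m1 s \<omega> \<le> p2 s \<omega> + m2 s \<omega>)"
    define \<theta> where "\<theta> = min (\<tau> \<omega>) (exit_time \<O> H X2 \<omega>)"
    have \<theta>: "\<theta> \<in> {0..H}" using stopped_time(2)[OF t 2 \<tau> \<omega>] by (simp add: \<theta>_def)
    then have \<theta>': "0 \<le> \<theta>" "\<theta> \<le> H" by auto
    have hA: "(LINT s:{0..\<theta>}|lborel. exp (- r * s) * h_ext (t + s) (X1 s \<omega>)) \<le> (LINT s:{0..\<theta>}|lborel. exp (- r * s) * h_ext (t + s) (X2 s \<omega>))"
    proof -
      \<comment> \<open>The first integrand, changed at \<open>H\<close> to agree with the second: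
        the integral stays the same, and the order holds at every time.\<close>
      define k where "k s = (if s = H then exp (- r * s) * h_ext (t + s) (X2 s \<omega>) else exp (- r * s) * h_ext (t + s) (X1 s \<omega>))" for s
      note i1 = h_discounted_integrable[OF t 1 \<omega> \<theta>'] and i2 = h_discounted_integrable[OF t 2 \<omega> \<theta>']
      have "(LINT s:{0..\<theta>}|lborel. exp (- r * s) * h_ext (t + s) (X1 s \<omega>)) = (LINT s:{0..\<theta>}|lborel. k s)"
        by (rule set_integral_cong_point[where p=H, symmetric, OF _ set_integrable_imp_measurable[OF i1]]) (simp add: k_def)
      also have "\<dots> \<le> (LINT s:{0..\<theta>}|lborel. exp (- r * s) * h_ext (t + s) (X2 s \<omega>))"
      proof (rule set_integral_mono[OF _ i2])
        have ae: "AE s in lborel. indicator {0..\<theta>} s *\<^sub>R (exp (- r * s) * h_ext (t + s) (X1 s \<omega>)) = indicator {0..\<theta>} s *\<^sub>R k s"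
          using AE_lborel_singleton[of H] by eventually_elim (simp add: k_def)
        have km: "(\<lambda>s. indicator {0..\<theta>} s *\<^sub>R k s) \<in> borel_measurable lborel"
        proof -
          have e: "(\<lambda>s. indicator {0..\<theta>} s *\<^sub>R k s) = (\<lambda>s. if s = H then indicator {0..\<theta>} H *\<^sub>R k H else indicator {0..\<theta>} s *\<^sub>R (exp (- r * s) * h_ext (t + s) (X1 s \<omega>)))"
            by (auto simp: k_def)
          show ?thesis
            using i1 by (subst e) (intro measurable_If, auto simp: set_integrable_def)
        qed
        show "set_integrable lborel {0..\<theta>} k"
          using i1 integrable_cong_AE[OF _ km ae] by (auto simp: set_integrable_def)
        fix s assume s: "s \<in> {0..\<theta>}"
        then have "X1 s \<omega> \<le> X2 s \<omega> \<or> s = H" using c \<theta>' by auto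
        then show "k s \<le> exp (- r * s) * h_ext (t + s) (X2 s \<omega>)" by (auto simp: k_def h_ext_mono)
      qed
      finally show ?thesis .
    qed
    have "(LINT s:{0..\<theta>}|lborel. exp (- r * s) * (p1 s \<omega> + m1 s \<omega>)) \<le> (LINT s:{0..\<theta>}|lborel. exp (- r * s) * (p2 s \<omega> + m2 s \<omega>))"
      using c \<theta>' by (intro set_integral_mono variation_discounted_integrable(1)[OF t 1 \<omega> \<theta>'] variation_discounted_integrable(1)[OF t 2 \<omega> \<theta>'] mult_left_mono) auto
    then have hB: "r * (LINT s:{0..\<theta>}|lborel. exp (- r * s) * (p1 s \<omega> + m1 s \<omega>)) \<le> r * (LINT s:{0..\<theta>}|lborel. exp (- r * s) * (p2 s \<omega> + m2 s \<omega>))"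
      using r_nonneg by (rule mult_left_mono)
    have hC: "exp (- r * \<theta>) * (p1 \<theta> \<omega> + m1 \<theta> \<omega>) \<le> exp (- r * \<theta>) * (p2 \<theta> \<omega> + m2 \<theta> \<omega>)"
      using c \<theta> by (intro mult_left_mono) auto
    have "gain t \<nu>1 X1 \<theta> \<omega> \<le> gain t \<nu>2 X2 \<theta> \<omega>"
      unfolding gain_eq[OF t 1 \<omega> \<theta>] gain_eq[OF t 2 \<omega> \<theta>]
      using hA mult_left_mono[OF add_mono[OF hC hB] less_imp_le[OF \<alpha>0_pos]] by linarith
    then show "gain t \<nu>1 X1 (min (\<tau> \<omega>) (exit_time \<O> H X1 \<omega>)) \<omega> \<le> gain t \<nu>2 X2 (min (\<tau> \<omega>) (exit_time \<O> H X2 \<omega>)) \<omega>"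
      using c by (simp add: \<theta>_def)
  qed
qed

end

section \<open>Comparison of initial states\<close>

text \<open>
  If \<open>g = \<phi> n - \<integral> \<phi>' n\<close>, that is \<open>dg = \<phi> dn\<close>, the increments of \<open>g\<close> are those of \<open>n\<close> weighted
  by values of \<open>\<phi>\<close>.
\<close>

lemma weighted_increment:
  fixes a n \<phi> :: "real \<Rightarrow> real"
  assumes a: "set_integrable lborel {0..H} a" and a0: "\<And>u. u \<in> {0..H} \<Longrightarrow> a u \<le> 0"
    and \<phi>: "\<And>s. s \<in> {0..H} \<Longrightarrow> \<phi> s = y0 + (LINT u:{0..s}|lborel. a u)"
    and an: "set_integrable lborel {0..H} (\<lambda>u. a u * n u)"
    and n: "\<And>u v. u \<le> v \<Longrightarrow> v \<le> H \<Longrightarrow> n u \<le> n v" "\<And>u. u < 0 \<Longrightarrow> n u = 0"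
    and uv: "u \<le> v" "v \<le> H"
  defines "\<psi> \<equiv> \<lambda>s. if s < 0 then y0 else \<phi> s"
    and "g \<equiv> \<lambda>s. if s < 0 then 0 else \<phi> s * n s - (LINT u:{0..s}|lborel. a u * n u)"
  shows "\<psi> v * (n v - n u) \<le> g v - g u" "g v - g u \<le> \<psi> u * (n v - n u)"
proof -
  \<comment> \<open>As \<open>a\<close> is non-positive and \<open>n\<close> is non-decreasing,
    \<open>n\<close> under the integral may be replaced by its value at either end of
    \<open>{p..q}\<close>.\<close>
  have J: "(\<phi> p - \<phi> q) * n p \<le> - (LINT w:{p..q}|lborel. a w * n w)" "- (LINT w:{p..q}|lborel. a w * n w) \<le> (\<phi> p - \<phi> q) * n q"
    if pq: "0 \<le> p" "p \<le> q" "q \<le> H" for p q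
  proof -
    have sub: "set_integrable lborel {p..q} f" if "set_integrable lborel {0..H} f" for f :: "real \<Rightarrow> real"
      using pq by (auto intro: set_integrable_subset[OF that])
    have d: "\<phi> p - \<phi> q = - (LINT w:{p..q}|lborel. a w)"
      using set_integral_split[OF a pq] pq by (simp add: \<phi>)
    have "(LINT w:{p..q}|lborel. a w * n w) \<le> (LINT w:{p..q}|lborel. a w * n p)"
      using sub[OF an] sub[OF a] pq a0 n(1) by (intro set_integral_mono set_integrable_mult_left) (auto intro!: mult_left_mono_neg)
    moreover have "(LINT w:{p..q}|lborel. a w * n q) \<le> (LINT w:{p..q}|lborel. a w * n w)"
      using sub[OF an] sub[OF a] pq a0 n(1) by (intro set_integral_mono set_integrable_mult_left) (auto intro!: mult_left_mono_neg)
    ultimately show "(\<phi> p - \<phi> q) * n p \<le> - (LINT w:{p..q}|lborel. a w * n w)" "- (LINT w:{p..q}|lborel. a w * n w) \<le> (\<phi> p - \<phi> q) * n q"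
      by (simp_all add: d)
  qed
  consider "v < 0" | "u < 0" "0 \<le> v" | "0 \<le> u" using uv by linarith
  then have "\<psi> v * (n v - n u) \<le> g v - g u \<and> g v - g u \<le> \<psi> u * (n v - n u)"
  proof cases
    case 1
    then show ?thesis using uv n(2) by (simp add: g_def)
  next
    \<comment> \<open>The interval contains the jump of \<open>n\<close> at 0, which
      \<open>g\<close> weights by \<open>\<phi> 0 = y0\<close>. The lower bound uses that
      \<open>(\<phi> 0 - \<phi> v) * n 0\<close> is non-negative.\<close>
    case 2
    have \<phi>0: "\<phi> 0 = y0" using \<phi>[of 0] 2 uv by simp
    have n0: "0 \<le> n 0" using n(1)[of "-1" 0] n(2)[of "-1"] 2 uv by simp
    have "\<phi> v \<le> \<phi> 0"
    proof -
      have "0 \<le> (LINT w:{0..v}|lborel. - a w)" using a0 uv by (intro set_integral_nonneg_real) auto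
      moreover have "(LINT w:{0..v}|lborel. - a w) = - (LINT w:{0..v}|lborel. a w)"
        using uv by (intro set_integral_uminus set_integrable_subset[OF a]) auto
      ultimately show ?thesis using \<phi>[of v] \<phi>0 2 uv by simp
    qed
    then have "0 \<le> (\<phi> 0 - \<phi> v) * n 0" using n0 by simp
    then show ?thesis using J[of 0 v] 2 uv n(2)[of u] by (simp add: \<psi>_def g_def \<phi>0 algebra_simps)
  next
    case 3
    then have "g v - g u = \<phi> v * n v - \<phi> u * n u + - (LINT w:{u..v}|lborel. a w * n w)"
      using set_integral_split[OF an 3 uv] uv by (simp add: g_def)
    then show ?thesis using J[OF 3 uv] 3 uv by (simp add: \<psi>_def algebra_simps)
  qed
  then show "\<psi> v * (n v - n u) \<le> g v - g u" "g v - g u \<le> \<psi> u * (n v - n u)" by auto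
qed

section \<open>Construction of the lower state and its control\<close>

context singular_control_game
begin

text \<open>As \<open>\<sigma>\<close> is constant, the Ito integral of the given solution also
  serves the new one. With the control unchanged, the difference \<open>D\<close> of the states
  solves an ordinary equation along each path.\<close>

lemma lower_initial_state_UNIV:
  assumes U: "\<O> = UNIV" and H: "0 \<le> H" and adm: "admissible H x2 \<nu> X \<nu>p \<nu>m" and x: "x1 < x2"
  obtains X' where "admissible H x1 \<nu> X' \<nu>p \<nu>m" "\<And>\<omega> s. \<omega> \<in> space M \<Longrightarrow> s \<in> {0..H} \<Longrightarrow> X' s \<omega> \<le> X s \<omega>"
proof -
  have sol: "controlled_solution M F W \<O> \<mu> \<sigma> H x2 \<nu> X" using adm by (simp add: admissible_def)
  note Xp = solution_progressive[OF H sol]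
  obtain L where L: "0 < L" "\<And>y z. \<bar>drift y - drift z\<bar> \<le> L * \<bar>y - z\<bar>" "\<And>y z. \<bar>\<sigma> y - \<sigma> z\<bar> \<le> L * \<bar>y - z\<bar>"
    using lipschitz_coefficients by blast
  have dm: "drift y = \<mu> y" for y unfolding drift_def proj_def by (simp add: U)
  define f where "f u \<omega> y = drift (X u \<omega>) - drift (X u \<omega> - y)" for u \<omega> y
  have flip: "\<bar>f u \<omega> y - f u \<omega> y'\<bar> \<le> L * \<bar>y - y'\<bar>" for u \<omega> y y'
    using L(2)[of "X u \<omega> - y'" "X u \<omega> - y"] by (simp add: f_def)
  have fprog: "progressive F H (\<lambda>u \<omega>. f u \<omega> (Z u \<omega>))" if "progressive F H Z" for Z
    unfolding f_def using Xp that by (rule progressive_comp2) measurable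
  obtain D where D: "progressive F H D" "\<And>\<omega>. \<omega> \<in> space M \<Longrightarrow> continuous_on {0..H} (\<lambda>s. D s \<omega>)"
    "\<And>\<omega>. \<omega> \<in> space M \<Longrightarrow> set_integrable lborel {0..H} (\<lambda>u. f u \<omega> (D u \<omega>))"
    "\<And>\<omega> s. \<omega> \<in> space M \<Longrightarrow> s \<in> {0..H} \<Longrightarrow> D s \<omega> = (x2 - x1) + (LINT u:{0..s}|lborel. f u \<omega> (D u \<omega>))"
    by (rule random_ode[OF filtration_F L(1) flip _ fprog, where ?y0.0="x2 - x1"]) (auto simp: f_def)
  have Dpos: "0 < D s \<omega>" if "\<omega> \<in> space M" "s \<in> {0..H}" for s \<omega>
    by (rule integral_equation_positive[OF D(4)[OF that(1)] D(3)[OF that(1)] D(2)[OF that(1)] _ L(1) _ that(2)])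
      (use flip[of _ \<omega> _ 0] x in \<open>auto simp: f_def\<close>)
  define X' where "X' s \<omega> = (if s < 0 then x1 else X s \<omega> - D s \<omega>)" for s \<omega>
  obtain I where I: "has_ito_integral M F W H (\<lambda>s \<omega>. \<sigma> (X s \<omega>)) I"
    "AE \<omega> in M. \<forall>s\<in>{0..exit_time \<O> H X \<omega>}. X s \<omega> = x2 + (LINT u:{0..s}|lborel. \<mu> (X u \<omega>)) + I s \<omega> + \<nu> s \<omega>"
    using sol unfolding controlled_solution_def by blast
  have "controlled_solution M F W \<O> \<mu> \<sigma> H x1 \<nu> X'"
    unfolding controlled_solution_def
  proof (intro conjI ballI allI impI)
    show "adapted_upto F H X'"
      unfolding adapted_upto_def
    proof
      fix s assume s: "s \<in> {0..H}"
      then have "X' s = (\<lambda>\<omega>. X s \<omega> - D s \<omega>)" by (auto simp: X'_def)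
      then show "X' s \<in> borel_measurable (F s)"
        using adaptedD[OF progressive_adapted[OF Xp] s] adaptedD[OF progressive_adapted[OF D(1)] s] by simp
    qed
    fix \<omega> assume \<omega>: "\<omega> \<in> space M"
    show "X' s \<omega> = x1" if "s < 0" for s using that by (simp add: X'_def)
    show "cadlag_upto H (\<lambda>s. X' s \<omega>)"
      by (rule cadlag_cong[OF cadlag_diff[OF solution_cadlag[OF H sol \<omega>] cadlag_continuous[OF D(2)[OF \<omega>]]]]) (simp add: X'_def)
    show "X' s \<omega> = 0" if "s \<in> {exit_time \<O> H X' \<omega><..H}" for s using that U by (simp add: exit_time_UNIV)
  next
    show "\<exists>I. has_ito_integral M F W H (\<lambda>s \<omega>. \<sigma> (X' s \<omega>)) I \<and>
        (AE \<omega> in M. \<forall>s\<in>{0..exit_time \<O> H X' \<omega>}. X' s \<omega> = x1 + (LINT u:{0..s}|lborel. \<mu> (X' u \<omega>)) + I s \<omega> + \<nu> s \<omega>)"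
    proof (intro exI[of _ I] conjI)
      have "UNIV \<noteq> {0::real<..}" by (metis UNIV_I greaterThan_iff less_irrefl)
      then obtain \<sigma>0 where "\<forall>x. \<sigma> x = \<sigma>0" using dynamics U by (auto simp: dynamics_assumptions_def)
      then have "(\<lambda>s \<omega>. \<sigma> (X' s \<omega>)) = (\<lambda>s \<omega>. \<sigma> (X s \<omega>))" by simp
      then show "has_ito_integral M F W H (\<lambda>s \<omega>. \<sigma> (X' s \<omega>)) I" using I(1) by (simp only:)
      show "AE \<omega> in M. \<forall>s\<in>{0..exit_time \<O> H X' \<omega>}. X' s \<omega> = x1 + (LINT u:{0..s}|lborel. \<mu> (X' u \<omega>)) + I s \<omega> + \<nu> s \<omega>"
        using I(2) AE_space
      proof eventually_elim
        fix \<omega> assume \<omega>: "\<omega> \<in> space M"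
          and e: "\<forall>s\<in>{0..exit_time \<O> H X \<omega>}. X s \<omega> = x2 + (LINT u:{0..s}|lborel. \<mu> (X u \<omega>)) + I s \<omega> + \<nu> s \<omega>"
        obtain B where B: "0 \<le> B" "\<And>u. u \<in> {0..H} \<Longrightarrow> \<bar>X u \<omega>\<bar> \<le> B"
          using cadlag_bounded[OF solution_cadlag[OF H sol \<omega>]] by blast
        show "\<forall>s\<in>{0..exit_time \<O> H X' \<omega>}. X' s \<omega> = x1 + (LINT u:{0..s}|lborel. \<mu> (X' u \<omega>)) + I s \<omega> + \<nu> s \<omega>"
        proof
          fix s assume "s \<in> {0..exit_time \<O> H X' \<omega>}"
          then have s: "s \<in> {0..H}" "s \<in> {0..exit_time \<O> H X \<omega>}" using U by (auto simp: exit_time_UNIV)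
          have "set_integrable lborel {0..s} (\<lambda>u. drift (X u \<omega>))"
          proof (rule set_integrable_bounded)
            show "set_borel_measurable lborel {0..s} (\<lambda>u. drift (X u \<omega>))"
              using s by (intro solution_path_measurable[OF H sol drift_measurable \<omega>]) auto
            fix u assume "u \<in> {0..s}"
            then have "L * \<bar>X u \<omega>\<bar> \<le> L * B" using B(2)[of u] s L(1) by (intro mult_left_mono) auto
            then show "\<bar>drift (X u \<omega>)\<bar> \<le> \<bar>drift 0\<bar> + L * B"
              using L(2)[of "X u \<omega>" 0] unfolding diff_0_right by linarith
          qed
          moreover have "set_integrable lborel {0..s} (\<lambda>u. f u \<omega> (D u \<omega>))"
            using s by (auto intro: set_integrable_subset[OF D(3)[OF \<omega>]])
          ultimately have "(LINT u:{0..s}|lborel. drift (X u \<omega>)) - (LINT u:{0..s}|lborel. f u \<omega> (D u \<omega>))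
              = (LINT u:{0..s}|lborel. drift (X u \<omega>) - f u \<omega> (D u \<omega>))" by (rule set_integral_diff(2)[symmetric])
          also have "\<dots> = (LINT u:{0..s}|lborel. \<mu> (X' u \<omega>))"
            by (intro set_lebesgue_integral_cong) (auto simp: f_def X'_def dm)
          finally show "X' s \<omega> = x1 + (LINT u:{0..s}|lborel. \<mu> (X' u \<omega>)) + I s \<omega> + \<nu> s \<omega>"
            using e s D(4)[OF \<omega> s(1)] by (simp add: X'_def dm)
        qed
      qed
    qed
  qed
  then have "admissible H x1 \<nu> X' \<nu>p \<nu>m" using adm by (simp add: admissible_def)
  moreover have "X' s \<omega> \<le> X s \<omega>" if "\<omega> \<in> space M" "s \<in> {0..H}" for \<omega> s
    using Dpos[OF that] that by (simp add: X'_def)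
  ultimately show thesis using that by blast
qed

text \<open>The order of the states is claimed only before \<open>H\<close>: there \<open>X\<close>
  is non-negative, so a factor below 1 lowers it, whereas a negative terminal value would be
  raised.\<close>

lemma lower_initial_state_pos:
  assumes P: "\<O> = {0<..}" and H: "0 \<le> H" and adm: "admissible H x2 \<nu> X \<nu>p \<nu>m" and x: "0 < x1" "x1 < x2"
  obtains \<nu>' X' \<nu>p' \<nu>m' where "admissible H x1 \<nu>' X' \<nu>p' \<nu>m'"
    "\<And>\<omega>. \<omega> \<in> space M \<Longrightarrow> exit_time \<O> H X' \<omega> = exit_time \<O> H X \<omega>"
    "\<And>\<omega> s. \<omega> \<in> space M \<Longrightarrow> s \<in> {0..<H} \<Longrightarrow> X' s \<omega> \<le> X s \<omega>"
    "\<And>\<omega> s. \<omega> \<in> space M \<Longrightarrow> s \<in> {0..H} \<Longrightarrow> \<nu>p' s \<omega> + \<nu>m' s \<omega> \<le> \<nu>p s \<omega> + \<nu>m s \<omega>"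
proof -
  have sol: "controlled_solution M F W \<O> \<mu> \<sigma> H x2 \<nu> X" using adm by (simp add: admissible_def)
  have ad: "adapted_upto F H \<nu>p" "adapted_upto F H \<nu>m"
    and jd: "\<And>\<omega>. \<omega> \<in> space M \<Longrightarrow> jordan_decomposition H (\<lambda>s. \<nu> s \<omega>) (\<lambda>s. \<nu>p s \<omega>) (\<lambda>s. \<nu>m s \<omega>)"
    and cd: "\<And>\<omega>. \<omega> \<in> space M \<Longrightarrow> cadlag_upto H (\<lambda>s. \<nu>p s \<omega>)" "\<And>\<omega>. \<omega> \<in> space M \<Longrightarrow> cadlag_upto H (\<lambda>s. \<nu>m s \<omega>)"
    and sq: "integrable M (\<lambda>\<omega>. (\<nu>p H \<omega>)\<^sup>2)" "integrable M (\<lambda>\<omega>. (\<nu>m H \<omega>)\<^sup>2)"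
    using adm by (auto simp: admissible_def)
  note Xp = solution_progressive[OF H sol]
  have np: "progressive F H \<nu>p" "progressive F H \<nu>m"
    using progressive_cadlag[OF filtration_F ad(1) cd(1)] progressive_cadlag[OF filtration_F ad(2) cd(2)] by auto
  obtain L where L: "0 < L" "\<And>y z. \<bar>drift y - drift z\<bar> \<le> L * \<bar>y - z\<bar>" "\<And>y z. \<bar>\<sigma> y - \<sigma> z\<bar> \<le> L * \<bar>y - z\<bar>"
    using lipschitz_coefficients by blast
  have nU: "\<O> \<noteq> UNIV" using P by (metis UNIV_I greaterThan_iff less_irrefl)
  then have pr: "proj y = max 0 y" for y by (simp add: proj_def)
  have "\<mu> 0 = 0" using dynamics P by (simp add: dynamics_assumptions_def)
  then have dneg: "drift y = 0" if "y \<le> 0" for y using that by (simp add: drift_def pr)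
  have dlin: "\<bar>drift y\<bar> \<le> L * \<bar>y\<bar>" for y using L(2)[of y 0] dneg[of 0] by simp
  \<comment> \<open>Solves \<open>y * drift X + f * X = drift (y * X)\<close> for \<open>f\<close>.
    Where \<open>X\<close> is non-positive the value 0 keeps this identity for positive
    \<open>y\<close>, since \<open>drift\<close> vanishes on non-positive arguments.\<close>
  define f where "f u \<omega> y = (if X u \<omega> \<le> 0 then 0 else (drift (y * X u \<omega>) - y * drift (X u \<omega>)) / X u \<omega>)" for u \<omega> y
  \<comment> \<open>Dividing by \<open>X\<close> is harmless: when \<open>y\<close> changes, each of
    the two terms of the numerator changes by at most \<open>L * X\<close> times the change of
    \<open>y\<close>. This accounts for the constant \<open>2 * L\<close>.\<close>
  have flip: "\<bar>f u \<omega> y - f u \<omega> y'\<bar> \<le> 2 * L * \<bar>y - y'\<bar>" for u \<omega> y y'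
  proof (cases "X u \<omega> \<le> 0")
    case False
    define z where "z = X u \<omega>"
    have z: "0 < z" using False by (simp add: z_def)
    have "\<bar>(drift (y * z) - drift (y' * z)) - (y - y') * drift z\<bar> \<le> \<bar>drift (y * z) - drift (y' * z)\<bar> + \<bar>(y - y') * drift z\<bar>"
      by (rule abs_triangle_ineq4)
    also have "\<dots> \<le> L * \<bar>y * z - y' * z\<bar> + \<bar>y - y'\<bar> * (L * \<bar>z\<bar>)"
      unfolding abs_mult using L(2) dlin by (intro add_mono mult_left_mono) auto
    also have "\<dots> = (2 * L * \<bar>y - y'\<bar>) * z" using z by (simp add: left_diff_distrib[symmetric] abs_mult)
    finally have "\<bar>(drift (y * z) - drift (y' * z)) - (y - y') * drift z\<bar> / z \<le> 2 * L * \<bar>y - y'\<bar>"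
      using z by (simp add: pos_divide_le_eq)
    moreover have "f u \<omega> y - f u \<omega> y' = ((drift (y * z) - drift (y' * z)) - (y - y') * drift z) / z"
      using z by (simp add: f_def z_def[symmetric] field_simps)
    ultimately show ?thesis using z by (simp add: abs_divide)
  qed (use L(1) in \<open>simp add: f_def\<close>)
  have f0: "f u \<omega> 0 = 0" for u \<omega> using dneg[of 0] by (simp add: f_def)
  have f1: "f u \<omega> 1 = 0" for u \<omega> by (simp add: f_def)
  have fprog: "progressive F H (\<lambda>u \<omega>. f u \<omega> (Z u \<omega>))" if "progressive F H Z" for Z
    unfolding f_def using Xp that by (rule progressive_comp2) measurable
  define y0 where "y0 = x1 / x2"
  have y0: "0 < y0" "y0 < 1" "y0 * x2 = x1" using x by (auto simp: y0_def)
  have L2: "0 < 2 * L" using L(1) by simp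
  obtain \<phi> where \<phi>: "progressive F H \<phi>" "\<And>\<omega>. \<omega> \<in> space M \<Longrightarrow> continuous_on {0..H} (\<lambda>s. \<phi> s \<omega>)"
    "\<And>\<omega>. \<omega> \<in> space M \<Longrightarrow> set_integrable lborel {0..H} (\<lambda>u. f u \<omega> (\<phi> u \<omega>))"
    "\<And>\<omega> s. \<omega> \<in> space M \<Longrightarrow> s \<in> {0..H} \<Longrightarrow> \<phi> s \<omega> = y0 + (LINT u:{0..s}|lborel. f u \<omega> (\<phi> u \<omega>))"
    by (rule random_ode[OF filtration_F L2 flip f0 fprog, where ?y0.0=y0]) auto
  define a where "a u \<omega> = f u \<omega> (\<phi> u \<omega>)" for u \<omega>
  have ap: "progressive F H a" unfolding a_def[abs_def] by (rule fprog[OF \<phi>(1)])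
  have ai: "set_integrable lborel {0..H} (\<lambda>u. a u \<omega>)" if "\<omega> \<in> space M" for \<omega> using \<phi>(3)[OF that] by (simp add: a_def)
  have \<phi>eq: "\<phi> s \<omega> = y0 + (LINT u:{0..s}|lborel. a u \<omega>)" if "\<omega> \<in> space M" "s \<in> {0..H}" for \<omega> s
    using \<phi>(4)[OF that] by (simp add: a_def)
  have \<phi>pos: "0 < \<phi> s \<omega>" if "\<omega> \<in> space M" "s \<in> {0..H}" for s \<omega>
    by (rule integral_equation_positive[OF \<phi>(4)[OF that(1)] \<phi>(3)[OF that(1)] \<phi>(2)[OF that(1)] _ L2 y0(1) that(2)])
      (use flip[of _ \<omega> _ 0] f0 in auto)
  \<comment> \<open>The constant 1 solves the equation for \<open>\<phi>\<close>, so
    \<open>1 - \<phi>\<close> satisfies an equation of the same kind with density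
    \<open>- a\<close>, and it starts at \<open>1 - y0 > 0\<close>.\<close>
  have \<phi>1: "\<phi> s \<omega> < 1" if \<omega>: "\<omega> \<in> space M" and s: "s \<in> {0..H}" for s \<omega>
  proof -
    have "0 < 1 - \<phi> s \<omega>"
    proof (rule integral_equation_positive[OF _ _ _ _ L2 _ s])
      show "set_integrable lborel {0..H} (\<lambda>u. - a u \<omega>)" using ai[OF \<omega>] by (simp add: set_integrable_def)
      show "1 - \<phi> s \<omega> = (1 - y0) + (LINT u:{0..s}|lborel. - a u \<omega>)" if "s \<in> {0..H}" for s
      proof -
        have "(LINT u:{0..s}|lborel. - a u \<omega>) = - (LINT u:{0..s}|lborel. a u \<omega>)"
          using that by (intro set_integral_uminus set_integrable_subset[OF ai[OF \<omega>]]) auto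
        then show ?thesis using \<phi>eq[OF \<omega> that] by simp
      qed
      show "continuous_on {0..H} (\<lambda>s. 1 - \<phi> s \<omega>)" using \<phi>(2)[OF \<omega>] by (intro continuous_intros)
      show "\<bar>- a u \<omega>\<bar> \<le> 2 * L * \<bar>1 - \<phi> u \<omega>\<bar>" for u
        using flip[of u \<omega> "\<phi> u \<omega>" 1] f1[of u \<omega>] by (simp add: a_def abs_minus_commute)
    qed (use y0 in simp)
    then show ?thesis by simp
  qed
  have ab: "\<bar>a u \<omega>\<bar> \<le> 2 * L" if "\<omega> \<in> space M" "u \<in> {0..H}" for u \<omega>
  proof -
    have "\<bar>a u \<omega>\<bar> \<le> 2 * L * \<bar>\<phi> u \<omega>\<bar>" using flip[of u \<omega> "\<phi> u \<omega>" 0] f0 by (simp add: a_def)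
    also have "\<dots> \<le> 2 * L * 1" using \<phi>pos[OF that] \<phi>1[OF that] L(1) by (intro mult_left_mono) auto
    finally show ?thesis by simp
  qed
  have a0: "a u \<omega> \<le> 0" if "\<omega> \<in> space M" "u \<in> {0..H}" for u \<omega>
  proof (cases "X u \<omega> \<le> 0")
    case False
    have "\<mu> (\<phi> u \<omega> * X u \<omega>) \<le> \<phi> u \<omega> * \<mu> (X u \<omega>)"
      using \<phi>pos[OF that] \<phi>1[OF that] False by (intro mu_subhomogeneous[OF P]) auto
    moreover have "0 < \<phi> u \<omega> * X u \<omega>" using \<phi>pos[OF that] False by simp
    ultimately have "drift (\<phi> u \<omega> * X u \<omega>) - \<phi> u \<omega> * drift (X u \<omega>) \<le> 0"
      using False by (simp add: drift_def pr)
    then show ?thesis using False by (simp add: a_def f_def divide_le_0_iff)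
  qed (simp add: a_def f_def)
  have key: "\<phi> u \<omega> * drift (X u \<omega>) + a u \<omega> * X u \<omega> = drift (\<phi> u \<omega> * X u \<omega>)" if "\<omega> \<in> space M" "u \<in> {0..H}" for u \<omega>
  proof (cases "X u \<omega> \<le> 0")
    case True
    then have "\<phi> u \<omega> * X u \<omega> \<le> 0" using \<phi>pos[OF that] by (simp add: mult_le_0_iff)
    then show ?thesis using True dneg by (simp add: a_def f_def)
  qed (simp add: a_def f_def)
  have nneg: "0 \<le> \<nu>p s \<omega>" "0 \<le> \<nu>m s \<omega>" if "\<omega> \<in> space M" "s \<le> H" for s \<omega>
    using jordan_decompositionD(7,8)[OF jd[OF that(1)]] that(2) by auto
  have nmono: "\<nu>p u \<omega> \<le> \<nu>p v \<omega>" "\<nu>m u \<omega> \<le> \<nu>m v \<omega>" if "\<omega> \<in> space M" "u \<le> v" "v \<le> H" for u v \<omega>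
    using jordan_decompositionD(3,4)[OF jd[OF that(1)]] that by auto
  have nz: "\<nu>p s \<omega> = 0" "\<nu>m s \<omega> = 0" if "\<omega> \<in> space M" "s < 0" for s \<omega>
    using jordan_decompositionD(1,2)[OF jd[OF that(1)]] that by auto
  have anp: "progressive F H (\<lambda>u \<omega>. a u \<omega> * n u \<omega>)" if "progressive F H n" for n :: "'a process"
    using ap that by (rule progressive_comp2) measurable
  have ani: "set_integrable lborel {0..H} (\<lambda>u. a u \<omega> * n u \<omega>) \<and> (\<exists>B. \<forall>u\<in>{0..H}. \<bar>a u \<omega> * n u \<omega>\<bar> \<le> B)"
    if \<omega>: "\<omega> \<in> space M" and n: "progressive F H n" "cadlag_upto H (\<lambda>s. n s \<omega>)" for n :: "'a process" and \<omega>
  proof -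
    obtain B where B: "0 \<le> B" "\<And>u. u \<in> {0..H} \<Longrightarrow> \<bar>n u \<omega>\<bar> \<le> B" using cadlag_bounded[OF n(2)] by blast
    have b: "\<bar>a u \<omega> * n u \<omega>\<bar> \<le> 2 * L * B" if "u \<in> {0..H}" for u
      unfolding abs_mult using ab[OF \<omega> that] B(2)[OF that] L(1) by (intro mult_mono) auto
    have "set_borel_measurable lborel {0..H} (\<lambda>u. a u \<omega> * n u \<omega>)"
      by (rule progressive_path(2)[OF anp[OF n(1)] H order_refl]) (simp add: space_F \<omega>)
    then have "set_integrable lborel {0..H} (\<lambda>u. a u \<omega> * n u \<omega>)" using b by (rule set_integrable_bounded)
    then show ?thesis using b by blast
  qed
  \<comment> \<open>The Stieltjes integral of \<open>\<phi>\<close> against \<open>n\<close> over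
    \<open>{0..s}\<close>, written by parts. At \<open>s = 0\<close> it equals
    \<open>\<phi> 0 * n 0\<close>, so the initial jump is included.\<close>
  define tr where "tr n s \<omega> = (if s < 0 then 0 else \<phi> s \<omega> * n s \<omega> - (LINT u:{0..s}|lborel. a u \<omega> * n u \<omega>))" for n :: "'a process" and s \<omega>
  \<comment> \<open>Continues \<open>\<phi>\<close> before time 0 by its initial value, so that
    increments across 0 are weighted correctly too.\<close>
  define \<psi> where "\<psi> s \<omega> = (if s < 0 then y0 else \<phi> s \<omega>)" for s \<omega>
  have tra: "adapted_upto F H (tr n)" if n: "progressive F H n" for n
    unfolding adapted_upto_def
  proof
    fix s assume s: "s \<in> {0..H}"
    have "(\<lambda>\<omega>. \<phi> s \<omega> * n s \<omega> - (LINT u:{0..s}|lborel. a u \<omega> * n u \<omega>)) \<in> borel_measurable (F s)"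
      using adaptedD[OF progressive_adapted[OF \<phi>(1)] s] adaptedD[OF progressive_adapted[OF n] s]
        adaptedD[OF progressive_set_integral[OF anp[OF n]] s] by (intro borel_measurable_diff borel_measurable_times)
    moreover have "tr n s = (\<lambda>\<omega>. \<phi> s \<omega> * n s \<omega> - (LINT u:{0..s}|lborel. a u \<omega> * n u \<omega>))" using s by (auto simp: tr_def)
    ultimately show "tr n s \<in> borel_measurable (F s)" by (simp only:)
  qed
  have trc: "cadlag_upto H (\<lambda>s. tr n s \<omega>)" if \<omega>: "\<omega> \<in> space M" and n: "progressive F H n" "cadlag_upto H (\<lambda>s. n s \<omega>)" for n \<omega>
  proof (rule cadlag_cong)
    have "continuous_on {0..H} (\<lambda>s. LINT u:{0..s}|lborel. a u \<omega> * n u \<omega>)"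
      using ani[OF that] set_integral_continuous_on by blast
    then show "cadlag_upto H (\<lambda>s. \<phi> s \<omega> * n s \<omega> - (LINT u:{0..s}|lborel. a u \<omega> * n u \<omega>))"
      using \<phi>(2)[OF \<omega>] n(2) by (intro cadlag_diff cadlag_mult) (auto intro: cadlag_continuous)
  qed (simp add: tr_def)
  define \<nu>' where "\<nu>' s \<omega> = tr \<nu>p s \<omega> - tr \<nu>m s \<omega>" for s \<omega>
  define X' where "X' s \<omega> = (if s < 0 then x1 else \<phi> s \<omega> * X s \<omega>)" for s \<omega>
  have inc: "\<psi> v \<omega> * (n v \<omega> - n u \<omega>) \<le> tr n v \<omega> - tr n u \<omega>" "tr n v \<omega> - tr n u \<omega> \<le> \<psi> u \<omega> * (n v \<omega> - n u \<omega>)"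
    if \<omega>: "\<omega> \<in> space M" and n: "progressive F H n" "cadlag_upto H (\<lambda>s. n s \<omega>)"
      "\<And>u v. u \<le> v \<Longrightarrow> v \<le> H \<Longrightarrow> n u \<omega> \<le> n v \<omega>" "\<And>u. u < 0 \<Longrightarrow> n u \<omega> = 0" and uv: "u \<le> v" "v \<le> H" for n u v \<omega>
    using weighted_increment[OF ai[OF \<omega>] a0[OF \<omega>] \<phi>eq[OF \<omega>] conjunct1[OF ani[OF \<omega> n(1,2)]] n(3,4) uv]
    unfolding \<psi>_def tr_def by auto
  have incp: "\<psi> v \<omega> * (\<nu>p v \<omega> - \<nu>p u \<omega>) \<le> tr \<nu>p v \<omega> - tr \<nu>p u \<omega>" "tr \<nu>p v \<omega> - tr \<nu>p u \<omega> \<le> \<psi> u \<omega> * (\<nu>p v \<omega> - \<nu>p u \<omega>)"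
    and incm: "\<psi> v \<omega> * (\<nu>m v \<omega> - \<nu>m u \<omega>) \<le> tr \<nu>m v \<omega> - tr \<nu>m u \<omega>" "tr \<nu>m v \<omega> - tr \<nu>m u \<omega> \<le> \<psi> u \<omega> * (\<nu>m v \<omega> - \<nu>m u \<omega>)"
    if \<omega>: "\<omega> \<in> space M" and uv: "u \<le> v" "v \<le> H" for u v \<omega>
    using inc[OF \<omega> np(1) cd(1)[OF \<omega>] nmono(1)[OF \<omega>] nz(1)[OF \<omega>] uv] inc[OF \<omega> np(2) cd(2)[OF \<omega>] nmono(2)[OF \<omega>] nz(2)[OF \<omega>] uv]
    by auto
  have \<psi>r: "0 \<le> \<psi> s \<omega>" "\<psi> s \<omega> \<le> 1" if "\<omega> \<in> space M" "s \<le> H" for s \<omega>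
    using \<phi>pos[OF that(1), of s] \<phi>1[OF that(1), of s] y0 that(2) by (auto simp: \<psi>_def)
  have \<psi>L: "\<psi> u \<omega> - \<psi> v \<omega> \<le> 2 * L * (v - u)" "\<psi> v \<omega> \<le> \<psi> u \<omega>" if \<omega>: "\<omega> \<in> space M" and uv: "u \<le> v" "v \<le> H" for u v \<omega>
  proof -
    have *: "\<phi> u \<omega> - \<phi> v \<omega> \<le> 2 * L * (v - u) \<and> \<phi> v \<omega> \<le> \<phi> u \<omega>" if uv: "0 \<le> u" "u \<le> v" "v \<le> H" for u v
    proof -
      have "\<bar>\<phi> v \<omega> - \<phi> u \<omega>\<bar> \<le> 2 * L * (v - u)"
        using set_integral_lipschitz[OF ai[OF \<omega>] ab[OF \<omega>] uv] uv by (simp add: \<phi>eq[OF \<omega>])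
      moreover have "0 \<le> (LINT w:{u..v}|lborel. - a w \<omega>)" using a0[OF \<omega>] uv by (intro set_integral_nonneg_real) auto
      moreover have "(LINT w:{u..v}|lborel. - a w \<omega>) = - (LINT w:{u..v}|lborel. a w \<omega>)"
        using uv by (intro set_integral_uminus set_integrable_subset[OF ai[OF \<omega>]]) auto
      ultimately show ?thesis using set_integral_split[OF ai[OF \<omega>] uv] uv by (simp add: \<phi>eq[OF \<omega>])
    qed
    have \<phi>0: "\<phi> 0 \<omega> = y0" using \<phi>eq[OF \<omega>, of 0] H by simp
    consider "v < 0" | "u < 0" "0 \<le> v" | "0 \<le> u" using uv by linarith
    then have "\<psi> u \<omega> - \<psi> v \<omega> \<le> 2 * L * (v - u) \<and> \<psi> v \<omega> \<le> \<psi> u \<omega>"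
    proof cases
      case 2
      have "2 * L * v \<le> 2 * L * (v - u)" using 2 L(1) by (intro mult_left_mono) auto
      then show ?thesis using *[of 0 v] 2 uv \<phi>0 by (simp add: \<psi>_def)
    qed (use * uv L(1) in \<open>auto simp: \<psi>_def\<close>)
    then show "\<psi> u \<omega> - \<psi> v \<omega> \<le> 2 * L * (v - u)" "\<psi> v \<omega> \<le> \<psi> u \<omega>" by auto
  qed
  \<comment> \<open>These are the increment bounds on the interval from -1 to \<open>s\<close>: at
    -1 all the functions are 0, and the upper weight is \<open>y0 < 1\<close>.\<close>
  have tr_le: "0 \<le> tr \<nu>p s \<omega>" "0 \<le> tr \<nu>m s \<omega>" "tr \<nu>p s \<omega> \<le> \<nu>p s \<omega>" "tr \<nu>m s \<omega> \<le> \<nu>m s \<omega>"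
    if \<omega>: "\<omega> \<in> space M" and s: "s \<in> {0..H}" for s \<omega>
  proof -
    have s': "-1 \<le> s" "s \<le> H" using s by auto
    have z: "tr \<nu>p (-1) \<omega> = 0" "tr \<nu>m (-1) \<omega> = 0" "\<nu>p (-1) \<omega> = 0" "\<nu>m (-1) \<omega> = 0" "\<psi> (-1) \<omega> = y0"
      using nz[OF \<omega>] by (auto simp: tr_def \<psi>_def)
    have "0 \<le> \<psi> s \<omega> * \<nu>p s \<omega>" "0 \<le> \<psi> s \<omega> * \<nu>m s \<omega>" using \<psi>r[OF \<omega> s'(2)] nneg[OF \<omega> s'(2)] by auto
    moreover have "y0 * \<nu>p s \<omega> \<le> \<nu>p s \<omega>" "y0 * \<nu>m s \<omega> \<le> \<nu>m s \<omega>"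
      using mult_right_mono[of y0 1] y0 nneg[OF \<omega> s'(2)] by auto
    ultimately show "0 \<le> tr \<nu>p s \<omega>" "0 \<le> tr \<nu>m s \<omega>" "tr \<nu>p s \<omega> \<le> \<nu>p s \<omega>" "tr \<nu>m s \<omega> \<le> \<nu>m s \<omega>"
      using incp[OF \<omega> s'] incm[OF \<omega> s'] unfolding z by auto
  qed
  have trsq: "integrable M (\<lambda>\<omega>. (tr n H \<omega>)\<^sup>2)"
    if "progressive F H n" "\<And>\<omega>. \<omega> \<in> space M \<Longrightarrow> 0 \<le> tr n H \<omega> \<and> tr n H \<omega> \<le> n H \<omega>" "integrable M (\<lambda>\<omega>. (n H \<omega>)\<^sup>2)" for n
  proof (rule Bochner_Integration.integrable_bound[OF that(3)])
    have "tr n H \<in> borel_measurable M" using adaptedD[OF tra[OF that(1)], of H] H measurable_F_M by auto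
    then show "(\<lambda>\<omega>. (tr n H \<omega>)\<^sup>2) \<in> borel_measurable M" by measurable
    show "AE \<omega> in M. norm ((tr n H \<omega>)\<^sup>2) \<le> norm ((n H \<omega>)\<^sup>2)" using that(2) by (intro AE_I2) (auto intro: power_mono)
  qed
  have exX: "exit_time \<O> H X' \<omega> = exit_time \<O> H X \<omega>" if \<omega>: "\<omega> \<in> space M" for \<omega>
  proof -
    have "X' s \<omega> \<in> \<O> \<longleftrightarrow> X s \<omega> \<in> \<O>" if "s \<in> {0..H}" for s
      using zero_less_mult_pos[OF _ \<phi>pos[OF \<omega> that], of "X s \<omega>"] mult_pos_pos[OF \<phi>pos[OF \<omega> that], of "X s \<omega>"] that
      by (auto simp: X'_def P)
    then have "{s \<in> {0..H}. X' s \<omega> \<notin> \<O>} = {s \<in> {0..H}. X s \<omega> \<notin> \<O>}" by blast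
    then show ?thesis by (simp add: exit_time_def)
  qed
  obtain \<sigma>1 where \<sigma>1: "0 < \<sigma>1" "\<And>x. \<sigma> x = \<sigma>1 * x"
    using dynamics nU by (auto simp: dynamics_assumptions_def)
  obtain I where I: "has_ito_integral M F W H (\<lambda>s \<omega>. \<sigma> (X s \<omega>)) I"
    "AE \<omega> in M. \<forall>s\<in>{0..exit_time \<O> H X \<omega>}. X s \<omega> = x2 + (LINT u:{0..s}|lborel. \<mu> (X u \<omega>)) + I s \<omega> + \<nu> s \<omega>"
    using sol unfolding controlled_solution_def by blast
  have Ic: "continuous_on {0..H} (\<lambda>s. I s \<omega>)" if "\<omega> \<in> space M" for \<omega> using I(1) that by (auto simp: has_ito_integral_def)
  have "adapted_upto F H I" using I(1) by (auto simp: has_ito_integral_def)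
  then have Ip: "progressive F H I" using Ic by (rule progressive_continuous[OF filtration_F])
  define I' where "I' s \<omega> = \<phi> s \<omega> * I s \<omega> - (LINT u:{0..s}|lborel. a u \<omega> * I u \<omega>)" for s \<omega>
  have I': "has_ito_integral M F W H (\<lambda>s \<omega>. \<sigma> (X' s \<omega>)) I'"
  proof (rule has_ito_integral_cong)
    show "has_ito_integral M F W H (\<lambda>s \<omega>. \<phi> s \<omega> * \<sigma> (X s \<omega>)) I'"
      unfolding I'_def[abs_def]
    proof (rule ito_product[OF I(1) progressive_comp[OF Xp sigma_measurable] H _ ap _ ab \<phi>(1) _ \<phi>eq])
      show "\<bar>\<phi> u \<omega>\<bar> \<le> 1" if "\<omega> \<in> space M" "u \<in> {0..H}" for u \<omega> using \<phi>pos[OF that] \<phi>1[OF that] by simp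
      fix \<omega> assume "\<omega> \<in> space M"
      then obtain B where B: "0 \<le> B" "\<And>u. u \<in> {0..H} \<Longrightarrow> \<bar>X u \<omega>\<bar> \<le> B" using cadlag_bounded[OF solution_cadlag[OF H sol]] by blast
      show "\<exists>B. \<forall>u\<in>{0..H}. \<bar>\<sigma> (X u \<omega>)\<bar> \<le> B"
        using B(2) \<sigma>1(1) by (intro exI[of _ "\<sigma>1 * B"]) (auto simp: \<sigma>1(2) abs_mult)
    qed (use L(1) in auto)
  qed (simp add: X'_def \<sigma>1(2))
  have sol': "controlled_solution M F W \<O> \<mu> \<sigma> H x1 \<nu>' X'"
    unfolding controlled_solution_def
  proof (intro conjI ballI allI impI)
    show "adapted_upto F H X'"
      unfolding adapted_upto_def
    proof
      fix s assume s: "s \<in> {0..H}"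
      then have "X' s = (\<lambda>\<omega>. \<phi> s \<omega> * X s \<omega>)" by (auto simp: X'_def)
      then show "X' s \<in> borel_measurable (F s)"
        using adaptedD[OF progressive_adapted[OF Xp] s] adaptedD[OF progressive_adapted[OF \<phi>(1)] s] by simp
    qed
    fix \<omega> assume \<omega>: "\<omega> \<in> space M"
    show "X' s \<omega> = x1" if "s < 0" for s using that by (simp add: X'_def)
    show "cadlag_upto H (\<lambda>s. X' s \<omega>)"
      by (rule cadlag_cong[OF cadlag_mult[OF cadlag_continuous[OF \<phi>(2)[OF \<omega>]] solution_cadlag[OF H sol \<omega>]]]) (simp add: X'_def)
    show "X' s \<omega> = 0" if s: "s \<in> {exit_time \<O> H X' \<omega><..H}" for s
    proof -
      have "X s \<omega> = 0" using s exX[OF \<omega>] by (intro solution_absorbed[OF H sol \<omega>]) auto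
      moreover have "0 \<le> s" using s exit_time_ge[OF H, of \<O> X' \<omega>] by auto
      ultimately show ?thesis by (simp add: X'_def)
    qed
  next
    show "\<exists>I. has_ito_integral M F W H (\<lambda>s \<omega>. \<sigma> (X' s \<omega>)) I \<and>
        (AE \<omega> in M. \<forall>s\<in>{0..exit_time \<O> H X' \<omega>}. X' s \<omega> = x1 + (LINT u:{0..s}|lborel. \<mu> (X' u \<omega>)) + I s \<omega> + \<nu>' s \<omega>)"
    proof (intro exI[of _ I'] conjI I')
      show "AE \<omega> in M. \<forall>s\<in>{0..exit_time \<O> H X' \<omega>}. X' s \<omega> = x1 + (LINT u:{0..s}|lborel. \<mu> (X' u \<omega>)) + I' s \<omega> + \<nu>' s \<omega>"
        using I(2) AE_space
      proof eventually_elim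
        fix \<omega> assume \<omega>: "\<omega> \<in> space M"
          and e: "\<forall>s\<in>{0..exit_time \<O> H X \<omega>}. X s \<omega> = x2 + (LINT u:{0..s}|lborel. \<mu> (X u \<omega>)) + I s \<omega> + \<nu> s \<omega>"
        obtain B where B: "0 \<le> B" "\<And>u. u \<in> {0..H} \<Longrightarrow> \<bar>X u \<omega>\<bar> \<le> B"
          using cadlag_bounded[OF solution_cadlag[OF H sol \<omega>]] by blast
        have db: "\<bar>drift (X u \<omega>)\<bar> \<le> L * B" if "u \<in> {0..H}" for u
          using order_trans[OF dlin mult_left_mono[OF B(2)[OF that] less_imp_le[OF L(1)]]] .
        have dm: "set_borel_measurable lborel {0..H} (\<lambda>u. drift (X u \<omega>))"
          by (rule solution_path_measurable[OF H sol drift_measurable \<omega> H order_refl])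
        have di: "set_integrable lborel {0..H} (\<lambda>u. drift (X u \<omega>))" using dm db by (rule set_integrable_bounded)
        \<comment> \<open>The initial value and drift part of \<open>X\<close>. It splits
          \<open>\<phi> * X\<close> into three products: \<open>G\<close> is treated by the product
          rule, the noise by \<open>I'\<close> and the control by \<open>tr\<close>.\<close>
        define G where "G s = x2 + (LINT u:{0..s}|lborel. drift (X u \<omega>))" for s
        show "\<forall>s\<in>{0..exit_time \<O> H X' \<omega>}. X' s \<omega> = x1 + (LINT u:{0..s}|lborel. \<mu> (X' u \<omega>)) + I' s \<omega> + \<nu>' s \<omega>"
        proof
          fix s assume "s \<in> {0..exit_time \<O> H X' \<omega>}"
          then have s: "0 \<le> s" "s \<le> exit_time \<O> H X \<omega>" "s \<in> {0..H}"
            using exX[OF \<omega>] exit_time_le[of \<O> H X \<omega>] by auto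
          have Xeq: "X u \<omega> = G u + I u \<omega> + (\<nu>p u \<omega> - \<nu>m u \<omega>)" if "u \<in> {0..s}" for u
            using e that s solution_drift_integral[OF H sol \<omega>, of u] jordan_decompositionD(5)[OF jd[OF \<omega>], of u]
            by (auto simp: G_def)
          have sub: "set_integrable lborel {0..s} k" if "set_integrable lborel {0..H} k" for k :: "real \<Rightarrow> real"
            using s by (auto intro: set_integrable_subset[OF that])
          have Gc: "continuous_on {0..H} G"
            unfolding G_def using set_integral_continuous_on[OF di db] by (intro continuous_intros)
          have prod: "\<phi> s \<omega> * G s = y0 * x2 + (LINT u:{0..s}|lborel. \<phi> u \<omega> * drift (X u \<omega>) + a u \<omega> * G u)"
            by (rule integral_product_rule[OF ai[OF \<omega>] ab[OF \<omega>] di db \<phi>eq[OF \<omega>] _ s(3)]) (simp_all add: G_def)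
          have i1: "set_integrable lborel {0..s} (\<lambda>u. \<phi> u \<omega> * drift (X u \<omega>) + a u \<omega> * G u)"
          proof -
            obtain Q where Q: "0 \<le> Q" "\<And>u. u \<in> {0..H} \<Longrightarrow> \<bar>G u\<bar> \<le> Q" using continuous_bounded_Icc[OF Gc] by blast
            have "set_integrable lborel {0..H} (\<lambda>u. a u \<omega> * G u)"
            proof (rule set_integrable_bounded)
              show "set_borel_measurable lborel {0..H} (\<lambda>u. a u \<omega> * G u)"
                by (intro set_borel_measurable_mult set_borel_measurable_continuous_on Gc set_integrable_imp_measurable ai[OF \<omega>])
              show "\<bar>a u \<omega> * G u\<bar> \<le> 2 * L * Q" if "u \<in> {0..H}" for u
                unfolding abs_mult using ab[OF \<omega> that] Q(2)[OF that] L(1) by (intro mult_mono) auto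
            qed
            moreover have "set_integrable lborel {0..H} (\<lambda>u. \<phi> u \<omega> * drift (X u \<omega>))"
            proof (rule set_integrable_bounded)
              show "set_borel_measurable lborel {0..H} (\<lambda>u. \<phi> u \<omega> * drift (X u \<omega>))"
                by (intro set_borel_measurable_mult set_borel_measurable_continuous_on \<phi>(2)[OF \<omega>] dm)
              show "\<bar>\<phi> u \<omega> * drift (X u \<omega>)\<bar> \<le> 1 * (L * B)" if "u \<in> {0..H}" for u
                unfolding abs_mult using \<phi>pos[OF \<omega> that] \<phi>1[OF \<omega> that] db[OF that] by (intro mult_mono) auto
            qed
            ultimately show ?thesis by (intro sub set_integral_add)
          qed
          have iI: "set_integrable lborel {0..s} (\<lambda>u. a u \<omega> * I u \<omega>)" and ip: "set_integrable lborel {0..s} (\<lambda>u. a u \<omega> * \<nu>p u \<omega>)"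
            and im: "set_integrable lborel {0..s} (\<lambda>u. a u \<omega> * \<nu>m u \<omega>)"
            using ani[OF \<omega> Ip cadlag_continuous[OF Ic[OF \<omega>]]] ani[OF \<omega> np(1) cd(1)[OF \<omega>]] ani[OF \<omega> np(2) cd(2)[OF \<omega>]] by (auto intro: sub)
          \<comment> \<open>The time integrals produced by the three integrations by parts add up to
            the integral of \<open>a * X\<close>, and by \<open>key\<close> this completes
            \<open>\<phi> * drift X\<close> to the drift of the new state.\<close>
          have "(LINT u:{0..s}|lborel. \<phi> u \<omega> * drift (X u \<omega>) + a u \<omega> * G u) + (LINT u:{0..s}|lborel. a u \<omega> * I u \<omega>)
              + ((LINT u:{0..s}|lborel. a u \<omega> * \<nu>p u \<omega>) - (LINT u:{0..s}|lborel. a u \<omega> * \<nu>m u \<omega>))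
            = (LINT u:{0..s}|lborel. ((\<phi> u \<omega> * drift (X u \<omega>) + a u \<omega> * G u) + a u \<omega> * I u \<omega>) + (a u \<omega> * \<nu>p u \<omega> - a u \<omega> * \<nu>m u \<omega>))"
            using set_integral_add[OF set_integral_add(1)[OF i1 iI] set_integral_diff(1)[OF ip im]]
              set_integral_add(2)[OF i1 iI] set_integral_diff(2)[OF ip im] by (simp only:)
          also have "\<dots> = (LINT u:{0..s}|lborel. drift (\<phi> u \<omega> * X u \<omega>))"
          proof (rule set_lebesgue_integral_cong)
            show "\<forall>u. u \<in> {0..s} \<longrightarrow> ((\<phi> u \<omega> * drift (X u \<omega>) + a u \<omega> * G u) + a u \<omega> * I u \<omega>) + (a u \<omega> * \<nu>p u \<omega> - a u \<omega> * \<nu>m u \<omega>) = drift (\<phi> u \<omega> * X u \<omega>)"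
            proof (intro allI impI)
              fix u assume u: "u \<in> {0..s}"
              have "((\<phi> u \<omega> * drift (X u \<omega>) + a u \<omega> * G u) + a u \<omega> * I u \<omega>) + (a u \<omega> * \<nu>p u \<omega> - a u \<omega> * \<nu>m u \<omega>)
                = \<phi> u \<omega> * drift (X u \<omega>) + a u \<omega> * (G u + I u \<omega> + (\<nu>p u \<omega> - \<nu>m u \<omega>))" by (simp add: algebra_simps)
              also have "\<dots> = \<phi> u \<omega> * drift (X u \<omega>) + a u \<omega> * X u \<omega>" by (simp only: Xeq[OF u])
              also have "\<dots> = drift (\<phi> u \<omega> * X u \<omega>)" using u s by (intro key[OF \<omega>]) auto
              finally show "((\<phi> u \<omega> * drift (X u \<omega>) + a u \<omega> * G u) + a u \<omega> * I u \<omega>) + (a u \<omega> * \<nu>p u \<omega> - a u \<omega> * \<nu>m u \<omega>) = drift (\<phi> u \<omega> * X u \<omega>)" .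
            qed
          qed simp
          \<comment> \<open>\<open>drift\<close> and \<open>\<mu>\<close> agree on the closure,
            hence along the new state at all times except possibly \<open>H\<close>.\<close>
          also have "\<dots> = (LINT u:{0..s}|lborel. \<mu> (X' u \<omega>))"
          proof (rule set_integral_cong_point[where p=H, symmetric])
            fix u assume u: "u \<in> {0..s}" "u \<noteq> H"
            then have "0 \<le> X u \<omega>" using solution_in_closure[OF H sol \<omega>, of u] s P by auto
            then have "0 \<le> \<phi> u \<omega> * X u \<omega>" using \<phi>pos[OF \<omega>, of u] u s by auto
            then show "\<mu> (X' u \<omega>) = drift (\<phi> u \<omega> * X u \<omega>)" using u by (simp add: X'_def drift_def pr)
          next
            have "progressive F H (\<lambda>u \<omega>. drift (\<phi> u \<omega> * X u \<omega>))" using \<phi>(1) Xp by (rule progressive_comp2) measurable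
            then show "set_borel_measurable lborel {0..s} (\<lambda>u. drift (\<phi> u \<omega> * X u \<omega>))"
              by (rule progressive_path(2)) (use s in \<open>auto simp: space_F \<omega>\<close>)
          qed
          finally have int: "(LINT u:{0..s}|lborel. \<phi> u \<omega> * drift (X u \<omega>) + a u \<omega> * G u) + (LINT u:{0..s}|lborel. a u \<omega> * I u \<omega>)
              + ((LINT u:{0..s}|lborel. a u \<omega> * \<nu>p u \<omega>) - (LINT u:{0..s}|lborel. a u \<omega> * \<nu>m u \<omega>)) = (LINT u:{0..s}|lborel. \<mu> (X' u \<omega>))" .
          have "X' s \<omega> = \<phi> s \<omega> * (G s + I s \<omega> + (\<nu>p s \<omega> - \<nu>m s \<omega>))" using Xeq[of s] s by (simp add: X'_def)
          also have "\<dots> = \<phi> s \<omega> * G s + \<phi> s \<omega> * I s \<omega> + (\<phi> s \<omega> * \<nu>p s \<omega> - \<phi> s \<omega> * \<nu>m s \<omega>)" by (simp add: algebra_simps)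
          also have "\<dots> = x1 + (LINT u:{0..s}|lborel. \<mu> (X' u \<omega>)) + I' s \<omega> + \<nu>' s \<omega>"
            unfolding prod y0(3) int[symmetric] I'_def \<nu>'_def using s by (simp add: tr_def)
          finally show "X' s \<omega> = x1 + (LINT u:{0..s}|lborel. \<mu> (X' u \<omega>)) + I' s \<omega> + \<nu>' s \<omega>" .
        qed
      qed
    qed
  qed
  have jd': "jordan_decomposition H (\<lambda>s. \<nu>' s \<omega>) (\<lambda>s. tr \<nu>p s \<omega>) (\<lambda>s. tr \<nu>m s \<omega>)" if \<omega>: "\<omega> \<in> space M" for \<omega>
    unfolding \<nu>'_def
  proof (rule jordan_decomposition_weighted[OF jd[OF \<omega>] \<psi>r[OF \<omega>] \<psi>L(2)[OF \<omega>] \<psi>L(1)[OF \<omega>] _ _ _ incp[OF \<omega>] incm[OF \<omega>]])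
    show "0 \<le> 2 * L" using L(1) by simp
    show "tr \<nu>p s \<omega> = 0" "tr \<nu>m s \<omega> = 0" if "s < 0" for s using that by (auto simp: tr_def)
  qed
  have adm': "admissible H x1 \<nu>' X' (tr \<nu>p) (tr \<nu>m)"
    unfolding admissible_def
  proof (intro conjI ballI)
    show "integrable M (\<lambda>\<omega>. (tr \<nu>p H \<omega>)\<^sup>2)" "integrable M (\<lambda>\<omega>. (tr \<nu>m H \<omega>)\<^sup>2)"
      using trsq[OF np(1) _ sq(1)] trsq[OF np(2) _ sq(2)] tr_le H by auto
  qed (use sol' tra[OF np(1)] tra[OF np(2)] jd' trc[OF _ np(1) cd(1)] trc[OF _ np(2) cd(2)] in auto)
  have Xle: "X' s \<omega> \<le> X s \<omega>" if "\<omega> \<in> space M" "s \<in> {0..<H}" for s \<omega>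
  proof -
    have "0 \<le> X s \<omega>" using solution_in_closure[OF H sol that(1), of s] that(2) P by auto
    then show ?thesis using mult_right_mono[of "\<phi> s \<omega>" 1 "X s \<omega>"] \<phi>1[OF that(1), of s] that(2) by (simp add: X'_def)
  qed
  show thesis by (rule that[OF adm' exX Xle add_mono[OF tr_le(3,4)]])
qed

end

section \<open>Monotonicity of the value\<close>

context singular_control_game
begin

lemma controls_admissible:
  assumes "\<nu> \<in> controls M F W \<O> \<mu> \<sigma> T t x"
  obtains \<nu>p \<nu>m where "admissible (T - t) x \<nu> (state M F W \<O> \<mu> \<sigma> (T - t) x \<nu>) \<nu>p \<nu>m"
  using assms unfolding controls_def admissible_def Let_def by blast

text \<open>The given \<open>X\<close> shows that the choice in \<open>state\<close> has a witness.
  The chosen version is then a solution for the same decomposition, and its exit condition comes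
  from \<open>solution_at_exit\<close>.\<close>

lemma admissible_controls:
  assumes t: "t \<in> {0..T}" and adm: "admissible (T - t) x \<nu> X \<nu>p \<nu>m"
  shows "\<nu> \<in> controls M F W \<O> \<mu> \<sigma> T t x"
    and "admissible (T - t) x \<nu> (state M F W \<O> \<mu> \<sigma> (T - t) x \<nu>) \<nu>p \<nu>m"
proof -
  have H: "0 \<le> T - t" using t by simp
  have S: "controlled_solution M F W \<O> \<mu> \<sigma> (T - t) x \<nu> (state M F W \<O> \<mu> \<sigma> (T - t) x \<nu>)"
    unfolding state_def by (rule someI[of _ X]) (use adm in \<open>simp add: admissible_def\<close>)
  then show *: "admissible (T - t) x \<nu> (state M F W \<O> \<mu> \<sigma> (T - t) x \<nu>) \<nu>p \<nu>m"
    using adm by (simp add: admissible_def)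
  have "AE \<omega> in M. exit_time \<O> (T - t) (state M F W \<O> \<mu> \<sigma> (T - t) x \<nu>) \<omega> < T - t \<longrightarrow>
      state M F W \<O> \<mu> \<sigma> (T - t) x \<nu> (exit_time \<O> (T - t) (state M F W \<O> \<mu> \<sigma> (T - t) x \<nu>) \<omega>) \<omega> = 0"
    by (intro AE_I2 impI solution_at_exit[OF H S])
  then show "\<nu> \<in> controls M F W \<O> \<mu> \<sigma> T t x"
    using * unfolding controls_def admissible_def Let_def by blast
qed

lemma payoff_eq_gain:
  "payoff M F W \<O> \<mu> \<sigma> T r \<alpha>0 g h t x \<tau> \<nu> = expectation (\<lambda>\<omega>. gain t \<nu> (state M F W \<O> \<mu> \<sigma> (T - t) x \<nu>)
     (min (\<tau> \<omega>) (exit_time \<O> (T - t) (state M F W \<O> \<mu> \<sigma> (T - t) x \<nu>) \<omega>)) \<omega>)"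
  unfolding payoff_def gain_def Let_def ..

lemma cheaper_control:
  assumes t: "t \<in> {0..T}" and x: "x1 \<in> \<O>" "x1 < x2" and \<nu>: "\<nu> \<in> controls M F W \<O> \<mu> \<sigma> T t x2"
  obtains \<nu>' where "\<nu>' \<in> controls M F W \<O> \<mu> \<sigma> T t x1"
    "\<And>\<tau>. \<tau> \<in> stopping_times M F T t \<Longrightarrow>
      payoff M F W \<O> \<mu> \<sigma> T r \<alpha>0 g h t x1 \<tau> \<nu>' \<le> payoff M F W \<O> \<mu> \<sigma> T r \<alpha>0 g h t x2 \<tau> \<nu>"
proof -
  define H where "H = T - t"
  define X where "X = state M F W \<O> \<mu> \<sigma> H x2 \<nu>"
  have H: "0 \<le> H" using t by (simp add: H_def)
  obtain \<nu>p \<nu>m where adm: "admissible H x2 \<nu> X \<nu>p \<nu>m"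
    using controls_admissible[OF \<nu>] by (auto simp: H_def X_def)
  obtain \<nu>' X' \<nu>p' \<nu>m' where adm': "admissible H x1 \<nu>' X' \<nu>p' \<nu>m'"
    and le: "\<And>\<omega>. \<omega> \<in> space M \<Longrightarrow> exit_time \<O> H X' \<omega> = exit_time \<O> H X \<omega>"
      "\<And>\<omega> s. \<omega> \<in> space M \<Longrightarrow> s \<in> {0..<H} \<Longrightarrow> X' s \<omega> \<le> X s \<omega>"
      "\<And>\<omega> s. \<omega> \<in> space M \<Longrightarrow> s \<in> {0..H} \<Longrightarrow> \<nu>p' s \<omega> + \<nu>m' s \<omega> \<le> \<nu>p s \<omega> + \<nu>m s \<omega>"
  proof (cases "\<O> = UNIV")
    case True
    obtain X' where "admissible H x1 \<nu> X' \<nu>p \<nu>m" "\<And>\<omega> s. \<omega> \<in> space M \<Longrightarrow> s \<in> {0..H} \<Longrightarrow> X' s \<omega> \<le> X s \<omega>"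
      using lower_initial_state_UNIV[OF True H adm x(2)] by blast
    then show thesis by (intro that[of \<nu> X' \<nu>p \<nu>m]) (auto simp: True exit_time_UNIV)
  next
    case False
    then have P: "\<O> = {0<..}" using \<O> by blast
    then have "0 < x1" using x(1) by simp
    from lower_initial_state_pos[OF P H adm this x(2)] show thesis using that by blast
  qed
  define Y where "Y = state M F W \<O> \<mu> \<sigma> H x1 \<nu>'"
  have \<nu>': "\<nu>' \<in> controls M F W \<O> \<mu> \<sigma> T t x1" and admY: "admissible H x1 \<nu>' Y \<nu>p' \<nu>m'"
    using admissible_controls[OF t adm'[unfolded H_def]] by (auto simp: Y_def H_def)
  have "controlled_solution M F W \<O> \<mu> \<sigma> H x1 \<nu>' Y" "controlled_solution M F W \<O> \<mu> \<sigma> H x1 \<nu>' X'"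
    using admY adm' by (auto simp: admissible_def)
  \<comment> \<open>The comparison is known for the constructed \<open>X'\<close>, whereas the
    payoff refers to the version \<open>Y\<close> chosen by \<open>state\<close>; uniqueness
    transfers it almost surely.\<close>
  from solution_unique[OF H this] AE_space
  have cmp: "AE \<omega> in M. exit_time \<O> H Y \<omega> = exit_time \<O> H X \<omega> \<and>
      (\<forall>s\<in>{0..H}. Y s \<omega> \<le> X s \<omega> \<or> s = H) \<and> (\<forall>s\<in>{0..H}. \<nu>p' s \<omega> + \<nu>m' s \<omega> \<le> \<nu>p s \<omega> + \<nu>m s \<omega>)"
    by eventually_elim (auto simp: le)
  show thesis
  proof (rule that[OF \<nu>'])
    fix \<tau> assume "\<tau> \<in> stopping_times M F T t"
    from gain_mono[OF t H_def admY adm cmp this]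
    show "payoff M F W \<O> \<mu> \<sigma> T r \<alpha>0 g h t x1 \<tau> \<nu>' \<le> payoff M F W \<O> \<mu> \<sigma> T r \<alpha>0 g h t x2 \<tau> \<nu>"
      unfolding payoff_eq_gain by (simp only: X_def Y_def H_def)
  qed
qed

text \<open>The cheaper control does not depend on the stopping time, so it may be fixed before the
  supremum is taken, as the order of infimum and supremum demands.\<close>

lemma upper_value_mono:
  assumes t: "t \<in> {0..T}" and x: "x1 \<in> \<O>" "x1 \<le> x2"
  shows "upper_value M F W \<O> \<mu> \<sigma> T r \<alpha>0 g h t x1 \<le> upper_value M F W \<O> \<mu> \<sigma> T r \<alpha>0 g h t x2"
proof (cases "x1 = x2")
  case False
  show ?thesis
    unfolding upper_value_def
  proof (rule INF_greatest)
    fix \<nu> assume "\<nu> \<in> controls M F W \<O> \<mu> \<sigma> T t x2"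
    then obtain \<nu>' where \<nu>': "\<nu>' \<in> controls M F W \<O> \<mu> \<sigma> T t x1"
      "\<And>\<tau>. \<tau> \<in> stopping_times M F T t \<Longrightarrow>
        payoff M F W \<O> \<mu> \<sigma> T r \<alpha>0 g h t x1 \<tau> \<nu>' \<le> payoff M F W \<O> \<mu> \<sigma> T r \<alpha>0 g h t x2 \<tau> \<nu>"
      using cheaper_control[OF t x(1)] x(2) False by (metis order_le_imp_less_or_eq)
    then show "(INF \<nu>\<in>controls M F W \<O> \<mu> \<sigma> T t x1. SUP \<tau>\<in>stopping_times M F T t. ereal (payoff M F W \<O> \<mu> \<sigma> T r \<alpha>0 g h t x1 \<tau> \<nu>))
        \<le> (SUP \<tau>\<in>stopping_times M F T t. ereal (payoff M F W \<O> \<mu> \<sigma> T r \<alpha>0 g h t x2 \<tau> \<nu>))"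
      by (intro INF_lower2[OF \<nu>'(1)] SUP_mono) auto
  qed
qed simp

end

theorem proposition3p1:
  fixes M :: "'a measure" and F :: "real \<Rightarrow> 'a measure" and W :: "real \<Rightarrow> 'a \<Rightarrow> real"
    and \<O> :: "real set" and \<mu> \<mu>' \<sigma> :: "real \<Rightarrow> real" and T r \<alpha>0 :: real
    and g g' :: "real \<Rightarrow> real" and h hx :: "real \<Rightarrow> real \<Rightarrow> real"
    and v :: "real \<Rightarrow> real \<Rightarrow> real"
  assumes "filtered_brownian_motion M F W"
    and "\<O> = UNIV \<or> \<O> = {0<..}"
    and "0 < T" and "0 \<le> r" and "0 < \<alpha>0"
    and "dynamics_assumptions \<O> \<mu> \<mu>' \<sigma>"
    and "payoff_assumptions \<O> T r g g' h hx"
    and value_lower: "\<And>t x. t \<in> {0..T} \<Longrightarrow> x \<in> \<O> \<Longrightarrow>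
      ereal (v t x) = lower_value M F W \<O> \<mu> \<sigma> T r \<alpha>0 g h t x"
    and value_upper: "\<And>t x. t \<in> {0..T} \<Longrightarrow> x \<in> \<O> \<Longrightarrow>
      ereal (v t x) = upper_value M F W \<O> \<mu> \<sigma> T r \<alpha>0 g h t x"
  shows "\<forall>t\<in>{0..T}. mono_on \<O> (v t)"
proof
  interpret singular_control_game M F W \<O> \<mu> \<mu>' \<sigma> T r \<alpha>0 g g' h hx
    using assms(1-7) unfolding singular_control_game_def singular_control_game_axioms_def by blast
  fix t assume t: "t \<in> {0..T}"
  show "mono_on \<O> (v t)"
  proof (rule mono_onI)
    fix x y assume xy: "x \<in> \<O>" "y \<in> \<O>" "x \<le> y"
    have "ereal (v t x) \<le> ereal (v t y)"
      unfolding value_upper[OF t xy(1)] value_upper[OF t xy(2)] by (rule upper_value_mono[OF t xy(1,3)])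
    then show "v t x \<le> v t y" by simp
  qed
qed

end
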